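(* For $m<\infty$, the algebra $\mathcal{F}_m\mathrm{Y}(d,m,n)$ is semisimple and the set $\{V_{\boldsymbol{\lambda}}\}_{\boldsymbol{\lambda}\in\mathcal{P}(d,m,n)}$ is a complete set of pairwise non-isomorphic irreducible representations of $\mathcal{F}_m\mathrm{Y}(d,m,n)$.
   Context: Algebra. Let $d,n,m\in\mathbb{Z}_{>0}$. Let $q,v_1,\ldots,v_m$ be indeterminates, $\mathcal{R}_m:=\mathbb{C}[q^{\pm1},v_1^{\pm1},\ldots,v_m^{\pm1}]$, and $\mathcal{F}_m$ its field of fractions. The cyclotomic Yokonuma--Hecke algebra $\mathrm{Y}(d,m,n)$ is the associative $\mathcal{R}_m$-algebra generated by $t_1,\ldots,t_n,g_1,\ldots,g_{n-1},X_1^{\pm1}$ with relations: $g_ig_j=g_jg_i$ if $|i-j|>1$; $g_ig_{i+1}g_i=g_{i+1}g_ig_{i+1}$; $t_it_j=t_jt_i$; $t_jg_i=g_it_{s_i(j)}$ with $s_i=(i,i+1)$; $t_j^d=1$; $g_i^2=1+(q-q^{-1})e_ig_i$ with $e_i:=\frac1d\sum_{s=0}^{d-1}t_i^st_{i+1}^{-s}$; $X_1g_1X_1g_1=g_1X_1g_1X_1$; $X_1g_i=g_iX_1$ for $i\ge2$; $X_1t_j=t_jX_1$ for all $j$; and $(X_1-v_1)\cdots(X_1-v_m)=0$. Put $\mathcal{F}_m\mathrm{Y}(d,m,n):=\mathcal{F}_m\otimes_{\mathcal{R}_m}\mathrm{Y}(d,m,n)$. Combinatorics. A $(d,m)$-partition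 of size $n$ is a $d$-tuple of $m$-tuples of partitions (identified with Young diagrams) with $n$ nodes in total; the $l$-th partition of the $k$-th $m$-tuple has position $(k,l)$. $\mathcal{P}(d,m,n)$ is the set of all $(d,m)$-partitions of size $n$. A $(d,m)$-node is a triple $\boldsymbol{\theta}=((x,y),k,l)$, consisting of a node in row $x$, column $y$, and a position $(k,l)$, $1\le k\le d$, $1\le l\le m$; set $\mathrm{p}^{(d)}(\boldsymbol\theta):=k$ and $\mathrm{c}(\boldsymbol\theta):=v_lq^{2(y-x)}$. A $(d,m)$-tableau of shape $\boldsymbol\lambda$ is a bijection between $\{1,\ldots,n\}$ and the $(d,m)$-nodes of $\boldsymbol\lambda$; it is standard if its entries increase along rows and down columns of every diagram. $\mathrm{p}^{(d)}(\mathcal{T}|i)$ and $\mathrm{c}(\mathcal{T}|i)$ denote $\mathrm{p}^{(d)}$ and $\mathrm{c}$ of the $(d,m)$-node of $\mathcal{T}$ containing $i$. $\mathcal{T}^\sigma$ is obtained from $\mathcal{T}$ by applying $\sigma\in\mathfrak{S}_n$ to its entries. $\{\xi_1,\ldots,\xi_d\}\subset\mathbb{C}$ is the set of all $d$-th roots of unity, ordered arbitrarily. Representations. For $\boldsymbol\lambda\in\mathcal{P}(d,m,n)$, $V_{\boldsymbol\lambda}$ is the $\mathcal{F}_m$-vector space with basis $\{\mathbf{v}_{\mathcal{T}}\}$ indexed by the standard $(d,m)$-tableaux of shape $\boldsymbol\lambda$ (with $\mathbf{v}_{\mathcal{T}}:=0$ for $\mathcal{T}$ non-standard), on which $\mathcal{F}_m\mathrm{Y}(d,m,n)$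 acts as follows. With $\mathrm{p}_i:=\mathrm{p}^{(d)}(\mathcal{T}|i)$, $\mathrm{c}_i:=\mathrm{c}(\mathcal{T}|i)$: $X_1(\mathbf{v}_{\mathcal{T}})=\mathrm{c}_1\mathbf{v}_{\mathcal{T}}$; $t_j(\mathbf{v}_{\mathcal{T}})=\xi_{\mathrm{p}_j}\mathbf{v}_{\mathcal{T}}$; $g_i(\mathbf{v}_{\mathcal{T}})=\mathbf{v}_{\mathcal{T}^{s_i}}$ if $\mathrm{p}_i\ne\mathrm{p}_{i+1}$; and $g_i(\mathbf{v}_{\mathcal{T}})=\frac{\mathrm{c}_{i+1}(q-q^{-1})}{\mathrm{c}_{i+1}-\mathrm{c}_i}\mathbf{v}_{\mathcal{T}}+\frac{q\mathrm{c}_{i+1}-q^{-1}\mathrm{c}_i}{\mathrm{c}_{i+1}-\mathrm{c}_i}\mathbf{v}_{\mathcal{T}^{s_i}}$ if $\mathrm{p}_i=\mathrm{p}_{i+1}$. *)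

theory Defs
  imports
    "HOL-Algebra.Algebra"
    "HOL-Library.Poly_Mapping"
    "HOL-Computational_Algebra.Fraction_Field"
    "HOL-Combinatorics.Transposition"
begin

section \<open>Associative algebras and their representations\<close>

text \<open>The library locale \<^locale>\<open>algebra\<close> requires a commutative multiplication.\<close>

locale assoc_algebra = module R A + ring A for R and A (structure) +
  assumes smult_mult_left:
      "\<lbrakk>c \<in> carrier R; a \<in> carrier A; b \<in> carrier A\<rbrakk>
        \<Longrightarrow> (c \<odot>\<^bsub>A\<^esub> a) \<otimes>\<^bsub>A\<^esub> b = c \<odot>\<^bsub>A\<^esub> (a \<otimes>\<^bsub>A\<^esub> b)"
    and smult_mult_right:
      "\<lbrakk>c \<in> carrier R; a \<in> carrier A; b \<in> carrier A\<rbrakk>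
        \<Longrightarrow> a \<otimes>\<^bsub>A\<^esub> (c \<odot>\<^bsub>A\<^esub> b) = c \<odot>\<^bsub>A\<^esub> (a \<otimes>\<^bsub>A\<^esub> b)"

locale representation = A: assoc_algebra R A + V: module R V
  for R :: "('k, 'r) ring_scheme" and A :: "('k, 'a, 's) module_scheme"
    and V :: "('k, 'v, 't) module_scheme" +
  fixes \<rho> :: "'a \<Rightarrow> 'v \<Rightarrow> 'v"
  assumes act_closed:
      "\<lbrakk>a \<in> carrier A; v \<in> carrier V\<rbrakk> \<Longrightarrow> \<rho> a v \<in> carrier V"
    and act_add:
      "\<lbrakk>a \<in> carrier A; v \<in> carrier V; w \<in> carrier V\<rbrakk>
        \<Longrightarrow> \<rho> a (v \<oplus>\<^bsub>V\<^esub> w) = \<rho> a v \<oplus>\<^bsub>V\<^esub> \<rho> a w"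
    and act_smult:
      "\<lbrakk>a \<in> carrier A; c \<in> carrier R; v \<in> carrier V\<rbrakk>
        \<Longrightarrow> \<rho> a (c \<odot>\<^bsub>V\<^esub> v) = c \<odot>\<^bsub>V\<^esub> \<rho> a v"
    and add_act:
      "\<lbrakk>a \<in> carrier A; b \<in> carrier A; v \<in> carrier V\<rbrakk>
        \<Longrightarrow> \<rho> (a \<oplus>\<^bsub>A\<^esub> b) v = \<rho> a v \<oplus>\<^bsub>V\<^esub> \<rho> b v"
    and smult_act:
      "\<lbrakk>a \<in> carrier A; c \<in> carrier R; v \<in> carrier V\<rbrakk>
        \<Longrightarrow> \<rho> (c \<odot>\<^bsub>A\<^esub> a) v = c \<odot>\<^bsub>V\<^esub> \<rho> a v"
    and mult_act:
      "\<lbrakk>a \<in> carrier A; b \<in> carrier A; v \<in> carrier V\<rbrakk>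
        \<Longrightarrow> \<rho> (a \<otimes>\<^bsub>A\<^esub> b) v = \<rho> a (\<rho> b v)"
    and one_act: "v \<in> carrier V \<Longrightarrow> \<rho> \<one>\<^bsub>A\<^esub> v = v"

definition subrep ::
    "('k, 'r) ring_scheme \<Rightarrow> ('a, 's) ring_scheme \<Rightarrow> ('k, 'v, 't) module_scheme
      \<Rightarrow> ('a \<Rightarrow> 'v \<Rightarrow> 'v) \<Rightarrow> 'v set \<Rightarrow> bool" where
  "subrep K A V \<rho> U \<longleftrightarrow> submodule U K V \<and> (\<forall>a\<in>carrier A. \<forall>u\<in>U. \<rho> a u \<in> U)"

definition simple_subrep ::
    "('k, 'r) ring_scheme \<Rightarrow> ('a, 's) ring_scheme \<Rightarrow> ('k, 'v, 't) module_scheme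
      \<Rightarrow> ('a \<Rightarrow> 'v \<Rightarrow> 'v) \<Rightarrow> 'v set \<Rightarrow> bool" where
  "simple_subrep K A V \<rho> U \<longleftrightarrow>
     subrep K A V \<rho> U \<and> U \<noteq> {\<zero>\<^bsub>V\<^esub>} \<and>
     (\<forall>U'. subrep K A V \<rho> U' \<and> U' \<subseteq> U \<longrightarrow> U' = {\<zero>\<^bsub>V\<^esub>} \<or> U' = U)"

definition irreducible_rep ::
    "('k, 'r) ring_scheme \<Rightarrow> ('k, 'a, 's) module_scheme \<Rightarrow> ('k, 'v, 't) module_scheme
      \<Rightarrow> ('a \<Rightarrow> 'v \<Rightarrow> 'v) \<Rightarrow> bool" where
  "irreducible_rep K A V \<rho> \<longleftrightarrow>
     representation K A V \<rho> \<and> simple_subrep K A V \<rho> (carrier V)"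

definition isomorphic_reps ::
    "('k, 'r) ring_scheme \<Rightarrow> ('a, 's) ring_scheme
      \<Rightarrow> ('k, 'v, 't) module_scheme \<Rightarrow> ('a \<Rightarrow> 'v \<Rightarrow> 'v)
      \<Rightarrow> ('k, 'w, 'u) module_scheme \<Rightarrow> ('a \<Rightarrow> 'w \<Rightarrow> 'w) \<Rightarrow> bool" where
  "isomorphic_reps K A V \<rho> W \<sigma> \<longleftrightarrow>
     (\<exists>\<phi>. bij_betw \<phi> (carrier V) (carrier W) \<and>
        (\<forall>v\<in>carrier V. \<forall>w\<in>carrier V. \<phi> (v \<oplus>\<^bsub>V\<^esub> w) = \<phi> v \<oplus>\<^bsub>W\<^esub> \<phi> w) \<and>
        (\<forall>c\<in>carrier K. \<forall>v\<in>carrier V. \<phi> (c \<odot>\<^bsub>V\<^esub> v) = c \<odot>\<^bsub>W\<^esub> \<phi> v) \<and>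
        (\<forall>a\<in>carrier A. \<forall>v\<in>carrier V. \<phi> (\<rho> a v) = \<sigma> a (\<phi> v)))"

text \<open>The left regular representation is a direct sum of simple subrepresentations
  (minimal left ideals). Since the algebra is unital, such a sum is necessarily finite.\<close>

definition semisimple_algebra ::
    "('k, 'r) ring_scheme \<Rightarrow> ('k, 'a, 's) module_scheme \<Rightarrow> bool" where
  "semisimple_algebra K A \<longleftrightarrow>
     assoc_algebra K A \<and>
     (\<exists>\<U>. finite \<U> \<and> (\<forall>U\<in>\<U>. simple_subrep K A A (\<lambda>a b. a \<otimes>\<^bsub>A\<^esub> b) U) \<and>
        (\<forall>a\<in>carrier A. \<exists>!f. f \<in> PiE \<U> (\<lambda>U. U) \<and> a = (\<Oplus>\<^bsub>A\<^esub>U\<in>\<U>. f U)))"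


section \<open>Constructions of algebras\<close>

definition quotient_algebra :: "('k, 'a) module \<Rightarrow> 'a set \<Rightarrow> ('k, 'a set) module" where
  "quotient_algebra A I =
     ring.extend (A Quot I) (module.fields (\<lambda>c C. \<Union>x\<in>C. I +>\<^bsub>A\<^esub> (c \<odot>\<^bsub>A\<^esub> x)))"

subsection \<open>Free algebras\<close>

text \<open>The free monoid, written additively as required by \<^theory>\<open>HOL-Library.Poly_Mapping\<close>:
  elements of the free algebra are finitely supported functions on words, with convolution
  as multiplication.\<close>

datatype 'g word = Word (letters: "'g list")

instantiation word :: (type) monoid_add
begin
definition "0 = Word []"
definition "u + w = Word (letters u @ letters w)"
instance
  by standard (simp_all add: zero_word_def plus_word_def)
end

definition scalar :: "'r::comm_ring_1 \<Rightarrow> 'g word \<Rightarrow>\<^sub>0 'r" where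
  "scalar c = Poly_Mapping.single 0 c"

definition letter :: "'g \<Rightarrow> 'g word \<Rightarrow>\<^sub>0 'r::comm_ring_1" where
  "letter x = Poly_Mapping.single (Word [x]) 1"

text \<open>Coefficients are taken from a subring of the ambient type.\<close>

definition free_algebra ::
    "'r::comm_ring_1 set \<Rightarrow> 'g set \<Rightarrow> ('r, 'g word \<Rightarrow>\<^sub>0 'r) module" where
  "free_algebra R S =
     \<lparr>carrier = {f. (\<forall>w. Poly_Mapping.lookup f w \<in> R) \<and> (\<forall>w\<in>Poly_Mapping.keys f. set (letters w) \<subseteq> S)},
      monoid.mult = (*), one = 1, ring.zero = 0, add = (+), smult = (\<lambda>c f. scalar c * f)\<rparr>"

subsection \<open>Extension of scalars\<close>

text \<open>For a commutative ring \<open>K\<close>, a ring homomorphism \<open>h\<close> from \<open>R\<close> to \<open>K\<close> and an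
  \<open>R\<close>-algebra \<open>A\<close>, the tensor product of \<open>K\<close> and \<open>A\<close> over \<open>R\<close> is the quotient of the free abelian
  group on pairs by the bilinearity relations. The product of pairs
  \<open>(a, x) (b, y) = (a b, x y)\<close> makes that free group a ring in which the subgroup spanned
  by these relations is already a two-sided ideal.\<close>

definition pair_ring :: "('k, 'b) ring_scheme \<Rightarrow> ('r, 'a) module \<Rightarrow> ('k, 'k \<times> 'a \<Rightarrow>\<^sub>0 int) module" where
  "pair_ring K A =
     \<lparr>carrier = {z. Poly_Mapping.keys z \<subseteq> carrier K \<times> carrier A},
      monoid.mult = (\<lambda>z w. frag_extend (\<lambda>(a, x).
                 frag_extend (\<lambda>(b, y). frag_of (a \<otimes>\<^bsub>K\<^esub> b, x \<otimes>\<^bsub>A\<^esub> y)) w) z),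
      one = frag_of (\<one>\<^bsub>K\<^esub>, \<one>\<^bsub>A\<^esub>), ring.zero = 0, add = (+),
      smult = (\<lambda>c. frag_extend (\<lambda>(a, x). frag_of (c \<otimes>\<^bsub>K\<^esub> a, x)))\<rparr>"

definition tensor_relators ::
    "('r, 'c) ring_scheme \<Rightarrow> ('k, 'b) ring_scheme \<Rightarrow> ('r \<Rightarrow> 'k) \<Rightarrow> ('r, 'a) module
      \<Rightarrow> ('k \<times> 'a \<Rightarrow>\<^sub>0 int) set" where
  "tensor_relators R K h A =
     {frag_of (a \<oplus>\<^bsub>K\<^esub> b, x) - frag_of (a, x) - frag_of (b, x) |a b x.
        a \<in> carrier K \<and> b \<in> carrier K \<and> x \<in> carrier A} \<union>
     {frag_of (a, x \<oplus>\<^bsub>A\<^esub> y) - frag_of (a, x) - frag_of (a, y) |a x y.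
        a \<in> carrier K \<and> x \<in> carrier A \<and> y \<in> carrier A} \<union>
     {frag_of (a \<otimes>\<^bsub>K\<^esub> h r, x) - frag_of (a, r \<odot>\<^bsub>A\<^esub> x) |a r x.
        a \<in> carrier K \<and> r \<in> carrier R \<and> x \<in> carrier A}"

definition tensor_ideal ::
    "('r, 'c) ring_scheme \<Rightarrow> ('k, 'b) ring_scheme \<Rightarrow> ('r \<Rightarrow> 'k) \<Rightarrow> ('r, 'a) module
      \<Rightarrow> ('k \<times> 'a \<Rightarrow>\<^sub>0 int) set" where
  "tensor_ideal R K h A = Idl\<^bsub>pair_ring K A\<^esub> (tensor_relators R K h A)"

definition extend_scalars ::
    "('r, 'c) ring_scheme \<Rightarrow> ('k, 'b) ring_scheme \<Rightarrow> ('r \<Rightarrow> 'k) \<Rightarrow> ('r, 'a) module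
      \<Rightarrow> ('k, ('k \<times> 'a \<Rightarrow>\<^sub>0 int) set) module" where
  "extend_scalars R K h A = quotient_algebra (pair_ring K A) (tensor_ideal R K h A)"

definition pure_tensor ::
    "('r, 'c) ring_scheme \<Rightarrow> ('k, 'b) ring_scheme \<Rightarrow> ('r \<Rightarrow> 'k) \<Rightarrow> ('r, 'a) module
      \<Rightarrow> 'k \<Rightarrow> 'a \<Rightarrow> ('k \<times> 'a \<Rightarrow>\<^sub>0 int) set" where
  "pure_tensor R K h A a x = tensor_ideal R K h A +>\<^bsub>pair_ring K A\<^esub> frag_of (a, x)"


section \<open>The base rings\<close>

text \<open>Complex Laurent polynomials in countably many indeterminates, as the group algebra of the
  free abelian group on \<^typ>\<open>nat\<close>. Indeterminate \<open>0\<close> is \<open>q\<close> and indeterminate \<open>l \<ge> 1\<close> is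
  \<open>v\<^sub>l\<close>; of these only \<open>q, v\<^sub>1, \<dots>, v\<^sub>m\<close> occur in \<open>Rm m\<close>.\<close>

type_synonym laurent = "(nat \<Rightarrow>\<^sub>0 int) \<Rightarrow>\<^sub>0 complex"

definition const :: "complex \<Rightarrow> laurent" where
  "const z = Poly_Mapping.single 0 z"

definition indet_pow :: "nat \<Rightarrow> int \<Rightarrow> laurent" where
  "indet_pow i k = Poly_Mapping.single (Poly_Mapping.single i k) 1"

definition Rm :: "nat \<Rightarrow> laurent ring" where
  "Rm m = \<lparr>carrier = {f. \<forall>e\<in>Poly_Mapping.keys f. Poly_Mapping.keys e \<subseteq> {0..m}},
           monoid.mult = (*), one = 1, ring.zero = 0, add = (+)\<rparr>"

definition Fm :: "nat \<Rightarrow> laurent fract ring" where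
  "Fm m = \<lparr>carrier = {Fract a b |a b. a \<in> carrier (Rm m) \<and> b \<in> carrier (Rm m) \<and> b \<noteq> 0},
           monoid.mult = (*), one = 1, ring.zero = 0, add = (+)\<rparr>"

definition to_Fm :: "laurent \<Rightarrow> laurent fract" where
  "to_Fm a = Fract a 1"

definition qF :: "laurent fract" where
  "qF = to_Fm (indet_pow 0 1)"

definition vF :: "nat \<Rightarrow> laurent fract" where
  "vF l = to_Fm (indet_pow l 1)"


section \<open>The cyclotomic Yokonuma--Hecke algebra\<close>

datatype gen = Tgen nat | Ggen nat | Xgen | Xinvgen

type_synonym pre_elt = "gen word \<Rightarrow>\<^sub>0 laurent"

definition yh_gens :: "nat \<Rightarrow> gen set" where
  "yh_gens n = Tgen ` {1..n} \<union> Ggen ` {1..n - 1} \<union> {Xgen, Xinvgen}"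

definition tt :: "nat \<Rightarrow> pre_elt" where "tt j = letter (Tgen j)"
definition gg :: "nat \<Rightarrow> pre_elt" where "gg i = letter (Ggen i)"
definition xx :: pre_elt where "xx = letter Xgen"
definition xx_inv :: pre_elt where "xx_inv = letter Xinvgen"

text \<open>Negative powers of \<open>t\<^sub>j\<close> are written via \<open>t\<^sub>j\<^sup>d\<^sup>-\<^sup>1\<close>, the inverse of \<open>t\<^sub>j\<close>
  by the relation \<open>t\<^sub>j\<^sup>d = 1\<close>.\<close>

definition ee :: "nat \<Rightarrow> nat \<Rightarrow> pre_elt" where
  "ee d i = scalar (const (1 / of_nat d)) * (\<Sum>s<d. tt i ^ s * (tt (i + 1) ^ (d - 1)) ^ s)"

definition q_diff :: pre_elt where
  "q_diff = scalar (indet_pow 0 1 - indet_pow 0 (- 1))"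

definition yh_relators :: "nat \<Rightarrow> nat \<Rightarrow> nat \<Rightarrow> pre_elt set" where
  "yh_relators d m n =
     {xx * xx_inv - 1, xx_inv * xx - 1} \<union>
     {gg i * gg j - gg j * gg i |i j.
        i \<in> {1..n - 1} \<and> j \<in> {1..n - 1} \<and> \<bar>int i - int j\<bar> > 1} \<union>
     {gg i * gg (i + 1) * gg i - gg (i + 1) * gg i * gg (i + 1) |i.
        i \<in> {1..n - 1} \<and> i + 1 \<in> {1..n - 1}} \<union>
     {tt i * tt j - tt j * tt i |i j. i \<in> {1..n} \<and> j \<in> {1..n}} \<union>
     {tt j * gg i - gg i * tt (Transposition.transpose i (i + 1) j) |i j. i \<in> {1..n - 1} \<and> j \<in> {1..n}} \<union>
     {tt j ^ d - 1 |j. j \<in> {1..n}} \<union>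
     {gg i ^ 2 - (1 + q_diff * ee d i * gg i) |i. i \<in> {1..n - 1}} \<union>
     (if n \<ge> 2 then {xx * gg 1 * xx * gg 1 - gg 1 * xx * gg 1 * xx} else {}) \<union>
     {xx * gg i - gg i * xx |i. i \<in> {1..n - 1} \<and> i \<ge> 2} \<union>
     {xx * tt j - tt j * xx |j. j \<in> {1..n}} \<union>
     {prod_list (map (\<lambda>l. xx - scalar (indet_pow l 1)) [1..<m + 1])}"

definition yh_free :: "nat \<Rightarrow> nat \<Rightarrow> (laurent, pre_elt) module" where
  "yh_free m n = free_algebra (carrier (Rm m)) (yh_gens n)"

definition yh_ideal :: "nat \<Rightarrow> nat \<Rightarrow> nat \<Rightarrow> pre_elt set" where
  "yh_ideal d m n = Idl\<^bsub>yh_free m n\<^esub> (yh_relators d m n)"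

definition YH :: "nat \<Rightarrow> nat \<Rightarrow> nat \<Rightarrow> (laurent, pre_elt set) module" where
  "YH d m n = quotient_algebra (yh_free m n) (yh_ideal d m n)"

type_synonym yh_elt = "(laurent fract \<times> pre_elt set \<Rightarrow>\<^sub>0 int) set"

definition FYH :: "nat \<Rightarrow> nat \<Rightarrow> nat \<Rightarrow> (laurent fract, yh_elt) module" where
  "FYH d m n = extend_scalars (Rm m) (Fm m) to_Fm (YH d m n)"

definition yh_gen :: "nat \<Rightarrow> nat \<Rightarrow> nat \<Rightarrow> gen \<Rightarrow> yh_elt" where
  "yh_gen d m n x =
     pure_tensor (Rm m) (Fm m) to_Fm (YH d m n) 1 (yh_ideal d m n +>\<^bsub>yh_free m n\<^esub> letter x)"


section \<open>Multipartitions and standard tableaux\<close>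

definition is_partition :: "nat list \<Rightarrow> bool" where
  "is_partition p \<longleftrightarrow> sorted_wrt (\<ge>) p \<and> 0 \<notin> set p"

type_synonym dm_partition = "nat list list list"

type_synonym dm_node = "(nat \<times> nat) \<times> nat \<times> nat"

text \<open>Rows, columns and positions are numbered from \<open>1\<close>, list entries from \<open>0\<close>.\<close>

definition dm_nodes :: "dm_partition \<Rightarrow> dm_node set" where
  "dm_nodes \<Lambda> = {((x, y), k, l) |x y k l.
     1 \<le> k \<and> k \<le> length \<Lambda> \<and> 1 \<le> l \<and> l \<le> length (\<Lambda> ! (k - 1)) \<and>
     1 \<le> x \<and> x \<le> length (\<Lambda> ! (k - 1) ! (l - 1)) \<and>
     1 \<le> y \<and> y \<le> \<Lambda> ! (k - 1) ! (l - 1) ! (x - 1)}"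

definition dm_partitions :: "nat \<Rightarrow> nat \<Rightarrow> nat \<Rightarrow> dm_partition set" where
  "dm_partitions d m n = {\<Lambda>. length \<Lambda> = d \<and>
     (\<forall>M\<in>set \<Lambda>. length M = m \<and> (\<forall>p\<in>set M. is_partition p)) \<and> card (dm_nodes \<Lambda>) = n}"

fun node_pos :: "dm_node \<Rightarrow> nat" where
  "node_pos ((x, y), k, l) = k"

fun node_content :: "dm_node \<Rightarrow> laurent fract" where
  "node_content ((x, y), k, l) = vF l * qF powi (2 * (int y - int x))"

text \<open>\<open>t i\<close> is the node containing the entry \<open>i\<close>.\<close>

type_synonym dm_tableau = "nat \<Rightarrow> dm_node"

definition dm_tableaux :: "nat \<Rightarrow> dm_partition \<Rightarrow> dm_tableau set" where
  "dm_tableaux n \<Lambda> = {t \<in> extensional {1..n}. bij_betw t {1..n} (dm_nodes \<Lambda>)}"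

definition standard_tableaux :: "nat \<Rightarrow> dm_partition \<Rightarrow> dm_tableau set" where
  "standard_tableaux n \<Lambda> = {t \<in> dm_tableaux n \<Lambda>. \<forall>i\<in>{1..n}. \<forall>j\<in>{1..n}. \<forall>x y x' y' k l.
     t i = ((x, y), k, l) \<and> t j = ((x', y'), k, l) \<and> (x = x' \<and> y < y' \<or> x < x' \<and> y = y')
       \<longrightarrow> i < j}"

text \<open>Replacing each entry \<open>i\<close> by \<open>\<sigma> i\<close> moves the entry \<open>i\<close> to the node formerly
  containing the \<open>\<sigma>\<close>-preimage of \<open>i\<close>.\<close>

definition permute_tableau :: "(nat \<Rightarrow> nat) \<Rightarrow> dm_tableau \<Rightarrow> dm_tableau" where
  "permute_tableau \<sigma> t = t \<circ> inv_into UNIV \<sigma>"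


section \<open>The representations\<close>

text \<open>There are finitely many standard tableaux, so their span consists of all functions
  vanishing outside the set of standard tableaux.\<close>

definition Vspace ::
    "nat \<Rightarrow> nat \<Rightarrow> dm_partition \<Rightarrow> (laurent fract, dm_tableau \<Rightarrow> laurent fract) module" where
  "Vspace m n \<Lambda> =
     \<lparr>carrier = {f. (\<forall>t. f t \<in> carrier (Fm m)) \<and> (\<forall>t. t \<notin> standard_tableaux n \<Lambda> \<longrightarrow> f t = 0)},
      monoid.mult = undefined, one = undefined,
      ring.zero = (\<lambda>t. 0), add = (\<lambda>f g t. f t + g t), smult = (\<lambda>c f t. c * f t)\<rparr>"

definition vbasis :: "nat \<Rightarrow> dm_partition \<Rightarrow> dm_tableau \<Rightarrow> dm_tableau \<Rightarrow> laurent fract" where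
  "vbasis n \<Lambda> t = (\<lambda>u. if u = t \<and> t \<in> standard_tableaux n \<Lambda> then 1 else 0)"

definition seminormal_rep ::
    "nat \<Rightarrow> nat \<Rightarrow> nat \<Rightarrow> (nat \<Rightarrow> complex) \<Rightarrow> dm_partition
      \<Rightarrow> (yh_elt \<Rightarrow> (dm_tableau \<Rightarrow> laurent fract) \<Rightarrow> dm_tableau \<Rightarrow> laurent fract) \<Rightarrow> bool" where
  "seminormal_rep d m n \<xi> \<Lambda> \<rho> \<longleftrightarrow>
     representation (Fm m) (FYH d m n) (Vspace m n \<Lambda>) \<rho> \<and>
     (\<forall>t\<in>standard_tableaux n \<Lambda>.
        let V = Vspace m n \<Lambda>; v = vbasis n \<Lambda>; p = (\<lambda>i. node_pos (t i)); c = (\<lambda>i. node_content (t i));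
            s = (\<lambda>i. permute_tableau (Transposition.transpose i (i + 1)) t)
        in \<rho> (yh_gen d m n Xgen) (v t) = c 1 \<odot>\<^bsub>V\<^esub> v t \<and>
           (\<forall>j\<in>{1..n}. \<rho> (yh_gen d m n (Tgen j)) (v t) = to_Fm (const (\<xi> (p j))) \<odot>\<^bsub>V\<^esub> v t) \<and>
           (\<forall>i\<in>{1..n - 1}. p i \<noteq> p (i + 1) \<longrightarrow>
              \<rho> (yh_gen d m n (Ggen i)) (v t) = v (s i)) \<and>
           (\<forall>i\<in>{1..n - 1}. p i = p (i + 1) \<longrightarrow>
              \<rho> (yh_gen d m n (Ggen i)) (v t) =
                (c (i + 1) * (qF - inverse qF) / (c (i + 1) - c i)) \<odot>\<^bsub>V\<^esub> v t \<oplus>\<^bsub>V\<^esub>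
                ((qF * c (i + 1) - inverse qF * c i) / (c (i + 1) - c i)) \<odot>\<^bsub>V\<^esub> v (s i)))"

end

theory Submission imports Defs begin

section \<open>The base field\<close>

text \<open>Write A for the algebra over the fraction field and put X_(i+1) = g_i X_i g_i, starting
  from X_1 (\<open>JM\<close>). These Jucys-Murphy elements commute with each other and with the
  t_j. On the seminormal basis they are diagonal: v_T is multiplied by the contents, and under the
  t_j by the roots of unity, of the nodes of T (\<open>Gop_Dop_Gop\<close>). As q and the v_l are
  indeterminates, contents of nodes of different diagonals or components are different monomials.
  Two consequences are used everywhere: a standard tableau is determined by its sequence of
  positions and contents (\<open>std_seq_weights_eq\<close>), and consecutive entries never share
  both position and content, so the denominators in the seminormal formulas are nonzero
  (\<open>std_seq_consecutive_diag\<close>, \<open>std_seq_separated\<close>).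

  The modules V_Lambda. The defining relations turn into identities between the matrix coefficients
  (\<open>coeff_product\<close>, \<open>diag_coeff_sum\<close>, \<open>diag_coeff_content\<close>,
  \<open>diag_coeff_braid\<close>), so the formulas do define a representation
  (\<open>seminormal_rho\<close>). A nonzero invariant subspace contains a basis vector because the
  diagonal operators separate the basis (\<open>subrep_basis_vector\<close>), and then all basis
  vectors because any two standard tableaux of one shape are linked by admissible exchanges with
  nonzero coefficients (\<open>subrep_connected\<close>). An isomorphism preserves the joint
  eigenvalues, hence the tableaux and the shape (\<open>seminormal_not_isomorphic\<close>).

  Semisimplicity and completeness. No dimension is counted; the argument analyses left
  multiplication on A itself. The central claim is \<open>annihilated_all\<close>: on a vector whose
  first i joint eigenvalues come from a standard tableau with i nodes, X_(i+1) is killed by a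
  product of distinct linear factors whose roots are contents of addable nodes. The induction uses
  intertwiners, which exchange two neighbouring eigenvalues. The braid relation forbids a return to
  a content that was just left (\<open>no_return_base\<close>, \<open>no_return\<close>), and a
  Jordan block argument forbids the same content twice in a row (\<open>no_jordan_block\<close>).
  Consequently 1 is a sum of weight vectors x_T indexed by standard tableaux
  (\<open>weight_decomp\<close>), and independence of different weights makes the x_T orthogonal
  idempotents (\<open>weight_idempotents\<close>).

  From a weight vector of weight T of shape Lambda, normalised intertwiners produce a vector for
  each standard tableau of that shape. The braid relation makes the result independent of the path
  (\<open>path_unique\<close>), so sending v_T to x_T extends to a homomorphism from V_Lambda to A
  (\<open>cp_Psi_hom\<close>). Hence each A x_T is simple and A is their direct sum
  (\<open>semisimple_orthogonal_idempotents\<close>). In an irreducible W some x_T moves some w to a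
  nonzero vector, which gives a nonzero map from V_Lambda to W, an isomorphism by Schur's
  lemma.\<close>

lemma Rm_closed:
  "0 \<in> carrier (Rm m)" "1 \<in> carrier (Rm m)"
  "a \<in> carrier (Rm m) \<Longrightarrow> b \<in> carrier (Rm m) \<Longrightarrow> a + b \<in> carrier (Rm m)"
  "a \<in> carrier (Rm m) \<Longrightarrow> - a \<in> carrier (Rm m)"
  "a \<in> carrier (Rm m) \<Longrightarrow> b \<in> carrier (Rm m) \<Longrightarrow> a - b \<in> carrier (Rm m)"
  "a \<in> carrier (Rm m) \<Longrightarrow> b \<in> carrier (Rm m) \<Longrightarrow> a * b \<in> carrier (Rm m)"
proof -
  show "a + b \<in> carrier (Rm m)" if "a \<in> carrier (Rm m)" "b \<in> carrier (Rm m)"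
    using that keys_add[of a b] by (auto simp: Rm_def dest!: subsetD)
  show "a - b \<in> carrier (Rm m)" if "a \<in> carrier (Rm m)" "b \<in> carrier (Rm m)"
    using that keys_diff[of a b] by (auto simp: Rm_def dest!: subsetD)
  show "a * b \<in> carrier (Rm m)" if "a \<in> carrier (Rm m)" "b \<in> carrier (Rm m)"
  proof -
    have "Poly_Mapping.keys e \<subseteq> {0..m}" if "e \<in> Poly_Mapping.keys (a * b)" for e
    proof -
      obtain u v where "u \<in> Poly_Mapping.keys a" "v \<in> Poly_Mapping.keys b" "e = u + v"
        using \<open>e \<in> _\<close> keys_mult[of a b] by blast
      then show ?thesis
        using keys_add[of u v] \<open>a \<in> _\<close> \<open>b \<in> _\<close> by (force simp: Rm_def)
    qed
    then show ?thesis by (simp add: Rm_def)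
  qed
qed (auto simp: Rm_def)

lemma Rm_const [simp]: "const z \<in> carrier (Rm m)"
  by (auto simp: Rm_def const_def)

lemma Rm_indet_pow: "i \<le> m \<Longrightarrow> indet_pow i k \<in> carrier (Rm m)"
  by (auto simp: Rm_def indet_pow_def split: if_splits)

lemma Rm_simps [simp]: "monoid.mult (Rm m) = (*)" "\<one>\<^bsub>Rm m\<^esub> = 1" "\<zero>\<^bsub>Rm m\<^esub> = 0" "add (Rm m) = (+)"
  by (simp_all add: Rm_def)

lemma Fm_simps [simp]: "monoid.mult (Fm m) = (*)" "\<one>\<^bsub>Fm m\<^esub> = 1" "\<zero>\<^bsub>Fm m\<^esub> = 0" "add (Fm m) = (+)"
  by (simp_all add: Fm_def)

lemma cring_Rm: "cring (Rm m)"
proof (rule cringI)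
  show "abelian_group (Rm m)"
    by (rule abelian_groupI)
      (auto simp: Rm_closed algebra_simps intro: bexI[of _ "- x" for x])
  show "comm_monoid (Rm m)"
    by (rule comm_monoidI) (auto simp: Rm_closed algebra_simps)
qed (auto simp: algebra_simps)

lemma to_Fm_simps [simp]:
  "to_Fm 0 = 0" "to_Fm 1 = 1" "to_Fm (a + b) = to_Fm a + to_Fm b" "to_Fm (a - b) = to_Fm a - to_Fm b"
  "to_Fm (- a) = - to_Fm a" "to_Fm (a * b) = to_Fm a * to_Fm b"
  by (simp_all add: to_Fm_def Zero_fract_def One_fract_def)

lemma to_Fm_eq_iff [simp]: "to_Fm a = to_Fm b \<longleftrightarrow> a = b"
  by (simp add: to_Fm_def eq_fract)

lemma to_Fm_closed: "a \<in> carrier (Rm m) \<Longrightarrow> to_Fm a \<in> carrier (Fm m)"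
  unfolding Fm_def to_Fm_def using Rm_closed(2)[of m] by fastforce

lemma Fm_closed:
  "0 \<in> carrier (Fm m)" "1 \<in> carrier (Fm m)"
  "a \<in> carrier (Fm m) \<Longrightarrow> b \<in> carrier (Fm m) \<Longrightarrow> a + b \<in> carrier (Fm m)"
  "a \<in> carrier (Fm m) \<Longrightarrow> - a \<in> carrier (Fm m)"
  "a \<in> carrier (Fm m) \<Longrightarrow> b \<in> carrier (Fm m) \<Longrightarrow> a - b \<in> carrier (Fm m)"
  "a \<in> carrier (Fm m) \<Longrightarrow> b \<in> carrier (Fm m) \<Longrightarrow> a * b \<in> carrier (Fm m)"
  "a \<in> carrier (Fm m) \<Longrightarrow> inverse a \<in> carrier (Fm m)"
  "a \<in> carrier (Fm m) \<Longrightarrow> b \<in> carrier (Fm m) \<Longrightarrow> a / b \<in> carrier (Fm m)"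
proof -
  show z: "0 \<in> carrier (Fm m)" "1 \<in> carrier (Fm m)"
    using to_Fm_closed[OF Rm_closed(1), of m] to_Fm_closed[OF Rm_closed(2), of m] by simp_all
  have repr: "\<exists>x y. a = Fract x y \<and> x \<in> carrier (Rm m) \<and> y \<in> carrier (Rm m) \<and> y \<noteq> 0"
    if "a \<in> carrier (Fm m)" for a
    using that by (auto simp: Fm_def)
  have mem: "Fract x y \<in> carrier (Fm m)" if "x \<in> carrier (Rm m)" "y \<in> carrier (Rm m)" "y \<noteq> 0" for x y
    using that by (auto simp: Fm_def)
  show add: "a + b \<in> carrier (Fm m)" if "a \<in> carrier (Fm m)" "b \<in> carrier (Fm m)" for a b
    using repr[OF that(1)] repr[OF that(2)] by (auto intro!: mem Rm_closed)
  show neg: "- a \<in> carrier (Fm m)" if "a \<in> carrier (Fm m)" for a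
    using repr[OF that] by (auto intro!: mem Rm_closed)
  show "a - b \<in> carrier (Fm m)" if "a \<in> carrier (Fm m)" "b \<in> carrier (Fm m)"
    using add[OF that(1) neg[OF that(2)]] by simp
  show mult: "a * b \<in> carrier (Fm m)" if "a \<in> carrier (Fm m)" "b \<in> carrier (Fm m)" for a b
    using repr[OF that(1)] repr[OF that(2)] by (auto intro!: mem Rm_closed)
  show inv: "inverse a \<in> carrier (Fm m)" if "a \<in> carrier (Fm m)" for a
  proof (cases "a = 0")
    case True then show ?thesis using z by simp
  next
    case False
    then show ?thesis using repr[OF that] by (auto intro!: mem simp: fract_collapse)
  qed
  show "a / b \<in> carrier (Fm m)" if "a \<in> carrier (Fm m)" "b \<in> carrier (Fm m)"
    using mult[OF that(1) inv[OF that(2)]] by (simp add: divide_inverse)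
qed

lemma cring_Fm: "cring (Fm m)"
proof (rule cringI)
  show "abelian_group (Fm m)"
    by (rule abelian_groupI)
      (auto simp: Fm_closed algebra_simps intro: bexI[of _ "- x" for x])
  show "comm_monoid (Fm m)"
    by (rule comm_monoidI) (auto simp: Fm_closed algebra_simps)
qed (auto simp: algebra_simps)

lemma Fm_powi: "a \<in> carrier (Fm m) \<Longrightarrow> a powi k \<in> carrier (Fm m)"
proof -
  have p: "b ^ i \<in> carrier (Fm m)" if "b \<in> carrier (Fm m)" for b and i :: nat
    using that by (induction i) (auto intro: Fm_closed)
  assume "a \<in> carrier (Fm m)"
  then show ?thesis by (auto simp: power_int_def intro!: p Fm_closed)
qed

lemma Fm_indets: "qF \<in> carrier (Fm m)" "l \<le> m \<Longrightarrow> vF l \<in> carrier (Fm m)"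
  by (auto simp: qF_def vF_def intro!: to_Fm_closed Rm_indet_pow)

lemma indet_pow_add: "indet_pow i (j + k) = indet_pow i j * indet_pow i k"
  by (simp add: indet_pow_def mult_single single_add)

lemma indet_pow_0 [simp]: "indet_pow i 0 = 1"
  by (simp add: indet_pow_def)

lemma qF_powi: "qF powi k = to_Fm (indet_pow 0 k)"
proof -
  have nat: "qF ^ j = to_Fm (indet_pow 0 (int j))" for j
    by (induction j) (simp_all add: qF_def indet_pow_add[symmetric] to_Fm_simps(6)[symmetric] add.commute
        del: to_Fm_simps(6))
  have inv: "inverse (to_Fm (indet_pow 0 (int j))) = to_Fm (indet_pow 0 (- int j))" for j
    by (rule inverse_unique)
      (simp add: to_Fm_simps(6)[symmetric] indet_pow_add[symmetric] del: to_Fm_simps(6))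
  show ?thesis
  proof (cases "k \<ge> 0")
    case True
    then show ?thesis using nat[of "nat k"] by (simp add: power_int_def)
  next
    case False
    then show ?thesis using nat[of "nat (- k)"] inv[of "nat (- k)"]
      by (simp add: power_int_def power_inverse)
  qed
qed

lemma indet_pow_nz [simp]: "indet_pow i k \<noteq> 0"
  by (metis indet_pow_def keys_single keys_zero insert_not_empty one_neq_zero)

lemma qF_nz [simp]: "qF \<noteq> 0"
proof
  assume "qF = 0"
  then have "indet_pow 0 1 = 0" using to_Fm_eq_iff[of "indet_pow 0 1" 0] by (simp add: qF_def)
  then show False by simp
qed

lemma inverse_qF: "inverse qF = to_Fm (indet_pow 0 (- 1))"
  using qF_powi[of "-1"] by (simp add: power_int_minus)

lemma vF_nz [simp]: "vF l \<noteq> 0"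
proof
  assume "vF l = 0"
  then have "indet_pow l 1 = 0" using to_Fm_eq_iff[of "indet_pow l 1" 0] by (simp add: vF_def)
  then show False by simp
qed

lemma content_monomial:
  "vF l * qF powi k = to_Fm (Poly_Mapping.single (Poly_Mapping.single l 1 + Poly_Mapping.single 0 k) 1)"
  by (simp add: qF_powi vF_def to_Fm_simps(6)[symmetric] indet_pow_def mult_single del: to_Fm_simps(6))

text \<open>Both sides are Laurent monomials, so the exponents can be compared. The bounds keep v_l
  apart from indeterminate 0, which is q.\<close>

lemma content_inj:
  assumes "l \<ge> 1" "l' \<ge> 1"
  shows "vF l * qF powi k = vF l' * qF powi k' \<longleftrightarrow> l = l' \<and> k = k'"
proof
  assume "vF l * qF powi k = vF l' * qF powi k'"
  then have eq: "Poly_Mapping.single l (1::int) + Poly_Mapping.single 0 k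
      = Poly_Mapping.single l' 1 + Poly_Mapping.single 0 k'"
    unfolding content_monomial to_Fm_eq_iff
    by (metis keys_single one_neq_zero singleton_inject)
  have "k = k'" using arg_cong[OF eq, of "\<lambda>f. Poly_Mapping.lookup f 0"] assms
    by (simp add: lookup_add lookup_single when_def)
  moreover have "l = l'" using arg_cong[OF eq, of "\<lambda>f. Poly_Mapping.lookup f l"] assms
    by (auto simp: lookup_add lookup_single when_def split: if_splits)
  ultimately show "l = l' \<and> k = k'" by simp
qed auto

lemma qF_powi_eq_1 [simp]: "qF powi k = 1 \<longleftrightarrow> k = 0"
  using content_inj[of 1 1 k 0] by simp

lemma q_diff_nz: "qF - inverse qF \<noteq> 0"
proof
  assume "qF - inverse qF = 0"
  then have "qF powi 2 = 1" by (simp add: power2_eq_square field_simps)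
  then show False unfolding qF_powi_eq_1 by simp
qed

text \<open>Contents of adjacent nodes differ by a factor q^2 or its inverse; this excludes that
  they add up to zero, which \<open>covers_coeff\<close> needs.\<close>

lemma qF_sq_neq_neg1: "qF\<^sup>2 \<noteq> - 1"
proof
  assume "qF\<^sup>2 = - 1"
  then have "(qF\<^sup>2)\<^sup>2 = 1" by simp
  then have "qF powi 4 = 1" by (simp flip: power_mult)
  then show False unfolding qF_powi_eq_1 by simp
qed

lemma qF_sq_neq_1: "qF\<^sup>2 \<noteq> 1"
  using qF_powi_eq_1[of 2] by simp

section \<open>Quotients, free algebras and extension of scalars\<close>

text \<open>Serves both the quotient of the free algebra and that of the pair ring. Of the scalars
  it asks only compatibility with the ideal and additivity in the vector: the pair ring is not yet a
  module, since (a + b, x) and (a, x) + (b, x) differ before the relations are imposed.\<close>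

locale quotient_alg = ideal I P for I and P :: "('k, 'a) module" (structure) +
  fixes R :: "('k, 'r) ring_scheme"
  assumes smult_carrier: "\<lbrakk>c \<in> carrier R; x \<in> carrier P\<rbrakk> \<Longrightarrow> c \<odot> x \<in> carrier P"
    and smult_ideal: "\<lbrakk>c \<in> carrier R; x \<in> I\<rbrakk> \<Longrightarrow> c \<odot> x \<in> I"
    and smult_add: "\<lbrakk>c \<in> carrier R; x \<in> carrier P; y \<in> carrier P\<rbrakk> \<Longrightarrow> c \<odot> (x \<oplus> y) = c \<odot> x \<oplus> c \<odot> y"
begin

abbreviation Q where "Q \<equiv> quotient_algebra P I"
abbreviation cl where "cl x \<equiv> I +> x"

lemma Q_simps:
  "carrier Q = carrier (P Quot I)" "monoid.mult Q = monoid.mult (P Quot I)"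
  "add Q = add (P Quot I)" "\<one>\<^bsub>Q\<^esub> = cl \<one>" "\<zero>\<^bsub>Q\<^esub> = I"
  by (simp_all add: quotient_algebra_def ring.defs module.defs FactRing_def)

lemma carrier_Q: "carrier Q = cl ` carrier P"
  by (auto simp: Q_simps FactRing_def A_RCOSETS_defs a_r_coset_def)

lemma cl_closed [simp, intro]: "x \<in> carrier P \<Longrightarrow> cl x \<in> carrier Q"
  by (simp add: carrier_Q)

lemma cl_add: "x \<in> carrier P \<Longrightarrow> y \<in> carrier P \<Longrightarrow> cl x \<oplus>\<^bsub>Q\<^esub> cl y = cl (x \<oplus> y)"
  by (simp add: Q_simps FactRing_def a_rcos_sum)

lemma cl_mult: "x \<in> carrier P \<Longrightarrow> y \<in> carrier P \<Longrightarrow> cl x \<otimes>\<^bsub>Q\<^esub> cl y = cl (x \<otimes> y)"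
  by (simp add: Q_simps FactRing_def rcoset_mult_add)

lemma cl_ideal: "x \<in> I \<Longrightarrow> cl x = \<zero>\<^bsub>Q\<^esub>"
  by (simp add: Q_simps a_rcos_const)

lemma cl_zero: "cl \<zero> = \<zero>\<^bsub>Q\<^esub>"
  by (rule cl_ideal) simp

lemma cl_smult: "c \<in> carrier R \<Longrightarrow> x \<in> carrier P \<Longrightarrow> c \<odot>\<^bsub>Q\<^esub> cl x = cl (c \<odot> x)"
proof -
  assume c: "c \<in> carrier R" and x: "x \<in> carrier P"
  \<comment> \<open>The scalar action on cosets is a union over all representatives. It is a single
    coset because scalars preserve the ideal.\<close>
  have "cl (c \<odot> y) = cl (c \<odot> x)" if y: "y \<in> cl x" for y
  proof -
    obtain i where i: "i \<in> I" "y = i \<oplus> x"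
      using y by (auto simp: a_r_coset_def r_coset_def)
    then have "c \<odot> y = c \<odot> i \<oplus> c \<odot> x" using c x by (simp add: smult_add a_Hcarr)
    then have "cl (c \<odot> y) = cl (c \<odot> i) \<oplus>\<^bsub>Q\<^esub> cl (c \<odot> x)"
      using c x i by (simp add: cl_add smult_carrier a_Hcarr)
    also have "\<dots> = cl \<zero> \<oplus>\<^bsub>Q\<^esub> cl (c \<odot> x)"
      using c i by (simp add: cl_ideal smult_ideal)
    finally show ?thesis using c x by (simp add: cl_add smult_carrier)
  qed
  moreover have "x \<in> cl x" using x by (rule a_rcos_self)
  ultimately have "(\<Union>y\<in>cl x. cl (c \<odot> y)) = cl (c \<odot> x)" by blast
  then show ?thesis by (simp add: quotient_algebra_def ring.defs module.defs)
qed

lemma cl_eq: "x \<in> carrier P \<Longrightarrow> y \<in> carrier P \<Longrightarrow> x \<ominus> y \<in> I \<Longrightarrow> cl x = cl y"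
  using quotient_eq_iff_same_a_r_cos[OF ideal_axioms, of x y] by blast

lemma cl_eqD: "x \<in> carrier P \<Longrightarrow> y \<in> carrier P \<Longrightarrow> cl x = cl y \<Longrightarrow> x \<ominus> y \<in> I"
  using quotient_eq_iff_same_a_r_cos[OF ideal_axioms, of x y] by blast

lemma ring_Q: "ring Q"
proof (rule ringI)
  show "abelian_group Q"
  proof (rule abelian_groupI)
    show "\<exists>y\<in>carrier Q. y \<oplus>\<^bsub>Q\<^esub> x = \<zero>\<^bsub>Q\<^esub>" if x: "x \<in> carrier Q" for x
    proof -
      obtain a where a: "a \<in> carrier P" "x = cl a" using x by (auto simp: carrier_Q)
      then have "cl (\<ominus> a) \<oplus>\<^bsub>Q\<^esub> x = \<zero>\<^bsub>Q\<^esub>" by (simp add: cl_add cl_zero l_neg)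
      then show ?thesis using a by blast
    qed
  qed (auto simp: carrier_Q cl_add a_ac cl_zero[symmetric] simp del: cl_zero)
  show "monoid Q"
    by (rule monoidI) (auto simp: carrier_Q cl_mult m_assoc Q_simps(4))
qed (auto simp: carrier_Q cl_mult cl_add l_distr r_distr)

end

section \<open>Free algebras with coefficients in a subring\<close>

lemma poly_mapping_sum_single: "f = (\<Sum>k\<in>Poly_Mapping.keys f. Poly_Mapping.single k (Poly_Mapping.lookup f k))"
  by (rule poly_mapping_eqI)
    (auto simp: lookup_sum lookup_single when_def not_in_keys_iff_lookup_eq_zero)

locale free_alg =
  fixes R :: "'r::comm_ring_1 set" and S :: "'g set"
  assumes R_zero: "0 \<in> R" and R_one: "1 \<in> R" and R_add: "a \<in> R \<Longrightarrow> b \<in> R \<Longrightarrow> a + b \<in> R"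
    and R_uminus: "a \<in> R \<Longrightarrow> - a \<in> R" and R_mult: "a \<in> R \<Longrightarrow> b \<in> R \<Longrightarrow> a * b \<in> R"
begin

abbreviation FA where "FA \<equiv> free_algebra R S"

lemma FA_simps [simp]:
  "monoid.mult FA = (*)" "add FA = (+)" "\<one>\<^bsub>FA\<^esub> = 1" "\<zero>\<^bsub>FA\<^esub> = 0" "smult FA = (\<lambda>c f. scalar c * f)"
  by (simp_all add: free_algebra_def)

lemma FA_iff: "f \<in> carrier FA \<longleftrightarrow>
    (\<forall>w. Poly_Mapping.lookup f w \<in> R) \<and> (\<forall>w\<in>Poly_Mapping.keys f. set (letters w) \<subseteq> S)"
  by (simp add: free_algebra_def)

lemma FA_single: "c \<in> R \<Longrightarrow> set (letters w) \<subseteq> S \<Longrightarrow> Poly_Mapping.single w c \<in> carrier FA"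
  by (auto simp: FA_iff lookup_single when_def R_zero split: if_splits)

lemma FA_zero [simp]: "0 \<in> carrier FA"
  by (simp add: FA_iff R_zero)

lemma FA_add: "f \<in> carrier FA \<Longrightarrow> g \<in> carrier FA \<Longrightarrow> f + g \<in> carrier FA"
  unfolding FA_iff lookup_add using keys_add[of f g] by (blast intro: R_add)

lemma FA_uminus: "f \<in> carrier FA \<Longrightarrow> - f \<in> carrier FA"
  by (simp add: FA_iff R_uminus)

lemma FA_diff: "f \<in> carrier FA \<Longrightarrow> g \<in> carrier FA \<Longrightarrow> f - g \<in> carrier FA"
  using FA_add[OF _ FA_uminus, of f g] by simp

lemma FA_sum: "(\<And>i. i \<in> B \<Longrightarrow> f i \<in> carrier FA) \<Longrightarrow> sum f B \<in> carrier FA"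
  by (induction B rule: infinite_finite_induct) (auto intro: FA_add)

lemma FA_mult: "f \<in> carrier FA \<Longrightarrow> g \<in> carrier FA \<Longrightarrow> f * g \<in> carrier FA"
proof -
  assume f: "f \<in> carrier FA" and g: "g \<in> carrier FA"
  have "f * g = (\<Sum>k\<in>Poly_Mapping.keys f. \<Sum>l\<in>Poly_Mapping.keys g.
      Poly_Mapping.single (k + l) (Poly_Mapping.lookup f k * Poly_Mapping.lookup g l))"
    by (subst poly_mapping_sum_single[of f], subst poly_mapping_sum_single[of g])
      (simp add: sum_product mult_single)
  also have "\<dots> \<in> carrier FA"
    using f g by (intro FA_sum FA_single) (auto simp: FA_iff R_mult plus_word_def dest: subsetD)
  finally show ?thesis .
qed

lemma FA_scalar: "c \<in> R \<Longrightarrow> scalar c \<in> carrier FA"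
  unfolding scalar_def by (rule FA_single) (simp_all add: zero_word_def)

lemma FA_letter: "x \<in> S \<Longrightarrow> letter x \<in> carrier FA"
  unfolding letter_def by (rule FA_single) (simp_all add: R_one)

lemma scalar_one [simp]: "scalar 1 = 1"
  by (simp add: scalar_def)

lemma FA_one [simp]: "1 \<in> carrier FA"
  using FA_scalar[OF R_one] by simp

lemma scalar_central: "f * scalar c = scalar c * (f :: 'h word \<Rightarrow>\<^sub>0 'r)"
proof -
  have "Poly_Mapping.single k a * scalar c = scalar c * Poly_Mapping.single k a" for k :: "'h word" and a
    by (simp add: scalar_def mult_single mult.commute)
  then show ?thesis
    by (subst (1 2) poly_mapping_sum_single[of f]) (simp add: sum_distrib_left sum_distrib_right)
qed

lemma ring_FA: "ring FA"
proof (rule ringI)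
  show "abelian_group FA"
    by (rule abelian_groupI)
      (auto simp: FA_add algebra_simps intro: bexI[of _ "- x" for x] FA_uminus)
  show "monoid FA"
    by (rule monoidI) (auto simp: FA_mult algebra_simps)
qed (auto simp: algebra_simps)

lemma FA_a_inv: "f \<in> carrier FA \<Longrightarrow> \<ominus>\<^bsub>FA\<^esub> f = - f"
  using abelian_group.minus_equality[OF ring.is_abelian_group[OF ring_FA], of "- f" f]
  by (simp add: FA_uminus)

lemma FA_minus: "f \<in> carrier FA \<Longrightarrow> g \<in> carrier FA \<Longrightarrow> f \<ominus>\<^bsub>FA\<^esub> g = f - g"
  by (simp add: a_minus_def FA_a_inv)

end

section \<open>Extension of scalars through the ring of pairs\<close>

locale scalar_extension =
  fixes R :: "('r, 'c) ring_scheme" and K :: "('k, 'b) ring_scheme" and h :: "'r \<Rightarrow> 'k"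
    and A :: "('r, 'a) module"
  assumes cring_K: "cring K" and ring_A: "ring A"
    and h_closed: "r \<in> carrier R \<Longrightarrow> h r \<in> carrier K"
    and A_smult_closed: "r \<in> carrier R \<Longrightarrow> x \<in> carrier A \<Longrightarrow> r \<odot>\<^bsub>A\<^esub> x \<in> carrier A"
begin

sublocale K: cring K by (rule cring_K)
sublocale A: ring A by (rule ring_A)

abbreviation PR where "PR \<equiv> pair_ring K A"
abbreviation TI where "TI \<equiv> tensor_ideal R K h A"

definition pm where "pm z w = frag_extend (\<lambda>(a, x). frag_extend (\<lambda>(b, y). frag_of (a \<otimes>\<^bsub>K\<^esub> b, x \<otimes>\<^bsub>A\<^esub> y)) w) z"

lemma PR_simps [simp]:
  "monoid.mult PR = pm" "add PR = (+)" "\<one>\<^bsub>PR\<^esub> = frag_of (\<one>\<^bsub>K\<^esub>, \<one>\<^bsub>A\<^esub>)" "\<zero>\<^bsub>PR\<^esub> = 0"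
  "smult PR = (\<lambda>c. frag_extend (\<lambda>(a, x). frag_of (c \<otimes>\<^bsub>K\<^esub> a, x)))"
  "carrier PR = {z. Poly_Mapping.keys z \<subseteq> carrier K \<times> carrier A}"
  by (simp_all add: pair_ring_def pm_def fun_eq_iff)

lemma pm_simps:
  "pm 0 w = 0" "pm z 0 = 0" "pm (frag_of (a, x)) (frag_of (b, y)) = frag_of (a \<otimes>\<^bsub>K\<^esub> b, x \<otimes>\<^bsub>A\<^esub> y)"
  "pm (z - z') w = pm z w - pm z' w" "pm (z + z') w = pm z w + pm z' w"
  by (simp_all add: pm_def frag_extend_diff frag_extend_add frag_extend_eq_0 case_prod_beta)

lemma pm_diff_right: "pm z (w - w') = pm z w - pm z w'"
  by (rule frag_induction[of z UNIV])
    (simp_all add: pm_simps, simp add: pm_def frag_extend_diff case_prod_beta)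

lemma pm_add_right: "pm z (w + w') = pm z w + pm z w'"
  using pm_diff_right[of z "w + w'" w'] by simp

lemma frag_of_PR: "a \<in> carrier K \<Longrightarrow> x \<in> carrier A \<Longrightarrow> frag_of (a, x) \<in> carrier PR"
  by simp

lemma pm_closed: "z \<in> carrier PR \<Longrightarrow> w \<in> carrier PR \<Longrightarrow> pm z w \<in> carrier PR"
proof -
  assume z: "z \<in> carrier PR" and w: "w \<in> carrier PR"
  have d: "u - v \<in> carrier PR" if "u \<in> carrier PR" "v \<in> carrier PR" for u v :: "'k \<times> 'a \<Rightarrow>\<^sub>0 int"
    using that keys_diff[of u v] by auto
  have "pm (frag_of (a, x)) w \<in> carrier PR" if "a \<in> carrier K" "x \<in> carrier A" for a x
    using w[simplified]
    by (rule frag_induction) (use that in \<open>auto simp: pm_simps pm_diff_right simp del: PR_simps(6) intro!: d frag_of_PR\<close>, simp)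
  then show ?thesis
    using z[simplified] by - (rule frag_induction, auto simp: pm_simps simp del: PR_simps(6) intro!: d, simp)
qed

lemma pm_assoc:
  assumes "u \<in> carrier PR" "v \<in> carrier PR" "w \<in> carrier PR"
  shows "pm (pm u v) w = pm u (pm v w)"
proof -
  have 1: "pm (pm (frag_of i) (frag_of j)) w = pm (frag_of i) (pm (frag_of j) w)"
    if "i \<in> carrier K \<times> carrier A" "j \<in> carrier K \<times> carrier A" for i j
    using assms(3)[simplified]
    by (rule frag_induction) (use that in \<open>auto simp: pm_simps pm_diff_right K.m_assoc A.m_assoc\<close>)
  have 2: "pm (pm (frag_of i) v) w = pm (frag_of i) (pm v w)" if "i \<in> carrier K \<times> carrier A" for i
    using assms(2)[simplified]
    by (rule frag_induction) (use that 1 in \<open>auto simp: pm_simps pm_diff_right\<close>)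
  show ?thesis
    using assms(1)[simplified]
    by (rule frag_induction) (use 2 in \<open>auto simp: pm_simps pm_diff_right\<close>)
qed

lemma ring_PR: "ring PR"
proof (rule ringI)
  show "abelian_group PR"
  proof (rule abelian_groupI)
    fix x y assume "x \<in> carrier PR" "y \<in> carrier PR"
    then show "x \<oplus>\<^bsub>PR\<^esub> y \<in> carrier PR" using keys_add[of x y] by auto
    show "\<exists>y\<in>carrier PR. y \<oplus>\<^bsub>PR\<^esub> x = \<zero>\<^bsub>PR\<^esub>" if "x \<in> carrier PR"
      using that by (intro bexI[of _ "- x"]) auto
  qed (auto simp: algebra_simps)
  show "monoid PR"
  proof (rule monoidI)
    show "\<one>\<^bsub>PR\<^esub> \<otimes>\<^bsub>PR\<^esub> x = x" "x \<otimes>\<^bsub>PR\<^esub> \<one>\<^bsub>PR\<^esub> = x" if "x \<in> carrier PR" for x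
    proof -
      have "pm \<one>\<^bsub>PR\<^esub> x = x \<and> pm x \<one>\<^bsub>PR\<^esub> = x"
        using that[simplified] by (rule frag_induction) (auto simp: pm_simps pm_diff_right)
      then show "\<one>\<^bsub>PR\<^esub> \<otimes>\<^bsub>PR\<^esub> x = x" "x \<otimes>\<^bsub>PR\<^esub> \<one>\<^bsub>PR\<^esub> = x" by simp_all
    qed
  qed (use pm_closed pm_assoc in auto)
qed (auto simp: pm_simps pm_add_right)

sublocale PR: ring PR by (rule ring_PR)

text \<open>Scalars act as left multiplication by the pair (c, 1), so every left ideal of the pair
  ring is stable under them.\<close>

lemma PR_smult: "c \<in> carrier K \<Longrightarrow> z \<in> carrier PR \<Longrightarrow> c \<odot>\<^bsub>PR\<^esub> z = pm (frag_of (c, \<one>\<^bsub>A\<^esub>)) z"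
  by (simp, erule frag_induction) (auto simp: pm_simps pm_diff_right frag_extend_diff)

lemma PR_central:
  assumes "c \<in> carrier K" "z \<in> carrier PR"
  shows "pm z (frag_of (c, \<one>\<^bsub>A\<^esub>)) = pm (frag_of (c, \<one>\<^bsub>A\<^esub>)) z"
  using assms(2)[simplified]
  by (rule frag_induction) (use assms(1) in \<open>auto simp: pm_simps pm_diff_right K.m_comm\<close>)

lemma PR_a_inv: "z \<in> carrier PR \<Longrightarrow> \<ominus>\<^bsub>PR\<^esub> z = - z"
  using PR.minus_equality[of "- z" z] by simp

lemma PR_minus: "z \<in> carrier PR \<Longrightarrow> w \<in> carrier PR \<Longrightarrow> z \<ominus>\<^bsub>PR\<^esub> w = z - w"
  by (simp add: a_minus_def PR_a_inv)

lemma PR_diff: "z \<in> carrier PR \<Longrightarrow> w \<in> carrier PR \<Longrightarrow> z - w \<in> carrier PR"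
  using keys_diff[of z w] by auto

lemma relators_subset: "tensor_relators R K h A \<subseteq> carrier PR"
proof -
  have f: "frag_of (a, x) \<in> carrier PR" if "a \<in> carrier K" "x \<in> carrier A" for a x
    using that by simp
  show ?thesis
    unfolding tensor_relators_def
    by (auto simp del: PR_simps(6) intro!: PR_diff f h_closed A_smult_closed)
qed

lemma ideal_TI: "ideal TI PR"
  unfolding tensor_ideal_def by (rule PR.genideal_ideal[OF relators_subset])

lemma relators_TI: "tensor_relators R K h A \<subseteq> TI"
  unfolding tensor_ideal_def by (rule PR.genideal_self[OF relators_subset])

lemma relators_mem:
  "\<lbrakk>a \<in> carrier K; b \<in> carrier K; x \<in> carrier A\<rbrakk>
    \<Longrightarrow> frag_of (a \<oplus>\<^bsub>K\<^esub> b, x) - frag_of (a, x) - frag_of (b, x) \<in> TI"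
  "\<lbrakk>a \<in> carrier K; x \<in> carrier A; y \<in> carrier A\<rbrakk>
    \<Longrightarrow> frag_of (a, x \<oplus>\<^bsub>A\<^esub> y) - frag_of (a, x) - frag_of (a, y) \<in> TI"
  "\<lbrakk>a \<in> carrier K; r \<in> carrier R; x \<in> carrier A\<rbrakk>
    \<Longrightarrow> frag_of (a \<otimes>\<^bsub>K\<^esub> h r, x) - frag_of (a, r \<odot>\<^bsub>A\<^esub> x) \<in> TI"
  by (rule subsetD[OF relators_TI], unfold tensor_relators_def, blast)+

sublocale Q: quotient_alg TI PR K
proof (intro quotient_alg.intro ideal_TI quotient_alg_axioms.intro)
  fix c x y assume c: "c \<in> carrier K"
  have cc: "frag_of (c, \<one>\<^bsub>A\<^esub>) \<in> carrier PR" using c by simp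
  show "c \<odot>\<^bsub>PR\<^esub> x \<in> carrier PR" if "x \<in> carrier PR"
    using pm_closed[OF cc that] PR_smult[OF c that] by simp
  show "c \<odot>\<^bsub>PR\<^esub> x \<in> TI" if "x \<in> TI"
  proof -
    have "x \<in> carrier PR" using that ideal.Icarr[OF ideal_TI] by blast
    then show ?thesis
      using ideal.I_l_closed[OF ideal_TI that cc] PR_smult[OF c, of x] by simp
  qed
  show "c \<odot>\<^bsub>PR\<^esub> (x \<oplus>\<^bsub>PR\<^esub> y) = c \<odot>\<^bsub>PR\<^esub> x \<oplus>\<^bsub>PR\<^esub> c \<odot>\<^bsub>PR\<^esub> y"
    by (simp add: frag_extend_add)
qed

abbreviation E where "E \<equiv> extend_scalars R K h A"
abbreviation pt where "pt \<equiv> pure_tensor R K h A"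

lemma E_eq: "E = quotient_algebra PR TI"
  by (simp add: extend_scalars_def)

lemma pt_eq: "pt a x = TI +>\<^bsub>PR\<^esub> frag_of (a, x)"
  by (simp add: pure_tensor_def)

lemma ring_E: "ring E"
  unfolding E_eq by (rule Q.ring_Q)

sublocale E: ring E by (rule ring_E)

lemma pt_closed [simp, intro]: "a \<in> carrier K \<Longrightarrow> x \<in> carrier A \<Longrightarrow> pt a x \<in> carrier E"
  unfolding E_eq pt_eq by (rule Q.cl_closed) simp

lemma pt_mult: "\<lbrakk>a \<in> carrier K; x \<in> carrier A; b \<in> carrier K; y \<in> carrier A\<rbrakk>
    \<Longrightarrow> pt a x \<otimes>\<^bsub>E\<^esub> pt b y = pt (a \<otimes>\<^bsub>K\<^esub> b) (x \<otimes>\<^bsub>A\<^esub> y)"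
  unfolding E_eq pt_eq by (subst Q.cl_mult) (simp_all add: pm_simps)

lemma pt_smult: "\<lbrakk>c \<in> carrier K; a \<in> carrier K; x \<in> carrier A\<rbrakk> \<Longrightarrow> c \<odot>\<^bsub>E\<^esub> pt a x = pt (c \<otimes>\<^bsub>K\<^esub> a) x"
  unfolding E_eq pt_eq by (subst Q.cl_smult) simp_all

lemma pt_one: "pt \<one>\<^bsub>K\<^esub> \<one>\<^bsub>A\<^esub> = \<one>\<^bsub>E\<^esub>"
  by (simp add: E_eq pt_eq Q.Q_simps)

lemma TI_eqI: "z \<in> carrier PR \<Longrightarrow> w \<in> carrier PR \<Longrightarrow> z - w \<in> TI \<Longrightarrow> TI +>\<^bsub>PR\<^esub> z = TI +>\<^bsub>PR\<^esub> w"
  by (rule Q.cl_eq) (simp_all add: PR_minus del: PR_simps(6))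

lemma pt_add_right: "\<lbrakk>a \<in> carrier K; x \<in> carrier A; y \<in> carrier A\<rbrakk>
    \<Longrightarrow> pt a (x \<oplus>\<^bsub>A\<^esub> y) = pt a x \<oplus>\<^bsub>E\<^esub> pt a y"
proof -
  assume a: "a \<in> carrier K" "x \<in> carrier A" "y \<in> carrier A"
  have "frag_of (a, x \<oplus>\<^bsub>A\<^esub> y) - frag_of (a, x) - frag_of (a, y) \<in> TI"
    using a by (intro relators_mem A.one_closed)
  then have "pt a (x \<oplus>\<^bsub>A\<^esub> y) = TI +>\<^bsub>PR\<^esub> (frag_of (a, x) + frag_of (a, y))"
    unfolding pt_eq using a keys_add[of "frag_of (a, x)" "frag_of (a, y)"]
    by (intro TI_eqI) (auto simp: diff_diff_eq)
  then show ?thesis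
    unfolding E_eq pt_eq using a by (subst Q.cl_add) simp_all
qed

lemma pt_balanced: "\<lbrakk>a \<in> carrier K; r \<in> carrier R; x \<in> carrier A\<rbrakk>
    \<Longrightarrow> pt a (r \<odot>\<^bsub>A\<^esub> x) = pt (a \<otimes>\<^bsub>K\<^esub> h r) x"
proof -
  assume a: "a \<in> carrier K" "r \<in> carrier R" "x \<in> carrier A"
  have "frag_of (a \<otimes>\<^bsub>K\<^esub> h r, x) - frag_of (a, r \<odot>\<^bsub>A\<^esub> x) \<in> TI"
    using a by (intro relators_mem A.one_closed)
  then show ?thesis
    unfolding pt_eq using a by (intro TI_eqI[symmetric]) (auto simp: h_closed A_smult_closed)
qed

text \<open>The free abelian group on pairs is generated by the pairs under subtraction alone, so
  closure under differences replaces separate cases for zero, sums and negatives.\<close>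

lemma E_induct [consumes 1, case_names pt minus]:
  assumes "D \<in> carrier E" "\<And>a x. a \<in> carrier K \<Longrightarrow> x \<in> carrier A \<Longrightarrow> P (pt a x)"
    "\<And>u v. u \<in> carrier E \<Longrightarrow> v \<in> carrier E \<Longrightarrow> P u \<Longrightarrow> P v \<Longrightarrow> P (u \<ominus>\<^bsub>E\<^esub> v)"
  shows "P D"
proof -
  obtain z where z: "z \<in> carrier PR" "D = TI +>\<^bsub>PR\<^esub> z"
    using assms(1) unfolding E_eq Q.carrier_Q by (elim imageE)
  have m: "TI +>\<^bsub>PR\<^esub> (u - v) = (TI +>\<^bsub>PR\<^esub> u) \<ominus>\<^bsub>E\<^esub> (TI +>\<^bsub>PR\<^esub> v)"
    if "u \<in> carrier PR" "v \<in> carrier PR" for u v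
  proof -
    have "(TI +>\<^bsub>PR\<^esub> (u - v)) \<oplus>\<^bsub>E\<^esub> (TI +>\<^bsub>PR\<^esub> v) = TI +>\<^bsub>PR\<^esub> u"
      unfolding E_eq using that PR_diff[OF that] by (subst Q.cl_add) simp_all
    moreover have "TI +>\<^bsub>PR\<^esub> w \<in> carrier E" if "w \<in> carrier PR" for w
      unfolding E_eq using that by (rule Q.cl_closed)
    ultimately show ?thesis using that PR_diff[OF that]
      by (metis E.minus_eq E.add.inv_solve_right)
  qed
  have z0: "P \<zero>\<^bsub>E\<^esub>"
    using assms(3)[of "pt \<zero>\<^bsub>K\<^esub> \<zero>\<^bsub>A\<^esub>" "pt \<zero>\<^bsub>K\<^esub> \<zero>\<^bsub>A\<^esub>"] assms(2)[of "\<zero>\<^bsub>K\<^esub>" "\<zero>\<^bsub>A\<^esub>"]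
    by (simp add: E.r_neg E.minus_eq)
  have "z \<in> carrier PR \<and> P (TI +>\<^bsub>PR\<^esub> z)"
    using z(1)[simplified]
  proof (rule frag_induction)
    show "0 \<in> carrier PR \<and> P (TI +>\<^bsub>PR\<^esub> 0)"
      using z0 Q.cl_zero by (simp add: E_eq)
    show "frag_of x \<in> carrier PR \<and> P (TI +>\<^bsub>PR\<^esub> frag_of x)" if "x \<in> carrier K \<times> carrier A" for x
      using that assms(2)[of "fst x" "snd x"] by (auto simp: pt_eq)
    show "u - v \<in> carrier PR \<and> P (TI +>\<^bsub>PR\<^esub> (u - v))"
      if "u \<in> carrier PR \<and> P (TI +>\<^bsub>PR\<^esub> u)" "v \<in> carrier PR \<and> P (TI +>\<^bsub>PR\<^esub> v)" for u v
    proof -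
      have "TI +>\<^bsub>PR\<^esub> u \<in> carrier E" "TI +>\<^bsub>PR\<^esub> v \<in> carrier E"
        unfolding E_eq using that Q.cl_closed by blast+
      then show ?thesis using that m[of u v] PR_diff[of u v] assms(3) by auto
    qed
  qed
  then show ?thesis using z by simp
qed

text \<open>In the quotient, c acts as left multiplication by the tensor of c and 1. This element is
  central because the field is commutative, and it is additive in c by the first kind of bilinearity
  relator.\<close>

lemma assoc_algebra_E: "assoc_algebra K E"
proof -
  note Esimp = E_eq
  define cc where "cc c = (frag_of (c, \<one>\<^bsub>A\<^esub>) :: 'k \<times> 'a \<Rightarrow>\<^sub>0 int)" for c
  have cc: "cc c \<in> carrier PR" if "c \<in> carrier K" for c using that by (simp add: cc_def)
  have sm: "c \<odot>\<^bsub>E\<^esub> x = pt c \<one>\<^bsub>A\<^esub> \<otimes>\<^bsub>E\<^esub> x" if c: "c \<in> carrier K" and x: "x \<in> carrier E" for c x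
  proof -
    obtain z where z: "z \<in> carrier PR" "x = TI +>\<^bsub>PR\<^esub> z"
      using x unfolding E_eq Q.carrier_Q by (elim imageE)
    have "c \<odot>\<^bsub>E\<^esub> x = TI +>\<^bsub>PR\<^esub> (c \<odot>\<^bsub>PR\<^esub> z)"
      unfolding E_eq z(2) by (rule Q.cl_smult[OF c z(1)])
    also have "\<dots> = (TI +>\<^bsub>PR\<^esub> cc c) \<otimes>\<^bsub>E\<^esub> (TI +>\<^bsub>PR\<^esub> z)"
      unfolding E_eq PR_smult[OF c z(1)]
      using Q.cl_mult[OF cc[OF c] z(1)] by (simp add: cc_def)
    finally show ?thesis by (simp add: z pt_eq cc_def)
  qed
  have comm: "x \<otimes>\<^bsub>E\<^esub> pt c \<one>\<^bsub>A\<^esub> = pt c \<one>\<^bsub>A\<^esub> \<otimes>\<^bsub>E\<^esub> x" if "c \<in> carrier K" "x \<in> carrier E" for c x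
    using that(2)
  proof (induction rule: E_induct)
    case (pt a y)
    then show ?case using that(1) by (simp add: pt_mult K.m_comm)
  next
    case (minus u v)
    define p where "p = pt c \<one>\<^bsub>A\<^esub>"
    have p: "p \<in> carrier E" using that(1) by (simp add: p_def)
    show ?case using minus unfolding p_def[symmetric]
      by (simp add: p E.r_minus E.l_minus E.l_distr E.r_distr E.minus_eq)
  qed
  have add: "pt (a \<oplus>\<^bsub>K\<^esub> b) \<one>\<^bsub>A\<^esub> = pt a \<one>\<^bsub>A\<^esub> \<oplus>\<^bsub>E\<^esub> pt b \<one>\<^bsub>A\<^esub>"
    if "a \<in> carrier K" "b \<in> carrier K" for a b
  proof -
    have "frag_of (a \<oplus>\<^bsub>K\<^esub> b, \<one>\<^bsub>A\<^esub>) - frag_of (a, \<one>\<^bsub>A\<^esub>) - frag_of (b, \<one>\<^bsub>A\<^esub>) \<in> TI"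
      using that by (intro relators_mem A.one_closed)
    then have "pt (a \<oplus>\<^bsub>K\<^esub> b) \<one>\<^bsub>A\<^esub> = TI +>\<^bsub>PR\<^esub> (frag_of (a, \<one>\<^bsub>A\<^esub>) + frag_of (b, \<one>\<^bsub>A\<^esub>))"
      unfolding pt_eq using that keys_add[of "frag_of (a, \<one>\<^bsub>A\<^esub>)" "frag_of (b, \<one>\<^bsub>A\<^esub>)"]
      by (intro TI_eqI) (auto simp: diff_diff_eq)
    then show ?thesis
      unfolding E_eq pt_eq using that by (subst Q.cl_add) simp_all
  qed
  have cl: "c \<odot>\<^bsub>E\<^esub> x \<in> carrier E" if "c \<in> carrier K" "x \<in> carrier E" for c x
    using that by (simp add: sm)
  have "module K E"
  proof (rule moduleI[OF cring_K E.is_abelian_group])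
    fix a b x y assume a: "a \<in> carrier K" and x: "x \<in> carrier E"
    show "a \<odot>\<^bsub>E\<^esub> x \<in> carrier E" using a x by (rule cl)
    show "(a \<oplus>\<^bsub>K\<^esub> b) \<odot>\<^bsub>E\<^esub> x = a \<odot>\<^bsub>E\<^esub> x \<oplus>\<^bsub>E\<^esub> b \<odot>\<^bsub>E\<^esub> x" if "b \<in> carrier K"
      using a x that by (simp add: sm add E.l_distr)
    show "a \<odot>\<^bsub>E\<^esub> (x \<oplus>\<^bsub>E\<^esub> y) = a \<odot>\<^bsub>E\<^esub> x \<oplus>\<^bsub>E\<^esub> a \<odot>\<^bsub>E\<^esub> y" if "y \<in> carrier E"
      using a x that by (simp add: sm E.r_distr)
    show "(a \<otimes>\<^bsub>K\<^esub> b) \<odot>\<^bsub>E\<^esub> x = a \<odot>\<^bsub>E\<^esub> (b \<odot>\<^bsub>E\<^esub> x)" if "b \<in> carrier K"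
      using a x that by (simp add: sm cl E.m_assoc[symmetric] pt_mult)
  next
    show "\<one>\<^bsub>K\<^esub> \<odot>\<^bsub>E\<^esub> x = x" if "x \<in> carrier E" for x
      using that by (simp add: sm pt_one)
  qed
  then show ?thesis
  proof (intro assoc_algebra.intro ring_E assoc_algebra_axioms.intro)
    fix c a b assume "c \<in> carrier K" "a \<in> carrier E" "b \<in> carrier E"
    then show "c \<odot>\<^bsub>E\<^esub> a \<otimes>\<^bsub>E\<^esub> b = c \<odot>\<^bsub>E\<^esub> (a \<otimes>\<^bsub>E\<^esub> b)" "a \<otimes>\<^bsub>E\<^esub> (c \<odot>\<^bsub>E\<^esub> b) = c \<odot>\<^bsub>E\<^esub> (a \<otimes>\<^bsub>E\<^esub> b)"
      by (simp_all add: sm E.m_assoc[symmetric] comm)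
  qed
qed

end

section \<open>Combinatorics of standard tableaux\<close>

abbreviation "row \<alpha> \<equiv> fst (fst \<alpha>)"
abbreviation "col \<alpha> \<equiv> snd (fst \<alpha>)"

text \<open>Half the exponent of q in the content; an integer because nodes below the main diagonal
  give negative values.\<close>

definition diag :: "dm_node \<Rightarrow> int" where
  "diag \<alpha> = int (col \<alpha>) - int (row \<alpha>)"

definition valid_node :: "nat \<Rightarrow> nat \<Rightarrow> dm_node \<Rightarrow> bool" where
  "valid_node d m \<alpha> \<longleftrightarrow> row \<alpha> \<ge> 1 \<and> col \<alpha> \<ge> 1 \<and> fst (snd \<alpha>) \<in> {1..d} \<and> snd (snd \<alpha>) \<in> {1..m}"

text \<open>The covering relation of \<open>node_le\<close>, with the smaller node as first
  argument.\<close>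

definition covers :: "dm_node \<Rightarrow> dm_node \<Rightarrow> bool" where
  "covers \<alpha> \<beta> \<longleftrightarrow> snd \<alpha> = snd \<beta> \<and>
     (row \<beta> = Suc (row \<alpha>) \<and> col \<beta> = col \<alpha> \<or> row \<beta> = row \<alpha> \<and> col \<beta> = Suc (col \<alpha>))"

definition node_le :: "dm_node \<Rightarrow> dm_node \<Rightarrow> bool" where
  "node_le \<alpha> \<beta> \<longleftrightarrow> snd \<alpha> = snd \<beta> \<and> row \<alpha> \<le> row \<beta> \<and> col \<alpha> \<le> col \<beta>"

definition down_closed :: "nat \<Rightarrow> nat \<Rightarrow> dm_node set \<Rightarrow> bool" where
  "down_closed d m D \<longleftrightarrow> (\<forall>\<beta>\<in>D. valid_node d m \<beta> \<and> (\<forall>\<alpha>. valid_node d m \<alpha> \<and> covers \<alpha> \<beta> \<longrightarrow> \<alpha> \<in> D))"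

definition addable :: "nat \<Rightarrow> nat \<Rightarrow> dm_node set \<Rightarrow> dm_node \<Rightarrow> bool" where
  "addable d m D \<beta> \<longleftrightarrow> valid_node d m \<beta> \<and> \<beta> \<notin> D \<and> (\<forall>\<alpha>. valid_node d m \<alpha> \<and> covers \<alpha> \<beta> \<longrightarrow> \<alpha> \<in> D)"

text \<open>Standard tableaux without reference to a shape: each entry goes to a node addable to
  those of the smaller entries. Restriction to the first i entries is then again such a sequence,
  which the inductions on Jucys-Murphy elements require.\<close>

definition std_seq :: "nat \<Rightarrow> nat \<Rightarrow> nat \<Rightarrow> (nat \<Rightarrow> dm_node) \<Rightarrow> bool" where
  "std_seq d m i T \<longleftrightarrow> (\<forall>j\<in>{1..i}. addable d m (T ` {1..<j}) (T j))"

abbreviation "swap i \<equiv> Transposition.transpose i (Suc i)"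

section \<open>Order ideals of nodes and addable nodes\<close>

lemma addableD:
  assumes "addable d m D \<beta>"
  shows "valid_node d m \<beta>" "\<beta> \<notin> D" "valid_node d m \<alpha> \<Longrightarrow> covers \<alpha> \<beta> \<Longrightarrow> \<alpha> \<in> D"
  using assms unfolding addable_def by blast+

lemma down_closedD:
  assumes "down_closed d m D" "\<beta> \<in> D"
  shows "valid_node d m \<beta>" "valid_node d m \<alpha> \<Longrightarrow> covers \<alpha> \<beta> \<Longrightarrow> \<alpha> \<in> D"
  using assms unfolding down_closed_def by blast+

lemma node_eqI: "snd \<alpha> = snd \<beta> \<Longrightarrow> row \<alpha> = row \<beta> \<Longrightarrow> col \<alpha> = col \<beta> \<Longrightarrow> \<alpha> = (\<beta> :: dm_node)"
  by (simp add: prod_eq_iff)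

lemma node_le_refl [simp]: "node_le \<alpha> \<alpha>"
  by (simp add: node_le_def)

lemma node_le_trans: "node_le \<alpha> \<beta> \<Longrightarrow> node_le \<beta> \<gamma> \<Longrightarrow> node_le \<alpha> \<gamma>"
  by (auto simp: node_le_def)

lemma covers_le: "covers \<alpha> \<beta> \<Longrightarrow> node_le \<alpha> \<beta> \<and> \<alpha> \<noteq> \<beta>"
  by (auto simp: covers_def node_le_def)

lemma node_le_covers:
  assumes "node_le \<alpha> \<beta>" "\<alpha> \<noteq> \<beta>" "valid_node d m \<alpha>" "valid_node d m \<beta>"
  obtains \<gamma> where "node_le \<alpha> \<gamma>" "covers \<gamma> \<beta>" "valid_node d m \<gamma>"
proof (cases "row \<alpha> < row \<beta>")
  case True
  then show thesis
    using assms that[of "((row \<beta> - 1, col \<beta>), snd \<beta>)"]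
    by (auto simp: node_le_def covers_def valid_node_def)
next
  case False
  then have "col \<alpha> < col \<beta>"
    using assms node_eqI[of \<alpha> \<beta>] by (auto simp: node_le_def le_less)
  then show thesis
    using assms that[of "((row \<beta>, col \<beta> - 1), snd \<beta>)"] False
    by (auto simp: node_le_def covers_def valid_node_def)
qed

lemma down_closed_le:
  assumes "down_closed d m D" "\<beta> \<in> D" "node_le \<alpha> \<beta>" "valid_node d m \<alpha>"
  shows "\<alpha> \<in> D"
  using assms(2,3)
proof (induction "row \<beta> + col \<beta>" arbitrary: \<beta> rule: less_induct)
  case less
  show ?case
  proof (cases "\<alpha> = \<beta>")
    case False
    have "valid_node d m \<beta>" using assms(1) less.prems by (auto simp: down_closed_def)
    then obtain \<gamma> where \<gamma>: "node_le \<alpha> \<gamma>" "covers \<gamma> \<beta>" "valid_node d m \<gamma>"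
      using node_le_covers[OF less.prems(2) False assms(4)] by blast
    moreover from this have "\<gamma> \<in> D" using down_closedD(2)[OF assms(1) less.prems(1)] by blast
    ultimately show ?thesis by (intro less.hyps[of \<gamma>]) (auto simp: covers_def)
  qed (use less in simp)
qed

lemma addable_le:
  assumes "down_closed d m D" "addable d m D \<beta>" "node_le \<alpha> \<beta>" "\<alpha> \<noteq> \<beta>" "valid_node d m \<alpha>"
  shows "\<alpha> \<in> D"
proof -
  obtain \<gamma> where \<gamma>: "node_le \<alpha> \<gamma>" "covers \<gamma> \<beta>" "valid_node d m \<gamma>"
    using node_le_covers[OF assms(3,4,5) addableD(1)[OF assms(2)]] by blast
  then have "\<gamma> \<in> D" using addableD(3)[OF assms(2)] by blast
  then show ?thesis using down_closed_le[OF assms(1) _ \<gamma>(1) assms(5)] by blast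
qed

lemma addable_comparable_eq:
  assumes "down_closed d m D" "addable d m D \<alpha>" "addable d m D \<beta>" "node_le \<alpha> \<beta> \<or> node_le \<beta> \<alpha>"
  shows "\<alpha> = \<beta>"
  using assms addable_le[of d m D \<beta> \<alpha>] addable_le[of d m D \<alpha> \<beta>] by (auto simp: addable_def)

text \<open>Incomparable nodes of one component differ in opposite directions in row and column, so
  their diagonals are at least two apart.\<close>

lemma near_diag_comparable:
  assumes "snd \<alpha> = snd \<beta>" "\<bar>diag \<alpha> - diag \<beta>\<bar> \<le> 1"
  shows "node_le \<alpha> \<beta> \<or> node_le \<beta> \<alpha>"
  using assms by (auto simp: node_le_def diag_def)

text \<open>Comparable addable nodes coincide, as the smaller would otherwise already be present. So
  an addable node is determined by its component and content.\<close>

lemma addable_same_diag: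
  assumes "down_closed d m D" "addable d m D \<alpha>" "addable d m D \<beta>" "snd \<alpha> = snd \<beta>"
    "\<bar>diag \<alpha> - diag \<beta>\<bar> \<le> 1"
  shows "\<alpha> = \<beta>"
  using addable_comparable_eq[OF assms(1-3)] near_diag_comparable[OF assms(4,5)] by blast

lemma down_closed_insert: "down_closed d m D \<Longrightarrow> addable d m D \<beta> \<Longrightarrow> down_closed d m (insert \<beta> D)"
  unfolding down_closed_def addable_def by blast

lemma covers_diag: "covers \<alpha> \<beta> \<Longrightarrow> snd \<alpha> = snd \<beta> \<and> \<bar>diag \<alpha> - diag \<beta>\<bar> = 1"
  by (auto simp: covers_def diag_def)

text \<open>The node \<gamma> would be comparable to \<beta>. If it is \<beta> or lies beyond it,
  then \<alpha> must already be in D; if it lies strictly before \<beta>, it can only be \<alpha>,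
  which has another diagonal. This is why an intertwiner vanishes when the exchange would violate
  standardness.\<close>

lemma covered_not_addable_diag:
  assumes "down_closed d m D" "addable d m D \<alpha>" "addable d m (insert \<alpha> D) \<beta>" "covers \<alpha> \<beta>"
    "addable d m D \<gamma>" "snd \<gamma> = snd \<beta>" "diag \<gamma> = diag \<beta>"
  shows False
proof -
  have dc: "down_closed d m (insert \<alpha> D)" using assms by (intro down_closed_insert)
  have v: "valid_node d m \<gamma>" "valid_node d m \<alpha>" "\<alpha> \<notin> D" "\<gamma> \<notin> D" using assms by (auto simp: addable_def)
  consider "\<gamma> = \<beta>" | "node_le \<gamma> \<beta>" "\<gamma> \<noteq> \<beta>" | "node_le \<beta> \<gamma>" "\<gamma> \<noteq> \<beta>"
    using near_diag_comparable[of \<gamma> \<beta>] assms by auto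
  then show False
  proof cases
    case 1 then show False using assms(4) v addableD(3)[OF assms(5), of \<alpha>] by simp
  next
    case 2
    then have "\<gamma> = \<alpha>" using addable_le[OF dc assms(3) 2 v(1)] v by simp
    then show False using covers_diag[OF assms(4)] assms by simp
  next
    case 3
    then have "node_le \<alpha> \<gamma>" using covers_le[OF assms(4)] node_le_trans by blast
    moreover have "\<alpha> \<noteq> \<gamma>" using covers_diag[OF assms(4)] assms by auto
    ultimately show False using addable_le[OF assms(1,5) _ _ v(2)] v by blast
  qed
qed

text \<open>A new node on the diagonal of \<alpha> lies strictly beyond \<alpha> in both directions,
  hence beyond \<beta>, so its addability would force \<beta> to be present.\<close>

lemma addable_not_above_covered:
  assumes "down_closed d m D" "\<alpha> \<in> D" "addable d m D \<beta>" "covers \<alpha> \<beta>"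
    "addable d m D \<gamma>" "snd \<gamma> = snd \<alpha>" "diag \<gamma> = diag \<alpha>"
  shows False
proof -
  have v: "valid_node d m \<beta>" "\<beta> \<notin> D" "valid_node d m \<gamma>" "\<gamma> \<notin> D" using assms by (auto simp: addable_def)
  have "node_le \<alpha> \<gamma> \<or> node_le \<gamma> \<alpha>"
    using near_diag_comparable[of \<gamma> \<alpha>] assms by auto
  moreover have "\<not> node_le \<gamma> \<alpha>" using down_closed_le[OF assms(1,2)] v by blast
  moreover have "\<gamma> \<noteq> \<alpha>" using v assms by auto
  ultimately have "node_le \<beta> \<gamma>" "\<beta> \<noteq> \<gamma>"
    using assms(4,6,7) node_eqI[of \<gamma> \<alpha>] by (auto simp: node_le_def covers_def diag_def)
  then show False using addable_le[OF assms(1,5) _ _ v(1)] v by blast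
qed

section \<open>Standard tableaux as growth sequences\<close>

lemma std_seq_mono: "std_seq d m i T \<Longrightarrow> j \<le> i \<Longrightarrow> std_seq d m j T"
  by (auto simp: std_seq_def)

lemma std_seq_Suc:
  "std_seq d m (Suc i) T \<longleftrightarrow> std_seq d m i T \<and> addable d m (T ` {1..i}) (T (Suc i))"
proof -
  have "{1..Suc i} = insert (Suc i) {1..i}" by auto
  moreover have "{1..<Suc i} = {1..i}" by auto
  ultimately show ?thesis unfolding std_seq_def by (simp add: conj_commute)
qed

lemma std_seq_cong: "(\<And>j. 1 \<le> j \<Longrightarrow> j \<le> i \<Longrightarrow> T j = S j) \<Longrightarrow> std_seq d m i T = std_seq d m i S"
proof -
  assume a: "\<And>j. 1 \<le> j \<Longrightarrow> j \<le> i \<Longrightarrow> T j = S j"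
  have "T ` {1..<j} = S ` {1..<j}" if "j \<in> {1..i}" for j
    using a that by (intro image_cong) auto
  then show ?thesis unfolding std_seq_def using a by (auto intro!: ball_cong)
qed

lemma std_seq_inj: "std_seq d m i T \<Longrightarrow> inj_on T {1..i}"
proof (rule linorder_inj_onI)
  fix x y assume "std_seq d m i T" "x < y" "x \<in> {1..i}" "y \<in> {1..i}"
  then have "T y \<notin> T ` {1..<y}" by (intro addableD(2)[of d m]) (auto simp: std_seq_def)
  moreover have "T x \<in> T ` {1..<y}" using \<open>x < y\<close> \<open>x \<in> {1..i}\<close> by auto
  ultimately show "T x \<noteq> T y" by metis
qed auto

lemma std_seq_down_closed: "std_seq d m i T \<Longrightarrow> down_closed d m (T ` {1..i})"
proof (induction i)
  case (Suc i)
  have "T ` {1..Suc i} = insert (T (Suc i)) (T ` {1..i})"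
    by (simp add: atLeastAtMostSuc_conv)
  with Suc show ?case by (auto simp: std_seq_Suc intro: down_closed_insert)
qed (simp add: down_closed_def)

lemma std_seq_valid: "std_seq d m i T \<Longrightarrow> 1 \<le> j \<Longrightarrow> j \<le> i \<Longrightarrow> valid_node d m (T j)"
  by (auto simp: std_seq_def addable_def)

lemma std_seq_addable: "std_seq d m i T \<Longrightarrow> 1 \<le> j \<Longrightarrow> j \<le> i \<Longrightarrow> addable d m (T ` {1..<j}) (T j)"
  by (auto simp: std_seq_def)

lemma std_seq_down_closed_less: "std_seq d m i T \<Longrightarrow> 1 \<le> j \<Longrightarrow> j \<le> i \<Longrightarrow> down_closed d m (T ` {1..<j})"
proof -
  assume "std_seq d m i T" "1 \<le> j" "j \<le> i"
  moreover have "{1..<j} = {1..j - 1}" using \<open>1 \<le> j\<close> by auto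
  ultimately show ?thesis using std_seq_down_closed[OF std_seq_mono[of d m i T "j - 1"]] by simp
qed

text \<open>When \<open>T j\<close> is placed, everything below it in the order is already
  there.\<close>

lemma std_seq_le_less:
  assumes "std_seq d m n T" "i \<in> {1..n}" "j \<in> {1..n}" "node_le (T i) (T j)" "T i \<noteq> T j"
  shows "i < j"
proof -
  have "T i \<in> T ` {1..<j}"
    using assms by (intro addable_le[OF std_seq_down_closed_less[OF assms(1)] std_seq_addable[OF assms(1)] assms(4,5)])
      (auto intro: std_seq_valid)
  then obtain k where "k \<in> {1..<j}" "T i = T k" by auto
  then show ?thesis using inj_onD[OF std_seq_inj[OF assms(1)], of i k] assms by auto
qed

lemma atLeastLessThan_Suc_image:
  "Suc 0 \<le> i \<Longrightarrow> T ` {Suc 0..<Suc i} = insert (T i) (T ` {Suc 0..<i})"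
  by (simp add: atLeastLessThanSuc)

text \<open>On diagonals at most one apart the two nodes are comparable, the earlier being smaller.
  Were there a node strictly between them, it would have been filled before entry i + 1 and hence
  before entry i, forcing the smaller node to be present too early. The first claim keeps
  denominators nonzero; the second says when exchange coefficients may vanish.\<close>

lemma std_seq_consecutive_diag:
  assumes "std_seq d m n T" "1 \<le> i" "i < n" "snd (T i) = snd (T (Suc i))"
  shows "diag (T i) \<noteq> diag (T (Suc i))"
    and "\<bar>diag (T i) - diag (T (Suc i))\<bar> = 1 \<Longrightarrow> covers (T i) (T (Suc i))"
proof -
  define D \<alpha> \<beta> where "D = T ` {1..<i}" and "\<alpha> = T i" and "\<beta> = T (Suc i)"
  have D: "down_closed d m D" unfolding D_def using assms by (intro std_seq_down_closed_less) auto
  have \<alpha>: "addable d m D \<alpha>" unfolding D_def \<alpha>_def using assms by (intro std_seq_addable) auto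
  have \<beta>: "addable d m (insert \<alpha> D) \<beta>"
    unfolding D_def \<alpha>_def \<beta>_def using assms std_seq_addable[OF assms(1), of "Suc i"]
    by (simp add: atLeastLessThan_Suc_image)
  have v: "valid_node d m \<alpha>" "\<alpha> \<notin> D" "valid_node d m \<beta>" "\<beta> \<notin> D" "\<beta> \<noteq> \<alpha>"
    using \<alpha> \<beta> by (auto simp: addable_def)
  have ng: "\<not> node_le \<beta> \<alpha>" using addable_le[OF D \<alpha>, of \<beta>] v by blast
  have mid: "\<not> covers \<gamma> \<beta>" if "node_le \<alpha> \<gamma>" "\<gamma> \<noteq> \<alpha>" "valid_node d m \<gamma>" for \<gamma>
  proof
    assume "covers \<gamma> \<beta>"
    then have "\<gamma> \<in> D" using addableD(3)[OF \<beta>] that by blast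
    then show False using down_closed_le[OF D _ that(1) v(1)] v by blast
  qed
  have key: "covers \<alpha> \<beta>" if "\<bar>diag \<alpha> - diag \<beta>\<bar> \<le> 1"
  proof -
    have s: "snd \<alpha> = snd \<beta>" using assms(4) by (simp add: \<alpha>_def \<beta>_def)
    then have le: "node_le \<alpha> \<beta>" using near_diag_comparable[OF s that] ng by blast
    show ?thesis
    proof (rule ccontr)
      assume nc: "\<not> covers \<alpha> \<beta>"
      have "row \<alpha> \<le> row \<beta>" "col \<alpha> \<le> col \<beta>" "\<not> (row \<alpha> = row \<beta> \<and> col \<alpha> = col \<beta>)"
        "\<not> (row \<beta> = Suc (row \<alpha>) \<and> col \<beta> = col \<alpha>)" "\<not> (row \<beta> = row \<alpha> \<and> col \<beta> = Suc (col \<alpha>))"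
        "\<bar>int (col \<alpha>) - int (row \<alpha>) - (int (col \<beta>) - int (row \<beta>))\<bar> \<le> 1"
        using le nc that s v(5) node_eqI[of \<alpha> \<beta>] by (auto simp: node_le_def diag_def covers_def)
      then have rc: "row \<alpha> < row \<beta>" "col \<alpha> < col \<beta>" by arith+
      define \<gamma> where "\<gamma> = (if diag \<alpha> \<le> diag \<beta> then ((row \<beta>, col \<beta> - 1), snd \<beta>) else ((row \<beta> - 1, col \<beta>), snd \<beta>))"
      have "covers \<gamma> \<beta>" "valid_node d m \<gamma>" "node_le \<alpha> \<gamma>"
        using rc s v by (auto simp: \<gamma>_def covers_def valid_node_def node_le_def)
      moreover have "\<gamma> \<noteq> \<alpha>" using calculation nc by auto
      ultimately show False using mid by blast
    qed
  qed
  show "\<bar>diag (T i) - diag (T (Suc i))\<bar> = 1 \<Longrightarrow> covers (T i) (T (Suc i))"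
    using key by (simp add: \<alpha>_def \<beta>_def)
  show "diag (T i) \<noteq> diag (T (Suc i))"
    using key covers_diag[of \<alpha> \<beta>] by (auto simp: \<alpha>_def \<beta>_def)
qed

text \<open>If the later node lay on the diagonal of the earlier one, both its left and its upper
  neighbour would have to be filled in between, but there is room for only one entry.\<close>

lemma std_seq_two_apart_diag:
  assumes "std_seq d m n T" "1 \<le> i" "Suc i < n" "snd (T i) = snd (T (Suc (Suc i)))"
  shows "diag (T i) \<noteq> diag (T (Suc (Suc i)))"
proof
  assume eq: "diag (T i) = diag (T (Suc (Suc i)))"
  define D \<alpha> \<beta> \<delta> where "D = T ` {1..<i}" and "\<alpha> = T i" and "\<beta> = T (Suc i)" and "\<delta> = T (Suc (Suc i))"
  have D: "down_closed d m D" unfolding D_def using assms by (intro std_seq_down_closed_less) auto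
  have \<alpha>: "addable d m D \<alpha>" unfolding D_def \<alpha>_def using assms by (intro std_seq_addable) auto
  have \<delta>: "addable d m (insert \<beta> (insert \<alpha> D)) \<delta>"
    unfolding D_def \<alpha>_def \<beta>_def \<delta>_def using assms std_seq_addable[OF assms(1), of "Suc (Suc i)"]
    by (simp add: atLeastLessThan_Suc_image)
  have v: "valid_node d m \<alpha>" "\<alpha> \<notin> D" "valid_node d m \<delta>" "\<delta> \<notin> D" "\<delta> \<noteq> \<alpha>"
    using \<alpha> \<delta> by (auto simp: addable_def)
  have "\<not> node_le \<delta> \<alpha>" using addable_le[OF D \<alpha>, of \<delta>] v by blast
  moreover have s: "snd \<alpha> = snd \<delta>" using assms(4) by (simp add: \<alpha>_def \<delta>_def)
  ultimately have "node_le \<alpha> \<delta>" using near_diag_comparable[OF s] eq by (simp add: \<alpha>_def \<delta>_def)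
  then have le: "row \<alpha> \<le> row \<delta>" "col \<alpha> \<le> col \<delta>"
    and df: "int (col \<alpha>) - int (row \<alpha>) = int (col \<delta>) - int (row \<delta>)"
    using eq by (auto simp: node_le_def diag_def \<alpha>_def \<delta>_def)
  have "row \<alpha> \<noteq> row \<delta>" using node_eqI[OF s] v(5) df by auto
  then have rc: "row \<alpha> < row \<delta>" "col \<alpha> < col \<delta>" using le df by auto
  have "\<gamma> = \<beta>" if "covers \<gamma> \<delta>" "valid_node d m \<gamma>" "node_le \<alpha> \<gamma>" for \<gamma>
  proof -
    have "\<gamma> \<noteq> \<alpha>" using that rc by (auto simp: covers_def)
    moreover have "\<gamma> \<notin> D" using down_closed_le[OF D _ that(3) v(1)] v by blast
    ultimately show ?thesis using addableD(3)[OF \<delta>] that by blast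
  qed
  \<comment> \<open>The two predecessors of \<delta> would both have to be \<beta>.\<close>
  note * = this[of "((row \<delta>, col \<delta> - 1), snd \<delta>)"] this[of "((row \<delta> - 1, col \<delta>), snd \<delta>)"]
  have "((row \<delta>, col \<delta> - 1), snd \<delta>) = \<beta>" "((row \<delta> - 1, col \<delta>), snd \<delta>) = \<beta>"
    by (rule *; use rc s v in \<open>auto simp: covers_def valid_node_def node_le_def\<close>)+
  then have "col \<delta> - 1 = col \<delta>" by (metis fst_conv snd_conv)
  then show False using rc by simp
qed

section \<open>Exchanging consecutive entries\<close>

lemma swap_image: "1 \<le> i \<Longrightarrow> Suc i < j \<Longrightarrow> (T \<circ> swap i) ` {1..<j} = T ` {1..<j}"
proof -
  assume "1 \<le> i" "Suc i < j"
  then have "swap i ` {1..<j} = {1..<j}" by (intro transpose_image_eq) auto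
  then show ?thesis by (metis image_comp)
qed

lemma swap_prefix: "j \<le> i \<Longrightarrow> (T \<circ> swap i) ` {1..<j} = T ` {1..<j}"
  by (intro image_cong) (auto simp: Transposition.transpose_def)

lemma swap_simps [simp]: "swap i i = Suc i" "swap i (Suc i) = i"
  by simp_all

lemma swap_other: "j \<noteq> i \<Longrightarrow> j \<noteq> Suc i \<Longrightarrow> swap i j = j"
  by simp

text \<open>If the node of i is not an immediate predecessor of that of i + 1, the latter is addable
  already without it, and the two may be placed in either order.\<close>

lemma std_seq_swap:
  assumes "std_seq d m n T" "1 \<le> i" "i < n" "\<not> covers (T i) (T (Suc i))"
  shows "std_seq d m n (T \<circ> swap i)"
  unfolding std_seq_def
proof
  fix j assume j: "j \<in> {1..n}"
  have a: "addable d m (T ` {1..<j}) (T j)" "addable d m (T ` {1..<i}) (T i)"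
    "addable d m (insert (T i) (T ` {1..<i})) (T (Suc i))"
    using std_seq_addable[OF assms(1), of j] std_seq_addable[OF assms(1), of i]
      std_seq_addable[OF assms(1), of "Suc i"] assms j atLeastLessThan_Suc_image[of i T] by auto
  consider "j < i" | "j = i" | "j = Suc i" | "Suc i < j" by linarith
  then show "addable d m ((T \<circ> swap i) ` {1..<j}) ((T \<circ> swap i) j)"
  proof cases
    case 1
    then have "(T \<circ> swap i) ` {1..<j} = T ` {1..<j}" by (intro swap_prefix) simp
    then show ?thesis using 1 a by (simp add: swap_other)
  next
    case 2
    then have "(T \<circ> swap i) ` {1..<j} = T ` {1..<i}" using swap_prefix[of j i T] by simp
    moreover have "addable d m (T ` {1..<i}) (T (Suc i))"
      using a(3) assms(4) unfolding addable_def by blast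
    ultimately show ?thesis using 2 by simp
  next
    case 3
    have "(T \<circ> swap i) ` {1..<j} = insert (T (Suc i)) (T ` {1..<i})"
      using 3 atLeastLessThan_Suc_image[of i "T \<circ> swap i"] assms(2) swap_prefix[of i i T] by simp
    then show ?thesis using 3 a by (auto simp: addable_def)
  next
    case 4
    then show ?thesis using a swap_image[OF assms(2), of j T] by (simp add: swap_other)
  qed
qed

lemma std_seq_swap_not_covers:
  assumes "std_seq d m n (T \<circ> swap i)" "1 \<le> i" "i < n"
  shows "\<not> covers (T i) (T (Suc i))"
proof
  assume c: "covers (T i) (T (Suc i))"
  then have "node_le (T i) (T (Suc i))" "T i \<noteq> T (Suc i)" using covers_le by auto
  then show False
    using std_seq_le_less[OF assms(1), of "Suc i" i] assms(2,3) by simp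
qed

lemma std_seq_swap_iff:
  "std_seq d m n T \<Longrightarrow> 1 \<le> i \<Longrightarrow> i < n \<Longrightarrow> std_seq d m n (T \<circ> swap i) \<longleftrightarrow> \<not> covers (T i) (T (Suc i))"
  using std_seq_swap std_seq_swap_not_covers by blast

section \<open>Contents and positions separate standard tableaux\<close>

lemma node_content_eq: "node_content \<alpha> = vF (snd (snd \<alpha>)) * qF powi (2 * diag \<alpha>)"
  by (cases \<alpha> rule: node_content.cases) (simp add: diag_def)

lemma node_pos_eq: "node_pos \<alpha> = fst (snd \<alpha>)"
  by (cases \<alpha> rule: node_pos.cases) simp

lemma node_content_nz [simp]: "node_content \<alpha> \<noteq> 0"
  by (simp add: node_content_eq)

lemma node_content_closed: "valid_node d m \<alpha> \<Longrightarrow> node_content \<alpha> \<in> carrier (Fm m)"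
  by (auto simp: node_content_eq valid_node_def intro!: Fm_closed Fm_powi Fm_indets)

lemma node_content_shift:
  assumes "valid_node d m \<alpha>" "valid_node d m \<beta>"
  shows "node_content \<beta> = qF powi (2 * j) * node_content \<alpha> \<longleftrightarrow>
    snd (snd \<alpha>) = snd (snd \<beta>) \<and> diag \<beta> = diag \<alpha> + j"
proof -
  have e: "qF powi (2 * j) * node_content \<alpha> = vF (snd (snd \<alpha>)) * qF powi (2 * (diag \<alpha> + j))"
    by (simp add: node_content_eq power_int_add distrib_left)
  show ?thesis
    unfolding e node_content_eq[of \<beta>]
    using content_inj[of "snd (snd \<beta>)" "snd (snd \<alpha>)"] assms by (auto simp: valid_node_def)
qed

lemma node_content_eq_iff:
  "valid_node d m \<alpha> \<Longrightarrow> valid_node d m \<beta> \<Longrightarrow> node_pos \<alpha> = node_pos \<beta> \<Longrightarrow>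
    node_content \<alpha> = node_content \<beta> \<longleftrightarrow> snd \<alpha> = snd \<beta> \<and> diag \<alpha> = diag \<beta>"
  using node_content_shift[of d m \<beta> \<alpha> 0] by (auto simp: prod_eq_iff node_pos_eq)

text \<open>Build both tableaux simultaneously: as long as they agree, the next nodes are addable to
  the same set and have the same component and diagonal, so they coincide by
  \<open>addable_same_diag\<close>.\<close>

lemma std_seq_weights_eq:
  assumes "std_seq d m n T" "std_seq d m n S"
    and "\<And>i. i \<in> {1..n} \<Longrightarrow> node_pos (T i) = node_pos (S i) \<and> node_content (T i) = node_content (S i)"
    and "i \<in> {1..n}"
  shows "T i = S i"
  using assms(4)
proof (induction i rule: less_induct)
  case (less i)
  have im: "T ` {1..<i} = S ` {1..<i}" using less by (intro image_cong) auto
  have a: "addable d m (T ` {1..<i}) (T i)" "addable d m (T ` {1..<i}) (S i)"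
    using std_seq_addable[OF assms(1), of i] std_seq_addable[OF assms(2), of i] less.prems unfolding im by auto
  have "snd (T i) = snd (S i) \<and> diag (T i) = diag (S i)"
    using node_content_eq_iff[of d m "T i" "S i"] assms(3)[OF less.prems] a by (auto simp: addable_def)
  then show ?case
    using addable_same_diag[OF std_seq_down_closed_less[OF assms(1)] a] less.prems by auto
qed

section \<open>Order ideals of nodes and multipartitions\<close>

lemma initial_segment:
  fixes S :: "nat set"
  assumes "finite S" "\<And>x. x \<in> S \<Longrightarrow> x \<ge> 1" "\<And>x. x \<in> S \<Longrightarrow> x > 1 \<Longrightarrow> x - 1 \<in> S"
  shows "S = {1..card S}"
proof -
  have down: "y \<in> S" if "x \<in> S" "1 \<le> y" "y \<le> x" for x y
    using that(3,1)
  proof (induction rule: inc_induct)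
    case (step k)
    then show ?case using assms(3)[of "Suc k"] that(2) by simp
  qed
  have "S = {1..h}" if h: "h = (if S = {} then 0 else Max S)" for h
  proof (cases "S = {}")
    case False
    show ?thesis
    proof (intro equalityI subsetI)
      show "x \<in> {1..h}" if "x \<in> S" for x
        using that Max_ge[OF assms(1) that] assms(2)[OF that] False h by simp
      show "x \<in> S" if "x \<in> {1..h}" for x
        using down[of "Max S" x] Max_in[OF assms(1) False] that False h by simp
    qed
  qed (use h in simp)
  then obtain h where "S = {1..h}" by blast
  then show ?thesis by simp
qed

lemma mem_dm_nodes:
  "\<alpha> \<in> dm_nodes \<Lambda> \<longleftrightarrow> 1 \<le> fst (snd \<alpha>) \<and> fst (snd \<alpha>) \<le> length \<Lambda> \<and>
     1 \<le> snd (snd \<alpha>) \<and> snd (snd \<alpha>) \<le> length (\<Lambda> ! (fst (snd \<alpha>) - 1)) \<and>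
     1 \<le> row \<alpha> \<and> row \<alpha> \<le> length (\<Lambda> ! (fst (snd \<alpha>) - 1) ! (snd (snd \<alpha>) - 1)) \<and>
     1 \<le> col \<alpha> \<and> col \<alpha> \<le> \<Lambda> ! (fst (snd \<alpha>) - 1) ! (snd (snd \<alpha>) - 1) ! (row \<alpha> - 1)"
  unfolding dm_nodes_def by (cases \<alpha>) force

lemma dm_partitionsD:
  assumes "\<Lambda> \<in> dm_partitions d m n"
  shows "length \<Lambda> = d" "k < d \<Longrightarrow> length (\<Lambda> ! k) = m" "k < d \<Longrightarrow> l < m \<Longrightarrow> is_partition (\<Lambda> ! k ! l)"
    "card (dm_nodes \<Lambda>) = n"
proof -
  have *: "length \<Lambda> = d" "\<And>M. M \<in> set \<Lambda> \<Longrightarrow> length M = m \<and> (\<forall>p\<in>set M. is_partition p)"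
    "card (dm_nodes \<Lambda>) = n"
    using assms by (auto simp: dm_partitions_def)
  then show "length \<Lambda> = d" "card (dm_nodes \<Lambda>) = n" by auto
  show "length (\<Lambda> ! k) = m" if "k < d" using *(2)[of "\<Lambda> ! k"] *(1) that by simp
  then show "is_partition (\<Lambda> ! k ! l)" if "k < d" "l < m" using *(2)[of "\<Lambda> ! k"] *(1) that by simp
qed

lemma dm_partitions_down_closed:
  assumes "\<Lambda> \<in> dm_partitions d m n"
  shows "down_closed d m (dm_nodes \<Lambda>)"
  unfolding down_closed_def
proof (intro ballI conjI allI impI)
  fix \<beta> assume \<beta>: "\<beta> \<in> dm_nodes \<Lambda>"
  note L = dm_partitionsD[OF assms]
  define k l p where "k = fst (snd \<beta>)" and "l = snd (snd \<beta>)" and "p = \<Lambda> ! (k - 1) ! (l - 1)"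
  have kl: "1 \<le> k" "k \<le> d" "1 \<le> l" "l \<le> m"
    and xy: "1 \<le> row \<beta>" "row \<beta> \<le> length p" "1 \<le> col \<beta>" "col \<beta> \<le> p ! (row \<beta> - 1)"
    using \<beta> L(2)[of "k - 1"] by (auto simp: mem_dm_nodes k_def l_def p_def L(1))
  then show "valid_node d m \<beta>" by (auto simp: valid_node_def k_def l_def)
  fix \<alpha> assume \<alpha>: "valid_node d m \<alpha> \<and> covers \<alpha> \<beta>"
  have "is_partition p" unfolding p_def using L(3)[of "k - 1" "l - 1"] kl by auto
  then have "p ! (row \<beta> - 1) \<le> p ! (row \<alpha> - 1)" "row \<alpha> \<le> row \<beta>" "col \<alpha> \<le> col \<beta>"
    using \<alpha> xy sorted_wrt_nth_less[of "(\<ge>)" p "row \<alpha> - 1" "row \<beta> - 1"]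
    by (auto simp: is_partition_def covers_def valid_node_def)
  then show "\<alpha> \<in> dm_nodes \<Lambda>"
    using \<alpha> \<beta> xy L(2)[of "k - 1"] kl
    by (auto simp: mem_dm_nodes covers_def valid_node_def L(1) k_def l_def p_def)
qed

text \<open>Parts are positive, so the first column determines the number of rows; then each row
  length is determined.\<close>

lemma partition_nodes_inj:
  assumes "is_partition p" "is_partition p'"
    and "\<And>x y. 1 \<le> x \<and> x \<le> length p \<and> 1 \<le> y \<and> y \<le> p ! (x - 1) \<longleftrightarrow>
      1 \<le> x \<and> x \<le> length p' \<and> 1 \<le> y \<and> y \<le> p' ! (x - 1)"
  shows "p = p'"
proof -
  have pos: "1 \<le> q ! (x - 1)" if "is_partition q" "1 \<le> x" "x \<le> length q" for q x
  proof -
    have "q ! (x - 1) \<in> set q" using that by simp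
    then have "q ! (x - 1) \<noteq> 0" using that(1) unfolding is_partition_def by metis
    then show ?thesis by simp
  qed
  have len: "1 \<le> x \<and> x \<le> length p \<longleftrightarrow> 1 \<le> x \<and> x \<le> length p'" for x
    using assms(3)[of x 1] pos[OF assms(1), of x] pos[OF assms(2), of x] by auto
  have l: "length p = length p'"
    using len[of "length p"] len[of "length p'"] by (cases p; cases p'; simp)
  show ?thesis
  proof (rule nth_equalityI[OF l])
    fix i assume i: "i < length p"
    show "p ! i = p' ! i"
      using assms(3)[of "Suc i" "p ! i"] assms(3)[of "Suc i" "p' ! i"]
        pos[OF assms(1), of "Suc i"] pos[OF assms(2), of "Suc i"] i l by simp
  qed
qed

lemma dm_nodes_inj:
  assumes "\<Lambda> \<in> dm_partitions d m n" "M \<in> dm_partitions d m n'" "dm_nodes \<Lambda> = dm_nodes M"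
  shows "\<Lambda> = M"
proof (rule nth_equalityI)
  note L = dm_partitionsD[OF assms(1)] and L' = dm_partitionsD[OF assms(2)]
  show "length \<Lambda> = length M" by (simp add: L(1) L'(1))
  fix k assume "k < length \<Lambda>"
  then have k: "k < d" by (simp add: L(1))
  show "\<Lambda> ! k = M ! k"
  proof (rule nth_equalityI)
    show "length (\<Lambda> ! k) = length (M ! k)" using L(2) L'(2) k by simp
    fix l assume "l < length (\<Lambda> ! k)"
    then have l: "l < m" using L(2) k by simp
    show "\<Lambda> ! k ! l = M ! k ! l"
    proof (rule partition_nodes_inj)
      fix x y
      have "((x, y), Suc k, Suc l) \<in> dm_nodes \<Lambda> \<longleftrightarrow> ((x, y), Suc k, Suc l) \<in> dm_nodes M"
        using assms(3) by simp
      then show "1 \<le> x \<and> x \<le> length (\<Lambda> ! k ! l) \<and> 1 \<le> y \<and> y \<le> \<Lambda> ! k ! l ! (x - 1) \<longleftrightarrow>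
          1 \<le> x \<and> x \<le> length (M ! k ! l) \<and> 1 \<le> y \<and> y \<le> M ! k ! l ! (x - 1)"
        using k l by (simp add: mem_dm_nodes L(1,2) L'(1,2))
    qed (use L(3) L'(3) k l in auto)
  qed
qed

text \<open>Row lengths and the first column are initial segments by down-closure, and lower rows
  cannot be longer than upper ones. This attaches a multipartition to a weight that is known only as
  a growth sequence.\<close>

lemma down_closed_shape:
  assumes "down_closed d m D" "finite D"
  obtains \<Lambda> where "\<Lambda> \<in> dm_partitions d m (card D)" "dm_nodes \<Lambda> = D"
proof -
  \<comment> \<open>The number of rows is counted in the first column, and \<open>r\<close> gives
    the row lengths.\<close>
  define h where "h k l = card {x. ((x, 1::nat), k, l) \<in> D}" for k l
  define r where "r k l x = card {y. ((x, y), k, l) \<in> D}" for k l and x :: nat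
  define \<Lambda> where "\<Lambda> = map (\<lambda>k. map (\<lambda>l. map (r k l) [1..<h k l + 1]) [1..<m + 1]) [1..<d + 1]"
  have v: "valid_node d m \<alpha>" if "\<alpha> \<in> D" for \<alpha> using down_closedD(1)[OF assms(1) that] .
  have "{x. ((x, 1), k, l) \<in> D} = {1..h k l}" for k l
    unfolding h_def
  proof (rule initial_segment)
    have "(\<lambda>x. ((x, 1), k, l)) ` {x. ((x, 1), k, l) \<in> D} \<subseteq> D" by auto
    then show "finite {x. ((x, 1), k, l) \<in> D}"
      by (rule inj_on_finite[rotated]) (auto simp: inj_on_def assms)
    show "x \<ge> 1" if "x \<in> {x. ((x, 1), k, l) \<in> D}" for x
      using v[of "((x, 1), k, l)"] that by (simp add: valid_node_def)
    show "x - 1 \<in> {x. ((x, 1), k, l) \<in> D}" if "x \<in> {x. ((x, 1), k, l) \<in> D}" "x > 1" for x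
      using down_closedD(2)[OF assms(1), of "((x, 1), k, l)" "((x - 1, 1), k, l)"] that v[of "((x, 1), k, l)"]
      by (auto simp: valid_node_def covers_def)
  qed
  then have H: "((x, 1), k, l) \<in> D \<longleftrightarrow> 1 \<le> x \<and> x \<le> h k l" for x k l
    by (simp add: set_eq_iff)
  have "{y. ((x, y), k, l) \<in> D} = {1..r k l x}" for x k l
    unfolding r_def
  proof (rule initial_segment)
    have "(\<lambda>y. ((x, y), k, l)) ` {y. ((x, y), k, l) \<in> D} \<subseteq> D" by auto
    then show "finite {y. ((x, y), k, l) \<in> D}"
      by (rule inj_on_finite[rotated]) (auto simp: inj_on_def assms)
    show "y \<ge> 1" if "y \<in> {y. ((x, y), k, l) \<in> D}" for y
      using v[of "((x, y), k, l)"] that by (simp add: valid_node_def)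
    show "y - 1 \<in> {y. ((x, y), k, l) \<in> D}" if "y \<in> {y. ((x, y), k, l) \<in> D}" "y > 1" for y
      using down_closedD(2)[OF assms(1), of "((x, y), k, l)" "((x, y - 1), k, l)"] that v[of "((x, y), k, l)"]
      by (auto simp: valid_node_def covers_def)
  qed
  then have R: "((x, y), k, l) \<in> D \<longleftrightarrow> 1 \<le> y \<and> y \<le> r k l x" for x y k l
    by (simp add: set_eq_iff)
  have le: "\<alpha> \<in> D" if "\<beta> \<in> D" "node_le \<alpha> \<beta>" "row \<alpha> \<ge> 1" "col \<alpha> \<ge> 1" for \<alpha> \<beta>
    using down_closed_le[OF assms(1) that(1,2)] v[OF that(1)] that
    by (auto simp: valid_node_def node_le_def)
  have nodes: "dm_nodes \<Lambda> = D"
  proof (rule Set.set_eqI)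
    fix \<alpha> :: dm_node
    obtain x y k l where \<alpha>: "\<alpha> = ((x, y), k, l)" by (metis surj_pair)
    show "\<alpha> \<in> dm_nodes \<Lambda> \<longleftrightarrow> \<alpha> \<in> D"
    proof
      assume "\<alpha> \<in> dm_nodes \<Lambda>"
      then show "\<alpha> \<in> D"
        by (auto simp: mem_dm_nodes \<Lambda>_def \<alpha> R simp del: upt_Suc)
    next
      assume a: "\<alpha> \<in> D"
      then have "1 \<le> x" "1 \<le> y" "1 \<le> k" "k \<le> d" "1 \<le> l" "l \<le> m"
        using v[OF a] by (auto simp: \<alpha> valid_node_def)
      moreover have "x \<le> h k l"
        using H[of x k l] le[OF a, of "((x, 1), k, l)"] calculation by (auto simp: \<alpha> node_le_def)
      ultimately show "\<alpha> \<in> dm_nodes \<Lambda>"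
        using a by (auto simp: mem_dm_nodes \<Lambda>_def \<alpha> R simp del: upt_Suc)
    qed
  qed
  moreover have "\<Lambda> \<in> dm_partitions d m (card D)"
  proof -
    have "is_partition (map (r k l) [1..<h k l + 1])" for k l
      unfolding is_partition_def
    proof
      have "r k l x \<ge> r k l x'" if "1 \<le> x" "x < x'" for x x'
      proof (cases "r k l x' = 0")
        case False
        then have "((x', r k l x'), k, l) \<in> D" by (simp add: R)
        then have "((x, r k l x'), k, l) \<in> D" using that False by (elim le) (auto simp: node_le_def)
        then show ?thesis by (simp add: R)
      qed simp
      then show "sorted_wrt (\<ge>) (map (r k l) [1..<h k l + 1])"
        by (auto simp: sorted_wrt_iff_nth_less simp del: upt_Suc)
      show "0 \<notin> set (map (r k l) [1..<h k l + 1])"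
      proof
        assume "0 \<in> set (map (r k l) [1..<h k l + 1])"
        then obtain x where "1 \<le> x" "x \<le> h k l" "r k l x = 0" by (auto simp del: upt_Suc)
        then show False using H[of x k l] R[of x 1 k l] by simp
      qed
    qed
    then show ?thesis
      unfolding dm_partitions_def using nodes by (auto simp: \<Lambda>_def simp del: upt_Suc)
  qed
  ultimately show thesis using that by blast
qed

text \<open>Monotonicity along rows and columns is equivalent to each node being placed after its
  immediate predecessors; the shape enters only through the final set of nodes.\<close>

lemma standard_tableaux_iff:
  assumes "\<Lambda> \<in> dm_partitions d m n"
  shows "T \<in> standard_tableaux n \<Lambda> \<longleftrightarrow>
    T \<in> extensional {1..n} \<and> std_seq d m n T \<and> T ` {1..n} = dm_nodes \<Lambda>"
proof
  note dc = dm_partitions_down_closed[OF assms]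
  assume T: "T \<in> standard_tableaux n \<Lambda>"
  then have bij: "bij_betw T {1..n} (dm_nodes \<Lambda>)" and ext: "T \<in> extensional {1..n}"
    by (auto simp: standard_tableaux_def dm_tableaux_def)
  have ord: "i < j" if "i \<in> {1..n}" "j \<in> {1..n}" "covers (T i) (T j)" for i j
  proof -
    have "T i = ((row (T i), col (T i)), fst (snd (T i)), snd (snd (T i)))"
      "T j = ((row (T j), col (T j)), fst (snd (T i)), snd (snd (T i)))"
      using that(3) by (simp_all add: prod_eq_iff covers_def)
    moreover have "row (T i) = row (T j) \<and> col (T i) < col (T j) \<or> row (T i) < row (T j) \<and> col (T i) = col (T j)"
      using that(3) by (auto simp: covers_def)
    ultimately show ?thesis
      using T that(1,2) unfolding standard_tableaux_def mem_Collect_eq by blast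
  qed
  have "addable d m (T ` {1..<j}) (T j)" if j: "j \<in> {1..n}" for j
    unfolding addable_def
  proof (intro conjI allI impI)
    have Tj: "T j \<in> dm_nodes \<Lambda>" using bij j by (auto simp: bij_betw_def)
    then show "valid_node d m (T j)" using down_closedD(1)[OF dc] by blast
    show "T j \<notin> T ` {1..<j}"
    proof
      assume "T j \<in> T ` {1..<j}"
      then obtain k where "k \<in> {1..<j}" "T j = T k" by blast
      then show False using inj_onD[OF bij_betw_imp_inj_on[OF bij], of j k] j by auto
    qed
    fix \<alpha> assume \<alpha>: "valid_node d m \<alpha> \<and> covers \<alpha> (T j)"
    then have "\<alpha> \<in> dm_nodes \<Lambda>" using down_closedD(2)[OF dc Tj] by blast
    then obtain i where "i \<in> {1..n}" "T i = \<alpha>" using bij unfolding bij_betw_def by (metis imageE)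
    then show "\<alpha> \<in> T ` {1..<j}" using ord[of i j] \<alpha> j by auto
  qed
  then show "T \<in> extensional {1..n} \<and> std_seq d m n T \<and> T ` {1..n} = dm_nodes \<Lambda>"
    using ext bij by (auto simp: std_seq_def bij_betw_def)
next
  assume T: "T \<in> extensional {1..n} \<and> std_seq d m n T \<and> T ` {1..n} = dm_nodes \<Lambda>"
  have "i < j" if "i \<in> {1..n}" "j \<in> {1..n}" "T i = ((x, y), k, l)" "T j = ((x', y'), k, l)"
    "x = x' \<and> y < y' \<or> x < x' \<and> y = y'" for i j x y x' y' k l
    using T that by (intro std_seq_le_less[of d m n T i j]) (auto simp: node_le_def)
  then show "T \<in> standard_tableaux n \<Lambda>"
    using T std_seq_inj[of d m n T]
    unfolding standard_tableaux_def dm_tableaux_def bij_betw_def by blast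
qed

lemma finite_dm_nodes: "\<Lambda> \<in> dm_partitions d m n \<Longrightarrow> n > 0 \<Longrightarrow> finite (dm_nodes \<Lambda>)"
  using dm_partitionsD(4) card_ge_0_finite by force

lemma finite_standard_tableaux: "\<Lambda> \<in> dm_partitions d m n \<Longrightarrow> n > 0 \<Longrightarrow> finite (standard_tableaux n \<Lambda>)"
proof -
  assume "\<Lambda> \<in> dm_partitions d m n" "n > 0"
  then have "finite ({1..n} \<rightarrow>\<^sub>E dm_nodes \<Lambda>)" by (intro finite_PiE finite_dm_nodes) auto
  moreover have "standard_tableaux n \<Lambda> \<subseteq> {1..n} \<rightarrow>\<^sub>E dm_nodes \<Lambda>"
    by (auto simp: standard_tableaux_def dm_tableaux_def bij_betw_def PiE_def Pi_def)
  ultimately show ?thesis by (rule finite_subset[rotated])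
qed

lemma std_seq_shape:
  assumes "std_seq d m n T"
  obtains \<Lambda> where "\<Lambda> \<in> dm_partitions d m n" "dm_nodes \<Lambda> = T ` {1..n}"
  using down_closed_shape[OF std_seq_down_closed[OF assms]] card_image[OF std_seq_inj[OF assms]] by auto

lemma inv_into_transpose: "inv_into UNIV (Transposition.transpose i j) = Transposition.transpose i j"
  by (rule inv_unique_comp) (simp_all add: fun_eq_iff)

lemma permute_swap: "permute_tableau (Transposition.transpose i (i + 1)) t = t \<circ> swap i"
  by (simp add: permute_tableau_def inv_into_transpose)

lemma swap_swap_comp [simp]: "(T \<circ> swap i) \<circ> swap i = T"
  by (simp add: fun_eq_iff)

lemma swap_extensional: "T \<in> extensional {1..n} \<Longrightarrow> 1 \<le> i \<Longrightarrow> i < n \<Longrightarrow> T \<circ> swap i \<in> extensional {1..n}"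
  by (auto simp: extensional_def Transposition.transpose_def)

lemma swap_image_full: "1 \<le> i \<Longrightarrow> i < n \<Longrightarrow> (T \<circ> swap i) ` {1..n} = T ` {1..n}"
  using swap_image[of i "Suc n" T] by (simp add: atLeastLessThanSuc_atLeastAtMost)

lemma standard_tableaux_swap:
  assumes "\<Lambda> \<in> dm_partitions d m n" "T \<in> standard_tableaux n \<Lambda>" "1 \<le> i" "i < n"
  shows "T \<circ> swap i \<in> standard_tableaux n \<Lambda> \<longleftrightarrow> \<not> covers (T i) (T (Suc i))"
  using assms std_seq_swap_iff[of d m n T i] swap_extensional[of T n i] swap_image_full[of i n T]
  by (simp add: standard_tableaux_iff[OF assms(1)])

subsection \<open>Inversions\<close>

definition inversions :: "nat \<Rightarrow> (nat \<Rightarrow> nat) \<Rightarrow> (nat \<times> nat) set" where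
  "inversions n f = {(i, j). i \<in> {1..n} \<and> j \<in> {1..n} \<and> i < j \<and> f j < f i}"

lemma finite_inversions: "finite (inversions n f)"
  by (rule finite_subset[of _ "{1..n} \<times> {1..n}"]) (auto simp: inversions_def)

lemma inj_swap: "inj (swap i)"
  by (rule bij_is_inj) simp

text \<open>Exchanging i and i + 1 maps the new inversions injectively into the old ones and misses
  the pair (i, i + 1).\<close>

lemma inversions_swap:
  assumes "1 \<le> i" "i < n" "f (Suc i) < f i"
  shows "card (inversions n (f \<circ> swap i)) < card (inversions n f)"
proof -
  have "map_prod (swap i) (swap i) ` inversions n (f \<circ> swap i) \<subseteq> inversions n f - {(i, Suc i)}"
    using assms by (auto simp: inversions_def Transposition.transpose_def split: if_splits)
  moreover have "inj_on (map_prod (swap i) (swap i)) (inversions n (f \<circ> swap i))"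
    by (rule inj_on_subset[OF prod.inj_map]) (simp_all add: inj_swap)
  ultimately have "card (inversions n (f \<circ> swap i)) \<le> card (inversions n f - {(i, Suc i)})"
    by (intro card_inj_on_le) (auto simp: finite_inversions)
  also have "\<dots> < card (inversions n f)"
    using assms by (intro card_Diff1_less[OF finite_inversions]) (simp add: inversions_def)
  finally show ?thesis .
qed

text \<open>Without descents the map is strictly increasing on {1..n}, which bounds
  \<open>f i\<close> from both sides by i.\<close>

lemma no_descent_id:
  assumes "\<And>i. i \<in> {1..n} \<Longrightarrow> f i \<in> {1..n}" "inj_on f {1..n}"
    and "\<And>i. 1 \<le> i \<Longrightarrow> i < n \<Longrightarrow> \<not> f (Suc i) < f i" "i \<in> {1..n}"
  shows "f i = i"
proof -
  have lt: "f j < f (Suc j)" if "1 \<le> j" "j < n" for j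
    using assms(3)[OF that] inj_onD[OF assms(2), of j "Suc j"] that by fastforce
  have "j \<le> n \<longrightarrow> j \<le> f j" if "1 \<le> j" for j
    using that
  proof (induction j rule: dec_induct)
    case base
    then show ?case using assms(1)[of 1] by auto
  next
    case (step j)
    then show ?case using lt[of j] by auto
  qed
  moreover have "1 \<le> j \<longrightarrow> f j \<le> j" if "j \<le> n" for j
    using that
  proof (induction rule: inc_induct)
    case base
    then show ?case using assms(1)[of n] by auto
  next
    case (step j)
    then show ?case using lt[of j] by auto
  qed
  ultimately show ?thesis using assms(4) by (simp add: antisym)
qed

text \<open>The permutation S^(-1) T comparing two tableaux of the same shape. Its number of
  inversions is the distance from T to S in terms of adjacent exchanges.\<close>

definition rel_pos :: "nat \<Rightarrow> (nat \<Rightarrow> dm_node) \<Rightarrow> (nat \<Rightarrow> dm_node) \<Rightarrow> nat \<Rightarrow> nat" where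
  "rel_pos n S T = inv_into {1..n} S \<circ> T"

context
  fixes d m n :: nat and S T :: dm_tableau
  assumes S: "std_seq d m n S" and T: "std_seq d m n T" and im: "T ` {1..n} = S ` {1..n}"
begin

lemma rel_pos_mem: "i \<in> {1..n} \<Longrightarrow> rel_pos n S T i \<in> {1..n} \<and> S (rel_pos n S T i) = T i"
proof -
  assume "i \<in> {1..n}"
  then have "T i \<in> S ` {1..n}" using im by blast
  then show ?thesis unfolding rel_pos_def comp_def using inv_into_into f_inv_into_f by metis
qed

lemma rel_pos_descent_exists:
  assumes "S \<in> extensional {1..n}" "T \<in> extensional {1..n}" "T \<noteq> S"
  obtains i where "1 \<le> i" "i < n" "rel_pos n S T (Suc i) < rel_pos n S T i"
proof -
  have "\<exists>i. 1 \<le> i \<and> i < n \<and> rel_pos n S T (Suc i) < rel_pos n S T i"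
  proof (rule ccontr)
  assume c: "\<not> ?thesis"
  have "rel_pos n S T i = i" if "i \<in> {1..n}" for i
  proof (rule no_descent_id[OF _ _ _ that])
    show "inj_on (rel_pos n S T) {1..n}"
      by (rule inj_onI) (metis rel_pos_mem inj_onD[OF std_seq_inj[OF T]])
    show "rel_pos n S T j \<in> {1..n}" if "j \<in> {1..n}" for j using rel_pos_mem[OF that] by blast
    show "\<not> rel_pos n S T (Suc j) < rel_pos n S T j" if "1 \<le> j" "j < n" for j using c that by blast
  qed
  then have "T i = S i" if "i \<in> {1..n}" for i using rel_pos_mem[OF that] that by simp
  then show False using extensionalityI[OF assms(2,1)] assms(3) by blast
  qed
  then show thesis using that by blast
qed

text \<open>At a descent S fills the node of i + 1 before that of i, so the latter cannot be a
  predecessor of the former. Hence T can be brought to S through standard tableaux only.\<close>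

lemma rel_pos_descent_std:
  assumes "1 \<le> i" "i < n" "rel_pos n S T (Suc i) < rel_pos n S T i"
  shows "std_seq d m n (T \<circ> swap i)"
proof (rule std_seq_swap[OF T assms(1,2)])
  show "\<not> covers (T i) (T (Suc i))"
    using std_seq_le_less[OF S, of "rel_pos n S T i" "rel_pos n S T (Suc i)"]
      rel_pos_mem[of i] rel_pos_mem[of "Suc i"] assms covers_le[of "T i" "T (Suc i)"] by auto
qed

end

lemma rel_pos_swap: "rel_pos n S (T \<circ> swap i) = rel_pos n S T \<circ> swap i"
  by (simp add: rel_pos_def comp_assoc)

section \<open>The seminormal operators\<close>

text \<open>With \<alpha> and \<beta> the nodes of i and i + 1 in T, this and
  \<open>swap_coeff\<close> are the coefficients of g_i at v_T. The values 0 and 1 for different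
  positions let one formula cover both cases of the action.\<close>

definition diag_coeff :: "dm_node \<Rightarrow> dm_node \<Rightarrow> laurent fract" where
  "diag_coeff \<alpha> \<beta> = (if node_pos \<alpha> = node_pos \<beta>
     then node_content \<beta> * (qF - inverse qF) / (node_content \<beta> - node_content \<alpha>) else 0)"

definition swap_coeff :: "dm_node \<Rightarrow> dm_node \<Rightarrow> laurent fract" where
  "swap_coeff \<alpha> \<beta> = (if node_pos \<alpha> = node_pos \<beta>
     then (qF * node_content \<beta> - inverse qF * node_content \<alpha>) / (node_content \<beta> - node_content \<alpha>) else 1)"

text \<open>Exactly the condition under which the denominators of the two coefficients are
  nonzero.\<close>

definition separated :: "dm_node \<Rightarrow> dm_node \<Rightarrow> bool" where
  "separated \<alpha> \<beta> \<longleftrightarrow> (node_pos \<alpha> = node_pos \<beta> \<longrightarrow> node_content \<alpha> \<noteq> node_content \<beta>)"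

lemma separated_sym: "separated \<alpha> \<beta> \<longleftrightarrow> separated \<beta> \<alpha>"
  by (auto simp: separated_def)

lemma coeff_closed:
  assumes "valid_node d m \<alpha>" "valid_node d m \<beta>"
  shows "diag_coeff \<alpha> \<beta> \<in> carrier (Fm m)" "swap_coeff \<alpha> \<beta> \<in> carrier (Fm m)"
  using node_content_closed[OF assms(1)] node_content_closed[OF assms(2)]
  by (auto simp: diag_coeff_def swap_coeff_def intro!: Fm_closed Fm_indets)

text \<open>Together with \<open>diag_coeff_sum\<close> this fixes determinant and trace of g_i on
  the plane of a tableau and its exchange; the quadratic relation is its characteristic
  equation.\<close>

lemma coeff_product:
  assumes "separated \<alpha> \<beta>"
  shows "swap_coeff \<alpha> \<beta> * swap_coeff \<beta> \<alpha> = 1 + diag_coeff \<alpha> \<beta> * diag_coeff \<beta> \<alpha>"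
proof (cases "node_pos \<alpha> = node_pos \<beta>")
  case True
  define x y where "x = node_content \<alpha>" and "y = node_content \<beta>"
  have "x - y \<noteq> 0" "y - x \<noteq> 0" using assms True by (auto simp: separated_def x_def y_def)
  then show ?thesis
    using True by (simp add: diag_coeff_def swap_coeff_def x_def[symmetric] y_def[symmetric] divide_simps)
      (simp add: algebra_simps)
qed (simp add: diag_coeff_def swap_coeff_def)

lemma diag_coeff_sum:
  assumes "separated \<alpha> \<beta>"
  shows "diag_coeff \<alpha> \<beta> + diag_coeff \<beta> \<alpha> = (if node_pos \<alpha> = node_pos \<beta> then qF - inverse qF else 0)"
proof (cases "node_pos \<alpha> = node_pos \<beta>")
  case True
  define x y where "x = node_content \<alpha>" and "y = node_content \<beta>"
  have "x - y \<noteq> 0" "y - x \<noteq> 0" using assms True by (auto simp: separated_def x_def y_def)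
  then show ?thesis
    using True by (simp add: diag_coeff_def x_def[symmetric] y_def[symmetric] divide_simps)
      (simp add: algebra_simps)
qed (simp add: diag_coeff_def)

text \<open>The cancellation that makes g_i X_i g_i diagonal.\<close>

lemma diag_coeff_content:
  assumes "separated \<alpha> \<beta>"
  shows "diag_coeff \<alpha> \<beta> * node_content \<alpha> + diag_coeff \<beta> \<alpha> * node_content \<beta> = 0"
proof (cases "node_pos \<alpha> = node_pos \<beta>")
  case True
  define x y where "x = node_content \<alpha>" and "y = node_content \<beta>"
  have "x - y \<noteq> 0" "y - x \<noteq> 0" using assms True by (auto simp: separated_def x_def y_def)
  then show ?thesis
    using True by (simp add: diag_coeff_def x_def[symmetric] y_def[symmetric] divide_simps)
      (simp add: algebra_simps)
qed (simp add: diag_coeff_def)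

text \<open>The coefficient identities left over when both sides of the braid relation are expanded
  at a tableau. If the three positions are not all equal, enough coefficients vanish to make them
  trivial.\<close>

lemma diag_coeff_braid:
  assumes "separated \<alpha> \<beta>" "separated \<beta> \<gamma>" "separated \<alpha> \<gamma>"
  shows "diag_coeff \<alpha> \<beta> * diag_coeff \<beta> \<gamma> + diag_coeff \<alpha> \<gamma> * diag_coeff \<beta> \<alpha> = diag_coeff \<beta> \<gamma> * diag_coeff \<alpha> \<gamma>" (is ?A)
    "diag_coeff \<alpha> \<beta> * diag_coeff \<alpha> \<gamma> = diag_coeff \<beta> \<gamma> * diag_coeff \<alpha> \<beta> + diag_coeff \<alpha> \<gamma> * diag_coeff \<gamma> \<beta>" (is ?B)
    "diag_coeff \<alpha> \<beta> * diag_coeff \<alpha> \<beta> * diag_coeff \<beta> \<gamma> + (1 + diag_coeff \<alpha> \<beta> * diag_coeff \<beta> \<alpha>) * diag_coeff \<alpha> \<gamma>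
      = diag_coeff \<beta> \<gamma> * diag_coeff \<beta> \<gamma> * diag_coeff \<alpha> \<beta> + (1 + diag_coeff \<beta> \<gamma> * diag_coeff \<gamma> \<beta>) * diag_coeff \<alpha> \<gamma>" (is ?C)
proof -
  define x y z where "x = node_content \<alpha>" and "y = node_content \<beta>" and "z = node_content \<gamma>"
  define \<kappa> where "\<kappa> = qF - inverse qF"
  have "?A \<and> ?B \<and> ?C" if "node_pos \<alpha> = node_pos \<beta>" "node_pos \<beta> = node_pos \<gamma>"
  proof -
    have nz: "y - x \<noteq> 0" "x - y \<noteq> 0" "z - y \<noteq> 0" "y - z \<noteq> 0" "z - x \<noteq> 0"
      using assms that by (auto simp: separated_def x_def y_def z_def)
    have c: "diag_coeff \<alpha> \<beta> = y * \<kappa> / (y - x)" "diag_coeff \<beta> \<alpha> = x * \<kappa> / (x - y)"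
      "diag_coeff \<beta> \<gamma> = z * \<kappa> / (z - y)" "diag_coeff \<gamma> \<beta> = y * \<kappa> / (y - z)" "diag_coeff \<alpha> \<gamma> = z * \<kappa> / (z - x)"
      using that by (simp_all add: diag_coeff_def x_def y_def z_def \<kappa>_def)
    have i1: "diag_coeff \<alpha> \<beta> * diag_coeff \<beta> \<gamma> + diag_coeff \<alpha> \<gamma> * diag_coeff \<beta> \<alpha> = diag_coeff \<beta> \<gamma> * diag_coeff \<alpha> \<gamma>"
      unfolding c using nz by (simp add: divide_simps) (simp add: algebra_simps)
    have i2: "diag_coeff \<alpha> \<beta> * diag_coeff \<alpha> \<gamma> = diag_coeff \<beta> \<gamma> * diag_coeff \<alpha> \<beta> + diag_coeff \<alpha> \<gamma> * diag_coeff \<gamma> \<beta>"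
      unfolding c using nz by (simp add: divide_simps) (simp add: algebra_simps)
    \<comment> \<open>The third identity follows from the other two: multiply the first by the
      coefficient of \<alpha>, \<beta> and apply the second with the factor of \<beta>,
      \<gamma>.\<close>
    have "diag_coeff \<alpha> \<beta> * diag_coeff \<alpha> \<beta> * diag_coeff \<beta> \<gamma> + diag_coeff \<alpha> \<beta> * diag_coeff \<beta> \<alpha> * diag_coeff \<alpha> \<gamma>
      = diag_coeff \<alpha> \<beta> * (diag_coeff \<alpha> \<beta> * diag_coeff \<beta> \<gamma> + diag_coeff \<alpha> \<gamma> * diag_coeff \<beta> \<alpha>)"
      by (simp add: algebra_simps)
    also have "\<dots> = diag_coeff \<beta> \<gamma> * (diag_coeff \<alpha> \<beta> * diag_coeff \<alpha> \<gamma>)"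
      unfolding i1 by (simp add: algebra_simps)
    also have "\<dots> = diag_coeff \<beta> \<gamma> * diag_coeff \<beta> \<gamma> * diag_coeff \<alpha> \<beta> + diag_coeff \<beta> \<gamma> * diag_coeff \<gamma> \<beta> * diag_coeff \<alpha> \<gamma>"
      unfolding i2 by (simp add: algebra_simps)
    finally show ?thesis using i1 i2 by (simp add: distrib_right)
  qed
  moreover have "?A \<and> ?B \<and> ?C" if "\<not> (node_pos \<alpha> = node_pos \<beta> \<and> node_pos \<beta> = node_pos \<gamma>)"
    using that by (auto simp: diag_coeff_def)
  ultimately show ?A ?B ?C by blast+
qed

text \<open>The numerator vanishes exactly if the content of \<beta> is q^(-2) times that of
  \<alpha>.\<close>

lemma swap_coeff_eq_0_iff:
  assumes "valid_node d m \<alpha>" "valid_node d m \<beta>" "separated \<alpha> \<beta>"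
  shows "swap_coeff \<alpha> \<beta> = 0 \<longleftrightarrow> snd \<alpha> = snd \<beta> \<and> diag \<beta> = diag \<alpha> - 1"
proof (cases "node_pos \<alpha> = node_pos \<beta>")
  case True
  have "qF * node_content \<beta> - inverse qF * node_content \<alpha> = 0 \<longleftrightarrow>
      node_content \<beta> = qF powi (2 * (- 1)) * node_content \<alpha>"
    by (simp add: power_int_minus power2_eq_square field_simps)
  also have "\<dots> \<longleftrightarrow> snd (snd \<alpha>) = snd (snd \<beta>) \<and> diag \<beta> = diag \<alpha> + (- 1)"
    by (rule node_content_shift[OF assms(1,2)])
  finally show ?thesis
    using True assms(3) by (auto simp: swap_coeff_def separated_def prod_eq_iff node_pos_eq)
next
  case False
  then show ?thesis by (auto simp: swap_coeff_def node_pos_eq)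
qed

text \<open>Adjacent nodes lie on neighbouring diagonals, so one of the two coefficients, depending
  on the direction, is zero.\<close>

lemma swap_coeff_covers:
  assumes "valid_node d m \<alpha>" "valid_node d m \<beta>" "covers \<alpha> \<beta>" "separated \<alpha> \<beta>"
  shows "swap_coeff \<alpha> \<beta> * swap_coeff \<beta> \<alpha> = 0"
  using covers_diag[OF assms(3)] swap_coeff_eq_0_iff[OF assms(1,2,4)]
    swap_coeff_eq_0_iff[OF assms(2,1) assms(4)[unfolded separated_sym[of \<alpha> \<beta>]]] by auto

lemma std_seq_separated:
  assumes "std_seq d m n T" "1 \<le> i" "i < n"
  shows "separated (T i) (T (Suc i))"
  using std_seq_consecutive_diag(1)[OF assms] node_content_eq_iff[of d m "T i" "T (Suc i)"]
    std_seq_valid[OF assms(1), of i] std_seq_valid[OF assms(1), of "Suc i"] assms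
  by (auto simp: separated_def)

lemma std_seq_separated2:
  assumes "std_seq d m n T" "1 \<le> i" "Suc i < n"
  shows "separated (T i) (T (Suc (Suc i)))"
  using std_seq_two_apart_diag[OF assms] node_content_eq_iff[of d m "T i" "T (Suc (Suc i))"]
    std_seq_valid[OF assms(1), of i] std_seq_valid[OF assms(1), of "Suc (Suc i)"] assms
  by (auto simp: separated_def)

lemma std_seq_swap_coeff_nz:
  assumes "std_seq d m n T" "1 \<le> i" "i < n" "\<not> covers (T i) (T (Suc i))"
  shows "swap_coeff (T i) (T (Suc i)) \<noteq> 0" "swap_coeff (T (Suc i)) (T i) \<noteq> 0"
proof -
  have v: "valid_node d m (T i)" "valid_node d m (T (Suc i))" using assms std_seq_valid by auto
  have s: "separated (T i) (T (Suc i))" using assms std_seq_separated by blast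
  have *: False if "snd (T i) = snd (T (Suc i))" "\<bar>diag (T i) - diag (T (Suc i))\<bar> = 1"
    using std_seq_consecutive_diag(2)[OF assms(1-3) that] assms(4) by blast
  show "swap_coeff (T i) (T (Suc i)) \<noteq> 0"
    unfolding swap_coeff_eq_0_iff[OF v s] by (rule notI, elim conjE, rule *, assumption, linarith)
  show "swap_coeff (T (Suc i)) (T i) \<noteq> 0"
    unfolding swap_coeff_eq_0_iff[OF v(2,1) s[unfolded separated_sym[of "T i" "T (Suc i)"]]]
    by (rule notI, elim conjE, rule *, erule sym, linarith)
qed

section \<open>Seminormal operators on coordinate functions\<close>

type_synonym vect = "dm_tableau \<Rightarrow> laurent fract"

locale shape =
  fixes d m n :: nat and \<xi> :: "nat \<Rightarrow> complex" and \<Lambda> :: dm_partition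
  assumes d_pos: "d > 0" and n_pos: "n > 0" and \<xi>: "bij_betw \<xi> {1..d} {z. z ^ d = 1}"
    and \<Lambda>: "\<Lambda> \<in> dm_partitions d m n"
begin

abbreviation St where "St \<equiv> standard_tableaux n \<Lambda>"

text \<open>Only the support is restricted. The relations are identities of operators valid for
  arbitrary coefficients; membership of the coefficients in \<open>Fm m\<close> is handled
  separately.\<close>

definition Vc :: "vect set" where
  "Vc = {f. \<forall>t. t \<notin> St \<longrightarrow> f t = 0}"

definition root :: "dm_node \<Rightarrow> laurent fract" where
  "root \<alpha> = to_Fm (const (\<xi> (node_pos \<alpha>)))"

text \<open>These operators act on coordinate functions, so the coefficient of \<open>g\<^sub>i\<close> at \<open>S\<close> collects the
  contributions of the basis vectors at \<open>S\<close> and at \<open>S\<close> with \<open>i\<close> and \<open>i + 1\<close> exchanged.\<close>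

definition Gop :: "nat \<Rightarrow> vect \<Rightarrow> vect" where
  "Gop i f S = (if S \<in> St then diag_coeff (S i) (S (Suc i)) * f S
     + swap_coeff (S (Suc i)) (S i) * f (S \<circ> swap i) else 0)"

definition Dop :: "nat \<Rightarrow> vect \<Rightarrow> vect" where
  "Dop i f S = node_content (S i) * f S"

definition Top :: "nat \<Rightarrow> vect \<Rightarrow> vect" where
  "Top j f S = root (S j) * f S"

lemma St_iff: "T \<in> St \<longleftrightarrow> T \<in> extensional {1..n} \<and> std_seq d m n T \<and> T ` {1..n} = dm_nodes \<Lambda>"
  by (rule standard_tableaux_iff[OF \<Lambda>])

lemma St_std: "T \<in> St \<Longrightarrow> std_seq d m n T"
  by (simp add: St_iff)

lemma St_valid: "T \<in> St \<Longrightarrow> 1 \<le> i \<Longrightarrow> i \<le> n \<Longrightarrow> valid_node d m (T i)"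
  using St_std std_seq_valid by blast

lemma St_swap: "T \<in> St \<Longrightarrow> 1 \<le> i \<Longrightarrow> i < n \<Longrightarrow> T \<circ> swap i \<in> St \<longleftrightarrow> \<not> covers (T i) (T (Suc i))"
  by (rule standard_tableaux_swap[OF \<Lambda>])

lemma finite_St: "finite St"
  by (rule finite_standard_tableaux[OF \<Lambda> n_pos])

lemma Vc_zero: "f \<in> Vc \<Longrightarrow> t \<notin> St \<Longrightarrow> f t = 0"
  by (simp add: Vc_def)

lemma ops_Vc: "Gop i f \<in> Vc" "f \<in> Vc \<Longrightarrow> Dop i f \<in> Vc" "f \<in> Vc \<Longrightarrow> Top j f \<in> Vc"
  by (simp_all add: Vc_def Gop_def Dop_def Top_def)

lemma Gop_St: "S \<in> St \<Longrightarrow> Gop i f S = diag_coeff (S i) (S (Suc i)) * f S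
     + swap_coeff (S (Suc i)) (S i) * f (S \<circ> swap i)"
  by (simp add: Gop_def)

lemma Gop_not_St: "S \<notin> St \<Longrightarrow> Gop i f S = 0"
  by (simp add: Gop_def)

text \<open>When the exchanged tableau is not standard, the product of the two exchange coefficients vanishes,
  so the round trip through it may be included without changing the result.\<close>

lemma round_trip:
  assumes "S \<in> St" "1 \<le> i" "i < n"
  shows "(if S \<circ> swap i \<in> St then swap_coeff (S (Suc i)) (S i) * swap_coeff (S i) (S (Suc i)) else 0)
    = 1 + diag_coeff (S i) (S (Suc i)) * diag_coeff (S (Suc i)) (S i)"
proof -
  have s: "separated (S i) (S (Suc i))" using St_std[OF assms(1)] assms std_seq_separated by blast
  have "swap_coeff (S i) (S (Suc i)) * swap_coeff (S (Suc i)) (S i) = 0" if "S \<circ> swap i \<notin> St"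
    using that St_swap[OF assms] swap_coeff_covers[of d m, OF _ _ _ s] St_valid[OF assms(1)] assms by auto
  then show ?thesis using coeff_product[OF s] by (auto simp: mult.commute)
qed

text \<open>The diagonal operators \<open>Dop\<close> are the Jucys-Murphy elements. The coefficient
  at the exchanged tableau is a multiple of the sum in \<open>diag_coeff_content\<close> and
  vanishes; the same sum reduces the diagonal coefficient, computed by \<open>round_trip\<close>, to
  the content of i + 1.\<close>

lemma Gop_Dop_Gop:
  assumes "f \<in> Vc" "1 \<le> i" "i < n"
  shows "Gop i (Dop i (Gop i f)) = Dop (Suc i) f"
proof
  fix S
  show "Gop i (Dop i (Gop i f)) S = Dop (Suc i) f S"
  proof (cases "S \<in> St")
    case True
    define S' where "S' = S \<circ> swap i"
    have s: "separated (S i) (S (Suc i))" using St_std[OF True] assms std_seq_separated by blast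
    define a a' b b' x y where "a = diag_coeff (S i) (S (Suc i))" and "a' = diag_coeff (S (Suc i)) (S i)"
      and "b = swap_coeff (S (Suc i)) (S i)" and "b' = swap_coeff (S i) (S (Suc i))"
      and "x = node_content (S i)" and "y = node_content (S (Suc i))"
    have "S' \<circ> swap i = S" "S' i = S (Suc i)" "S' (Suc i) = S i" by (simp_all add: S'_def)
    then have "Gop i (Dop i (Gop i f)) S = a * x * (a * f S + b * f S') +
        b * (y * (if S' \<in> St then a' * f S' + b' * f S else 0))"
      using True by (simp add: Gop_def Dop_def a_def a'_def b_def b'_def x_def y_def S'_def[symmetric] del: comp_apply)
    also have "\<dots> = (a * a * x + (if S' \<in> St then b * b' else 0) * y) * f S + b * (a * x + a' * y) * f S'"
      using Vc_zero[OF assms(1), of S'] by (simp add: algebra_simps)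
    also have "\<dots> = (a * (a * x + a' * y) + y) * f S + b * (a * x + a' * y) * f S'"
      using round_trip[OF True assms(2,3)] unfolding S'_def[symmetric] a_def[symmetric] a'_def[symmetric] b_def[symmetric] b'_def[symmetric]
      by (simp only:) (simp add: algebra_simps)
    also have "\<dots> = y * f S"
      using diag_coeff_content[OF s] by (simp add: a_def a'_def x_def y_def)
    finally show ?thesis by (simp add: Dop_def y_def)
  next
    case False
    then show ?thesis using assms(1) by (simp add: Gop_def Dop_def Vc_zero)
  qed
qed

text \<open>By \<open>round_trip\<close> and \<open>diag_coeff_sum\<close>; the factor depending on
  positions is what (q - q^(-1)) e_i turns into.\<close>

lemma Gop_quadratic:
  assumes "f \<in> Vc" "1 \<le> i" "i < n"
  shows "Gop i (Gop i f) S = f S + (if node_pos (S i) = node_pos (S (Suc i)) then qF - inverse qF else 0) * Gop i f S"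
proof (cases "S \<in> St")
  case True
  define S' where "S' = S \<circ> swap i"
  have s: "separated (S i) (S (Suc i))" using St_std[OF True] assms std_seq_separated by blast
  define a a' b b' where "a = diag_coeff (S i) (S (Suc i))" and "a' = diag_coeff (S (Suc i)) (S i)"
    and "b = swap_coeff (S (Suc i)) (S i)" and "b' = swap_coeff (S i) (S (Suc i))"
  have "S' \<circ> swap i = S" "S' i = S (Suc i)" "S' (Suc i) = S i" by (simp_all add: S'_def)
  then have "Gop i (Gop i f) S = a * (a * f S + b * f S') + b * (if S' \<in> St then a' * f S' + b' * f S else 0)"
    using True by (simp add: Gop_def a_def a'_def b_def b'_def S'_def[symmetric] del: comp_apply)
  also have "\<dots> = (a * a + (if S' \<in> St then b * b' else 0)) * f S + b * (a + a') * f S'"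
    using Vc_zero[OF assms(1), of S'] by (simp add: algebra_simps)
  also have "\<dots> = f S + (a + a') * (a * f S + b * f S')"
    using round_trip[OF True assms(2,3)] unfolding S'_def[symmetric] a_def[symmetric] a'_def[symmetric] b_def[symmetric] b'_def[symmetric]
    by (simp only:) (simp add: algebra_simps)
  finally show ?thesis
    using diag_coeff_sum[OF s] True by (simp add: Gop_def a_def a'_def b_def S'_def)
next
  case False
  then show ?thesis using assms(1) by (simp add: Gop_def Vc_zero)
qed

text \<open>Both sides are expanded at S over its orbit under exchanges of three consecutive
  entries, at most six tableaux. The two longest words lead to the same tableau, and the remaining
  coefficients agree by \<open>diag_coeff_braid\<close>.\<close>

lemma Gop_braid:
  assumes "f \<in> Vc" "1 \<le> i" "Suc i < n"
  shows "Gop i (Gop (Suc i) (Gop i f)) = Gop (Suc i) (Gop i (Gop (Suc i) f))"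
proof
  fix S
  show "Gop i (Gop (Suc i) (Gop i f)) S = Gop (Suc i) (Gop i (Gop (Suc i) f)) S"
  proof (cases "S \<in> St")
    case True
    define j where "j = Suc i"
    have jn: "1 \<le> j" "j < n" "i < n" using assms by (auto simp: j_def)
    define x y z where "x = S i" and "y = S (Suc i)" and "z = S (Suc (Suc i))"
    define S1 S2 S12 S21 S121 where "S1 = S \<circ> swap i" and "S2 = S \<circ> swap j"
      and "S12 = S1 \<circ> swap j" and "S21 = S2 \<circ> swap i" and "S121 = S12 \<circ> swap i"
    have rev: "S1 \<circ> swap i = S" "S2 \<circ> swap j = S" "S12 \<circ> swap j = S1" "S21 \<circ> swap i = S2"
      by (simp_all add: S1_def S2_def S12_def S21_def)
    have S212: "S21 \<circ> swap j = S121"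
      by (auto simp: S121_def S21_def S12_def S1_def S2_def j_def fun_eq_iff Transposition.transpose_def)
    have v: "S i = x" "S j = y" "S (Suc j) = z" "S1 i = y" "S1 j = x" "S1 (Suc j) = z"
      "S2 i = x" "S2 j = z" "S2 (Suc j) = y" "S12 i = y" "S12 j = z" "S12 (Suc j) = x"
      "S21 i = z" "S21 j = x" "S21 (Suc j) = y" "S121 i = z" "S121 j = y" "S121 (Suc j) = x"
      by (auto simp: S121_def S21_def S12_def S1_def S2_def j_def x_def y_def z_def Transposition.transpose_def)
    have sep: "separated x y" "separated y z" "separated x z"
      using std_seq_separated[OF St_std[OF True], of i] std_seq_separated[OF St_std[OF True], of j]
        std_seq_separated2[OF St_std[OF True], of i] assms jn v by (auto simp: j_def z_def)
    have va: "valid_node d m x" "valid_node d m y" "valid_node d m z"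
      using St_valid[OF True] assms by (auto simp: x_def y_def z_def)
    \<comment> \<open>Which members of the orbit are standard depends only on the three pairs of
      nodes.\<close>
    define P Q R where "P = (\<not> covers x y)" and "Q = (\<not> covers y z)" and "R = (\<not> covers x z)"
    have m1: "S1 \<in> St \<longleftrightarrow> P" using St_swap[OF True assms(2) jn(3)] by (simp add: P_def S1_def v[symmetric] j_def)
    have m2: "S2 \<in> St \<longleftrightarrow> Q" using St_swap[OF True jn(1,2)] by (simp add: Q_def S2_def v[symmetric] j_def)
    have m12: "S12 \<in> St \<longleftrightarrow> R" if P
      using St_swap[of S1 j] m1 that jn v by (simp add: R_def S12_def)
    have m21: "S21 \<in> St \<longleftrightarrow> R" if Q
      using St_swap[of S2 i] m2 that jn assms v by (simp add: R_def S21_def j_def[symmetric])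
    have m121: "S121 \<in> St \<longleftrightarrow> Q" if P R
      using St_swap[of S12 i] m12 that jn assms v by (simp add: Q_def S121_def j_def[symmetric])
    have m212: "S121 \<in> St \<longleftrightarrow> P" if Q R
      using St_swap[of S21 j] m21 that jn v S212 by (simp add: P_def)
    define axy ayx ayz azy axz where "axy = diag_coeff x y" and "ayx = diag_coeff y x"
      and "ayz = diag_coeff y z" and "azy = diag_coeff z y" and "axz = diag_coeff x z"
    define bxy byx byz bzy bzx where "bxy = swap_coeff x y" and "byx = swap_coeff y x"
      and "byz = swap_coeff y z" and "bzy = swap_coeff z y" and "bzx = swap_coeff z x"
    note ab = axy_def ayx_def ayz_def azy_def axz_def bxy_def byx_def byz_def bzy_def bzx_def
    have Gi: "Gop i h U = (if U \<in> St then diag_coeff (U i) (U j) * h U + swap_coeff (U j) (U i) * h (U \<circ> swap i) else 0)"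
      for h U by (simp add: Gop_def j_def)
    note Gj = Gop_def[of j]
    have G1: "Gop i h S = axy * h S + byx * h S1" "Gop j h S = ayz * h S + bzy * h S2"
      for h using True by (simp_all add: Gi Gj v ab S1_def[symmetric] S2_def[symmetric] del: comp_apply)
    have G2: "Gop j h S1 = (if P then axz * h S1 + bzx * h S12 else 0)"
      "Gop i h S1 = (if P then ayx * h S1 + bxy * h S else 0)"
      "Gop i h S2 = (if Q then axz * h S2 + bzx * h S21 else 0)"
      "Gop j h S2 = (if Q then azy * h S2 + byz * h S else 0)" for h
      by (simp_all add: Gi Gj m1 m2 v ab S12_def[symmetric] S21_def[symmetric] rev del: comp_apply)
    have G3: "P \<Longrightarrow> Gop i h S12 = (if R then ayz * h S12 + bzy * h S121 else 0)"
      "Q \<Longrightarrow> Gop j h S21 = (if R then axy * h S21 + byx * h S121 else 0)" for h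
      by (simp_all add: Gi Gj m12 m21 v ab S121_def[symmetric] S212 rev del: comp_apply)
    have z0: "\<not> P \<Longrightarrow> f S1 = 0" "\<not> Q \<Longrightarrow> f S2 = 0" "P \<Longrightarrow> \<not> R \<Longrightarrow> f S12 = 0" "Q \<Longrightarrow> \<not> R \<Longrightarrow> f S21 = 0"
      "P \<Longrightarrow> R \<Longrightarrow> \<not> Q \<Longrightarrow> f S121 = 0" "Q \<Longrightarrow> R \<Longrightarrow> \<not> P \<Longrightarrow> f S121 = 0"
      using m1 m2 m12 m21 m121 m212 Vc_zero[OF assms(1)] by auto
    have rt: "(if P then byx * bxy else 0) = 1 + axy * ayx" "(if Q then bzy * byz else 0) = 1 + ayz * azy"
      using round_trip[OF True assms(2) jn(3), folded S1_def, folded j_def, unfolded m1 v]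
        round_trip[OF True jn(1,2), folded S2_def, unfolded m2 v]
      by (simp_all only: ab)
    have br: "axy * ayz + axz * ayx = ayz * axz" "axy * axz = ayz * axy + axz * azy"
      "axy * axy * ayz + (1 + axy * ayx) * axz = ayz * ayz * axy + (1 + ayz * azy) * axz"
      using diag_coeff_braid[OF sep] by (simp_all add: ab)
    \<comment> \<open>Values at nonstandard tableaux are set to zero, so one polynomial expression
      serves all eight cases.\<close>
    define e1 e2 e3 e4 e5 where "e1 = (if P then f S1 else 0)" and "e2 = (if Q then f S2 else 0)"
      and "e3 = (if P \<and> R then f S12 else 0)" and "e4 = (if Q \<and> R then f S21 else 0)"
      and "e5 = (if P \<and> Q \<and> R then f S121 else 0)"
    have L: "Gop i (Gop j (Gop i f)) S =
        (axy * axy * ayz + (if P then byx * bxy else 0) * axz) * f S + byx * (axy * ayz + axz * ayx) * e1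
        + bzy * (axy * axz) * e2 + axy * bzy * bzx * e4 + byx * bzx * ayz * e3 + byx * bzx * bzy * e5"
      unfolding G1 G2 e1_def e2_def e3_def e4_def e5_def
      by (cases P; cases Q; cases R) (simp_all add: G1 G2 G3 z0 algebra_simps)
    have R': "Gop j (Gop i (Gop j f)) S =
        (ayz * ayz * axy + (if Q then bzy * byz else 0) * axz) * f S + byx * (ayz * axz) * e1
        + bzy * (ayz * axy + axz * azy) * e2 + axy * bzy * bzx * e4 + byx * bzx * ayz * e3 + byx * bzx * bzy * e5"
      unfolding G1 G2 e1_def e2_def e3_def e4_def e5_def
      by (cases P; cases Q; cases R) (simp_all add: G1 G2 G3 z0 algebra_simps)
    have "Gop i (Gop j (Gop i f)) S = Gop j (Gop i (Gop j f)) S"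
      unfolding L R' rt br(1,3) br(2)[symmetric] by simp
    then show ?thesis by (simp add: j_def)
  qed (simp add: Gop_def)
qed

lemma swap_commute: "Suc i < j \<Longrightarrow> S \<circ> swap i \<circ> swap j = S \<circ> swap j \<circ> swap i"
  by (auto simp: fun_eq_iff Transposition.transpose_def)

lemma Gop_far:
  assumes "f \<in> Vc" "1 \<le> i" "Suc i < j" "j < n"
  shows "Gop i (Gop j f) = Gop j (Gop i f)"
proof
  fix S
  show "Gop i (Gop j f) S = Gop j (Gop i f) S"
  proof (cases "S \<in> St")
    case True
    define S1 S2 S12 where "S1 = S \<circ> swap i" and "S2 = S \<circ> swap j" and "S12 = S1 \<circ> swap j"
    have S21: "S2 \<circ> swap i = S12"
      unfolding S12_def S1_def S2_def by (rule swap_commute[OF assms(3), symmetric])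
    have v: "S1 j = S j" "S1 (Suc j) = S (Suc j)" "S2 i = S i" "S2 (Suc i) = S (Suc i)"
      using assms by (auto simp: S1_def S2_def Transposition.transpose_def)
    have m: "S1 \<in> St \<Longrightarrow> S12 \<in> St \<longleftrightarrow> S2 \<in> St" "S2 \<in> St \<Longrightarrow> S12 \<in> St \<longleftrightarrow> S1 \<in> St"
      using St_swap[of S1 j] St_swap[of S2 i] St_swap[OF True, of i] St_swap[OF True, of j] assms v S21
      by (simp_all add: S12_def S1_def[symmetric] S2_def[symmetric])
    have "f S1 = 0" if "S1 \<notin> St" using that Vc_zero[OF assms(1)] by simp
    moreover have "f S2 = 0" if "S2 \<notin> St" using that Vc_zero[OF assms(1)] by simp
    moreover have "f S12 = 0" if "S12 \<notin> St" using that Vc_zero[OF assms(1)] by simp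
    ultimately show ?thesis
      using True m
      by (cases "S1 \<in> St"; cases "S2 \<in> St")
        (simp_all add: Gop_def S1_def[symmetric] S2_def[symmetric] S12_def[symmetric] S21 v algebra_simps del: comp_apply)
  qed (simp add: Gop_def)
qed

text \<open>The diagonal coefficient is nonzero only when i and i + 1 have equal positions, and then
  exchanging the index does not alter the root of unity.\<close>

lemma Top_Gop:
  assumes "1 \<le> i" "i < n"
  shows "Top j (Gop i f) = Gop i (Top (swap i j) f)"
proof
  fix S
  have "root (S j) * diag_coeff (S i) (S (Suc i)) = diag_coeff (S i) (S (Suc i)) * root (S (swap i j))"
    by (cases "j = i \<or> j = Suc i") (auto simp: diag_coeff_def root_def)
  then show "Top j (Gop i f) S = Gop i (Top (swap i j) f) S"
    by (simp add: Top_def Gop_def distrib_left mult.assoc[symmetric] mult.commute[of _ "swap_coeff _ _"])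
qed

lemma Dop_Gop:
  assumes "k \<noteq> i" "k \<noteq> Suc i"
  shows "Dop k (Gop i f) = Gop i (Dop k f)"
  using assms by (auto simp: Dop_def Gop_def fun_eq_iff algebra_simps)

end

section \<open>The algebra and its generators\<close>

text \<open>A geometric sum in \<zeta> times the inverse of \<eta>, the inverse being the power d -
  1. It shows that e_i projects onto the vectors on which t_i and t_(i+1) have the same
  eigenvalue.\<close>

lemma root_of_unity_sum:
  fixes \<zeta> \<eta> :: complex
  assumes "d > 0" "\<zeta> ^ d = 1" "\<eta> ^ d = 1"
  shows "1 / of_nat d * (\<Sum>s<d. \<zeta> ^ s * (\<eta> ^ (d - 1)) ^ s) = (if \<zeta> = \<eta> then 1 else 0)"
proof -
  define \<omega> where "\<omega> = \<zeta> * \<eta> ^ (d - 1)"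
  have \<eta>: "\<eta> * \<eta> ^ (d - 1) = 1" using assms by (simp flip: power_Suc)
  have eq: "\<omega> = 1 \<longleftrightarrow> \<zeta> = \<eta>"
  proof
    assume "\<omega> = 1"
    have "\<zeta> * (\<eta> * \<eta> ^ (d - 1)) = \<omega> * \<eta>" by (simp only: \<omega>_def mult_ac)
    then show "\<zeta> = \<eta>" unfolding \<eta> \<open>\<omega> = 1\<close> by simp
  qed (use \<eta> in \<open>simp add: \<omega>_def\<close>)
  have "\<omega> ^ d = \<zeta> ^ d * (\<eta> ^ d) ^ (d - 1)"
    by (simp add: \<omega>_def power_mult_distrib power_mult[symmetric] mult.commute)
  then have "\<omega> ^ d = 1" using assms by simp
  then have "(\<omega> - 1) * (\<Sum>s<d. \<omega> ^ s) = 0" by (simp add: power_diff_1_eq[symmetric])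
  then have "(\<Sum>s<d. \<omega> ^ s) = (if \<omega> = 1 then of_nat d else 0)" by auto
  then show ?thesis using assms eq by (simp add: \<omega>_def power_mult_distrib)
qed

lemma const_simps: "const 1 = 1" "const 0 = 0" "const (x * y) = const x * const y" "const (x + y) = const x + const y"
  by (simp_all add: const_def mult_single single_add)

lemma const_power: "const (x ^ k) = const x ^ k"
  by (induction k) (simp_all add: const_simps)

lemma const_sum: "const (sum f A) = (\<Sum>x\<in>A. const (f x))"
  by (induction A rule: infinite_finite_induct) (simp_all add: const_simps)

lemma const_eq_iff: "const x = const y \<longleftrightarrow> x = y"
  by (metis const_def lookup_single_eq)

lemma to_Fm_power: "to_Fm (x ^ k) = to_Fm x ^ k"
  by (induction k) simp_all

lemma to_Fm_sum: "to_Fm (sum f A) = (\<Sum>x\<in>A. to_Fm (f x))"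
  by (induction A rule: infinite_finite_induct) simp_all

section \<open>The algebra as a quotient and its generators\<close>

locale yh =
  fixes d m n :: nat
begin

sublocale F: free_alg "carrier (Rm m)" "yh_gens n"
  by unfold_locales (simp_all add: Rm_closed)

abbreviation FF where "FF \<equiv> carrier (yh_free m n)"

lemma yh_free_eq: "yh_free m n = F.FA"
  by (simp add: yh_free_def)

lemma FF_closed:
  "0 \<in> FF" "1 \<in> FF" "f \<in> FF \<Longrightarrow> g \<in> FF \<Longrightarrow> f + g \<in> FF" "f \<in> FF \<Longrightarrow> g \<in> FF \<Longrightarrow> f - g \<in> FF"
  "f \<in> FF \<Longrightarrow> g \<in> FF \<Longrightarrow> f * g \<in> FF" "c \<in> carrier (Rm m) \<Longrightarrow> scalar c \<in> FF"
  "x \<in> yh_gens n \<Longrightarrow> letter x \<in> FF"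
  unfolding yh_free_eq by (simp_all add: F.FA_add F.FA_diff F.FA_mult F.FA_scalar F.FA_letter)

lemma FF_power: "f \<in> FF \<Longrightarrow> f ^ k \<in> FF"
  by (induction k) (auto intro: FF_closed)

lemma FF_sum: "(\<And>i. i \<in> B \<Longrightarrow> f i \<in> FF) \<Longrightarrow> sum f B \<in> FF"
  unfolding yh_free_eq by (rule F.FA_sum)

lemma FF_prod_list: "(\<And>x. x \<in> set xs \<Longrightarrow> f x \<in> FF) \<Longrightarrow> prod_list (map f xs) \<in> FF"
  by (induction xs) (auto intro: FF_closed)

lemma FF_gens:
  "xx \<in> FF" "xx_inv \<in> FF" "1 \<le> j \<Longrightarrow> j \<le> n \<Longrightarrow> tt j \<in> FF" "1 \<le> i \<Longrightarrow> i < n \<Longrightarrow> gg i \<in> FF"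
  "1 \<le> i \<Longrightarrow> i < n \<Longrightarrow> ee d i \<in> FF" "q_diff \<in> FF"
proof -
  show t: "tt j \<in> FF" if "1 \<le> j" "j \<le> n" for j
    using that unfolding tt_def by (intro FF_closed) (auto simp: yh_gens_def)
  show "ee d i \<in> FF" if "1 \<le> i" "i < n"
    unfolding ee_def using that by (intro FF_closed FF_sum FF_power t Rm_const) auto
  show "q_diff \<in> FF" unfolding q_diff_def by (intro FF_closed Rm_closed Rm_indet_pow) auto
qed (auto simp: xx_def xx_inv_def gg_def yh_gens_def intro!: FF_closed)

lemma swap_mem: "1 \<le> i \<Longrightarrow> i < n \<Longrightarrow> 1 \<le> j \<Longrightarrow> j \<le> n \<Longrightarrow> 1 \<le> swap i j \<and> swap i j \<le> n"
  by (auto simp: Transposition.transpose_def)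

lemma relators_FF: "yh_relators d m n \<subseteq> FF"
proof -
  have "swap i j \<in> {1..n}" if "i \<in> {1..n - 1}" "j \<in> {1..n}" for i j
    using that swap_mem[of i j] by auto
  then show ?thesis
    unfolding yh_relators_def
    by (intro Un_least subsetI)
      (auto simp: power2_eq_square intro!: FF_closed FF_power FF_gens FF_prod_list Rm_indet_pow split: if_splits)
qed

sublocale FR: ring "yh_free m n"
  unfolding yh_free_eq by (rule F.ring_FA)

lemma ideal_yh: "ideal (yh_ideal d m n) (yh_free m n)"
  unfolding yh_ideal_def by (rule FR.genideal_ideal[OF relators_FF])

lemma relators_ideal: "yh_relators d m n \<subseteq> yh_ideal d m n"
  unfolding yh_ideal_def by (rule FR.genideal_self[OF relators_FF])

sublocale Y: quotient_alg "yh_ideal d m n" "yh_free m n" "Rm m"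
proof (intro quotient_alg.intro ideal_yh quotient_alg_axioms.intro)
  fix c x y assume c: "c \<in> carrier (Rm m)"
  show "c \<odot>\<^bsub>yh_free m n\<^esub> x \<in> FF" if "x \<in> FF"
    using FF_closed(5)[OF FF_closed(6)[OF c] that] by (simp add: yh_free_eq)
  show "c \<odot>\<^bsub>yh_free m n\<^esub> x \<in> yh_ideal d m n" if "x \<in> yh_ideal d m n"
    using ideal.I_l_closed[OF ideal_yh that FF_closed(6)[OF c]] by (simp add: yh_free_eq)
  show "c \<odot>\<^bsub>yh_free m n\<^esub> (x \<oplus>\<^bsub>yh_free m n\<^esub> y) = c \<odot>\<^bsub>yh_free m n\<^esub> x \<oplus>\<^bsub>yh_free m n\<^esub> c \<odot>\<^bsub>yh_free m n\<^esub> y"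
    by (simp add: yh_free_eq distrib_left)
qed

lemma YH_eq: "YH d m n = Y.Q"
  by (simp add: YH_def)

sublocale E: scalar_extension "Rm m" "Fm m" to_Fm "YH d m n"
proof (rule scalar_extension.intro)
  show "cring (Fm m)" by (rule cring_Fm)
  show "ring (YH d m n)" unfolding YH_eq by (rule Y.ring_Q)
  show "to_Fm r \<in> carrier (Fm m)" if "r \<in> carrier (Rm m)" for r using that by (rule to_Fm_closed)
  show "r \<odot>\<^bsub>YH d m n\<^esub> x \<in> carrier (YH d m n)" if "r \<in> carrier (Rm m)" "x \<in> carrier (YH d m n)" for r x
  proof -
    obtain f where f: "f \<in> FF" "x = Y.cl f" using \<open>x \<in> _\<close> unfolding YH_eq Y.carrier_Q by (elim imageE)
    have "r \<odot>\<^bsub>YH d m n\<^esub> x = Y.cl (r \<odot>\<^bsub>yh_free m n\<^esub> f)"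
      unfolding YH_eq f(2) by (rule Y.cl_smult) (use f that in auto)
    also have "\<dots> \<in> carrier (YH d m n)"
      unfolding YH_eq by (rule Y.cl_closed, rule Y.smult_carrier) (use f that in auto)
    finally show ?thesis .
  qed
qed

abbreviation A where "A \<equiv> FYH d m n"

lemma A_eq: "A = E.E"
  by (simp add: FYH_def)

lemma assoc_algebra_A: "assoc_algebra (Fm m) A"
  unfolding A_eq by (rule E.assoc_algebra_E)

sublocale A: assoc_algebra "Fm m" A
  by (rule assoc_algebra_A)

definition quot :: "pre_elt \<Rightarrow> yh_elt" where
  "quot f = pure_tensor (Rm m) (Fm m) to_Fm (YH d m n) 1 (Y.cl f)"

lemma cl_YH: "f \<in> FF \<Longrightarrow> Y.cl f \<in> carrier (YH d m n)"
  unfolding YH_eq by (rule Y.cl_closed)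

lemma quot_closed: "f \<in> FF \<Longrightarrow> quot f \<in> carrier A"
  unfolding quot_def A_eq by (rule E.pt_closed) (simp_all add: cl_YH Fm_closed)

lemma quot_add: "f \<in> FF \<Longrightarrow> g \<in> FF \<Longrightarrow> quot (f + g) = quot f \<oplus>\<^bsub>A\<^esub> quot g"
proof -
  assume f: "f \<in> FF" and g: "g \<in> FF"
  have "Y.cl (f + g) = Y.cl f \<oplus>\<^bsub>YH d m n\<^esub> Y.cl g"
    unfolding YH_eq Y.cl_add[OF f g] by (simp add: yh_free_eq)
  then show ?thesis
    unfolding quot_def A_eq by (simp add: E.pt_add_right cl_YH f g Fm_closed)
qed

lemma quot_mult: "f \<in> FF \<Longrightarrow> g \<in> FF \<Longrightarrow> quot (f * g) = quot f \<otimes>\<^bsub>A\<^esub> quot g"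
proof -
  assume f: "f \<in> FF" and g: "g \<in> FF"
  have "Y.cl (f * g) = Y.cl f \<otimes>\<^bsub>YH d m n\<^esub> Y.cl g"
    unfolding YH_eq Y.cl_mult[OF f g] by (simp add: yh_free_eq)
  then show ?thesis
    unfolding quot_def A_eq by (simp add: E.pt_mult cl_YH f g Fm_closed)
qed

lemma quot_one: "quot 1 = \<one>\<^bsub>A\<^esub>"
proof -
  have "Y.cl 1 = \<one>\<^bsub>YH d m n\<^esub>" unfolding YH_eq Y.Q_simps by (simp add: yh_free_eq)
  then show ?thesis using E.pt_one by (simp add: quot_def A_eq)
qed

lemma quot_scalar: "c \<in> carrier (Rm m) \<Longrightarrow> quot (scalar c) = to_Fm c \<odot>\<^bsub>A\<^esub> \<one>\<^bsub>A\<^esub>"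
proof -
  assume c: "c \<in> carrier (Rm m)"
  have "Y.cl (scalar c) = c \<odot>\<^bsub>YH d m n\<^esub> Y.cl 1"
    unfolding YH_eq Y.cl_smult[OF c FF_closed(2)] by (simp add: yh_free_eq)
  then have "quot (scalar c) = pure_tensor (Rm m) (Fm m) to_Fm (YH d m n) (to_Fm c) (Y.cl 1)"
    using E.pt_balanced[of 1 c "Y.cl 1"] c cl_YH[OF FF_closed(2)] by (simp add: quot_def Fm_closed)
  also have "\<dots> = to_Fm c \<odot>\<^bsub>A\<^esub> quot 1"
    unfolding quot_def A_eq by (subst E.pt_smult) (simp_all add: c to_Fm_closed Fm_closed cl_YH FF_closed)
  finally show ?thesis by (simp add: quot_one)
qed

lemma quot_ideal: "f \<in> yh_ideal d m n \<Longrightarrow> quot f = \<zero>\<^bsub>A\<^esub>"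
proof -
  assume f: "f \<in> yh_ideal d m n"
  have z: "quot 0 = \<zero>\<^bsub>A\<^esub>"
    using quot_add[OF FF_closed(1,1)] quot_closed[OF FF_closed(1)] by (simp add: A.add.r_cancel_one)
  have "Y.cl f = Y.cl 0" using Y.cl_ideal[OF f] Y.cl_zero by (simp add: yh_free_eq)
  then show ?thesis using z by (simp add: quot_def)
qed

lemma yh_gen_quot: "yh_gen d m n x = quot (letter x)"
  by (simp add: yh_gen_def quot_def)

lemma yh_gen_closed: "x \<in> yh_gens n \<Longrightarrow> yh_gen d m n x \<in> carrier A"
  by (simp add: yh_gen_quot quot_closed FF_closed)

text \<open>Every pure tensor is a scalar times the image of a noncommutative polynomial, and that
  image is a combination of products of generators. Subtraction is addition of the multiple by
  -1.\<close>

lemma A_induct [consumes 1, case_names gen one add mult smult]: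
  assumes a: "a \<in> carrier A"
    and gen: "\<And>x. x \<in> yh_gens n \<Longrightarrow> P (yh_gen d m n x)" and one: "P \<one>\<^bsub>A\<^esub>"
    and add: "\<And>a b. a \<in> carrier A \<Longrightarrow> b \<in> carrier A \<Longrightarrow> P a \<Longrightarrow> P b \<Longrightarrow> P (a \<oplus>\<^bsub>A\<^esub> b)"
    and mult: "\<And>a b. a \<in> carrier A \<Longrightarrow> b \<in> carrier A \<Longrightarrow> P a \<Longrightarrow> P b \<Longrightarrow> P (a \<otimes>\<^bsub>A\<^esub> b)"
    and smult: "\<And>c a. c \<in> carrier (Fm m) \<Longrightarrow> a \<in> carrier A \<Longrightarrow> P a \<Longrightarrow> P (c \<odot>\<^bsub>A\<^esub> a)"
  shows "P a"
proof -
  have word: "P (quot (Poly_Mapping.single (Word xs) 1)) \<and> Poly_Mapping.single (Word xs) 1 \<in> FF"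
    if "set xs \<subseteq> yh_gens n" for xs
    using that
  proof (induction xs)
    case Nil
    have "Poly_Mapping.single (Word []) 1 = (1 :: pre_elt)" by (metis single_one zero_word_def)
    then show ?case using one FF_closed by (simp add: quot_one)
  next
    case (Cons x xs)
    have "Poly_Mapping.single (Word (x # xs)) 1 = letter x * Poly_Mapping.single (Word xs) (1 :: laurent)"
      by (simp add: letter_def mult_single plus_word_def)
    moreover have "letter x \<in> FF" using Cons.prems by (auto intro: FF_closed)
    ultimately show ?case
      using Cons mult[of "quot (letter x)" "quot (Poly_Mapping.single (Word xs) 1)"] gen[of x]
      by (simp add: quot_mult quot_closed FF_closed yh_gen_quot)
  qed
  have single: "P (quot (Poly_Mapping.single w c)) \<and> Poly_Mapping.single w c \<in> FF"
    if "set (letters w) \<subseteq> yh_gens n" "c \<in> carrier (Rm m)" for w c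
  proof -
    have "Poly_Mapping.single w c = scalar c * Poly_Mapping.single (Word (letters w)) 1"
      by (simp add: scalar_def mult_single)
    moreover have "P (quot (scalar c))"
      using that by (simp add: quot_scalar smult one to_Fm_closed)
    ultimately show ?thesis
      using word[OF that(1)] that(2) mult by (simp add: quot_mult quot_closed FF_closed)
  qed
  have zero: "P \<zero>\<^bsub>A\<^esub>"
    using smult[of 0 "\<one>\<^bsub>A\<^esub>"] one A.smult_l_null[of "\<one>\<^bsub>A\<^esub>"] by (simp add: Fm_closed)
  have q0: "quot 0 = \<zero>\<^bsub>A\<^esub>" by (rule quot_ideal) (metis Y.zero_closed yh_free_eq F.FA_simps(4))
  have all: "P (quot f)" if f: "f \<in> FF" for f
  proof -
    have "P (quot (\<Sum>w\<in>B. Poly_Mapping.single w (Poly_Mapping.lookup f w)))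
        \<and> (\<Sum>w\<in>B. Poly_Mapping.single w (Poly_Mapping.lookup f w)) \<in> FF"
      if "B \<subseteq> Poly_Mapping.keys f" for B
      using finite_subset[OF that finite_keys] that
    proof (induction B)
      case empty
      then show ?case using zero q0 FF_closed(1) by simp
    next
      case (insert w B)
      have "P (quot (Poly_Mapping.single w (Poly_Mapping.lookup f w)))
          \<and> Poly_Mapping.single w (Poly_Mapping.lookup f w) \<in> FF"
        using f insert.prems by (intro single) (auto simp: yh_free_eq F.FA_iff)
      then show ?case using insert add by (simp add: quot_add quot_closed FF_closed)
    qed
    from this[of "Poly_Mapping.keys f"] show ?thesis
      using poly_mapping_sum_single[of f] by simp
  qed
  show ?thesis
    using a[unfolded A_eq]
  proof (induction rule: E.E_induct)
    case (pt c x)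
    obtain f where f: "f \<in> FF" "x = Y.cl f" using pt(2) unfolding YH_eq Y.carrier_Q by (elim imageE)
    have "E.pt c x = c \<odot>\<^bsub>A\<^esub> quot f"
      unfolding quot_def A_eq f(2) by (subst E.pt_smult) (simp_all add: pt(1) Fm_closed cl_YH f)
    then show ?case using smult[OF pt(1) quot_closed[OF f(1)] all[OF f(1)]] by simp
  next
    case (minus u v)
    have uv: "u \<in> carrier A" "v \<in> carrier A" using minus by (simp_all add: A_eq)
    have "u \<ominus>\<^bsub>A\<^esub> v = u \<oplus>\<^bsub>A\<^esub> (- 1) \<odot>\<^bsub>A\<^esub> v"
    proof -
      have "v \<oplus>\<^bsub>A\<^esub> (- 1) \<odot>\<^bsub>A\<^esub> v = (1 + (- 1)) \<odot>\<^bsub>A\<^esub> v"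
        using A.smult_l_distr[of 1 "- 1" v] A.smult_one[of v] uv by (simp add: Fm_closed)
      then have "v \<oplus>\<^bsub>A\<^esub> (- 1) \<odot>\<^bsub>A\<^esub> v = \<zero>\<^bsub>A\<^esub>" using A.smult_l_null[of v] uv by simp
      then have "\<ominus>\<^bsub>A\<^esub> v = (- 1) \<odot>\<^bsub>A\<^esub> v"
        using uv A.add.inv_equality A.add.m_comm by (metis A.minus_equality A.smult_closed Fm_closed(2,4))
      then show ?thesis by (simp add: a_minus_def)
    qed
    then show ?case
      using add[OF uv(1) A.smult_closed[of "- 1" v]] smult[of "- 1" v] uv minus
      by (simp add: Fm_closed A_eq)
  qed
qed

end

section \<open>The seminormal representations\<close>

lemma Vspace_simps [simp]:
  "add (Vspace m n \<Lambda>) = (\<lambda>f g t. f t + g t)" "\<zero>\<^bsub>Vspace m n \<Lambda>\<^esub> = (\<lambda>t. 0)"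
  "smult (Vspace m n \<Lambda>) = (\<lambda>c f t. c * f t)"
  by (simp_all add: Vspace_def)

context shape
begin

sublocale yh d m n .

abbreviation V where "V \<equiv> Vspace m n \<Lambda>"

lemma carrier_V: "f \<in> carrier V \<longleftrightarrow> (\<forall>t. f t \<in> carrier (Fm m)) \<and> f \<in> Vc"
  by (simp add: Vspace_def Vc_def)

lemma V_closed:
  "(\<lambda>t. 0) \<in> carrier V" "f \<in> carrier V \<Longrightarrow> g \<in> carrier V \<Longrightarrow> (\<lambda>t. f t + g t) \<in> carrier V"
  "c \<in> carrier (Fm m) \<Longrightarrow> f \<in> carrier V \<Longrightarrow> (\<lambda>t. c * f t) \<in> carrier V"
  by (auto simp: carrier_V Vc_def Fm_closed)

lemma V_sum: "(\<And>i. i \<in> B \<Longrightarrow> f i \<in> carrier V) \<Longrightarrow> (\<lambda>t. \<Sum>i\<in>B. f i t) \<in> carrier V"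
  by (induction B rule: infinite_finite_induct) (auto intro: V_closed)

lemma module_V: "module (Fm m) V"
proof (rule moduleI[OF cring_Fm])
  show "abelian_group V"
    by (rule abelian_groupI)
      (auto simp: V_closed algebra_simps fun_eq_iff intro!: bexI[of _ "\<lambda>t. - 1 * x t" for x] V_closed(3) Fm_closed)
qed (auto simp: V_closed algebra_simps)

section \<open>The action of words, of the quotient and of the tensor product\<close>

definition Xinv_op :: "vect \<Rightarrow> vect" where
  "Xinv_op f S = inverse (node_content (S 1)) * f S"

fun gen_op :: "gen \<Rightarrow> vect \<Rightarrow> vect" where
  "gen_op (Tgen j) = Top j"
| "gen_op (Ggen i) = Gop i"
| "gen_op Xgen = Dop 1"
| "gen_op Xinvgen = Xinv_op"

lemma gen_op_linear:
  "gen_op x (\<lambda>t. u t + v t) = (\<lambda>t. gen_op x u t + gen_op x v t)"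
  "gen_op x (\<lambda>t. c * v t) = (\<lambda>t. c * gen_op x v t)"
  by (cases x; simp add: fun_eq_iff Top_def Gop_def Dop_def Xinv_op_def algebra_simps)+

lemma root_closed: "root \<alpha> \<in> carrier (Fm m)"
  by (simp add: root_def to_Fm_closed)

lemma gen_op_closed:
  assumes "x \<in> yh_gens n" "f \<in> carrier V"
  shows "gen_op x f \<in> carrier V"
proof -
  have f0: "f t = 0" if "t \<notin> St" for t using assms(2) that by (simp add: carrier_V Vc_zero)
  have c: "node_content (S 1) \<in> carrier (Fm m)" if "S \<in> St" for S
    using St_valid[OF that, of 1] n_pos by (intro node_content_closed) auto
  have "Dop 1 f t \<in> carrier (Fm m)" "Xinv_op f t \<in> carrier (Fm m)" for t
    using assms(2) c[of t] f0[of t] by (cases "t \<in> St"; auto simp: carrier_V Dop_def Xinv_op_def intro!: Fm_closed)+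
  moreover have "Gop i f t \<in> carrier (Fm m)" if "1 \<le> i" "i < n" for i t
    using assms(2) St_valid[of t] that
    by (auto simp: Gop_def carrier_V intro!: Fm_closed coeff_closed[of d m])
  moreover have "Top j f t \<in> carrier (Fm m)" for j t
    using assms(2) by (simp add: Top_def carrier_V Fm_closed root_closed)
  ultimately show ?thesis
    using assms by (cases x) (auto simp: carrier_V yh_gens_def ops_Vc, auto simp: Vc_def Xinv_op_def)
qed

definition word_op :: "gen word \<Rightarrow> vect \<Rightarrow> vect" where
  "word_op w = foldr gen_op (letters w)"

lemma word_op_simps: "word_op 0 v = v" "word_op (u + w) v = word_op u (word_op w v)" "word_op (Word [x]) v = gen_op x v"
  by (simp_all add: word_op_def zero_word_def plus_word_def)

lemma word_op_linear:
  "word_op w (\<lambda>t. u t + v t) = (\<lambda>t. word_op w u t + word_op w v t)"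
  "word_op w (\<lambda>t. c * v t) = (\<lambda>t. c * word_op w v t)"
proof -
  have "foldr gen_op xs (\<lambda>t. u t + v t) = (\<lambda>t. foldr gen_op xs u t + foldr gen_op xs v t)
      \<and> foldr gen_op xs (\<lambda>t. c * v t) = (\<lambda>t. c * foldr gen_op xs v t)" for xs
    by (induction xs) (simp_all add: gen_op_linear)
  then show "word_op w (\<lambda>t. u t + v t) = (\<lambda>t. word_op w u t + word_op w v t)"
    "word_op w (\<lambda>t. c * v t) = (\<lambda>t. c * word_op w v t)" by (simp_all add: word_op_def)
qed

lemma word_op_sum: "word_op w (\<lambda>t. \<Sum>i\<in>B. u i t) = (\<lambda>t. \<Sum>i\<in>B. word_op w (u i) t)"
proof (induction B rule: infinite_finite_induct)
  case (insert x F)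
  then show ?case by (simp add: word_op_linear)
qed (use word_op_linear(2)[of w 0] in simp_all)

definition pre_act :: "pre_elt \<Rightarrow> vect \<Rightarrow> vect" where
  "pre_act f v = (\<lambda>t. \<Sum>w\<in>Poly_Mapping.keys f. to_Fm (Poly_Mapping.lookup f w) * word_op w v t)"

lemma pre_act_superset:
  assumes "finite B" "Poly_Mapping.keys f \<subseteq> B"
  shows "pre_act f v t = (\<Sum>w\<in>B. to_Fm (Poly_Mapping.lookup f w) * word_op w v t)"
  unfolding pre_act_def
  by (rule sum.mono_neutral_left) (use assms in \<open>auto simp: not_in_keys_iff_lookup_eq_zero\<close>)

lemma pre_act_add: "pre_act (f + g) v = (\<lambda>t. pre_act f v t + pre_act g v t)"
proof
  fix t
  let ?B = "Poly_Mapping.keys f \<union> Poly_Mapping.keys g"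
  show "pre_act (f + g) v t = pre_act f v t + pre_act g v t"
    using keys_add[of f g]
    by (simp add: pre_act_superset[of ?B] lookup_add sum.distrib distrib_right)
qed

lemma pre_act_diff: "pre_act (f - g) v = (\<lambda>t. pre_act f v t - pre_act g v t)"
  using pre_act_add[of "f - g" g v] by (simp add: fun_eq_iff)

lemma pre_act_zero: "pre_act 0 v = (\<lambda>t. 0)"
  by (simp add: pre_act_def)

lemma pre_act_single: "pre_act (Poly_Mapping.single w c) v = (\<lambda>t. to_Fm c * word_op w v t)"
  by (simp add: pre_act_def)

lemma pre_act_sum: "pre_act (\<Sum>i\<in>B. f i) v = (\<lambda>t. \<Sum>i\<in>B. pre_act (f i) v t)"
  by (induction B rule: infinite_finite_induct) (simp_all add: pre_act_add pre_act_zero)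

lemma pre_act_linear:
  "pre_act f (\<lambda>t. u t + v t) = (\<lambda>t. pre_act f u t + pre_act f v t)"
  "pre_act f (\<lambda>t. c * v t) = (\<lambda>t. c * pre_act f v t)"
  by (simp_all add: pre_act_def word_op_linear distrib_left sum.distrib sum_distrib_left mult_ac)

lemma pre_act_mult: "pre_act (f * g) v = pre_act f (pre_act g v)"
proof -
  have "f * g = (\<Sum>k\<in>Poly_Mapping.keys f. \<Sum>l\<in>Poly_Mapping.keys g.
      Poly_Mapping.single (k + l) (Poly_Mapping.lookup f k * Poly_Mapping.lookup g l))"
    by (subst poly_mapping_sum_single[of f], subst poly_mapping_sum_single[of g])
      (simp add: sum_product mult_single)
  then show ?thesis
    by (simp add: pre_act_sum pre_act_single word_op_simps pre_act_def[of f] pre_act_def[of g] word_op_sum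
        word_op_linear sum_distrib_left mult_ac)
qed

lemma pre_act_letter: "pre_act (letter x) v = gen_op x v"
  by (simp add: letter_def pre_act_single word_op_simps)

lemma pre_act_scalar: "pre_act (scalar c) v = (\<lambda>t. to_Fm c * v t)"
  by (simp add: scalar_def pre_act_single word_op_simps)

lemma pre_act_one: "pre_act 1 v = v"
  using pre_act_scalar[of 1 v] by simp

lemma pre_act_power_diag:
  assumes "\<And>v. pre_act f v = (\<lambda>t. e t * v t)"
  shows "pre_act (f ^ k) v = (\<lambda>t. e t ^ k * v t)"
  by (induction k) (simp_all add: pre_act_one pre_act_mult assms mult_ac)

lemmas pre_act_simps = pre_act_add pre_act_diff pre_act_mult pre_act_scalar pre_act_one pre_act_letter

lemma pre_act_closed: "f \<in> FF \<Longrightarrow> v \<in> carrier V \<Longrightarrow> pre_act f v \<in> carrier V"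
proof -
  assume f: "f \<in> FF" and v: "v \<in> carrier V"
  have "foldr gen_op xs v \<in> carrier V" if "set xs \<subseteq> yh_gens n" for xs
    using that by (induction xs) (auto intro: gen_op_closed v)
  then have "word_op w v \<in> carrier V" if "w \<in> Poly_Mapping.keys f" for w
    using that f by (auto simp: word_op_def yh_free_eq F.FA_iff)
  then show ?thesis
    unfolding pre_act_def using f by (intro V_sum V_closed to_Fm_closed) (auto simp: yh_free_eq F.FA_iff)
qed

lemma pre_act_gens:
  "pre_act xx v = Dop 1 v" "pre_act xx_inv v = Xinv_op v" "pre_act (tt j) v = Top j v" "pre_act (gg i) v = Gop i v"
  by (simp_all add: xx_def xx_inv_def tt_def gg_def pre_act_letter)

lemma \<xi>_root: "k \<in> {1..d} \<Longrightarrow> \<xi> k ^ d = 1"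
  using \<xi> by (auto simp: bij_betw_def)

lemma \<xi>_eq_iff: "k \<in> {1..d} \<Longrightarrow> k' \<in> {1..d} \<Longrightarrow> \<xi> k = \<xi> k' \<longleftrightarrow> k = k'"
  by (rule inj_on_eq_iff[OF bij_betw_imp_inj_on[OF \<xi>]])

text \<open>Orthogonality of roots of unity, applied to the eigenvalues of t_i and t_(i+1) at each
  standard tableau.\<close>

lemma pre_act_ee:
  assumes "v \<in> Vc" "1 \<le> i" "i < n"
  shows "pre_act (ee d i) v S = (if node_pos (S i) = node_pos (S (Suc i)) then v S else 0)"
proof (cases "S \<in> St")
  case True
  have t: "pre_act (tt j ^ k) u = (\<lambda>S. root (S j) ^ k * u S)" for j k u
    by (rule pre_act_power_diag) (simp add: pre_act_gens Top_def fun_eq_iff)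
  then have "pre_act ((tt j ^ k) ^ s) u = (\<lambda>S. (root (S j) ^ k) ^ s * u S)" for j k s u
    by (rule pre_act_power_diag)
  then have "pre_act (ee d i) v S = to_Fm (const (1 / of_nat d)) *
      (\<Sum>s<d. root (S i) ^ s * (root (S (Suc i)) ^ (d - 1)) ^ s) * v S"
    by (simp add: ee_def pre_act_mult pre_act_scalar pre_act_sum t sum_distrib_left sum_distrib_right mult_ac)
  also have "\<dots> = to_Fm (const (1 / of_nat d *
      (\<Sum>s<d. \<xi> (node_pos (S i)) ^ s * (\<xi> (node_pos (S (Suc i))) ^ (d - 1)) ^ s))) * v S"
    by (simp only: root_def const_simps const_sum const_power to_Fm_sum to_Fm_power to_Fm_simps)
  also have "\<dots> = (if node_pos (S i) = node_pos (S (Suc i)) then v S else 0)"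
  proof -
    have "node_pos (S j) \<in> {1..d}" if "1 \<le> j" "j \<le> n" for j
      using St_valid[OF True that] by (simp add: valid_node_def node_pos_eq)
    then show ?thesis
      using assms(2,3) by (subst root_of_unity_sum[OF d_pos]) (simp_all add: \<xi>_root \<xi>_eq_iff const_simps)
  qed
  finally show ?thesis .
next
  case False
  have vz: "v \<in> Vc \<Longrightarrow> pre_act (tt j ^ k) v \<in> Vc" for j k v
    by (subst pre_act_power_diag[of "tt j" "\<lambda>S. root (S j)"])
      (auto simp: pre_act_gens Top_def fun_eq_iff Vc_def)
  have "pre_act ((tt j ^ k) ^ s) u = (\<lambda>S. (root (S j) ^ k) ^ s * u S)" for j k s u
    by (rule pre_act_power_diag, rule pre_act_power_diag) (simp add: pre_act_gens Top_def fun_eq_iff)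
  moreover have "pre_act (tt j ^ k) u = (\<lambda>S. root (S j) ^ k * u S)" for j k u
    by (rule pre_act_power_diag) (simp add: pre_act_gens Top_def fun_eq_iff)
  ultimately show ?thesis using False assms(1)
    by (simp add: ee_def pre_act_mult pre_act_scalar pre_act_sum Vc_zero)
qed

text \<open>The entry 1 sits in a corner (1, 1), whose content is some v_l; this is the cyclotomic
  relation.\<close>

lemma first_node_content:
  assumes "S \<in> St"
  obtains l where "l \<in> {1..m}" "node_content (S 1) = vF l"
proof -
  have a: "addable d m {} (S 1)" using std_seq_addable[OF St_std[OF assms], of 1] n_pos by simp
  have v: "valid_node d m (S 1)" using addableD(1)[OF a] .
  have "row (S 1) = 1"
    using addableD(3)[OF a, of "((row (S 1) - 1, col (S 1)), snd (S 1))"] v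
    by (force simp: valid_node_def covers_def)
  moreover have "col (S 1) = 1"
    using addableD(3)[OF a, of "((row (S 1), col (S 1) - 1), snd (S 1))"] v
    by (force simp: valid_node_def covers_def)
  ultimately have "node_content (S 1) = vF (snd (snd (S 1)))"
    by (simp add: node_content_eq diag_def)
  then show thesis using that v by (auto simp: valid_node_def)
qed

lemma relators_act:
  assumes r: "r \<in> yh_relators d m n" and v: "v \<in> carrier V"
  shows "pre_act r v = (\<lambda>t. 0)"
proof -
  have vc: "v \<in> Vc" using v by (simp add: carrier_V)
  have xxv: "pre_act (xx * xx_inv - 1) v = (\<lambda>t. 0)" "pre_act (xx_inv * xx - 1) v = (\<lambda>t. 0)"
    by (simp_all add: pre_act_simps pre_act_gens Dop_def Xinv_op_def fun_eq_iff)
  have far: "Gop i (Gop j v) = Gop j (Gop i v)" if "i \<in> {1..n - 1}" "j \<in> {1..n - 1}" "\<bar>int i - int j\<bar> > 1" for i j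
    using Gop_far[OF vc, of i j] Gop_far[OF vc, of j i] that by (cases "i < j") auto
  \<comment> \<open>Both sides are products of the two diagonal operators \<open>Dop 1\<close> and
    \<open>Dop 2\<close>, the latter in the form g_1 X_1 g_1.\<close>
  have "Gop 1 (Dop 1 (Gop 1 (Dop 1 v))) = Dop 1 (Gop 1 (Dop 1 (Gop 1 v)))" if "n \<ge> 2"
    using Gop_Dop_Gop[OF ops_Vc(2)[OF vc], of 1] Gop_Dop_Gop[OF vc, of 1] that
    by (simp add: Dop_def fun_eq_iff)
  moreover have "pre_act (gg i ^ 2 - (1 + q_diff * ee d i * gg i)) v = (\<lambda>t. 0)" if "i \<in> {1..n - 1}" for i
  proof
    fix t
    have "pre_act (ee d i) (Gop i v) t = (if node_pos (t i) = node_pos (t (Suc i)) then Gop i v t else 0)"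
      using that by (intro pre_act_ee ops_Vc) auto
    then show "pre_act (gg i ^ 2 - (1 + q_diff * ee d i * gg i)) v t = 0"
      using Gop_quadratic[OF vc, of i t] that
      by (auto simp: pre_act_simps pre_act_gens power2_eq_square q_diff_def qF_def[symmetric] inverse_qF[symmetric])
  qed
  moreover have "pre_act (tt j ^ d - 1) v = (\<lambda>t. 0)" if "j \<in> {1..n}" for j
  proof
    fix t
    have "root (t j) ^ d = 1" if "t \<in> St"
      using St_valid[OF that, of j] \<open>j \<in> _\<close> \<xi>_root[of "node_pos (t j)"]
      by (simp add: root_def to_Fm_power[symmetric] const_power[symmetric] const_simps valid_node_def node_pos_eq)
    then show "pre_act (tt j ^ d - 1) v t = 0"
      using pre_act_power_diag[of "tt j" "\<lambda>S. root (S j)" d v] Vc_zero[OF vc, of t]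
      by (cases "t \<in> St") (auto simp: pre_act_diff pre_act_one pre_act_gens Top_def fun_eq_iff)
  qed
  moreover have "pre_act (prod_list (map (\<lambda>l. xx - scalar (indet_pow l 1)) [1..<m + 1])) v = (\<lambda>t. 0)"
  proof
    fix t
    have "pre_act (prod_list (map (\<lambda>l. xx - scalar (indet_pow l 1)) ls)) u
        = (\<lambda>t. prod_list (map (\<lambda>l. node_content (t 1) - vF l) ls) * u t)" for ls u
      by (induction ls) (simp_all add: pre_act_simps pre_act_gens Dop_def vF_def algebra_simps fun_eq_iff)
    moreover have "prod_list (map (\<lambda>l. node_content (t 1) - vF l) [1..<m + 1]) = 0" if tS: "t \<in> St"
    proof -
      obtain l where "l \<in> {1..m}" "node_content (t 1) = vF l" using first_node_content[OF tS] .
      then have "0 \<in> set (map (\<lambda>l. node_content (t 1) - vF l) [1..<m + 1])"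
        by (auto simp del: upt_Suc intro!: image_eqI[of _ _ l])
      then show ?thesis unfolding prod_list_zero_iff .
    qed
    ultimately show "pre_act (prod_list (map (\<lambda>l. xx - scalar (indet_pow l 1)) [1..<m + 1])) v t = 0"
      using Vc_zero[OF vc, of t] by (cases "t \<in> St") simp_all
  qed
  moreover have "Gop i (Gop (Suc i) (Gop i v)) = Gop (Suc i) (Gop i (Gop (Suc i) v))"
    if "i \<in> {1..n - 1}" "i + 1 \<in> {1..n - 1}" for i
    using that by (intro Gop_braid vc) auto
  moreover have "Top j (Gop i v) = Gop i (Top (swap i j) v)" if "i \<in> {1..n - 1}" for i j
    using that by (intro Top_Gop) auto
  moreover have "Dop 1 (Gop i v) = Gop i (Dop 1 v)" if "i \<ge> 2" for i
    using that by (intro Dop_Gop) auto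
  moreover have "Top i (Top j v) = Top j (Top i v)" "Dop 1 (Top j v) = Top j (Dop 1 v)" for i j
    by (simp_all add: Top_def Dop_def fun_eq_iff)
  ultimately show ?thesis
    using r xxv far unfolding yh_relators_def
    by (elim UnE) (auto simp: pre_act_simps(2,3) pre_act_gens fun_eq_iff split: if_splits)
qed

text \<open>The polynomials acting as zero on V form a two-sided ideal, because V is stable under
  all of them, and it contains the relators.\<close>

lemma ideal_act:
  assumes "f \<in> yh_ideal d m n" "v \<in> carrier V"
  shows "pre_act f v = (\<lambda>t. 0)"
proof -
  define N where "N = {f \<in> FF. \<forall>v\<in>carrier V. pre_act f v = (\<lambda>t. 0)}"
  have lin0: "pre_act f (\<lambda>t. 0) = (\<lambda>t. 0)" for f
    using pre_act_linear(2)[of f 0] by simp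
  have "ideal N (yh_free m n)"
  proof (rule idealI[OF FR.ring_axioms])
    show "subgroup N (add_monoid (yh_free m n))"
    proof (rule FR.add.subgroupI)
      show "N \<subseteq> carrier (yh_free m n)" "N \<noteq> {}"
        using FF_closed(1) by (auto simp: N_def pre_act_zero intro!: exI[of _ 0])
      show "\<ominus>\<^bsub>yh_free m n\<^esub> f \<in> N" if "f \<in> N" for f
        using that pre_act_diff[of 0 f] FF_closed(4)[OF FF_closed(1), of f] F.FA_a_inv[of f]
        by (simp add: N_def yh_free_eq pre_act_zero)
      show "f \<oplus>\<^bsub>yh_free m n\<^esub> g \<in> N" if "f \<in> N" "g \<in> N" for f g
        using that FF_closed(3)[of f g] by (simp add: N_def yh_free_eq pre_act_add)
    qed
    show "g \<otimes>\<^bsub>yh_free m n\<^esub> f \<in> N" "f \<otimes>\<^bsub>yh_free m n\<^esub> g \<in> N" if "f \<in> N" "g \<in> carrier (yh_free m n)" for f g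
      using that FF_closed(5)[of f g] FF_closed(5)[of g f] pre_act_closed[of g]
      by (auto simp: N_def yh_free_eq pre_act_mult lin0)
  qed
  moreover have "yh_relators d m n \<subseteq> N" using relators_FF relators_act by (auto simp: N_def)
  ultimately have "yh_ideal d m n \<subseteq> N" unfolding yh_ideal_def by (rule FR.genideal_minimal)
  then show ?thesis using assms by (auto simp: N_def)
qed

text \<open>A representative of the coset is chosen; \<open>act1_cl\<close> shows that the choice
  does not matter. The same device reappears for \<open>rho\<close>.\<close>

definition act1 :: "pre_elt set \<Rightarrow> vect \<Rightarrow> vect" where
  "act1 C v = pre_act (SOME f. f \<in> FF \<and> C = Y.cl f) v"

lemma act1_cl:
  assumes "f \<in> FF" "v \<in> carrier V"
  shows "act1 (Y.cl f) v = pre_act f v"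
proof -
  define g where "g = (SOME g. g \<in> FF \<and> Y.cl f = Y.cl g)"
  have g: "g \<in> FF \<and> Y.cl f = Y.cl g"
    unfolding g_def by (rule someI[of _ f]) (simp add: assms)
  then have "g - f \<in> yh_ideal d m n"
    using Y.cl_eqD[of g f] F.FA_minus[of g f] assms(1) by (simp add: yh_free_eq)
  then have "pre_act g v = pre_act f v"
    using ideal_act[of "g - f" v] assms(2) by (simp add: pre_act_diff fun_eq_iff)
  then show ?thesis by (simp add: act1_def g_def)
qed

lemma YH_cases:
  assumes "C \<in> carrier (YH d m n)"
  obtains f where "f \<in> FF" "C = Y.cl f"
  using assms unfolding YH_eq Y.carrier_Q by (elim imageE)

lemma act1_closed: "C \<in> carrier (YH d m n) \<Longrightarrow> v \<in> carrier V \<Longrightarrow> act1 C v \<in> carrier V"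
  by (elim YH_cases) (simp add: act1_cl pre_act_closed)

lemma act1_add:
  assumes "C \<in> carrier (YH d m n)" "D \<in> carrier (YH d m n)" "v \<in> carrier V"
  shows "act1 (C \<oplus>\<^bsub>YH d m n\<^esub> D) v = (\<lambda>t. act1 C v t + act1 D v t)"
proof -
  obtain f g where fg: "f \<in> FF" "C = Y.cl f" "g \<in> FF" "D = Y.cl g" using assms YH_cases by metis
  then have "C \<oplus>\<^bsub>YH d m n\<^esub> D = Y.cl (f + g)" unfolding YH_eq using Y.cl_add[of f g] by (simp add: yh_free_eq)
  then show ?thesis using fg assms by (simp add: act1_cl pre_act_add FF_closed)
qed

lemma act1_mult:
  assumes "C \<in> carrier (YH d m n)" "D \<in> carrier (YH d m n)" "v \<in> carrier V"
  shows "act1 (C \<otimes>\<^bsub>YH d m n\<^esub> D) v = act1 C (act1 D v)"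
proof -
  obtain f g where fg: "f \<in> FF" "C = Y.cl f" "g \<in> FF" "D = Y.cl g" using assms YH_cases by metis
  then have "C \<otimes>\<^bsub>YH d m n\<^esub> D = Y.cl (f * g)" unfolding YH_eq using Y.cl_mult[of f g] by (simp add: yh_free_eq)
  then show ?thesis using fg assms by (simp add: act1_cl pre_act_mult FF_closed pre_act_closed)
qed

lemma act1_smult:
  assumes "c \<in> carrier (Rm m)" "C \<in> carrier (YH d m n)" "v \<in> carrier V"
  shows "act1 (c \<odot>\<^bsub>YH d m n\<^esub> C) v = (\<lambda>t. to_Fm c * act1 C v t)"
proof -
  obtain f where f: "f \<in> FF" "C = Y.cl f" using assms YH_cases by metis
  then have "c \<odot>\<^bsub>YH d m n\<^esub> C = Y.cl (scalar c * f)"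
    unfolding YH_eq using assms(1) Y.cl_smult[of c f] by (simp add: yh_free_eq)
  then show ?thesis using f assms by (simp add: act1_cl pre_act_mult pre_act_scalar FF_closed)
qed

lemma act1_one: "v \<in> carrier V \<Longrightarrow> act1 \<one>\<^bsub>YH d m n\<^esub> v = v"
proof -
  assume "v \<in> carrier V"
  moreover have "\<one>\<^bsub>YH d m n\<^esub> = Y.cl 1" unfolding YH_eq Y.Q_simps by (simp add: yh_free_eq)
  ultimately show ?thesis by (simp add: act1_cl pre_act_one FF_closed)
qed

lemma act1_linear:
  assumes "C \<in> carrier (YH d m n)" "u \<in> carrier V" "v \<in> carrier V" "c \<in> carrier (Fm m)"
  shows "act1 C (\<lambda>t. u t + v t) = (\<lambda>t. act1 C u t + act1 C v t)"
    "act1 C (\<lambda>t. c * v t) = (\<lambda>t. c * act1 C v t)"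
proof -
  obtain f where f: "f \<in> FF" "C = Y.cl f" using assms YH_cases by metis
  show "act1 C (\<lambda>t. u t + v t) = (\<lambda>t. act1 C u t + act1 C v t)"
    "act1 C (\<lambda>t. c * v t) = (\<lambda>t. c * act1 C v t)"
    using f assms by (simp_all add: act1_cl V_closed pre_act_linear)
qed

lemma act1_diff:
  assumes "C \<in> carrier (YH d m n)" "u \<in> carrier V" "v \<in> carrier V"
  shows "act1 C (\<lambda>t. u t - v t) = (\<lambda>t. act1 C u t - act1 C v t)"
proof -
  have m: "- 1 \<in> carrier (Fm m)" by (intro Fm_closed)
  then have "(\<lambda>t. - 1 * v t) \<in> carrier V" using assms by (intro V_closed)
  from act1_linear(1)[OF assms(1,2) this m, unfolded act1_linear(2)[OF assms(1,3,3) m]]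
  show ?thesis by simp
qed

definition act2 :: "(laurent fract \<times> pre_elt set \<Rightarrow>\<^sub>0 int) \<Rightarrow> vect \<Rightarrow> vect" where
  "act2 z v = (\<lambda>t. \<Sum>p\<in>Poly_Mapping.keys z. of_int (Poly_Mapping.lookup z p) * (fst p * act1 (snd p) v t))"

lemma act2_superset:
  assumes "finite B" "Poly_Mapping.keys f \<subseteq> B"
  shows "act2 f v t = (\<Sum>p\<in>B. of_int (Poly_Mapping.lookup f p) * (fst p * act1 (snd p) v t))"
  unfolding act2_def
  by (rule sum.mono_neutral_left) (use assms in \<open>auto simp: not_in_keys_iff_lookup_eq_zero\<close>)

lemma act2_add: "act2 (f + g) v = (\<lambda>t. act2 f v t + act2 g v t)"
proof
  fix t
  let ?B = "Poly_Mapping.keys f \<union> Poly_Mapping.keys g"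
  show "act2 (f + g) v t = act2 f v t + act2 g v t"
    using keys_add[of f g]
    by (simp add: act2_superset[of ?B] lookup_add sum.distrib distrib_right)
qed

lemma act2_diff: "act2 (f - g) v = (\<lambda>t. act2 f v t - act2 g v t)"
  using act2_add[of "f - g" g v] by (simp add: fun_eq_iff)

lemma act2_zero: "act2 0 v = (\<lambda>t. 0)"
  by (simp add: act2_def)

lemma act2_frag_of: "act2 (frag_of (a, C)) v = (\<lambda>t. a * act1 C v t)"
  by (simp add: act2_def)

abbreviation PC where "PC \<equiv> carrier E.PR"

lemma PC_induct [consumes 1, case_names zero one diff]:
  assumes "z \<in> PC" "P 0"
    "\<And>a C. a \<in> carrier (Fm m) \<Longrightarrow> C \<in> carrier (YH d m n) \<Longrightarrow> P (frag_of (a, C))"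
    "\<And>u v. u \<in> PC \<Longrightarrow> v \<in> PC \<Longrightarrow> P u \<Longrightarrow> P v \<Longrightarrow> P (u - v)"
  shows "P z"
proof -
  have "z \<in> PC \<and> P z"
    using assms(1)[unfolded E.PR_simps mem_Collect_eq]
  proof (rule frag_induction)
    show "u - v \<in> PC \<and> P (u - v)" if "u \<in> PC \<and> P u" "v \<in> PC \<and> P v" for u v
      using that assms(4) E.PR_diff[of u v] by blast
    show "frag_of x \<in> PC \<and> P (frag_of x)" if "x \<in> carrier (Fm m) \<times> carrier (YH d m n)" for x
      using that assms(3) E.frag_of_PR by auto
  qed (use assms(2) in auto)
  then show ?thesis by simp
qed

lemma act2_closed: "z \<in> PC \<Longrightarrow> v \<in> carrier V \<Longrightarrow> act2 z v \<in> carrier V"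
proof (induction z rule: PC_induct)
  case (diff u w)
  then have "(\<lambda>t. act2 u v t + (- 1) * act2 w v t) \<in> carrier V" by (intro V_closed Fm_closed) auto
  then show ?case by (simp add: act2_diff)
qed (auto simp: act2_zero act2_frag_of intro!: V_closed act1_closed)

lemma act2_linear:
  assumes "z \<in> PC" "u \<in> carrier V" "v \<in> carrier V" "c \<in> carrier (Fm m)"
  shows "act2 z (\<lambda>t. u t + v t) = (\<lambda>t. act2 z u t + act2 z v t)"
    "act2 z (\<lambda>t. c * v t) = (\<lambda>t. c * act2 z v t)"
  using assms(1)
  by (induction z rule: PC_induct)
    (simp_all add: act2_zero act2_frag_of act2_diff act1_linear(1)[OF _ assms(2-4)]
      act1_linear(2)[OF _ assms(3,3,4)] algebra_simps)

lemma act2_mult: "z \<in> PC \<Longrightarrow> w \<in> PC \<Longrightarrow> v \<in> carrier V \<Longrightarrow> act2 (E.pm z w) v = act2 z (act2 w v)"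
proof (induction z rule: PC_induct)
  case (one a C)
  from one(3) show ?case
  proof (induction w rule: PC_induct)
    case zero
    have "act1 C (\<lambda>t. 0) = (\<lambda>t. 0)"
      using act1_linear(2)[OF one(2) one(4) one(4), of 0] by (simp add: Fm_closed)
    then show ?case by (simp add: E.pm_simps act2_zero act2_frag_of)
  next
    case (one b D)
    then show ?case using \<open>a \<in> _\<close> \<open>C \<in> _\<close> \<open>v \<in> _\<close>
      by (simp add: E.pm_simps act2_frag_of act1_mult act1_linear[OF _ _ act1_closed] act1_closed mult_ac)
  next
    case (diff u w)
    have e: "E.pm (frag_of (a, C)) (u - w) = E.pm (frag_of (a, C)) u - E.pm (frag_of (a, C)) w"
      by (rule E.pm_diff_right)
    show ?case using diff \<open>C \<in> _\<close> \<open>v \<in> _\<close> unfolding e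
      by (simp add: act2_diff act2_frag_of act1_diff act2_closed right_diff_distrib del: E.PR_simps)
  qed
qed (simp_all add: E.pm_simps act2_zero act2_diff)

end

context shape
begin

lemma relators2_act:
  assumes "z \<in> tensor_relators (Rm m) (Fm m) to_Fm (YH d m n)" "v \<in> carrier V"
  shows "act2 z v = (\<lambda>t. 0)"
  using assms unfolding tensor_relators_def
  by (auto simp: act2_diff act2_frag_of act1_add act1_smult fun_eq_iff distrib_left distrib_right mult.assoc)

lemma ideal2_act:
  assumes "z \<in> E.TI" "v \<in> carrier V"
  shows "act2 z v = (\<lambda>t. 0)"
proof -
  define N where "N = {z \<in> PC. \<forall>v\<in>carrier V. act2 z v = (\<lambda>t. 0)}"
  have lin0: "act2 z (\<lambda>t. 0) = (\<lambda>t. 0)" if "z \<in> PC" for z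
    using act2_linear(2)[OF that V_closed(1,1) Fm_closed(1)] by simp
  have "ideal N E.PR"
  proof (rule idealI[OF E.ring_PR])
    show "subgroup N (add_monoid E.PR)"
    proof (rule E.PR.add.subgroupI)
      show "N \<subseteq> PC" by (auto simp: N_def)
      have "0 \<in> N" using E.PR.zero_closed by (simp add: N_def act2_zero)
      then show "N \<noteq> {}" by blast
      show "\<ominus>\<^bsub>E.PR\<^esub> f \<in> N" if "f \<in> N" for f
      proof -
        have f: "f \<in> PC" using that by (simp add: N_def)
        have "0 - f \<in> PC" using E.PR_diff[OF E.PR.zero_closed f] unfolding E.PR_simps(4) .
        then show ?thesis
          using that act2_diff[of 0 f] unfolding E.PR_a_inv[OF f] by (simp add: N_def act2_zero del: E.PR_simps)
      qed
      show "f \<oplus>\<^bsub>E.PR\<^esub> g \<in> N" if "f \<in> N" "g \<in> N" for f g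
        using that E.PR.add.m_closed[of f g] by (simp add: N_def act2_add)
    qed
    show "g \<otimes>\<^bsub>E.PR\<^esub> f \<in> N" "f \<otimes>\<^bsub>E.PR\<^esub> g \<in> N" if "f \<in> N" "g \<in> carrier E.PR" for f g
      using that E.pm_closed[of f g] E.pm_closed[of g f] act2_closed[of g]
      by (auto simp: N_def act2_mult lin0 simp del: E.PR_simps(6))
  qed
  moreover have "tensor_relators (Rm m) (Fm m) to_Fm (YH d m n) \<subseteq> N"
    using E.relators_subset relators2_act unfolding N_def by blast
  ultimately have "E.TI \<subseteq> N" unfolding tensor_ideal_def by (rule E.PR.genideal_minimal)
  then show ?thesis using assms by (auto simp: N_def)
qed

definition rho :: "yh_elt \<Rightarrow> vect \<Rightarrow> vect" where
  "rho D v = act2 (SOME z. z \<in> PC \<and> D = E.Q.cl z) v"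

lemma rho_cl:
  assumes "z \<in> PC" "v \<in> carrier V"
  shows "rho (E.Q.cl z) v = act2 z v"
proof -
  define w where "w = (SOME w. w \<in> PC \<and> E.Q.cl z = E.Q.cl w)"
  have w: "w \<in> PC \<and> E.Q.cl z = E.Q.cl w"
    unfolding w_def by (rule someI[of _ z]) (use assms in blast)
  then have "w - z \<in> E.TI"
    using E.Q.cl_eqD[of w z] E.PR_minus[of w z] assms(1) by simp
  then have "act2 w v = act2 z v"
    using ideal2_act[of "w - z" v] assms(2) by (simp add: act2_diff fun_eq_iff)
  then show ?thesis by (simp add: rho_def w_def)
qed

lemma A_cases:
  assumes "D \<in> carrier A"
  obtains z where "z \<in> PC" "D = E.Q.cl z"
  using assms unfolding A_eq E.E_eq E.Q.carrier_Q by (elim imageE)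

lemma representation_rho: "representation (Fm m) A V rho"
proof (intro representation.intro representation_axioms.intro assoc_algebra_A module_V)
  fix a b v w c
  assume a: "a \<in> carrier A"
  obtain z where z: "z \<in> PC" "a = E.Q.cl z" using A_cases[OF a] .
  show "rho a v \<in> carrier V" if "v \<in> carrier V"
    using that z by (simp add: rho_cl act2_closed del: E.PR_simps)
  show "rho a (v \<oplus>\<^bsub>V\<^esub> w) = rho a v \<oplus>\<^bsub>V\<^esub> rho a w" if "v \<in> carrier V" "w \<in> carrier V"
    using that z act2_linear(1)[OF z(1) that Fm_closed(1)] by (simp add: rho_cl V_closed del: E.PR_simps)
  show "rho a (c \<odot>\<^bsub>V\<^esub> v) = c \<odot>\<^bsub>V\<^esub> rho a v" if "c \<in> carrier (Fm m)" "v \<in> carrier V"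
    using that z act2_linear(2)[OF z(1) that(2,2,1)] by (simp add: rho_cl V_closed del: E.PR_simps)
  show "rho (c \<odot>\<^bsub>A\<^esub> a) v = c \<odot>\<^bsub>V\<^esub> rho a v" if c: "c \<in> carrier (Fm m)" and v: "v \<in> carrier V"
  proof -
    have cc: "frag_of (c, \<one>\<^bsub>YH d m n\<^esub>) \<in> PC" using c by (intro E.frag_of_PR) auto
    have "c \<odot>\<^bsub>A\<^esub> a = E.Q.cl (c \<odot>\<^bsub>E.PR\<^esub> z)"
      unfolding A_eq E.E_eq z(2) by (rule E.Q.cl_smult[OF c z(1)])
    also have "\<dots> = E.Q.cl (E.pm (frag_of (c, \<one>\<^bsub>YH d m n\<^esub>)) z)" unfolding E.PR_smult[OF c z(1)] ..
    finally have "rho (c \<odot>\<^bsub>A\<^esub> a) v = act2 (frag_of (c, \<one>\<^bsub>YH d m n\<^esub>)) (act2 z v)"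
      using rho_cl[OF E.pm_closed[OF cc z(1)] v] act2_mult[OF cc z(1) v] by simp
    then show ?thesis
      using act1_one[OF act2_closed[OF z(1) v]] rho_cl[OF z(1) v] z(2) by (simp add: act2_frag_of)
  qed
  assume b: "b \<in> carrier A"
  obtain y where y: "y \<in> PC" "b = E.Q.cl y" using A_cases[OF b] .
  have zy: "z + y \<in> PC" using E.PR.add.m_closed[OF z(1) y(1)] by simp
  have "a \<oplus>\<^bsub>A\<^esub> b = E.Q.cl (z + y)"
    unfolding A_eq E.E_eq z(2) y(2) E.Q.cl_add[OF z(1) y(1)] by simp
  then show "rho (a \<oplus>\<^bsub>A\<^esub> b) v = rho a v \<oplus>\<^bsub>V\<^esub> rho b v" if "v \<in> carrier V"
    using rho_cl[OF zy that] rho_cl[OF z(1) that] rho_cl[OF y(1) that] z(2) y(2) by (simp add: act2_add)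
  have "a \<otimes>\<^bsub>A\<^esub> b = E.Q.cl (E.pm z y)"
    unfolding A_eq E.E_eq z(2) y(2) E.Q.cl_mult[OF z(1) y(1)] by simp
  then show "rho (a \<otimes>\<^bsub>A\<^esub> b) v = rho a (rho b v)" if "v \<in> carrier V"
    using rho_cl[OF E.pm_closed[OF z(1) y(1)] that] rho_cl[OF y(1) that] z(2) y(2)
      rho_cl[OF z(1) act2_closed[OF y(1) that]] by (simp add: act2_mult[OF z(1) y(1) that])
next
  fix v assume v: "v \<in> carrier V"
  have "E.Q.cl (frag_of (1, \<one>\<^bsub>YH d m n\<^esub>)) = \<one>\<^bsub>A\<^esub>"
    using E.pt_one by (simp add: E.pt_eq A_eq)
  then show "rho \<one>\<^bsub>A\<^esub> v = v"
    using rho_cl[OF E.frag_of_PR[of 1 "\<one>\<^bsub>YH d m n\<^esub>"] v] act1_one[OF v] by (simp add: act2_frag_of Fm_closed)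
qed

lemma rho_gen: "x \<in> yh_gens n \<Longrightarrow> v \<in> carrier V \<Longrightarrow> rho (yh_gen d m n x) v = gen_op x v"
proof -
  assume x: "x \<in> yh_gens n" and v: "v \<in> carrier V"
  have l: "letter x \<in> FF" using x by (rule FF_closed)
  then show ?thesis
    using rho_cl[OF E.frag_of_PR[OF _ cl_YH[OF l], of 1] v] act1_cl[OF l v]
    by (simp add: yh_gen_def E.pt_eq act2_frag_of pre_act_letter Fm_closed)
qed

abbreviation vb where "vb \<equiv> vbasis n \<Lambda>"

lemma vb_closed: "vb t \<in> carrier V"
  by (auto simp: carrier_V vbasis_def Vc_def Fm_closed)

lemma Gop_vb:
  assumes "t \<in> St" "1 \<le> i" "i < n"
  shows "Gop i (vb t) = (\<lambda>u. diag_coeff (t i) (t (Suc i)) * vb t u + swap_coeff (t i) (t (Suc i)) * vb (t \<circ> swap i) u)"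
proof
  fix S
  have inj: "t i \<noteq> t (Suc i)"
    using inj_onD[OF std_seq_inj[OF St_std[OF assms(1)]], of i "Suc i"] assms by auto
  have ne: "t \<circ> swap i \<noteq> t"
  proof
    assume "t \<circ> swap i = t"
    then have "(t \<circ> swap i) i = t i" by (rule fun_cong)
    then show False using inj by simp
  qed
  have sw: "S \<circ> swap i = t \<longleftrightarrow> S = t \<circ> swap i" by (metis swap_swap_comp)
  show "Gop i (vb t) S = diag_coeff (t i) (t (Suc i)) * vb t S + swap_coeff (t i) (t (Suc i)) * vb (t \<circ> swap i) S"
  proof (cases "S \<in> St")
    case True
    then show ?thesis using ne sw assms(1)
      by (auto simp: Gop_def vbasis_def simp del: comp_apply) (simp_all)
  next
    case False
    then show ?thesis using assms(1) by (auto simp: Gop_def vbasis_def)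
  qed
qed

lemma diag_op_vb:
  assumes "t \<in> St"
  shows "Dop i (vb t) = (\<lambda>u. node_content (t i) * vb t u)" "Top j (vb t) = (\<lambda>u. root (t j) * vb t u)"
  by (auto simp: Dop_def Top_def vbasis_def fun_eq_iff)

text \<open>The prescribed formulas say that generators act as \<open>gen_op\<close> on basis
  vectors. The inverse of X_1 is not prescribed, hence the exclusion; \<open>rep_gen\<close>
  recovers it.\<close>

lemma seminormal_rep_iff:
  "seminormal_rep d m n \<xi> \<Lambda> \<rho> \<longleftrightarrow> representation (Fm m) A V \<rho> \<and>
    (\<forall>t\<in>St. \<forall>x\<in>yh_gens n - {Xinvgen}. \<rho> (yh_gen d m n x) (vb t) = gen_op x (vb t))"
proof -
  have "(let V = V; v = vb; p = (\<lambda>i. node_pos (t i)); c = (\<lambda>i. node_content (t i));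
            s = (\<lambda>i. permute_tableau (Transposition.transpose i (i + 1)) t)
        in \<rho> (yh_gen d m n Xgen) (v t) = c 1 \<odot>\<^bsub>V\<^esub> v t \<and>
           (\<forall>j\<in>{1..n}. \<rho> (yh_gen d m n (Tgen j)) (v t) = to_Fm (const (\<xi> (p j))) \<odot>\<^bsub>V\<^esub> v t) \<and>
           (\<forall>i\<in>{1..n - 1}. p i \<noteq> p (i + 1) \<longrightarrow>
              \<rho> (yh_gen d m n (Ggen i)) (v t) = v (s i)) \<and>
           (\<forall>i\<in>{1..n - 1}. p i = p (i + 1) \<longrightarrow>
              \<rho> (yh_gen d m n (Ggen i)) (v t) =
                (c (i + 1) * (qF - inverse qF) / (c (i + 1) - c i)) \<odot>\<^bsub>V\<^esub> v t \<oplus>\<^bsub>V\<^esub>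
                ((qF * c (i + 1) - inverse qF * c i) / (c (i + 1) - c i)) \<odot>\<^bsub>V\<^esub> v (s i))) \<longleftrightarrow>
      (\<forall>x\<in>yh_gens n - {Xinvgen}. \<rho> (yh_gen d m n x) (vb t) = gen_op x (vb t))" (is "?L \<longleftrightarrow> ?R")
    if t: "t \<in> St" for t
  proof -
    have "?L \<longleftrightarrow> \<rho> (yh_gen d m n Xgen) (vb t) = gen_op Xgen (vb t) \<and>
        (\<forall>j\<in>{1..n}. \<rho> (yh_gen d m n (Tgen j)) (vb t) = gen_op (Tgen j) (vb t)) \<and>
        (\<forall>i\<in>{1..n - 1}. \<rho> (yh_gen d m n (Ggen i)) (vb t) = gen_op (Ggen i) (vb t))"
    proof -
      have g: "(node_pos (t i) \<noteq> node_pos (t (Suc i)) \<longrightarrow> \<rho> (yh_gen d m n (Ggen i)) (vb t) = vb (t \<circ> swap i)) \<and>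
          (node_pos (t i) = node_pos (t (Suc i)) \<longrightarrow> \<rho> (yh_gen d m n (Ggen i)) (vb t) =
            (\<lambda>u. node_content (t (Suc i)) * (qF - inverse qF) / (node_content (t (Suc i)) - node_content (t i)) * vb t u +
              (qF * node_content (t (Suc i)) - inverse qF * node_content (t i)) / (node_content (t (Suc i)) - node_content (t i))
                * vb (t \<circ> swap i) u)) \<longleftrightarrow>
          \<rho> (yh_gen d m n (Ggen i)) (vb t) = gen_op (Ggen i) (vb t)" if "i \<in> {1..n - 1}" for i
        using that Gop_vb[OF t, of i] by (auto simp: diag_coeff_def swap_coeff_def)
      then show ?thesis
        unfolding Let_def permute_swap
        unfolding Vspace_simps Suc_eq_plus1[symmetric] ball_conj_distrib[symmetric]
        by (intro arg_cong2[of _ _ _ _ "(\<and>)"] ball_cong refl g) (simp_all only: gen_op.simps diag_op_vb[OF t] root_def)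
    qed
    also have "\<dots> \<longleftrightarrow> ?R" by (auto simp: yh_gens_def)
    finally show ?thesis .
  qed
  then show ?thesis unfolding seminormal_rep_def by (intro arg_cong2[of _ _ _ _ "(\<and>)"] refl ball_cong)
qed

lemma seminormal_rho: "seminormal_rep d m n \<xi> \<Lambda> rho"
  unfolding seminormal_rep_iff by (auto simp: representation_rho rho_gen vb_closed)

lemma V_basis_induct [consumes 1, case_names zero add basis]:
  assumes f: "f \<in> carrier V" and zero: "P (\<lambda>t. 0)"
    and add: "\<And>f g. f \<in> carrier V \<Longrightarrow> g \<in> carrier V \<Longrightarrow> P f \<Longrightarrow> P g \<Longrightarrow> P (\<lambda>t. f t + g t)"
    and basis: "\<And>c t. c \<in> carrier (Fm m) \<Longrightarrow> t \<in> St \<Longrightarrow> P (\<lambda>u. c * vb t u)"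
  shows "P f"
proof -
  have "P f" if "finite B" "B \<subseteq> St" "f \<in> carrier V" "\<And>t. t \<notin> B \<Longrightarrow> f t = 0" for B f
    using that
  proof (induction B arbitrary: f rule: finite_induct)
    case empty
    then have "f = (\<lambda>t. 0)" by auto
    then show ?case using zero by simp
  next
    case (insert t B)
    have g: "f(t := 0) \<in> carrier V" using insert.prems(2) by (auto simp: carrier_V Vc_def Fm_closed)
    have "P (f(t := 0))" using insert.prems by (intro insert.IH g) auto
    moreover have c: "f t \<in> carrier (Fm m)" using insert.prems(2) by (simp add: carrier_V)
    ultimately have "P (\<lambda>u. (f(t := 0)) u + f t * vb t u)"
      using insert.prems(1) by (intro add[OF g V_closed(3)[OF c vb_closed] _ basis[OF c]]) auto
    moreover have "(\<lambda>u. (f(t := 0)) u + f t * vb t u) = f"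
      by (rule ext) (use insert.prems(1) in \<open>auto simp: vbasis_def\<close>)
    ultimately show ?case by simp
  qed
  from this[OF finite_St subset_refl f] show ?thesis using f by (auto simp: carrier_V Vc_def)
qed

end

text \<open>A node with maximal row plus column is an immediate predecessor of no other node; give
  it the largest entry and continue with the rest.\<close>

lemma down_closed_std_seq:
  assumes "down_closed d m D" "finite D"
  shows "\<exists>T. std_seq d m (card D) T \<and> T ` {1..card D} = D"
  using assms
proof (induction "card D" arbitrary: D)
  case 0
  then show ?case by (auto simp: std_seq_def)
next
  case (Suc k)
  then have "D \<noteq> {}" by auto
  define h where "h \<alpha> = row \<alpha> + col \<alpha>" for \<alpha> :: dm_node
  obtain \<beta> where \<beta>: "\<beta> \<in> D" "\<And>\<alpha>. \<alpha> \<in> D \<Longrightarrow> h \<alpha> \<le> h \<beta>"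
  proof -
    have "Max (h ` D) \<in> h ` D" using Suc.prems \<open>D \<noteq> {}\<close> by (intro Max_in) auto
    then obtain \<beta> where "\<beta> \<in> D" "Max (h ` D) = h \<beta>" by blast
    then show thesis using that[of \<beta>] Max_ge[of "h ` D"] Suc.prems by auto
  qed
  have nc: "\<not> covers \<beta> \<alpha>" if "\<alpha> \<in> D" for \<alpha> using \<beta>(2)[OF that] by (auto simp: covers_def h_def)
  have dc: "down_closed d m (D - {\<beta>})"
    using Suc.prems(1) nc unfolding down_closed_def by blast
  obtain T where T: "std_seq d m k T" "T ` {1..k} = D - {\<beta>}"
    using Suc.hyps(1)[OF _ dc] Suc.hyps(2) Suc.prems(2) \<beta>(1) by (metis card_Diff_singleton diff_Suc_1 finite_Diff)
  let ?T = "T(Suc k := \<beta>)"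
  have im: "?T ` {1..k} = D - {\<beta>}" using T(2) by (metis fun_upd_image atLeastAtMost_iff not_less_eq_eq order_refl)
  have "addable d m (D - {\<beta>}) \<beta>"
    using down_closedD[OF Suc.prems(1) \<beta>(1)] covers_le unfolding addable_def by blast
  moreover have "std_seq d m k ?T" using T(1) by (subst std_seq_cong[of k ?T T]) auto
  ultimately have "std_seq d m (Suc k) ?T" unfolding std_seq_Suc im by simp
  moreover have "?T ` {1..Suc k} = D"
  proof -
    have "{1..Suc k} = insert (Suc k) {1..k}" by auto
    then have "?T ` {1..Suc k} = insert (?T (Suc k)) (?T ` {1..k})" by (simp only: image_insert)
    then show ?thesis unfolding im using \<beta>(1) by (simp add: insert_absorb)
  qed
  ultimately show ?case unfolding Suc.hyps(2)[symmetric] by blast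
qed

lemma (in shape) St_nonempty: "St \<noteq> {}"
proof -
  obtain T where T: "std_seq d m n T" "T ` {1..n} = dm_nodes \<Lambda>"
    using down_closed_std_seq[OF dm_partitions_down_closed[OF \<Lambda>] finite_dm_nodes[OF \<Lambda> n_pos]] dm_partitionsD(4)[OF \<Lambda>]
    by auto
  have "restrict T {1..n} \<in> St"
    unfolding St_iff using T std_seq_cong[of n "restrict T {1..n}" T d m] by auto
  then show ?thesis by blast
qed

section \<open>Irreducibility and pairwise non-isomorphism\<close>

locale seminormal = shape +
  fixes \<rho> :: "yh_elt \<Rightarrow> vect \<Rightarrow> vect"
  assumes semi: "seminormal_rep d m n \<xi> \<Lambda> \<rho>"
begin

lemma repr: "representation (Fm m) A V \<rho>"
  using semi unfolding seminormal_rep_iff by blast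

sublocale R: representation "Fm m" A V \<rho>
  by (rule repr)

lemma rep_linear:
  assumes "a \<in> carrier A" "f \<in> carrier V"
  shows "g \<in> carrier V \<Longrightarrow> \<rho> a (\<lambda>t. f t + g t) = (\<lambda>t. \<rho> a f t + \<rho> a g t)"
    "c \<in> carrier (Fm m) \<Longrightarrow> \<rho> a (\<lambda>t. c * f t) = (\<lambda>t. c * \<rho> a f t)"
  using R.act_add[OF assms] R.act_smult[OF assms(1) _ assms(2)] by simp_all

lemma rep_gen_noninv:
  assumes x: "x \<in> yh_gens n - {Xinvgen}" and f: "f \<in> carrier V"
  shows "\<rho> (yh_gen d m n x) f = gen_op x f"
proof -
  have xg: "yh_gen d m n x \<in> carrier A" using x by (intro yh_gen_closed) auto
  have z: "gen_op x (\<lambda>t. 0) = (\<lambda>t. 0)" using gen_op_linear(2)[of x 0] by simp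
  have z': "\<rho> (yh_gen d m n x) (\<lambda>t. 0) = (\<lambda>t. 0)"
    using rep_linear(2)[OF xg V_closed(1) Fm_closed(1)] by simp
  have b: "\<rho> (yh_gen d m n x) (vb t) = gen_op x (vb t)" if "t \<in> St" for t
    using semi x that by (simp add: seminormal_rep_iff)
  show ?thesis
    using f
  proof (induction f rule: V_basis_induct)
    case zero
    then show ?case by (simp add: z z')
  next
    case (add f g)
    then show ?case by (simp add: rep_linear[OF xg] gen_op_linear)
  next
    case (basis c t)
    then show ?case by (simp add: rep_linear[OF xg vb_closed] gen_op_linear b)
  qed
qed

lemma quot_relator_eq: "f - g \<in> yh_relators d m n \<Longrightarrow> f \<in> FF \<Longrightarrow> g \<in> FF \<Longrightarrow> quot f = quot g"
proof -
  assume r: "f - g \<in> yh_relators d m n" and f: "f \<in> FF" and g: "g \<in> FF"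
  have "quot f = quot ((f - g) + g)" by simp
  also have "\<dots> = quot (f - g) \<oplus>\<^bsub>A\<^esub> quot g" using f g by (intro quot_add FF_closed)
  also have "quot (f - g) = \<zero>\<^bsub>A\<^esub>" using r relators_ideal by (intro quot_ideal) auto
  finally show ?thesis using quot_closed[OF g] by simp
qed

text \<open>The action of the inverse of X_1 is forced, since X_1 is already known to act
  invertibly.\<close>

lemma rep_gen: "x \<in> yh_gens n \<Longrightarrow> f \<in> carrier V \<Longrightarrow> \<rho> (yh_gen d m n x) f = gen_op x f"
proof (cases "x = Xinvgen")
  case True
  assume x: "x \<in> yh_gens n" and f: "f \<in> carrier V"
  have X: "Xgen \<in> yh_gens n - {Xinvgen}" "Xinvgen \<in> yh_gens n" by (auto simp: yh_gens_def)
  have c: "Xinv_op f \<in> carrier V" using gen_op_closed[OF X(2) f] by simp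
  have "quot (xx_inv * xx) = quot 1"
    by (rule quot_relator_eq) (auto simp: yh_relators_def intro!: FF_closed FF_gens)
  then have "yh_gen d m n Xinvgen \<otimes>\<^bsub>A\<^esub> yh_gen d m n Xgen = \<one>\<^bsub>A\<^esub>"
    by (simp add: yh_gen_quot quot_one quot_mult FF_gens flip: xx_def xx_inv_def)
  then have "Xinv_op f = \<rho> (yh_gen d m n Xinvgen) (\<rho> (yh_gen d m n Xgen) (Xinv_op f))"
    using R.mult_act[OF yh_gen_closed[OF X(2)] yh_gen_closed c, of Xgen] R.one_act[OF c] X(1) by simp
  also have "\<rho> (yh_gen d m n Xgen) (Xinv_op f) = f"
    using rep_gen_noninv[OF X(1) c] by (simp add: Dop_def Xinv_op_def fun_eq_iff)
  finally show ?thesis using True by simp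
qed (use rep_gen_noninv in blast)

lemma subrep_closed:
  assumes "subrep (Fm m) A V \<rho> U"
  shows "U \<subseteq> carrier V" "(\<lambda>t. 0) \<in> U" "f \<in> U \<Longrightarrow> g \<in> U \<Longrightarrow> (\<lambda>t. f t + g t) \<in> U"
    "c \<in> carrier (Fm m) \<Longrightarrow> f \<in> U \<Longrightarrow> (\<lambda>t. c * f t) \<in> U" "x \<in> yh_gens n \<Longrightarrow> f \<in> U \<Longrightarrow> gen_op x f \<in> U"
proof -
  have sub: "submodule U (Fm m) V" and stable: "\<And>a u. a \<in> carrier A \<Longrightarrow> u \<in> U \<Longrightarrow> \<rho> a u \<in> U"
    using assms by (auto simp: subrep_def)
  show s: "U \<subseteq> carrier V" "(\<lambda>t. 0) \<in> U" "f \<in> U \<Longrightarrow> g \<in> U \<Longrightarrow> (\<lambda>t. f t + g t) \<in> U"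
    "c \<in> carrier (Fm m) \<Longrightarrow> f \<in> U \<Longrightarrow> (\<lambda>t. c * f t) \<in> U"
    using module.submoduleE[OF module_V sub] subgroup.one_closed[OF submodule.axioms(1)[OF sub]] by auto
  show "gen_op x f \<in> U" if x: "x \<in> yh_gens n" and f: "f \<in> U"
    using stable[OF yh_gen_closed[OF x] f] rep_gen[OF x subsetD[OF s(1) f]] by simp
qed

lemma subrep_diff:
  assumes "subrep (Fm m) A V \<rho> U" "f \<in> U" "g \<in> U" "c \<in> carrier (Fm m)"
  shows "(\<lambda>t. f t - c * g t) \<in> U"
proof -
  have "(\<lambda>t. f t + (- c) * g t) \<in> U"
    using assms by (intro subrep_closed(3,4)[OF assms(1)]) (auto intro: Fm_closed)
  then show ?thesis by simp
qed

text \<open>Only \<open>Dop 1\<close> is a generator; the others are reached through g_i X_i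
  g_i.\<close>

lemma subrep_Dop:
  assumes "subrep (Fm m) A V \<rho> U" "f \<in> U" "1 \<le> i" "i \<le> n"
  shows "Dop i f \<in> U"
  using assms(3,4,2)
proof (induction i arbitrary: f rule: dec_induct)
  case base
  then show ?case using subrep_closed(5)[OF assms(1), of Xgen f] by (simp add: yh_gens_def)
next
  case (step i)
  have G: "Gop i g \<in> U" if "g \<in> U" for g
    using subrep_closed(5)[OF assms(1), of "Ggen i" g] that step by (auto simp: yh_gens_def)
  have "f \<in> Vc" using subrep_closed(1)[OF assms(1)] step by (auto simp: carrier_V)
  then show ?case using Gop_Dop_Gop[of f i] G step by (metis Suc_le_lessD Suc_leD)
qed

lemma root_eq_iff: "valid_node d m \<alpha> \<Longrightarrow> valid_node d m \<beta> \<Longrightarrow> root \<alpha> = root \<beta> \<longleftrightarrow> node_pos \<alpha> = node_pos \<beta>"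
  by (simp add: root_def const_eq_iff \<xi>_eq_iff valid_node_def node_pos_eq)

lemma weights_separate:
  assumes "t \<in> St" "std_seq d m n s" "s \<in> extensional {1..n}" "s \<noteq> t"
  obtains i where "i \<in> {1..n}" "node_content (s i) \<noteq> node_content (t i) \<or> root (s i) \<noteq> root (t i)"
proof -
  have "\<exists>i\<in>{1..n}. node_content (s i) \<noteq> node_content (t i) \<or> root (s i) \<noteq> root (t i)"
  proof (rule ccontr)
    assume c: "\<not> ?thesis"
    have w: "node_pos (s i) = node_pos (t i) \<and> node_content (s i) = node_content (t i)" if "i \<in> {1..n}" for i
      using c that root_eq_iff[of "s i" "t i"] std_seq_valid[OF assms(2), of i] St_valid[OF assms(1), of i] by auto
    have "s = t"
    proof (rule extensionalityI[OF assms(3)])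
      show "t \<in> extensional {1..n}" using assms(1) by (simp add: St_iff)
      show "s i = t i" if "i \<in> {1..n}" for i
        by (rule std_seq_weights_eq[OF assms(2) St_std[OF assms(1)] w that])
    qed
    then show False using assms(4) by simp
  qed
  then show thesis using that by blast
qed

text \<open>The unwanted coordinates of f are killed one after another: for each tableau s other
  than t some diagonal operator has different eigenvalues at s and t, and subtracting its eigenvalue
  at s erases the coordinate s but keeps t.\<close>

lemma subrep_basis_vector:
  assumes U: "subrep (Fm m) A V \<rho> U" and f: "f \<in> U" and t: "f t \<noteq> 0"
  shows "vb t \<in> U"
proof -
  have "f \<in> carrier V" using subrep_closed(1)[OF U] f by blast
  then have tS: "t \<in> St" using t Vc_zero[of f t] by (auto simp: carrier_V)
  have "\<exists>g\<in>U. g t \<noteq> 0 \<and> (\<forall>s\<in>B. g s = 0)" if "finite B" "B \<subseteq> St - {t}" for B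
    using that
  proof (induction B rule: finite_induct)
    case empty
    then show ?case using f t by blast
  next
    case (insert s B)
    then obtain g where g: "g \<in> U" "g t \<noteq> 0" "\<And>r. r \<in> B \<Longrightarrow> g r = 0" by auto
    have s: "s \<in> St" "s \<noteq> t" using insert.prems by auto
    obtain i where i: "i \<in> {1..n}" "node_content (s i) \<noteq> node_content (t i) \<or> root (s i) \<noteq> root (t i)"
      using weights_separate[OF tS St_std[OF s(1)] _ s(2)] s(1) by (auto simp: St_iff)
    have op: ?case if z: "z s \<noteq> z t" "z s \<in> carrier (Fm m)" and zg: "(\<lambda>u. z u * g u) \<in> U" for z
    proof
      show "(\<lambda>u. z u * g u - z s * g u) \<in> U" by (rule subrep_diff[OF U zg g(1) z(2)])
      show "z t * g t - z s * g t \<noteq> 0 \<and> (\<forall>r\<in>insert s B. z r * g r - z s * g r = 0)"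
        using g z by auto
    qed
    show ?case
    proof (cases "node_content (s i) = node_content (t i)")
      case False
      have "node_content (s i) \<in> carrier (Fm m)"
        using St_valid[OF s(1), of i] i(1) by (intro node_content_closed) auto
      then show ?thesis
        using subrep_Dop[OF U g(1), of i] i(1) False
        by (intro op[of "\<lambda>u. node_content (u i)"]) (auto simp: Dop_def[abs_def])
    next
      case True
      have "Top i g \<in> U" using subrep_closed(5)[OF U, of "Tgen i" g] g(1) i(1) by (auto simp: yh_gens_def)
      then show ?thesis
        using i(2) True by (intro op[of "\<lambda>u. root (u i)"]) (auto simp: Top_def[abs_def] root_closed)
    qed
  qed
  from this[of "St - {t}"] obtain g where g: "g \<in> U" "g t \<noteq> 0" "\<And>s. s \<in> St - {t} \<Longrightarrow> g s = 0"
    using finite_St by auto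
  have gV: "g \<in> carrier V" using g(1) subrep_closed(1)[OF U] by blast
  have "(\<lambda>u. inverse (g t) * g u) \<in> U"
    using g(1) gV by (intro subrep_closed(4)[OF U] Fm_closed) (auto simp: carrier_V)
  moreover have "(\<lambda>u. inverse (g t) * g u) = vb t"
  proof
    fix u show "inverse (g t) * g u = vb t u"
      using g tS gV by (cases "u = t"; cases "u \<in> St") (auto simp: vbasis_def carrier_V Vc_def)
  qed
  ultimately show ?thesis by simp
qed

text \<open>Induct on the number of inversions between t and s. At a descent the exchanged tableau
  is standard and its coefficient in g_i v_t is nonzero, so its basis vector lies in U as
  well.\<close>

lemma subrep_connected:
  assumes U: "subrep (Fm m) A V \<rho> U" and s: "s \<in> St"
  shows "t \<in> St \<Longrightarrow> vb t \<in> U \<Longrightarrow> vb s \<in> U"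
proof (induction "card (inversions n (rel_pos n s t))" arbitrary: t rule: less_induct)
  case less
  show ?case
  proof (cases "t = s")
    case False
    have im: "t ` {1..n} = s ` {1..n}" using less.prems(1) s by (simp add: St_iff)
    note st = St_std[OF s] St_std[OF less.prems(1)]
    obtain i where i: "1 \<le> i" "i < n" "rel_pos n s t (Suc i) < rel_pos n s t i"
      using rel_pos_descent_exists[OF st im] False s less.prems(1) by (auto simp: St_iff)
    have "std_seq d m n (t \<circ> swap i)" by (rule rel_pos_descent_std[OF st im i])
    then have t': "t \<circ> swap i \<in> St" and nc: "\<not> covers (t i) (t (Suc i))"
      using St_swap[OF less.prems(1) i(1,2)] std_seq_swap_not_covers[OF _ i(1,2)] by blast+
    define c where "c = swap_coeff (t i) (t (Suc i))"
    have c: "c \<noteq> 0" unfolding c_def using std_seq_swap_coeff_nz[OF st(2) i(1,2) nc] by blast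
    have v: "valid_node d m (t i)" "valid_node d m (t (Suc i))" using St_valid[OF less.prems(1)] i by auto
    have "Gop i (vb t) \<in> U"
      using subrep_closed(5)[OF U, of "Ggen i" "vb t"] less.prems i by (auto simp: yh_gens_def)
    then have "(\<lambda>u. Gop i (vb t) u - diag_coeff (t i) (t (Suc i)) * vb t u) \<in> U"
      by (rule subrep_diff[OF U _ less.prems(2)]) (use coeff_closed[OF v] in blast)
    then have "(\<lambda>u. c * vb (t \<circ> swap i) u) \<in> U"
      by (simp add: Gop_vb[OF less.prems(1) i(1,2)] c_def)
    moreover have "inverse c \<in> carrier (Fm m)" unfolding c_def by (intro Fm_closed coeff_closed[OF v])
    ultimately have "(\<lambda>u. inverse c * (c * vb (t \<circ> swap i) u)) \<in> U" using subrep_closed(4)[OF U] by blast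
    moreover have "(\<lambda>u. inverse c * (c * vb (t \<circ> swap i) u)) = vb (t \<circ> swap i)"
      using c by (simp add: fun_eq_iff)
    ultimately have "vb (t \<circ> swap i) \<in> U" by simp
    then show ?thesis
      using less.hyps[OF _ t'] inversions_swap[OF i] by (simp add: rel_pos_swap)
  qed (use less.prems in simp)
qed

lemma irreducible: "irreducible_rep (Fm m) A V \<rho>"
  unfolding irreducible_rep_def simple_subrep_def
proof (intro conjI allI impI repr)
  show "subrep (Fm m) A V \<rho> (carrier V)"
    unfolding subrep_def using module.carrier_is_submodule[OF module_V] R.act_closed by blast
  obtain t where t: "t \<in> St" using St_nonempty by blast
  have "vb t \<noteq> (\<lambda>t. 0)" using t by (auto simp: vbasis_def fun_eq_iff)
  then show "carrier V \<noteq> {\<zero>\<^bsub>V\<^esub>}" using vb_closed[of t] by auto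
  fix U assume U': "subrep (Fm m) A V \<rho> U \<and> U \<subseteq> carrier V"
  then have U: "subrep (Fm m) A V \<rho> U" by simp
  show "U = {\<zero>\<^bsub>V\<^esub>} \<or> U = carrier V"
  proof (cases "U \<subseteq> {\<lambda>t. 0}")
    case True
    then show ?thesis using subrep_closed(2)[OF U] by auto
  next
    case False
    then obtain f t where f: "f \<in> U" "f t \<noteq> 0" by (auto simp: fun_eq_iff)
    then have "f \<in> carrier V" using subrep_closed(1)[OF U] by blast
    then have "t \<in> St" "vb t \<in> U"
      using f subrep_basis_vector[OF U f] Vc_zero[of f t] by (auto simp: carrier_V)
    then have all: "vb s \<in> U" if "s \<in> St" for s using subrep_connected[OF U that] by blast
    have "g \<in> U" if "g \<in> carrier V" for g
      using that by (induction g rule: V_basis_induct) (auto intro: subrep_closed[OF U] all)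
    then show ?thesis using U' by blast
  qed
qed

end

text \<open>The isomorphism commutes with all Jucys-Murphy elements and all t_j, so the image of v_t
  has the eigenvalues of t. Any tableau s in its support then has the weights of t, hence equals t
  on entries, and the two shapes have the same nodes.\<close>

lemma seminormal_not_isomorphic:
  assumes 1: "seminormal d m n \<xi> \<Lambda> \<rho>" and 2: "seminormal d m n \<xi> M \<sigma>"
    and iso: "isomorphic_reps (Fm m) (FYH d m n) (Vspace m n \<Lambda>) \<rho> (Vspace m n M) \<sigma>"
  shows "\<Lambda> = M"
proof -
  interpret S1: seminormal d m n \<xi> \<Lambda> \<rho> by (rule 1)
  interpret S2: seminormal d m n \<xi> M \<sigma> by (rule 2)
  obtain \<phi> where bij: "bij_betw \<phi> (carrier S1.V) (carrier S2.V)"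
    and hom: "\<And>c v. c \<in> carrier (Fm m) \<Longrightarrow> v \<in> carrier S1.V \<Longrightarrow> \<phi> (\<lambda>t. c * v t) = (\<lambda>t. c * \<phi> v t)"
      "\<And>a v. a \<in> carrier (FYH d m n) \<Longrightarrow> v \<in> carrier S1.V \<Longrightarrow> \<phi> (\<rho> a v) = \<sigma> a (\<phi> v)"
    using iso unfolding isomorphic_reps_def by auto
  have \<phi>: "\<phi> v \<in> carrier S2.V" if "v \<in> carrier S1.V" for v using bij that by (auto simp: bij_betw_def)
  have gen: "\<phi> (S1.gen_op x v) = S2.gen_op x (\<phi> v)" if "x \<in> yh_gens n" "v \<in> carrier S1.V" for x v
    using hom(2)[OF S1.yh_gen_closed[OF that(1)] that(2)] S1.rep_gen[OF that] S2.rep_gen[OF that(1) \<phi>[OF that(2)]]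
    by simp
  have D: "\<phi> (S1.Dop i v) = S2.Dop i (\<phi> v) \<and> S1.Dop i v \<in> carrier S1.V"
    if "1 \<le> i" "i \<le> n" "v \<in> carrier S1.V" for i v
    using that
  proof (induction i arbitrary: v rule: dec_induct)
    case base
    then show ?case using gen[of Xgen v] S1.gen_op_closed[of Xgen v] by (simp add: yh_gens_def)
  next
    case (step i)
    have G: "Ggen i \<in> yh_gens n" using step by (auto simp: yh_gens_def)
    have Gv: "S1.Gop i u \<in> carrier S1.V" if "u \<in> carrier S1.V" for u using S1.gen_op_closed[OF G that] by simp
    have "S1.Dop (Suc i) v = S1.Gop i (S1.Dop i (S1.Gop i v))"
      using step S1.Gop_Dop_Gop[of v i] by (simp add: S1.carrier_V)
    moreover have "S2.Dop (Suc i) (\<phi> v) = S2.Gop i (S2.Dop i (S2.Gop i (\<phi> v)))"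
      using step S2.Gop_Dop_Gop[of "\<phi> v" i] \<phi>[of v] by (simp add: S2.carrier_V)
    ultimately show ?case using gen[OF G] Gv step by simp
  qed
  obtain t where t: "t \<in> S1.St" using S1.St_nonempty by blast
  define w where "w = \<phi> (S1.vb t)"
  have wV: "w \<in> carrier S2.V" using \<phi>[OF S1.vb_closed] by (simp add: w_def)
  have "w \<noteq> (\<lambda>t. 0)"
  proof
    assume "w = (\<lambda>t. 0)"
    moreover have "\<phi> (\<lambda>t. 0) = (\<lambda>t. 0)" using hom(1)[OF Fm_closed(1) S1.V_closed(1)] by simp
    ultimately have "S1.vb t = (\<lambda>t. 0)"
      using inj_onD[OF bij_betw_imp_inj_on[OF bij], of "S1.vb t" "\<lambda>t. 0"] S1.vb_closed S1.V_closed(1) by (simp add: w_def)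
    then have "S1.vb t t = 0" by simp
    then show False using t by (simp add: vbasis_def)
  qed
  \<comment> \<open>Any tableau in the support of the image will do.\<close>
  then obtain s where s: "w s \<noteq> 0" by auto
  then have sS: "s \<in> S2.St" using wV by (auto simp: S2.carrier_V S2.Vc_def)
  have v: "valid_node d m (t i)" "valid_node d m (s i)" if "i \<in> {1..n}" for i
    using S1.St_valid[OF t, of i] S2.St_valid[OF sS, of i] that by auto
  have "node_pos (t i) = node_pos (s i) \<and> node_content (t i) = node_content (s i)" if i: "i \<in> {1..n}" for i
  proof
    have "S2.Dop i w = \<phi> (S1.Dop i (S1.vb t))" using D[of i "S1.vb t"] i S1.vb_closed by (simp add: w_def)
    also have "\<dots> = (\<lambda>u. node_content (t i) * w u)"
      unfolding S1.diag_op_vb[OF t] w_def by (rule hom(1)[OF node_content_closed[OF v(1)[OF i]] S1.vb_closed])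
    finally show "node_content (t i) = node_content (s i)"
      using s by (metis S2.Dop_def mult_right_cancel)
    have "S2.Top i w = \<phi> (S1.Top i (S1.vb t))"
      using gen[of "Tgen i" "S1.vb t"] i S1.vb_closed by (auto simp: w_def yh_gens_def)
    also have "\<dots> = (\<lambda>u. S1.root (t i) * w u)"
      unfolding S1.diag_op_vb[OF t] w_def by (rule hom(1)[OF S1.root_closed S1.vb_closed])
    finally have "S1.root (t i) = S2.root (s i)"
      using s by (metis S2.Top_def mult_right_cancel)
    then show "node_pos (t i) = node_pos (s i)"
      using S1.root_eq_iff[OF v[OF i]] by (simp add: S1.root_def S2.root_def)
  qed
  then have eq: "t i = s i" if "i \<in> {1..n}" for i
    by (rule std_seq_weights_eq[OF S1.St_std[OF t] S2.St_std[OF sS] _ that])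
  have "dm_nodes \<Lambda> = t ` {1..n}" using t by (simp add: S1.St_iff)
  also have "\<dots> = s ` {1..n}" using eq by (rule image_cong[OF refl])
  also have "\<dots> = dm_nodes M" using sS by (simp add: S2.St_iff)
  finally show ?thesis by (rule dm_nodes_inj[OF S1.\<Lambda> S2.\<Lambda>])
qed

section \<open>Weight vectors\<close>

text \<open>Finite sums of elements satisfying P. Scalars are omitted since the predicates of
  interest are themselves closed under them.\<close>

inductive_set add_span :: "('y::ring_1 \<Rightarrow> bool) \<Rightarrow> 'y set" for P where
  zero: "0 \<in> add_span P"
| step: "P u \<Longrightarrow> v \<in> add_span P \<Longrightarrow> u + v \<in> add_span P"

lemma add_span_base: "P u \<Longrightarrow> u \<in> add_span P"
  using add_span.step[OF _ add_span.zero, of P u] by simp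

lemma add_span_add: "u \<in> add_span P \<Longrightarrow> v \<in> add_span P \<Longrightarrow> u + v \<in> add_span P"
  by (induction rule: add_span.induct) (auto simp: add.assoc intro: add_span.step)

lemma add_span_bind: "w \<in> add_span P \<Longrightarrow> (\<And>u. P u \<Longrightarrow> u \<in> add_span Q) \<Longrightarrow> w \<in> add_span Q"
  by (induction rule: add_span.induct) (auto intro: add_span.zero add_span_add)

lemma add_span_mono: "w \<in> add_span P \<Longrightarrow> (\<And>u. P u \<Longrightarrow> Q u) \<Longrightarrow> w \<in> add_span Q"
  by (erule add_span_bind) (auto intro: add_span_base)

lemma conjugate_commute:
  fixes a x y z :: "'y::ring_1"
  assumes "z = a * x * a" "a * y = y * a" "x * y = y * x"
  shows "z * y = y * z"
proof -
  have "a * x * a * y = a * x * (y * a)" by (simp only: assms(2) mult.assoc)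
  also have "\<dots> = a * (y * x) * a" by (simp only: assms(3)[symmetric] mult.assoc)
  also have "\<dots> = (y * a) * x * a" by (simp only: assms(2)[symmetric] mult.assoc)
  finally show ?thesis by (simp only: assms(1) mult.assoc)
qed

text \<open>Applies the factors Z - s b to w successively: a polynomial in Z given by its list of
  roots.\<close>

fun ann :: "('c \<Rightarrow> 'y::ring_1) \<Rightarrow> 'y \<Rightarrow> 'c list \<Rightarrow> 'y \<Rightarrow> 'y" where
  "ann s Z [] w = w"
| "ann s Z (b # bs) w = ann s Z bs (Z * w - s b * w)"

lemma ann_append: "ann s Z (xs @ ys) w = ann s Z ys (ann s Z xs w)"
  by (induction xs arbitrary: w) simp_all

lemma ann_add: "ann s Z bs (u + v) = ann s Z bs u + ann s Z bs v"
proof (induction bs arbitrary: u v)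
  case (Cons b bs)
  have "Z * (u + v) - s b * (u + v) = (Z * u - s b * u) + (Z * v - s b * v)" by (simp add: algebra_simps)
  then show ?case using Cons by simp
qed simp

lemma ann_zero: "ann s Z bs 0 = 0"
  by (induction bs) simp_all

lemma ann_uminus: "ann s Z bs (- u) = - ann s Z bs u"
  using ann_add[of s Z bs u "- u"] by (simp add: ann_zero eq_neg_iff_add_eq_0 add.commute)

lemma ann_add_span: "w \<in> add_span P \<Longrightarrow> (\<And>u. P u \<Longrightarrow> ann s Z bs u = 0) \<Longrightarrow> ann s Z bs w = 0"
  by (induction rule: add_span.induct) (auto simp: ann_zero ann_add)

text \<open>A map intertwining Z with Z' carries annihilating polynomials along. The predicate P
  restricts the vectors on which the intertwining property has to hold.\<close>

lemma ann_transport: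
  assumes "\<And>v. P v \<Longrightarrow> F (Z * v) = Z' * F v" "\<And>b v. b \<in> set bs \<Longrightarrow> P v \<Longrightarrow> F (s b * v) = s b * F v"
    "\<And>u v. F (u - v) = F u - F v" "\<And>b v. b \<in> set bs \<Longrightarrow> P v \<Longrightarrow> P (Z * v - s b * v)" "P w"
  shows "F (ann s Z bs w) = ann s Z' bs (F w)"
  using assms(2,4,5)
proof (induction bs arbitrary: w)
  case (Cons b bs)
  have "F (Z * w - s b * w) = Z' * F w - s b * F w" using Cons.prems assms(1,3) by simp
  then show ?case using Cons.IH[of "Z * w - s b * w"] Cons.prems by simp
qed simp

text \<open>The algebra is placed in a ring type as a corner with unit e, which need not be the unit
  of the type. Ring elements serve at the same time as vectors, acted on by left multiplication, so
  the locale describes the regular module.\<close>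

locale hecke_ring =
  fixes d m n :: nat and \<xi> :: "nat \<Rightarrow> complex"
    and e :: "'y::ring_1" and s :: "laurent fract \<Rightarrow> 'y" and T G :: "nat \<Rightarrow> 'y" and X1 :: 'y
  assumes d_pos: "d > 0" and n_pos: "n > 0" and \<xi>: "bij_betw \<xi> {1..d} {z. z ^ d = 1}"
    and s_add: "\<lbrakk>a \<in> carrier (Fm m); b \<in> carrier (Fm m)\<rbrakk> \<Longrightarrow> s (a + b) = s a + s b"
    and s_mult: "\<lbrakk>a \<in> carrier (Fm m); b \<in> carrier (Fm m)\<rbrakk> \<Longrightarrow> s (a * b) = s a * s b"
    and s_one: "s 1 = e"
    and s_central: "a \<in> carrier (Fm m) \<Longrightarrow> y * s a = s a * y"
    and e_gen: "\<lbrakk>1 \<le> j; j \<le> n\<rbrakk> \<Longrightarrow> e * T j = T j" "\<lbrakk>1 \<le> i; i < n\<rbrakk> \<Longrightarrow> e * G i = G i" "e * X1 = X1"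
    and TT: "\<lbrakk>1 \<le> i; i \<le> n; 1 \<le> j; j \<le> n\<rbrakk> \<Longrightarrow> T i * T j = T j * T i"
    and Td: "\<lbrakk>1 \<le> j; j \<le> n\<rbrakk> \<Longrightarrow> T j ^ d = e"
    and TG: "\<lbrakk>1 \<le> i; i < n; 1 \<le> j; j \<le> n\<rbrakk> \<Longrightarrow> T j * G i = G i * T (swap i j)"
    and GG: "\<lbrakk>1 \<le> i; i < n\<rbrakk> \<Longrightarrow> G i * G i = e + s (qF - inverse qF) *
      (s (to_Fm (const (1 / of_nat d))) * (\<Sum>k<d. T i ^ k * (T (Suc i) ^ (d - 1)) ^ k)) * G i"
    and braid: "\<lbrakk>1 \<le> i; Suc i < n\<rbrakk> \<Longrightarrow> G i * G (Suc i) * G i = G (Suc i) * G i * G (Suc i)"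
    and far: "\<lbrakk>1 \<le> i; Suc i < j; j < n\<rbrakk> \<Longrightarrow> G i * G j = G j * G i"
    and XGXG: "2 \<le> n \<Longrightarrow> X1 * G 1 * X1 * G 1 = G 1 * X1 * G 1 * X1"
    and XG: "\<lbrakk>2 \<le> i; i < n\<rbrakk> \<Longrightarrow> X1 * G i = G i * X1"
    and XT: "\<lbrakk>1 \<le> j; j \<le> n\<rbrakk> \<Longrightarrow> X1 * T j = T j * X1"
    and cyc: "ann s X1 (map vF [1..<m + 1]) e = 0"
begin

section \<open>Jucys-Murphy elements and their commutation\<close>

abbreviation "K \<equiv> carrier (Fm m)"

text \<open>Jucys-Murphy elements with indices from 1; the value at 0 is a default.\<close>

fun JM :: "nat \<Rightarrow> 'y" where
  "JM 0 = 0"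
| "JM (Suc i) = (if i = 0 then X1 else G i * JM i * G i)"

declare JM.simps(2) [simp del]

lemma JM_1: "JM (Suc 0) = X1"
  by (simp add: JM.simps)

lemma JM_Suc: "1 \<le> i \<Longrightarrow> JM (Suc i) = G i * JM i * G i"
  by (cases i) (simp_all add: JM.simps)

lemma e_central: "y * e = e * y"
  using s_central[OF Fm_closed(2)] by (simp add: s_one)

lemma JM_T:
  assumes "1 \<le> i" "i \<le> n" "1 \<le> j" "j \<le> n"
  shows "JM i * T j = T j * JM i"
  using assms
proof (induction i arbitrary: j rule: dec_induct)
  case base
  then show ?case by (simp add: JM_1 XT)
next
  case (step i)
  have sw: "1 \<le> swap i j" "swap i j \<le> n" "swap i (swap i j) = j"
    using step yh.swap_mem[of i n j] by (auto simp: Transposition.transpose_def)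
  have "JM (Suc i) * T j = G i * JM i * (G i * T j)" using step by (simp add: JM_Suc mult.assoc)
  also have "G i * T j = T (swap i j) * G i" using TG[of i "swap i j"] sw step by simp
  also have "G i * JM i * (T (swap i j) * G i) = G i * (JM i * T (swap i j)) * G i" by (simp add: mult.assoc)
  also have "\<dots> = (G i * T (swap i j)) * JM i * G i" using step sw by (simp add: mult.assoc)
  also have "G i * T (swap i j) = T j * G i" using TG[of i j] step by simp
  finally show ?case using step by (simp add: JM_Suc mult.assoc)
qed

lemma JM_G_ge:
  assumes "1 \<le> i" "i < k" "k < n"
  shows "JM i * G k = G k * JM i"
  using assms
proof (induction i rule: dec_induct)
  case base
  then show ?case by (simp add: JM_1 XG)
next
  case (step i)
  have f: "G i * G k = G k * G i" and ih: "JM i * G k = G k * JM i" using step far[of i k] by auto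
  show ?case using step(1) by (intro conjugate_commute[OF _ f ih]) (simp add: JM_Suc)
qed

text \<open>The first case is i = k + 2, where g_k is moved through by two braid relations; larger i
  follow by conjugating with far commuting g's.\<close>

lemma JM_G_less:
  assumes "1 \<le> k" "Suc k < i" "i \<le> n"
  shows "JM i * G k = G k * JM i"
proof -
  have "Suc (Suc k) \<le> i" using assms by simp
  then show ?thesis using assms(3)
  proof (induction i rule: dec_induct)
    case base
    have k: "1 \<le> k" "Suc k < n" using assms(1) base by auto
    define a b x where "a = G k" and "b = G (Suc k)" and "x = JM k"
    have br: "a * b * a = b * a * b" using braid[OF k] by (simp add: a_def b_def)
    have bx: "x * b = b * x" using JM_G_ge[of k "Suc k"] k by (simp add: b_def x_def)
    have "JM (Suc (Suc k)) = b * (a * x * a) * b" using k by (simp add: JM_Suc a_def b_def x_def)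
    moreover have "b * (a * x * a) * b * a = a * (b * (a * x * a) * b)"
    proof -
      have "b * (a * x * a) * b * a = b * a * x * (a * b * a)" by (simp add: mult.assoc)
      also have "\<dots> = b * a * (x * b) * a * b" unfolding br by (simp add: mult.assoc)
      also have "\<dots> = (b * a * b) * x * a * b" unfolding bx by (simp add: mult.assoc)
      also have "\<dots> = a * (b * (a * x * a) * b)" unfolding br[symmetric] by (simp add: mult.assoc)
      finally show ?thesis .
    qed
    ultimately show ?case by (simp add: a_def)
  next
    case (step i)
    have f: "G i * G k = G k * G i" and ih: "JM i * G k = G k * JM i" using step far[of k i] assms(1) by auto
    show ?case using step(1) by (intro conjugate_commute[OF _ f ih]) (simp add: JM_Suc)
  qed
qed

text \<open>X_(j+1) commutes with X_k for k < j because both g_j and X_j do. For k = j write X_j =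
  g_(j-1) X_(j-1) g_(j-1), whose factors commute with X_(j+1); the start j = 1 is the relation
  between X_1 and g_1.\<close>

lemma JM_commute_less:
  assumes "1 \<le> i" "i < j" "j \<le> n"
  shows "JM j * JM i = JM i * JM j"
proof -
  have "1 \<le> j" using assms by simp
  then show ?thesis using assms
  proof (induction j arbitrary: i rule: dec_induct)
    case (step j)
    have low: "JM (Suc j) * JM k = JM k * JM (Suc j)" if "1 \<le> k" "k < j" for k
    proof -
      have gk: "JM k * G j = G j * JM k" using JM_G_ge[of k j] that step by simp
      have ik: "JM j * JM k = JM k * JM j" using step that by simp
      show ?thesis using step(1) by (intro conjugate_commute[OF _ gk[symmetric] ik]) (simp add: JM_Suc)
    qed
    show ?case
    proof (cases "i < j")
      case False
      then have i: "i = j" using step by simp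
      show ?thesis
      proof (cases "j = 1")
        case True
        have "JM (Suc (Suc 0)) = G 1 * X1 * G 1" using JM_Suc[of 1] by (simp add: JM_1)
        then show ?thesis using XGXG step True by (simp add: i JM_1 mult.assoc)
      next
        case False
        then obtain k where k: "j = Suc k" "1 \<le> k" using step by (cases j) auto
        have g: "JM (Suc j) * G k = G k * JM (Suc j)" using JM_G_less[of k "Suc j"] k step by simp
        have lk: "JM k * JM (Suc j) = JM (Suc j) * JM k" using low[OF k(2)] k(1) by (simp only: lessI)
        have z: "JM j = G k * JM k * G k" unfolding k(1) by (rule JM_Suc[OF k(2)])
        show ?thesis unfolding i by (rule conjugate_commute[OF z g[symmetric] lk, symmetric])
      qed
    qed (use low step in simp)
  qed simp
qed

lemma JM_commute: "\<lbrakk>1 \<le> i; i \<le> n; 1 \<le> j; j \<le> n\<rbrakk> \<Longrightarrow> JM j * JM i = JM i * JM j"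
  using JM_commute_less[of i j] JM_commute_less[of j i] by (cases i j rule: linorder_cases) auto

lemma s_act:
  assumes "a \<in> K" "b \<in> K"
  shows "s (a + b) * w = s a * w + s b * w" "s a * (s b * w) = s (a * b) * w" "y * (s a * w) = s a * (y * w)"
proof -
  show "s (a + b) * w = s a * w + s b * w" by (simp add: s_add assms distrib_right)
  show "s a * (s b * w) = s (a * b) * w" by (simp add: s_mult assms mult.assoc)
  have "y * (s a * w) = (y * s a) * w" by (simp add: mult.assoc)
  then show "y * (s a * w) = s a * (y * w)" by (simp add: s_central assms mult.assoc)
qed

lemma s_zero: "s 0 = 0"
  using s_add[OF Fm_closed(1,1)] by simp

lemma s_uminus: "a \<in> K \<Longrightarrow> s (- a) = - s a"
  using s_add[of a "- a"] by (simp add: Fm_closed s_zero eq_neg_iff_add_eq_0 add.commute)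

lemma s_diff: "a \<in> K \<Longrightarrow> b \<in> K \<Longrightarrow> s (a - b) = s a - s b"
  using s_add[of a "- b"] s_uminus[of b] by (simp add: Fm_closed)

lemma s_cancel:
  assumes "a \<in> K" "a \<noteq> 0" "e * w = w" "s a * w = 0"
  shows "w = 0"
proof -
  have "s (inverse a) * (s a * w) = s (inverse a * a) * w" using assms by (simp only: s_mult Fm_closed mult.assoc)
  also have "\<dots> = w" using assms by (simp add: s_one)
  finally show ?thesis using assms by simp
qed

lemma kappa_closed: "qF - inverse qF \<in> K"
  by (intro Fm_closed Fm_indets)

section \<open>Weight vectors and diagonalisation\<close>

definition rt :: "nat \<Rightarrow> laurent fract" where
  "rt k = to_Fm (const (\<xi> k))"

lemma rt_closed: "rt k \<in> K"
  by (simp add: rt_def to_Fm_closed)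

definition teig :: "(nat \<Rightarrow> nat) \<Rightarrow> 'y \<Rightarrow> bool" where
  "teig p w \<longleftrightarrow> e * w = w \<and> (\<forall>j\<in>{1..n}. p j \<in> {1..d} \<and> T j * w = s (rt (p j)) * w)"

text \<open>The map p records the t-eigenvalues for all n indices, whereas the tableau \<tau>
  accounts only for the first i Jucys-Murphy elements.\<close>

definition wt :: "nat \<Rightarrow> (nat \<Rightarrow> nat) \<Rightarrow> (nat \<Rightarrow> dm_node) \<Rightarrow> 'y \<Rightarrow> bool" where
  "wt i p \<tau> w \<longleftrightarrow> teig p w \<and> std_seq d m i \<tau> \<and>
     (\<forall>j\<in>{1..i}. node_pos (\<tau> j) = p j \<and> JM j * w = s (node_content (\<tau> j)) * w)"

text \<open>Predicates that behave like subspaces of the corner.\<close>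

definition stable :: "('y \<Rightarrow> bool) \<Rightarrow> bool" where
  "stable P \<longleftrightarrow> (\<forall>u. P u \<longrightarrow> e * u = u) \<and> (\<forall>u v. P u \<longrightarrow> P v \<longrightarrow> P (u + v)) \<and> (\<forall>c u. c \<in> K \<longrightarrow> P u \<longrightarrow> P (s c * u))"

lemma stableD:
  assumes "stable P"
  shows "P u \<Longrightarrow> e * u = u" "P u \<Longrightarrow> P v \<Longrightarrow> P (u + v)" "c \<in> K \<Longrightarrow> P u \<Longrightarrow> P (s c * u)"
    "P u \<Longrightarrow> P v \<Longrightarrow> P (u - v)" "P u \<Longrightarrow> c \<in> K \<Longrightarrow> P v \<Longrightarrow> P (u - s c * v)"
proof -
  show *: "P u \<Longrightarrow> e * u = u" "P u \<Longrightarrow> P v \<Longrightarrow> P (u + v)" "c \<in> K \<Longrightarrow> P u \<Longrightarrow> P (s c * u)" for c u v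
    using assms by (auto simp: stable_def)
  show **: "P (u - v)" if "P u" "P v" for u v
  proof -
    have "- 1 \<in> K" by (intro Fm_closed)
    then have "P (u + s (- 1) * v)" using that by (intro *)
    moreover have "s (- 1) * v = - v" using s_uminus[OF Fm_closed(2)] *(1)[OF that(2)] by (simp add: s_one)
    ultimately show ?thesis by simp
  qed
  show "P u \<Longrightarrow> c \<in> K \<Longrightarrow> P v \<Longrightarrow> P (u - s c * v)" using * ** by blast
qed

lemma add_span_stable:
  assumes "stable P" "w \<in> add_span P" "P v"
  shows "P w"
proof -
  have "P 0" using stableD(4)[OF assms(1,3,3)] by simp
  from assms(2) this show ?thesis by (induction rule: add_span.induct) (auto intro: stableD(2)[OF assms(1)])
qed

lemma eigen_scale:
  assumes "a \<in> K" "c \<in> K" "Z * u = s c * u"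
  shows "Z * (s a * u) = s c * (s a * u)"
proof -
  have "Z * (s a * u) = s a * (s c * u)" using s_act(3)[OF assms(1,1)] assms(3) by simp
  also have "\<dots> = s (c * a) * u" using s_act(2)[OF assms(1,2)] by (simp only: mult.commute)
  also have "\<dots> = s c * (s a * u)" using s_act(2)[OF assms(2,1)] by simp
  finally show ?thesis .
qed

lemma e_scale: "a \<in> K \<Longrightarrow> e * u = u \<Longrightarrow> e * (s a * u) = s a * u"
  using s_act(3)[of a a e u] by simp

lemma stable_corner: "stable (\<lambda>w. e * w = w)"
  by (simp add: stable_def distrib_left e_scale)

lemma stableI:
  assumes "\<And>u. P u \<Longrightarrow> e * u = u" "\<And>u v. P u \<Longrightarrow> P v \<Longrightarrow> P (u + v)" "\<And>c u. c \<in> K \<Longrightarrow> P u \<Longrightarrow> P (s c * u)"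
  shows "stable P"
  using assms unfolding stable_def by blast

lemma stable_eigen:
  assumes "c \<in> K" "stable P"
  shows "stable (\<lambda>w. P w \<and> Z * w = s c * w)"
proof (rule stableI)
  fix u v a assume u: "P u \<and> Z * u = s c * u"
  show "e * u = u" using stableD(1)[OF assms(2)] u by blast
  show "P (u + v) \<and> Z * (u + v) = s c * (u + v)" if "P v \<and> Z * v = s c * v"
    using stableD(2)[OF assms(2)] u that by (simp add: distrib_left)
  show "P (s a * u) \<and> Z * (s a * u) = s c * (s a * u)" if "a \<in> K"
    using stableD(3)[OF assms(2) that] eigen_scale[OF that assms(1)] u by blast
qed

lemma teig_stable: "stable (teig p)"
proof (rule stableI)
  fix u v a assume u: "teig p u"
  show "e * u = u" using u by (simp add: teig_def)
  show "teig p (u + v)" if "teig p v" using u that by (simp add: teig_def distrib_left)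
  show "teig p (s a * u)" if "a \<in> K"
    using u eigen_scale[OF that rt_closed] e_scale[OF that] unfolding teig_def by blast
qed

lemma wt_content: "wt i p \<tau> w \<Longrightarrow> j \<in> {1..i} \<Longrightarrow> node_content (\<tau> j) \<in> K"
  unfolding wt_def using std_seq_valid[of d m i \<tau> j] node_content_closed by auto

lemma wt_stable: "stable (wt i p \<tau>)"
  unfolding stable_def
proof (intro conjI allI impI)
  note ts = stableD[OF teig_stable]
  fix u v c assume u: "wt i p \<tau> u"
  show "e * u = u" using u by (simp add: wt_def teig_def)
  show "wt i p \<tau> (u + v)" if "wt i p \<tau> v"
    using u that ts(2) by (auto simp: wt_def distrib_left)
  show "wt i p \<tau> (s c * u)" if c: "c \<in> K"
    unfolding wt_def
  proof (intro conjI ballI)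
    fix j assume j: "j \<in> {1..i}"
    show "JM j * (s c * u) = s (node_content (\<tau> j)) * (s c * u)"
      using u j by (intro eigen_scale c wt_content[OF u j]) (simp add: wt_def)
  qed (use u ts(3) c in \<open>auto simp: wt_def\<close>)
qed

lemma ann_value:
  assumes "set bs \<subseteq> K" "x \<in> K" "Z * w = s x * w" "e * w = w"
  shows "ann s Z bs w = s (prod_list (map (\<lambda>b. x - b) bs)) * w"
  using assms(1,3,4)
proof (induction bs arbitrary: w)
  case Nil
  then show ?case by (simp add: s_one)
next
  case (Cons b bs)
  have b: "b \<in> K" "x - b \<in> K" using Cons.prems assms(2) by (auto intro: Fm_closed)
  define v where "v = s (x - b) * w"
  have v: "Z * w - s b * w = v" using Cons.prems b assms(2) by (simp add: v_def s_diff left_diff_distrib)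
  have "Z * v = s x * v" unfolding v_def by (rule eigen_scale[OF b(2) assms(2) Cons.prems(2)])
  moreover have "e * v = v" unfolding v_def by (rule e_scale[OF b(2) Cons.prems(3)])
  ultimately have "ann s Z bs v = s (prod_list (map (\<lambda>b. x - b) bs)) * v" using Cons by simp
  then have "ann s Z (b # bs) w = s (prod_list (map (\<lambda>b. x - b) bs)) * v" by (simp only: ann.simps v)
  also have "\<dots> = s (prod_list (map (\<lambda>b. x - b) bs) * (x - b)) * w"
  proof -
    have "prod_list (map (\<lambda>b. x - b) bs) \<in> K"
      using Cons.prems(1) assms(2) by (induction bs) (auto intro: Fm_closed)
    then show ?thesis unfolding v_def by (rule s_act(2)[OF _ b(2)])
  qed
  finally show ?case by (simp add: mult.commute)
qed

lemma ann_eigen_zero: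
  assumes "set bs \<subseteq> K" "x \<in> K" "Z * w = s x * w" "e * w = w"
  shows "x \<in> set bs \<Longrightarrow> ann s Z bs w = 0" "x \<notin> set bs \<Longrightarrow> ann s Z bs w = 0 \<Longrightarrow> w = 0"
proof -
  show "ann s Z bs w = 0" if "x \<in> set bs"
  proof -
    have "prod_list (map (\<lambda>b. x - b) bs) = 0" using that by (auto simp: prod_list_zero_iff)
    then show ?thesis unfolding ann_value[OF assms] by (simp only: s_zero mult_zero_left)
  qed
  assume x: "x \<notin> set bs" "ann s Z bs w = 0"
  have "prod_list (map (\<lambda>b. x - b) bs) \<in> K"
    using assms(1,2) by (induction bs) (auto intro: Fm_closed)
  moreover have "prod_list (map (\<lambda>b. x - b) bs) \<noteq> 0" using x by (auto simp: prod_list_zero_iff)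
  ultimately show "w = 0" using s_cancel[OF _ _ assms(4)] ann_value[OF assms] x(2) by simp
qed

lemma ann_shift:
  assumes "set bs \<subseteq> K" "b \<in> K"
  shows "ann s Z bs (Z * w - s b * w) = Z * ann s Z bs w - s b * ann s Z bs w"
proof -
  define F where "F v = Z * v - s b * v" for v
  have "F (ann s Z bs w) = ann s Z bs (F w)"
  proof (rule ann_transport[where P = "\<lambda>_. True"])
    show "F (Z * v) = Z * F v" for v
      unfolding F_def right_diff_distrib s_act(3)[OF assms(2,2)] ..
    show "F (u - v) = F u - F v" for u v by (simp add: F_def algebra_simps)
    show "F (s c * v) = s c * F v" if "c \<in> set bs" for c v
    proof -
      have c: "c \<in> K" using that assms(1) by blast
      have "s b * (s c * v) = s c * (s b * v)" by (rule s_act(3)[OF c c])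
      then show ?thesis unfolding F_def right_diff_distrib s_act(3)[OF c c] by simp
    qed
  qed simp_all
  then show ?thesis by (simp add: F_def)
qed

text \<open>An eigenvector decomposition from an annihilating product of distinct linear factors.\<close>

lemma eigen_decomp:
  assumes st: "stable P" and Z: "\<And>u. P u \<Longrightarrow> P (Z * u)"
  shows "distinct bs \<Longrightarrow> set bs \<subseteq> K \<Longrightarrow> P w \<Longrightarrow> ann s Z bs w = 0 \<Longrightarrow>
    w \<in> add_span (\<lambda>u. P u \<and> (\<exists>b\<in>set bs. Z * u = s b * u))"
proof (induction bs arbitrary: w)
  case Nil
  then show ?case by (simp add: add_span.zero)
next
  case (Cons b bs)
  let ?Q = "\<lambda>u. P u \<and> (\<exists>b\<in>set bs. Z * u = s b * u)"
  have b: "b \<in> K" "b \<notin> set bs" "set bs \<subseteq> K" using Cons.prems by auto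
  define u where "u = Z * w - s b * w"
  have Pu: "P u" unfolding u_def using Cons.prems Z b by (intro stableD(5)[OF st])
  have "u \<in> add_span ?Q" using Cons Pu by (simp add: u_def)
  \<comment> \<open>By induction (Z - b) w is a sum of eigenvectors for the other roots, on which Z
    - b is invertible. Subtracting the preimage u' from w leaves an eigenvector for b.\<close>
  then obtain u' where u': "u' \<in> add_span ?Q" "Z * u' - s b * u' = u"
  proof (induction arbitrary: thesis rule: add_span.induct)
    case zero
    show ?case by (rule zero[of 0]) (simp_all add: add_span.zero)
  next
    case (step u v)
    obtain v' where v': "v' \<in> add_span ?Q" "Z * v' - s b * v' = v" using step.IH by blast
    obtain b' where b': "b' \<in> set bs" "Z * u = s b' * u" and Pu: "P u" using step.hyps(1) by blast
    have bK: "b' \<in> K" "b' - b \<noteq> 0" "b' - b \<in> K" "inverse (b' - b) \<in> K"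
      using b' b by (auto intro!: Fm_closed)
    define x where "x = s (inverse (b' - b)) * u"
    have "Z * x = s b' * x" unfolding x_def by (rule eigen_scale[OF bK(4,1) b'(2)])
    moreover have Px: "P x" unfolding x_def using bK Pu by (intro stableD(3)[OF st])
    moreover have "Z * x - s b * x = u"
    proof -
      have "Z * x - s b * x = s (b' - b) * x" using calculation bK b by (simp add: s_diff left_diff_distrib)
      also have "\<dots> = u" using bK stableD(1)[OF st Pu] by (simp add: x_def s_act(2) s_one)
      finally show ?thesis .
    qed
    ultimately have "?Q x" "Z * (x + v') - s b * (x + v') = u + v"
      using b'(1) v'(2) by (blast, simp add: algebra_simps)
    then show ?case using step.prems[of "x + v'"] add_span.step[of ?Q x v'] v'(1) by blast
  qed
  have "u' \<in> add_span P" using u'(1) by (rule add_span_mono) auto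
  then have Pu': "P u'" using add_span_stable[OF st _ Cons.prems(3)] by blast
  have "Z * (w - u') = s b * (w - u')" using u'(2) by (simp add: u_def algebra_simps)
  then have "w - u' \<in> add_span (\<lambda>u. P u \<and> (\<exists>b\<in>set (b # bs). Z * u = s b * u))"
    using stableD(4)[OF st Cons.prems(3) Pu'] by (intro add_span_base) auto
  moreover have "u' \<in> add_span (\<lambda>u. P u \<and> (\<exists>b\<in>set (b # bs). Z * u = s b * u))"
    using u'(1) by (rule add_span_mono) auto
  ultimately show ?case using add_span_add[of "w - u'" _ u'] by simp
qed

text \<open>Let v' = (Z - a) v. Dropping one factor Z - a, if present, from the annihilating product
  of v gives a product without the root a that kills v'; but v' is an eigenvector for a, so v' =
  0.\<close>

lemma no_jordan_block:
  assumes "distinct bs" "set bs \<subseteq> K" "a \<in> K" "ann s Z bs v = 0" "e * v = v" "e * (Z * v) = Z * v"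
    "Z * (Z * v - s a * v) = s a * (Z * v - s a * v)"
  shows "Z * v = s a * v"
proof -
  define v' where "v' = Z * v - s a * v"
  have ev: "e * v' = v'" unfolding v'_def right_diff_distrib s_act(3)[OF assms(3,3)] assms(5,6) ..
  have Zv: "Z * v' = s a * v'" unfolding v'_def by (rule assms(7))
  have "v' = 0"
  proof (cases "a \<in> set bs")
    case False
    have "ann s Z bs v' = 0" unfolding v'_def ann_shift[OF assms(2,3)] assms(4) by simp
    then show ?thesis using ann_eigen_zero(2)[OF assms(2,3) Zv ev False] by blast
  next
    case True
    then obtain xs ys where bs: "bs = xs @ a # ys" by (meson split_list)
    have sub: "set (xs @ ys) \<subseteq> K" "set xs \<subseteq> K" and na: "a \<notin> set (xs @ ys)" using assms(1,2) unfolding bs by auto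
    have "ann s Z (xs @ ys) v' = ann s Z ys (Z * ann s Z xs v - s a * ann s Z xs v)"
      unfolding ann_append v'_def ann_shift[OF sub(2) assms(3)] ..
    also have "\<dots> = ann s Z bs v" unfolding bs ann_append by simp
    also have "\<dots> = 0" by (rule assms(4))
    finally show ?thesis using ann_eigen_zero(2)[OF sub(1) assms(3) Zv ev na] by blast
  qed
  then show ?thesis by (simp add: v'_def)
qed

end

context hecke_ring
begin

section \<open>Action of the g_i on weight vectors\<close>

lemma K_power: "c \<in> K \<Longrightarrow> c ^ k \<in> K"
  by (induction k) (auto intro: Fm_closed)

lemma K_sum: "(\<And>i. i \<in> B \<Longrightarrow> f i \<in> K) \<Longrightarrow> sum f B \<in> K"
  by (induction B rule: infinite_finite_induct) (auto intro: Fm_closed)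

lemma s_sum: "(\<And>i. i \<in> B \<Longrightarrow> f i \<in> K) \<Longrightarrow> s (sum f B) = (\<Sum>i\<in>B. s (f i))"
  by (induction B rule: infinite_finite_induct) (auto simp: s_zero s_add K_sum)

lemma eigen_power:
  assumes "c \<in> K" "Z * u = s c * u" "e * u = u"
  shows "Z ^ k * u = s (c ^ k) * u"
proof (induction k)
  case 0
  then show ?case using assms by (simp add: s_one)
next
  case (Suc k)
  have "Z ^ Suc k * u = Z ^ k * (Z * u)" by (simp only: power_Suc2 mult.assoc)
  also have "\<dots> = s c * (s (c ^ k) * u)" using s_act(3)[OF assms(1,1)] Suc assms(2) by simp
  finally show ?case using s_act(2)[OF assms(1) K_power[OF assms(1)]] by simp
qed

lemma rt_root: "k \<in> {1..d} \<Longrightarrow> \<xi> k ^ d = 1"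
  using \<xi> by (auto simp: bij_betw_def)

lemma \<xi>_inj: "k \<in> {1..d} \<Longrightarrow> k' \<in> {1..d} \<Longrightarrow> \<xi> k = \<xi> k' \<longleftrightarrow> k = k'"
  by (rule inj_on_eq_iff[OF bij_betw_imp_inj_on[OF \<xi>]])

lemma teigD: "teig p w \<Longrightarrow> e * w = w" "teig p w \<Longrightarrow> 1 \<le> j \<Longrightarrow> j \<le> n \<Longrightarrow> T j * w = s (rt (p j)) * w"
  "teig p w \<Longrightarrow> 1 \<le> j \<Longrightarrow> j \<le> n \<Longrightarrow> p j \<in> {1..d}"
  by (simp_all add: teig_def)

lemma teig_G:
  assumes "teig p w" "1 \<le> i" "i < n"
  shows "teig (p \<circ> swap i) (G i * w)"
  unfolding teig_def
proof (intro conjI ballI)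
  show "e * (G i * w) = G i * w" using e_gen(2)[OF assms(2,3)] by (simp add: mult.assoc[symmetric])
  fix j assume "j \<in> {1..n}"
  then have j: "1 \<le> j" "j \<le> n" by auto
  have sj: "1 \<le> swap i j" "swap i j \<le> n" using yh.swap_mem[OF assms(2,3) j] by auto
  show "(p \<circ> swap i) j \<in> {1..d}" using teigD(3)[OF assms(1) sj] by simp
  have "T j * (G i * w) = G i * (T (swap i j) * w)"
    using TG[OF assms(2,3) j] by (simp only: mult.assoc[symmetric])
  also have "\<dots> = s (rt (p (swap i j))) * (G i * w)"
    using teigD(2)[OF assms(1) sj] s_act(3)[OF rt_closed rt_closed] by simp
  finally show "T j * (G i * w) = s (rt ((p \<circ> swap i) j)) * (G i * w)" by simp
qed

text \<open>The scalar by which (q - q^(-1)) e_i acts on vectors with positions p.\<close>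

definition kap :: "(nat \<Rightarrow> nat) \<Rightarrow> nat \<Rightarrow> laurent fract" where
  "kap p i = (if p i = p (Suc i) then qF - inverse qF else 0)"

lemma kap_closed: "kap p i \<in> K"
  by (simp add: kap_def kappa_closed Fm_closed)

lemma kap_swap: "kap (p \<circ> swap i) i = kap p i"
  by (auto simp: kap_def)

lemma GG_act:
  assumes "teig p w" "1 \<le> i" "i < n"
  shows "G i * (G i * w) = w + s (kap p i) * (G i * w)"
proof -
  define u where "u = G i * w"
  have u: "teig (p \<circ> swap i) u" unfolding u_def by (rule teig_G[OF assms])
  have i: "1 \<le> i" "i \<le> n" "1 \<le> Suc i" "Suc i \<le> n" using assms by auto
  \<comment> \<open>Applying g_i has exchanged the t-eigenvalues of i and i + 1.\<close>
  define a b where "a = rt (p (Suc i))" and "b = rt (p i)"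
  have ab: "a \<in> K" "b ^ (d - 1) \<in> K" by (simp_all add: a_def b_def rt_closed K_power)
  have Ta: "T i * u = s a * u" and Tb: "T (Suc i) * u = s b * u"
    using teigD(2)[OF u i(1,2)] teigD(2)[OF u i(3,4)] by (simp_all add: a_def b_def)
  have eu: "e * u = u" by (rule teigD(1)[OF u])
  have tm: "T i ^ k * (T (Suc i) ^ (d - 1)) ^ k * u = s (a ^ k * (b ^ (d - 1)) ^ k) * u" for k
  proof -
    have "(T (Suc i) ^ (d - 1)) ^ k * u = s ((b ^ (d - 1)) ^ k) * u"
      by (rule eigen_power[OF ab(2) eigen_power[OF _ Tb eu] eu]) (simp add: b_def rt_closed)
    then have "T i ^ k * (T (Suc i) ^ (d - 1)) ^ k * u = s ((b ^ (d - 1)) ^ k) * (T i ^ k * u)"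
      using s_act(3)[OF K_power[OF ab(2)] K_power[OF ab(2)]] by (simp add: mult.assoc)
    also have "\<dots> = s ((b ^ (d - 1)) ^ k * a ^ k) * u"
      unfolding eigen_power[OF ab(1) Ta eu] by (rule s_act(2)[OF K_power[OF ab(2)] K_power[OF ab(1)]])
    finally show ?thesis by (simp only: mult.commute)
  qed
  have tK: "a ^ k * (b ^ (d - 1)) ^ k \<in> K" for k unfolding a_def b_def by (intro Fm_closed K_power rt_closed)
  define c where "c = to_Fm (const (1 / of_nat d))"
  have c: "c \<in> K" by (simp add: c_def to_Fm_closed)
  have "s c * (\<Sum>k<d. T i ^ k * (T (Suc i) ^ (d - 1)) ^ k) * u = s c * (s (\<Sum>k<d. a ^ k * (b ^ (d - 1)) ^ k) * u)"
  proof -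
    have "s (\<Sum>k<d. a ^ k * (b ^ (d - 1)) ^ k) = (\<Sum>k<d. s (a ^ k * (b ^ (d - 1)) ^ k))"
      by (rule s_sum) (rule tK)
    then show ?thesis by (simp only: mult.assoc[of "s c"] sum_distrib_right tm)
  qed
  also have "\<dots> = s (c * (\<Sum>k<d. a ^ k * (b ^ (d - 1)) ^ k)) * u"
    by (rule s_act(2)[OF c K_sum]) (rule tK)
  also have "c * (\<Sum>k<d. a ^ k * (b ^ (d - 1)) ^ k) =
      to_Fm (const (1 / of_nat d * (\<Sum>k<d. \<xi> (p (Suc i)) ^ k * (\<xi> (p i) ^ (d - 1)) ^ k)))"
    by (simp only: c_def a_def b_def rt_def const_simps const_sum const_power to_Fm_sum to_Fm_power to_Fm_simps)
  also have "\<dots> = (if p i = p (Suc i) then 1 else 0)"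
  proof -
    have pd: "p i \<in> {1..d}" "p (Suc i) \<in> {1..d}"
      using teigD(3)[OF assms(1) i(1,2)] teigD(3)[OF assms(1) i(3,4)] .
    have "\<xi> (p (Suc i)) = \<xi> (p i) \<longleftrightarrow> p i = p (Suc i)" unfolding \<xi>_inj[OF pd(2,1)] by (rule eq_commute)
    then show ?thesis unfolding root_of_unity_sum[OF d_pos rt_root[OF pd(2)] rt_root[OF pd(1)]]
      by (simp add: const_simps)
  qed
  finally have E: "s c * (\<Sum>k<d. T i ^ k * (T (Suc i) ^ (d - 1)) ^ k) * u = s (if p i = p (Suc i) then 1 else 0) * u" .
  have "G i * (G i * w) = (G i * G i) * w" by (simp add: mult.assoc)
  also have "\<dots> = e * w + s (qF - inverse qF) * (s c * (\<Sum>k<d. T i ^ k * (T (Suc i) ^ (d - 1)) ^ k) * u)"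
    unfolding GG[OF assms(2,3)] c_def[symmetric] u_def by (simp only: distrib_right mult.assoc)
  also have "\<dots> = w + s (kap p i) * u"
    unfolding E using teigD(1)[OF assms(1)] eu by (simp add: kap_def s_one s_zero)
  finally show ?thesis by (simp add: u_def)
qed

lemma e_JM: "1 \<le> i \<Longrightarrow> i \<le> n \<Longrightarrow> e * JM i = JM i"
  by (induction i rule: dec_induct) (simp_all add: JM_1 e_gen JM_Suc mult.assoc[symmetric])

lemma teig_JM:
  assumes "teig p w" "1 \<le> i" "i \<le> n"
  shows "teig p (JM i * w)"
  unfolding teig_def
proof (intro conjI ballI)
  show "e * (JM i * w) = JM i * w" using e_JM[OF assms(2,3)] by (simp add: mult.assoc[symmetric])
  fix j assume "j \<in> {1..n}"
  then have j: "1 \<le> j" "j \<le> n" by auto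
  show "p j \<in> {1..d}" by (rule teigD(3)[OF assms(1) j])
  have "T j * (JM i * w) = JM i * (T j * w)" using JM_T[OF assms(2,3) j] by (simp only: mult.assoc[symmetric])
  then show "T j * (JM i * w) = s (rt (p j)) * (JM i * w)"
    using teigD(2)[OF assms(1) j] s_act(3)[OF rt_closed rt_closed] by simp
qed

text \<open>Expand X_(i+1) = g_i X_i g_i and use the quadratic relation on the resulting g_i^2;
  \<open>JM_G\<close> is the mirror image.\<close>

lemma JM_Suc_G:
  assumes "teig p w" "1 \<le> i" "i < n"
  shows "JM (Suc i) * (G i * w) = G i * (JM i * w) + s (kap p i) * (JM (Suc i) * w)"
proof -
  have "JM (Suc i) * (G i * w) = G i * (JM i * (G i * (G i * w)))"
    using assms by (simp add: JM_Suc mult.assoc)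
  also have "\<dots> = G i * (JM i * w) + s (kap p i) * (G i * (JM i * (G i * w)))"
    unfolding GG_act[OF assms] distrib_left s_act(3)[OF kap_closed kap_closed] ..
  finally show ?thesis using assms by (simp add: JM_Suc mult.assoc)
qed

lemma JM_G:
  assumes "teig p w" "1 \<le> i" "i < n"
  shows "JM i * (G i * w) = G i * (JM (Suc i) * w) - s (kap p i) * (JM (Suc i) * w)"
proof -
  have "teig (p \<circ> swap i) (JM i * (G i * w))" using assms by (intro teig_JM teig_G) auto
  from GG_act[OF this assms(2,3)]
  have "G i * (JM (Suc i) * w) = JM i * (G i * w) + s (kap p i) * (JM (Suc i) * w)"
    using assms by (simp add: kap_swap JM_Suc mult.assoc)
  then show ?thesis by simp
qed

lemma JM_G_other:
  assumes "1 \<le> j" "j \<le> n" "j \<noteq> i" "j \<noteq> Suc i" "1 \<le> i" "i < n"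
  shows "JM j * (G i * w) = G i * (JM j * w)"
proof -
  have "JM j * G i = G i * JM j"
    using JM_G_ge[of j i] JM_G_less[of i j] assms by (cases "j < i") auto
  then show ?thesis by (simp only: mult.assoc[symmetric])
qed

subsection \<open>Intertwiners\<close>

text \<open>The off-diagonal part of g_i. On a weight vector whose eigenvalues at i and i + 1 come
  from \<alpha> and \<beta> it exchanges the two.\<close>

definition itw :: "nat \<Rightarrow> dm_node \<Rightarrow> dm_node \<Rightarrow> 'y \<Rightarrow> 'y" where
  "itw i \<alpha> \<beta> w = G i * w - s (diag_coeff \<alpha> \<beta>) * w"

lemma G_itw: "G i * w = s (diag_coeff \<alpha> \<beta>) * w + itw i \<alpha> \<beta> w"
  by (simp add: itw_def)

context
  fixes i :: nat and p :: "nat \<Rightarrow> nat" and \<alpha> \<beta> :: dm_node and w :: 'y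
  assumes i: "1 \<le> i" "i < n" and w: "teig p w"
    and pos: "p i = node_pos \<alpha>" "p (Suc i) = node_pos \<beta>"
    and valid: "valid_node d m \<alpha>" "valid_node d m \<beta>"
begin

lemma kap_pos: "kap p i = (if node_pos \<alpha> = node_pos \<beta> then qF - inverse qF else 0)"
  using pos by (simp add: kap_def)

lemma dK: "diag_coeff \<alpha> \<beta> \<in> K" "diag_coeff \<beta> \<alpha> \<in> K" "node_content \<alpha> \<in> K" "node_content \<beta> \<in> K"
  by (intro coeff_closed[OF valid] coeff_closed[OF valid(2,1)] node_content_closed[OF valid(1)]
      node_content_closed[OF valid(2)])+

lemma itw_teig: "teig (p \<circ> swap i) (itw i \<alpha> \<beta> w)"
proof (cases "node_pos \<alpha> = node_pos \<beta>")
  case True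
  have "p \<circ> swap i = p" using True pos by (auto simp: fun_eq_iff Transposition.transpose_def)
  then show ?thesis
    unfolding itw_def using teig_G[OF w i] by (intro stableD(5)[OF teig_stable] dK) (simp_all add: w)
next
  case False
  then show ?thesis unfolding itw_def using teig_G[OF w i] by (simp add: diag_coeff_def s_zero)
qed

lemma itw_JM_other:
  assumes "1 \<le> j" "j \<le> n" "j \<noteq> i" "j \<noteq> Suc i" "c \<in> K" "JM j * w = s c * w"
  shows "JM j * itw i \<alpha> \<beta> w = s c * itw i \<alpha> \<beta> w"
  unfolding itw_def right_diff_distrib JM_G_other[OF assms(1-4) i] assms(6) s_act(3)[OF assms(5,5)]
    eigen_scale[OF dK(1) assms(5,6)] ..

context
  assumes sep: "separated \<alpha> \<beta>" and JM: "JM i * w = s (node_content \<alpha>) * w" "JM (Suc i) * w = s (node_content \<beta>) * w"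
begin

lemma coeff_rel:
  "kap p i * node_content \<beta> + diag_coeff \<alpha> \<beta> * node_content \<alpha> = diag_coeff \<alpha> \<beta> * node_content \<beta>"
proof (cases "node_pos \<alpha> = node_pos \<beta>")
  case True
  then have "node_content \<beta> - node_content \<alpha> \<noteq> 0" using sep by (simp add: separated_def)
  then have "diag_coeff \<alpha> \<beta> * (node_content \<beta> - node_content \<alpha>) = kap p i * node_content \<beta>"
    using True by (simp add: kap_pos diag_coeff_def)
  then show ?thesis by (simp add: algebra_simps)
next
  case False
  then show ?thesis by (simp add: kap_pos diag_coeff_def)
qed

lemma itw_JM_i: "JM i * itw i \<alpha> \<beta> w = s (node_content \<beta>) * itw i \<alpha> \<beta> w"
proof -
  let ?a = "diag_coeff \<alpha> \<beta>" and ?x = "node_content \<alpha>" and ?y = "node_content \<beta>"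
  have "JM i * itw i \<alpha> \<beta> w = s ?y * (G i * w) - s (kap p i * ?y) * w - s (?a * ?x) * w"
    unfolding itw_def right_diff_distrib JM_G[OF w i] JM s_act(3)[OF dK(1,1), of "JM i"] s_act(3)[OF dK(4,4), of "G i"]
      s_act(2)[OF kap_closed dK(4)] JM s_act(2)[OF dK(1) dK(3)] ..
  also have "\<dots> = s ?y * (G i * w) - s (kap p i * ?y + ?a * ?x) * w"
    using kap_closed dK by (simp add: s_add Fm_closed distrib_right)
  also have "\<dots> = s ?y * itw i \<alpha> \<beta> w"
    unfolding coeff_rel itw_def right_diff_distrib s_act(2)[OF dK(4,1)] by (simp only: mult.commute)
  finally show ?thesis .
qed

lemma itw_JM_Suc: "JM (Suc i) * itw i \<alpha> \<beta> w = s (node_content \<alpha>) * itw i \<alpha> \<beta> w"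
proof -
  let ?a = "diag_coeff \<alpha> \<beta>" and ?x = "node_content \<alpha>" and ?y = "node_content \<beta>"
  have "JM (Suc i) * itw i \<alpha> \<beta> w = s ?x * (G i * w) + s (kap p i * ?y) * w - s (?a * ?y) * w"
    unfolding itw_def right_diff_distrib JM_Suc_G[OF w i] JM s_act(3)[OF dK(1,1), of "JM (Suc i)"] s_act(3)[OF dK(3,3), of "G i"]
      s_act(2)[OF kap_closed dK(4)] s_act(2)[OF dK(1) dK(4)] ..
  also have "s (?a * ?y) * w = s (kap p i * ?y) * w + s (?a * ?x) * w"
    unfolding coeff_rel[symmetric] using kap_closed dK by (simp add: s_add Fm_closed distrib_right)
  also have "s ?x * (G i * w) + s (kap p i * ?y) * w - (s (kap p i * ?y) * w + s (?a * ?x) * w) = s ?x * itw i \<alpha> \<beta> w"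
    unfolding itw_def right_diff_distrib s_act(2)[OF dK(3,1)] by (simp add: mult.commute[of ?x])
  finally show ?thesis .
qed

text \<open>The quadratic relation with \<open>diag_coeff_sum\<close> leaves 1 plus the product of
  the diagonal coefficients, which is the product in \<open>coeff_product\<close>. Where this
  product is nonzero, the intertwiner is injective.\<close>

lemma itw_itw: "itw i \<beta> \<alpha> (itw i \<alpha> \<beta> w) = s (swap_coeff \<alpha> \<beta> * swap_coeff \<beta> \<alpha>) * w"
proof -
  let ?a = "diag_coeff \<alpha> \<beta>" and ?b = "diag_coeff \<beta> \<alpha>"
  have k: "kap p i = ?a + ?b" using diag_coeff_sum[OF sep] kap_pos by simp
  have "itw i \<beta> \<alpha> (itw i \<alpha> \<beta> w) = G i * (G i * w) - s ?a * (G i * w) - (s ?b * (G i * w) - s (?b * ?a) * w)"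
    unfolding itw_def right_diff_distrib s_act(3)[OF dK(1,1), of "G i"] s_act(2)[OF dK(2,1)] ..
  also have "\<dots> = w + s (?b * ?a) * w"
    unfolding GG_act[OF w i] k s_add[OF dK(1,2)] by (simp add: distrib_right)
  also have "\<dots> = s (1 + ?a * ?b) * w"
    using teigD(1)[OF w] dK by (simp add: s_add Fm_closed distrib_right s_one mult.commute)
  finally show ?thesis using coeff_product[OF sep] by simp
qed

end

end

lemma wtD:
  assumes "wt i p \<tau> w"
  shows "teig p w" "std_seq d m i \<tau>" "1 \<le> j \<Longrightarrow> j \<le> i \<Longrightarrow> node_pos (\<tau> j) = p j"
    "1 \<le> j \<Longrightarrow> j \<le> i \<Longrightarrow> JM j * w = s (node_content (\<tau> j)) * w"
    "1 \<le> j \<Longrightarrow> j \<le> i \<Longrightarrow> valid_node d m (\<tau> j)"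
  using assms std_seq_valid[of d m i \<tau> j] by (auto simp: wt_def)

lemma wt_le: "wt i p \<tau> w \<Longrightarrow> k \<le> i \<Longrightarrow> wt k p \<tau> w"
  unfolding wt_def using std_seq_mono[of d m i \<tau> k] by auto

lemma wt_JM:
  assumes "wt i p \<tau> w" "i \<le> n" "1 \<le> j" "j \<le> n"
  shows "wt i p \<tau> (JM j * w)"
  unfolding wt_def
proof (intro conjI ballI)
  fix k assume "k \<in> {1..i}"
  then have k: "1 \<le> k" "k \<le> i" "k \<le> n" using assms by auto
  have c: "node_content (\<tau> k) \<in> K" using wt_content[OF assms(1), of k] k by simp
  have "JM k * (JM j * w) = JM j * (JM k * w)"
    using JM_commute[OF k(1,3) assms(3,4)] by (simp only: mult.assoc[symmetric])
  then show "JM k * (JM j * w) = s (node_content (\<tau> k)) * (JM j * w)"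
    using wtD(4)[OF assms(1) k(1,2)] s_act(3)[OF c c] by simp
  show "node_pos (\<tau> k) = p k" by (rule wtD(3)[OF assms(1) k(1,2)])
qed (use teig_JM[OF wtD(1)[OF assms(1)] assms(3,4)] wtD(2)[OF assms(1)] in auto)

lemma wt_G:
  assumes "wt k p \<tau> w" "k < i" "i < n"
  shows "wt k (p \<circ> swap i) \<tau> (G i * w)"
  unfolding wt_def
proof (intro conjI ballI)
  show "teig (p \<circ> swap i) (G i * w)" using teig_G[OF wtD(1)[OF assms(1)]] assms by simp
  show "std_seq d m k \<tau>" by (rule wtD(2)[OF assms(1)])
  fix j assume "j \<in> {1..k}"
  then have j: "1 \<le> j" "j \<le> k" by auto
  show "node_pos (\<tau> j) = (p \<circ> swap i) j"
    using wtD(3)[OF assms(1) j] j assms by simp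
  have c: "node_content (\<tau> j) \<in> K" using wt_content[OF assms(1), of j] j by simp
  show "JM j * (G i * w) = s (node_content (\<tau> j)) * (G i * w)"
    using JM_G_other[of j i w] wtD(4)[OF assms(1) j] j assms s_act(3)[OF c c] by simp
qed

text \<open>Only the first k < i eigenvalues are claimed, so \<alpha> and \<beta> have to match p
  but not \<tau>.\<close>

lemma wt_itw:
  assumes "wt k p \<tau> w" "k < i" "i < n" "p i = node_pos \<alpha>" "p (Suc i) = node_pos \<beta>"
    "valid_node d m \<alpha>" "valid_node d m \<beta>"
  shows "wt k (p \<circ> swap i) \<tau> (itw i \<alpha> \<beta> w)"
proof -
  have i: "1 \<le> i" using assms by simp
  show ?thesis
    unfolding wt_def
  proof (intro conjI ballI)
    show "teig (p \<circ> swap i) (itw i \<alpha> \<beta> w)" by (rule itw_teig[OF i assms(3) wtD(1)[OF assms(1)] assms(4-7)])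
    show "std_seq d m k \<tau>" by (rule wtD(2)[OF assms(1)])
    fix j assume "j \<in> {1..k}"
    then have j: "1 \<le> j" "j \<le> k" by auto
    show "node_pos (\<tau> j) = (p \<circ> swap i) j" using wtD(3)[OF assms(1) j] j assms by simp
    show "JM j * itw i \<alpha> \<beta> w = s (node_content (\<tau> j)) * itw i \<alpha> \<beta> w"
      using j assms wt_content[OF assms(1), of j] wtD(4)[OF assms(1) j]
      by (intro itw_JM_other[OF i assms(3) wtD(1)[OF assms(1)] assms(4-7)]) auto
  qed
qed

text \<open>An admissible exchange loses no vector and does not disturb later Jucys-Murphy
  eigenvalues. The last clause is used when \<open>no_return\<close> moves an entry while the
  eigenvalue of X_(i+1) is fixed.\<close>

lemma wt_swap:
  assumes "wt i p \<tau> w" "1 \<le> j" "j < i" "i \<le> n" "\<not> covers (\<tau> j) (\<tau> (Suc j))"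
  shows "wt i (p \<circ> swap j) (\<tau> \<circ> swap j) (itw j (\<tau> j) (\<tau> (Suc j)) w)"
    and "itw j (\<tau> j) (\<tau> (Suc j)) w = 0 \<Longrightarrow> w = 0"
    and "\<lbrakk>i < k; k \<le> n; c \<in> K; JM k * w = s c * w\<rbrakk> \<Longrightarrow>
      JM k * itw j (\<tau> j) (\<tau> (Suc j)) w = s c * itw j (\<tau> j) (\<tau> (Suc j)) w"
proof -
  note W = wtD[OF assms(1)]
  have jn: "j < n" using assms by simp
  have pos: "p j = node_pos (\<tau> j)" "p (Suc j) = node_pos (\<tau> (Suc j))" using W(3)[of j] W(3)[of "Suc j"] assms by auto
  have v: "valid_node d m (\<tau> j)" "valid_node d m (\<tau> (Suc j))" using W(5)[of j] W(5)[of "Suc j"] assms by auto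
  have sep: "separated (\<tau> j) (\<tau> (Suc j))" using std_seq_separated[OF W(2)] assms by simp
  have JM: "JM j * w = s (node_content (\<tau> j)) * w" "JM (Suc j) * w = s (node_content (\<tau> (Suc j))) * w"
    using W(4)[of j] W(4)[of "Suc j"] assms by auto
  note ctx = assms(2) jn W(1) pos v
  show "wt i (p \<circ> swap j) (\<tau> \<circ> swap j) (itw j (\<tau> j) (\<tau> (Suc j)) w)"
    unfolding wt_def
  proof (intro conjI ballI)
    show "teig (p \<circ> swap j) (itw j (\<tau> j) (\<tau> (Suc j)) w)" by (rule itw_teig[OF ctx])
    show "std_seq d m i (\<tau> \<circ> swap j)" by (rule std_seq_swap[OF W(2) assms(2,3,5)])
    fix k assume "k \<in> {1..i}"
    then have k: "1 \<le> k" "k \<le> i" "k \<le> n" using assms by auto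
    have "1 \<le> swap j k" "swap j k \<le> i" using yh.swap_mem[OF assms(2,3) k(1,2)] by auto
    then show "node_pos ((\<tau> \<circ> swap j) k) = (p \<circ> swap j) k" using W(3) by simp
    consider "k = j" | "k = Suc j" | "k \<noteq> j" "k \<noteq> Suc j" by blast
    then show "JM k * itw j (\<tau> j) (\<tau> (Suc j)) w = s (node_content ((\<tau> \<circ> swap j) k)) * itw j (\<tau> j) (\<tau> (Suc j)) w"
    proof cases
      case 1
      then show ?thesis using itw_JM_i[OF ctx sep JM] by simp
    next
      case 2
      then show ?thesis using itw_JM_Suc[OF ctx sep JM] by simp
    next
      case 3
      then show ?thesis
        using itw_JM_other[OF ctx k(1,3) 3 _ W(4)[OF k(1,2)]] wt_content[OF assms(1), of k] k by (simp add: swap_other)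
    qed
  qed
  show "w = 0" if "itw j (\<tau> j) (\<tau> (Suc j)) w = 0"
  proof -
    have "s (swap_coeff (\<tau> j) (\<tau> (Suc j)) * swap_coeff (\<tau> (Suc j)) (\<tau> j)) * w = 0"
      unfolding itw_itw[OF ctx sep JM, symmetric] that by (simp add: itw_def)
    moreover have "swap_coeff (\<tau> j) (\<tau> (Suc j)) * swap_coeff (\<tau> (Suc j)) (\<tau> j) \<in> K"
      by (intro Fm_closed coeff_closed[OF v] coeff_closed[OF v(2,1)])
    moreover have "swap_coeff (\<tau> j) (\<tau> (Suc j)) * swap_coeff (\<tau> (Suc j)) (\<tau> j) \<noteq> 0"
      using std_seq_swap_coeff_nz[OF W(2) assms(2,3,5)] by simp
    ultimately show ?thesis using s_cancel teigD(1)[OF W(1)] by blast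
  qed
  show "JM k * itw j (\<tau> j) (\<tau> (Suc j)) w = s c * itw j (\<tau> j) (\<tau> (Suc j)) w"
    if "i < k" "k \<le> n" "c \<in> K" "JM k * w = s c * w"
    using that assms by (intro itw_JM_other[OF ctx]) auto
qed

end

section \<open>The weights are contents of standard tableaux\<close>

context hecke_ring
begin

definition next_contents :: "nat \<Rightarrow> (nat \<Rightarrow> nat) \<Rightarrow> (nat \<Rightarrow> dm_node) \<Rightarrow> laurent fract set" where
  "next_contents i p \<tau> = node_content ` {\<alpha>. addable d m (\<tau> ` {1..i}) \<alpha> \<and> node_pos \<alpha> = p (Suc i)}"

text \<open>X_(i+1) acts semisimply on weight vectors of level i, with eigenvalues among the
  contents of addable nodes of the right position. Proving this for all i < n is the core of the
  argument.\<close>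

definition annihilated :: "nat \<Rightarrow> bool" where
  "annihilated i \<longleftrightarrow> (\<forall>p \<tau> w. wt i p \<tau> w \<longrightarrow>
     (\<exists>bs. distinct bs \<and> set bs \<subseteq> next_contents i p \<tau> \<and> ann s (JM (Suc i)) bs w = 0))"

lemma next_contents_K: "next_contents i p \<tau> \<subseteq> K"
  unfolding next_contents_def using node_content_closed addableD(1) by blast

lemma annihilated_eigenvalue:
  assumes "annihilated i" "wt i p \<tau> w" "c \<in> K" "JM (Suc i) * w = s c * w" "w \<noteq> 0"
  shows "c \<in> next_contents i p \<tau>"
proof -
  obtain bs where bs: "set bs \<subseteq> next_contents i p \<tau>" "ann s (JM (Suc i)) bs w = 0"
    using assms(1,2) unfolding annihilated_def by blast
  have "c \<in> set bs"
    using ann_eigen_zero(2)[OF subset_trans[OF bs(1) next_contents_K] assms(3,4) teigD(1)[OF wtD(1)[OF assms(2)]]]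
      bs(2) assms(5) by blast
  then show ?thesis using bs(1) by blast
qed

lemma addable_empty: "1 \<le> k \<Longrightarrow> k \<le> d \<Longrightarrow> 1 \<le> l \<Longrightarrow> l \<le> m \<Longrightarrow> addable d m {} ((1, 1), k, l)"
  by (auto simp: addable_def valid_node_def covers_def)

text \<open>Addable to the empty diagram are the corners, with contents v_l, so this is the
  cyclotomic relation.\<close>

lemma annihilated_0: "annihilated 0"
  unfolding annihilated_def
proof (intro allI impI)
  fix p \<tau> w assume w: "wt 0 p \<tau> w"
  have k: "1 \<le> p 1" "p 1 \<le> d" using teigD(3)[OF wtD(1)[OF w], of 1] n_pos by auto
  have "distinct (map vF [1..<m + 1])"
  proof -
    have "inj_on vF {1..m}" by (rule inj_onI) (use content_inj[where k = 0 and k' = 0] in force)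
    then show ?thesis by (simp add: distinct_map atLeastLessThanSuc_atLeastAtMost del: upt_Suc)
  qed
  moreover have "set (map vF [1..<m + 1]) \<subseteq> next_contents 0 p \<tau>"
  proof
    fix c assume "c \<in> set (map vF [1..<m + 1])"
    then obtain l where l: "1 \<le> l" "l \<le> m" "c = vF l" by (auto simp del: upt_Suc)
    then have "addable d m (\<tau> ` {1..0}) ((1, 1), p 1, l)" using addable_empty[OF k l(1,2)] by simp
    moreover have "node_content ((1, 1), p 1, l) = c" "node_pos ((1, 1), p 1, l) = p (Suc 0)" using l by simp_all
    ultimately show "c \<in> next_contents 0 p \<tau>" unfolding next_contents_def by force
  qed
  moreover have "ann s (JM (Suc 0)) (map vF [1..<m + 1]) w = 0"
  proof -
    \<comment> \<open>Right multiplication by w carries the relation from the unit of the corner to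
      w.\<close>
    have "(\<lambda>v. v * w) (ann s X1 (map vF [1..<m + 1]) e) = ann s X1 (map vF [1..<m + 1]) (e * w)"
      by (rule ann_transport[where P = "\<lambda>_. True"]) (simp_all add: mult.assoc left_diff_distrib)
    then show ?thesis using cyc teigD(1)[OF wtD(1)[OF w]] by (simp add: JM_1)
  qed
  ultimately show "\<exists>bs. distinct bs \<and> set bs \<subseteq> next_contents 0 p \<tau> \<and> ann s (JM (Suc 0)) bs w = 0" by blast
qed

lemma content_shift_iff:
  assumes "valid_node d m \<alpha>" "valid_node d m \<beta>" "node_pos \<alpha> = node_pos \<beta>"
  shows "node_content \<beta> = qF powi (2 * j) * node_content \<alpha> \<longleftrightarrow> snd \<alpha> = snd \<beta> \<and> diag \<beta> = diag \<alpha> + j"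
  using node_content_shift[OF assms(1,2), of j] assms(3) by (auto simp: prod_eq_iff node_pos_eq)

text \<open>For contents x and y the diagonal coefficients agree only if x^2 = y^2. Adjacent
  contents differ by q^2 or its inverse, so x = y and x = -y are both impossible.\<close>

lemma covers_coeff:
  assumes "valid_node d m \<alpha>" "valid_node d m \<beta>" "covers \<alpha> \<beta>"
  shows "separated \<alpha> \<beta>" "diag_coeff \<alpha> \<beta> \<noteq> 0" "diag_coeff \<beta> \<alpha> \<noteq> 0" "diag_coeff \<alpha> \<beta> \<noteq> diag_coeff \<beta> \<alpha>"
proof -
  have cd: "snd \<alpha> = snd \<beta>" "\<bar>diag \<alpha> - diag \<beta>\<bar> = 1" using covers_diag[OF assms(3)] by auto
  then have pos: "node_pos \<alpha> = node_pos \<beta>" by (simp add: node_pos_eq)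
  define x y where "x = node_content \<alpha>" and "y = node_content \<beta>"
  have ne: "x \<noteq> y" using node_content_eq_iff[OF assms(1,2) pos] cd by (auto simp: x_def y_def)
  then show sep: "separated \<alpha> \<beta>" by (simp add: separated_def x_def y_def)
  have nz: "x \<noteq> 0" "y \<noteq> 0" by (simp_all add: x_def y_def)
  have c: "diag_coeff \<alpha> \<beta> = y * (qF - inverse qF) / (y - x)" "diag_coeff \<beta> \<alpha> = x * (qF - inverse qF) / (x - y)"
    using pos by (simp_all add: diag_coeff_def x_def y_def)
  show "diag_coeff \<alpha> \<beta> \<noteq> 0" "diag_coeff \<beta> \<alpha> \<noteq> 0" unfolding c using ne nz q_diff_nz by simp_all
  \<comment> \<open>A zero sum would force q^2 = -1.\<close>
  have "x + y \<noteq> 0"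
  proof
    assume "x + y = 0"
    then have xy: "x = - y" by (simp add: eq_neg_iff_add_eq_0)
    consider "diag \<beta> = diag \<alpha> + 1" | "diag \<alpha> = diag \<beta> + 1" using cd(2) by linarith
    then show False
    proof cases
      case 1
      then have "y = qF powi (2 * 1) * x"
        using content_shift_iff[OF assms(1,2) pos, of 1] cd(1) by (simp add: x_def y_def)
      then have h: "y = qF\<^sup>2 * x" by simp
      have "qF\<^sup>2 * y = - (qF\<^sup>2 * x)" by (simp add: xy)
      also have "\<dots> = (- 1) * y" using h by simp
      finally have "qF\<^sup>2 * y = (- 1) * y" .
      then show False using qF_sq_neq_neg1 nz(2) by (simp only: mult_cancel_right) simp
    next
      case 2
      then have "x = qF powi (2 * 1) * y"
        using content_shift_iff[OF assms(2,1) pos[symmetric], of 1] cd(1) by (simp add: x_def y_def)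
      then have "qF\<^sup>2 * y = (- 1) * y" using xy by simp
      then show False using qF_sq_neq_neg1 nz(2) by (simp only: mult_cancel_right) simp
    qed
  qed
  show "diag_coeff \<alpha> \<beta> \<noteq> diag_coeff \<beta> \<alpha>"
  proof
    assume "diag_coeff \<alpha> \<beta> = diag_coeff \<beta> \<alpha>"
    then have eq: "y * (qF - inverse qF) / (y - x) = x * (qF - inverse qF) / (x - y)" unfolding c .
    define \<kappa> where "\<kappa> = qF - inverse qF"
    have "x - y \<noteq> 0" "y - x \<noteq> 0" using ne by auto
    then have "\<kappa> = 0 \<or> x * x = y * y"
      using eq[folded \<kappa>_def] by (simp add: divide_simps) (auto simp: algebra_simps)
    then show False using \<open>x + y \<noteq> 0\<close> ne q_diff_nz by (auto simp: \<kappa>_def square_eq_iff)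
  qed
qed

lemma image_atLeastAtMost_Suc: "\<tau> ` {1..Suc k} = insert (\<tau> (Suc k)) (\<tau> ` {1..k})"
proof -
  have "{1..Suc k} = insert (Suc k) {1..k}" by auto
  then show ?thesis by (simp only: image_insert)
qed

text \<open>A vector whose contents at three consecutive places are \<open>c\<close>, \<open>c q\<^sup>\<plusminus>\<^sup>2\<close>, \<open>c\<close> would be a common eigenvector
  of \<open>g\<^sub>k\<^sub>+\<^sub>1\<close> and \<open>g\<^sub>k\<^sub>+\<^sub>2\<close> with different eigenvalues, contradicting the braid relation.\<close>

lemma no_return_base:
  assumes ann: "annihilated k" "annihilated (Suc k)"
    and w: "wt (Suc (Suc k)) p \<tau> w" and n: "Suc (Suc k) < n"
    and cov: "covers (\<tau> (Suc k)) (\<tau> (Suc (Suc k)))"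
    and JM: "JM (Suc (Suc (Suc k))) * w = s (node_content (\<tau> (Suc k))) * w"
    and pos: "p (Suc (Suc (Suc k))) = node_pos (\<tau> (Suc (Suc k)))"
  shows "w = 0"
proof (rule ccontr)
  assume nz: "w \<noteq> 0"
  define i where "i = Suc k"
  define \<gamma> \<alpha> where "\<gamma> = \<tau> i" and "\<alpha> = \<tau> (Suc i)"
  note W = wtD[OF w]
  have w1: "wt k p \<tau> w" "wt i p \<tau> w" using wt_le[OF w] by (auto simp: i_def)
  have in': "1 \<le> i" "i < n" "1 \<le> Suc i" "Suc i < n" using n by (auto simp: i_def)
  have v: "valid_node d m \<gamma>" "valid_node d m \<alpha>" using W(5) by (auto simp: \<gamma>_def \<alpha>_def i_def)
  have cg: "covers \<gamma> \<alpha>" using cov by (simp add: \<gamma>_def \<alpha>_def i_def)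
  have sd: "snd \<gamma> = snd \<alpha>" using covers_diag[OF cg] by simp
  have psd: "node_pos \<gamma> = node_pos \<alpha>" using sd by (simp add: node_pos_eq)
  have p: "p i = node_pos \<gamma>" "p (Suc i) = node_pos \<alpha>" "p (Suc (Suc i)) = node_pos \<gamma>"
    using W(3)[of i] W(3)[of "Suc i"] pos psd by (simp_all add: \<gamma>_def \<alpha>_def i_def)
  have J: "JM i * w = s (node_content \<gamma>) * w" "JM (Suc i) * w = s (node_content \<alpha>) * w"
    "JM (Suc (Suc i)) * w = s (node_content \<gamma>) * w"
    using W(4)[of i] W(4)[of "Suc i"] JM by (simp_all add: \<gamma>_def \<alpha>_def i_def)
  have sep: "separated \<gamma> \<alpha>" "separated \<alpha> \<gamma>" using covers_coeff(1)[OF v cg] separated_sym by blast+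
  have c: "node_content \<alpha> \<in> K" "node_content \<gamma> \<in> K" using node_content_closed v by auto
  have D: "down_closed d m (\<tau> ` {1..k})" "addable d m (\<tau> ` {1..k}) \<gamma>" "addable d m (insert \<gamma> (\<tau> ` {1..k})) \<alpha>"
    using W(2) std_seq_down_closed[of d m k \<tau>] unfolding std_seq_Suc image_atLeastAtMost_Suc
    by (auto simp: \<gamma>_def \<alpha>_def i_def)
  define u where "u = itw i \<gamma> \<alpha> w"
  have u: "wt k (p \<circ> swap i) \<tau> u" unfolding u_def
    by (rule wt_itw[OF w1(1) _ in'(2) p(1,2) v]) (simp add: i_def)
  have "JM (Suc k) * u = s (node_content \<alpha>) * u"
    using itw_JM_i[OF in'(1,2) W(1) p(1,2) v sep(1) J(1,2)] by (simp add: u_def i_def)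
  \<comment> \<open>A nonzero u would be a weight vector of level k whose next content is that of
    \<alpha>. No node addable at that level has this content, since \<alpha> becomes available only
    after \<gamma>.\<close>
  then have "u = 0"
  proof (rule contrapos_pp)
    assume "u \<noteq> 0"
    show "JM (Suc k) * u \<noteq> s (node_content \<alpha>) * u"
    proof
      assume "JM (Suc k) * u = s (node_content \<alpha>) * u"
      from annihilated_eigenvalue[OF ann(1) u c(1) this \<open>u \<noteq> 0\<close>]
      obtain \<delta> where \<delta>: "addable d m (\<tau> ` {1..k}) \<delta>" "node_pos \<delta> = node_pos \<alpha>" "node_content \<delta> = node_content \<alpha>"
        using p(2) by (auto simp: next_contents_def i_def)
      then have "snd \<delta> = snd \<alpha>" "diag \<delta> = diag \<alpha>"
        using node_content_eq_iff[OF addableD(1)[OF \<delta>(1)] v(2) \<delta>(2)] by auto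
      then show False using covered_not_addable_diag[OF D cg \<delta>(1)] by blast
    qed
  qed
  then have G1: "G i * w = s (diag_coeff \<gamma> \<alpha>) * w" using G_itw[of i w \<gamma> \<alpha>] by (simp add: u_def)
  define u' where "u' = itw (Suc i) \<alpha> \<gamma> w"
  have u': "wt i (p \<circ> swap (Suc i)) \<tau> u'" unfolding u'_def
    by (rule wt_itw[OF w1(2) _ in'(4) p(2,3) v(2,1)]) simp
  have J': "JM (Suc i) * u' = s (node_content \<gamma>) * u'"
    using itw_JM_i[OF in'(3,4) W(1) p(2,3) v(2,1) sep(2) J(2,3)] by (simp add: u'_def)
  have "u' = 0"
  proof (rule ccontr)
    assume "u' \<noteq> 0"
    from annihilated_eigenvalue[OF ann(2)[folded i_def] u' c(2) J' this]
    obtain \<delta> where \<delta>: "addable d m (\<tau> ` {1..i}) \<delta>" "node_pos \<delta> = node_pos \<gamma>" "node_content \<delta> = node_content \<gamma>"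
      using p(3) by (auto simp: next_contents_def)
    then have sdd: "snd \<delta> = snd \<gamma>" "diag \<delta> = diag \<gamma>"
      using node_content_eq_iff[OF addableD(1)[OF \<delta>(1)] v(1) \<delta>(2)] by auto
    have im: "\<tau> ` {1..i} = insert \<gamma> (\<tau> ` {1..k})" unfolding i_def image_atLeastAtMost_Suc by (simp add: \<gamma>_def i_def)
    show False
      using addable_not_above_covered[OF down_closed_insert[OF D(1,2)] _ D(3) cg _ sdd] \<delta>(1) unfolding im by blast
  qed
  then have G2: "G (Suc i) * w = s (diag_coeff \<alpha> \<gamma>) * w" using G_itw[of "Suc i" w \<alpha> \<gamma>] by (simp add: u'_def)
  define a b where "a = diag_coeff \<gamma> \<alpha>" and "b = diag_coeff \<alpha> \<gamma>"
  have K: "a \<in> K" "b \<in> K" using coeff_closed(1)[OF v] coeff_closed(1)[OF v(2,1)] by (simp_all add: a_def b_def)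
  note GA = G1[folded a_def] G2[folded b_def]
  have "G i * (G (Suc i) * (G i * w)) = G (Suc i) * (G i * (G (Suc i) * w))"
    using braid[of i] in' by (simp add: mult.assoc[symmetric])
  moreover have "G i * (G (Suc i) * (G i * w)) = s (a * (b * a)) * w"
    unfolding GA s_act(3)[OF K(1,1), of "G (Suc i)"] s_act(3)[OF K(1,1), of "G i"] s_act(3)[OF K(2,2), of "G i"]
      s_act(2)[OF K(2,1)] s_act(2)[OF K(1) Fm_closed(6)[OF K(2,1)]] ..
  moreover have "G (Suc i) * (G i * (G (Suc i) * w)) = s (b * (a * b)) * w"
    unfolding GA s_act(3)[OF K(2,2), of "G i"] s_act(3)[OF K(2,2), of "G (Suc i)"] s_act(3)[OF K(1,1), of "G (Suc i)"]
      s_act(2)[OF K(1,2)] s_act(2)[OF K(2) Fm_closed(6)[OF K(1,2)]] ..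
  ultimately have "s (a * (b * a) - b * (a * b)) * w = 0"
    using K by (simp add: s_diff Fm_closed left_diff_distrib)
  moreover have "a * (b * a) - b * (a * b) = a * b * (a - b)" by (simp add: algebra_simps)
  moreover have "a * b * (a - b) \<noteq> 0" using covers_coeff[OF v cg] by (simp add: a_def b_def)
  moreover have "a * b * (a - b) \<in> K" using K by (intro Fm_closed)
  ultimately show False using s_cancel[OF _ _ teigD(1)[OF W(1)]] nz by metis
qed

text \<open>Exchange the entry j upwards until it stands directly before i; then
  \<open>no_return_base\<close> applies. The exchanges are admissible and injective because no other
  entry below i sits on a node covered by that of j.\<close>

lemma no_return:
  assumes ann: "\<And>k. k < i \<Longrightarrow> annihilated k" and i: "i < n"
  shows "\<lbrakk>wt i p \<tau> w; 1 \<le> j; j < i; covers (\<tau> j) (\<tau> i);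
     \<And>r. 1 \<le> r \<Longrightarrow> r < i \<Longrightarrow> \<not> covers (\<tau> j) (\<tau> r);
     JM (Suc i) * w = s (node_content (\<tau> j)) * w; p (Suc i) = node_pos (\<tau> i)\<rbrakk> \<Longrightarrow> w = 0"
proof (induction "i - j" arbitrary: j p \<tau> w rule: less_induct)
  case less
  note W = wtD[OF less.prems(1)]
  show ?case
  proof (cases "Suc j = i")
    case True
    then obtain k where k: "j = Suc k" "i = Suc (Suc k)" using less.prems(2) by (cases j) auto
    show ?thesis
    proof (rule no_return_base)
      show "annihilated k" "annihilated (Suc k)" using ann k(2) by simp_all
      show "wt (Suc (Suc k)) p \<tau> w" "Suc (Suc k) < n" using less.prems(1) i unfolding k(2) .
      show "covers (\<tau> (Suc k)) (\<tau> (Suc (Suc k)))" using less.prems(4) unfolding k .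
      show "JM (Suc (Suc (Suc k))) * w = s (node_content (\<tau> (Suc k))) * w" using less.prems(6) unfolding k .
      show "p (Suc (Suc (Suc k))) = node_pos (\<tau> (Suc (Suc k)))" using less.prems(7) unfolding k .
    qed
  next
    case False
    then have j: "Suc j < i" using less.prems by simp
    have nc: "\<not> covers (\<tau> j) (\<tau> (Suc j))" using less.prems(5)[of "Suc j"] j by simp
    have jn: "i \<le> n" using i by simp
    define u where "u = itw j (\<tau> j) (\<tau> (Suc j)) w"
    note sw = wt_swap[OF less.prems(1,2,3) jn nc, folded u_def]
    have "u = 0"
    proof (rule less.hyps[of "Suc j" "p \<circ> swap j" "\<tau> \<circ> swap j" u])
      show "wt i (p \<circ> swap j) (\<tau> \<circ> swap j) u" by (rule sw(1))
      have \<tau>i: "(\<tau> \<circ> swap j) i = \<tau> i" using j by simp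
      show "covers ((\<tau> \<circ> swap j) (Suc j)) ((\<tau> \<circ> swap j) i)" unfolding \<tau>i using less.prems(4) by simp
      show "\<not> covers ((\<tau> \<circ> swap j) (Suc j)) ((\<tau> \<circ> swap j) r)" if "1 \<le> r" "r < i" for r
        using less.prems(5)[of "swap j r"] that j less.prems(2) covers_le[of "\<tau> j" "\<tau> j"]
        by (cases "r = j \<or> r = Suc j") auto
      show "JM (Suc i) * u = s (node_content ((\<tau> \<circ> swap j) (Suc j))) * u"
        using sw(3)[of "Suc i"] i less.prems(6) node_content_closed[OF W(5)[of j]] less.prems(2,3) by simp
      show "(p \<circ> swap j) (Suc i) = node_pos ((\<tau> \<circ> swap j) i)" unfolding \<tau>i using less.prems(7) j by simp
    qed (use j in auto)
    then show ?thesis by (rule sw(2))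
  qed
qed

lemma qF_shift_closed: "c \<in> K \<Longrightarrow> qF powi (2 * j) * c \<in> K"
  by (intro Fm_closed Fm_powi Fm_indets)

text \<open>An eigenvector of the next Jucys--Murphy element whose content is not that of an addable node vanishes.\<close>

lemma neighbour_addable:
  assumes ann: "\<And>k. k < i \<Longrightarrow> annihilated k" and i: "1 \<le> i" "i < n"
    and w: "wt i p \<tau> w" "w \<noteq> 0" and pos: "p (Suc i) = p i"
    and J: "JM (Suc i) * w = s (qF powi (2 * j) * node_content (\<tau> i)) * w" and j: "j = 1 \<or> j = - 1"
  shows "qF powi (2 * j) * node_content (\<tau> i) \<in> next_contents i p \<tau>"
proof -
  note W = wtD[OF w(1)]
  define \<alpha> where "\<alpha> = \<tau> i"
  have v: "valid_node d m \<alpha>" using W(5)[of i] i by (simp add: \<alpha>_def)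
  \<comment> \<open>The neighbour of the last node with the content in question: to the right for j
    = 1, below for j = -1.\<close>
  define \<beta> :: dm_node where "\<beta> = (if j = 1 then ((row \<alpha>, Suc (col \<alpha>)), snd \<alpha>) else ((Suc (row \<alpha>), col \<alpha>), snd \<alpha>))"
  have \<beta>: "valid_node d m \<beta>" "covers \<alpha> \<beta>" "snd \<beta> = snd \<alpha>" "diag \<beta> = diag \<alpha> + j"
    using v j by (auto simp: \<beta>_def valid_node_def covers_def diag_def)
  have posb: "node_pos \<alpha> = node_pos \<beta>" using \<beta>(3) by (simp add: node_pos_eq)
  have cb: "node_content \<beta> = qF powi (2 * j) * node_content (\<tau> i)"
    using content_shift_iff[OF v \<beta>(1) posb, of j] \<beta>(3,4) by (simp add: \<alpha>_def)
  have a: "addable d m (\<tau> ` {1..<i}) \<alpha>" using std_seq_addable[OF W(2), of i] i by (simp add: \<alpha>_def)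
  have dc: "down_closed d m (\<tau> ` {1..i})" by (rule std_seq_down_closed[OF W(2)])
  have im: "\<tau> ` {1..i} = insert \<alpha> (\<tau> ` {1..<i})"
  proof -
    have "{1..i} = insert i {1..<i}" using i by auto
    then show ?thesis by (simp add: \<alpha>_def)
  qed
  have bn: "\<beta> \<notin> \<tau> ` {1..i}"
  proof
    assume "\<beta> \<in> \<tau> ` {1..i}"
    then have "\<beta> \<in> \<tau> ` {1..<i}" using im covers_le[OF \<beta>(2)] by auto
    moreover have "down_closed d m (\<tau> ` {1..<i})" using std_seq_down_closed_less[OF W(2), of i] i by simp
    ultimately show False
      using down_closed_le[of d m _ \<beta> \<alpha>] covers_le[OF \<beta>(2)] v addableD(2)[OF a] by blast
  qed
  show ?thesis
  proof (cases "addable d m (\<tau> ` {1..i}) \<beta>")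
    case True
    then have "\<beta> \<in> {\<alpha>. addable d m (\<tau> ` {1..i}) \<alpha> \<and> node_pos \<alpha> = p (Suc i)}"
      using posb pos W(3)[of i] i by (simp add: \<alpha>_def)
    then show ?thesis unfolding next_contents_def cb[symmetric] by (rule imageI)
  next
    case False
    then obtain \<delta> where \<delta>: "valid_node d m \<delta>" "covers \<delta> \<beta>" "\<delta> \<notin> \<tau> ` {1..i}"
      using \<beta>(1) bn unfolding addable_def by blast
    have "\<delta> \<noteq> \<alpha>" using \<delta>(3) im by auto
    \<comment> \<open>If \<beta> is not addable, its other predecessor \<delta> is missing. The node
      \<gamma> before both \<alpha> and \<delta> has the content of \<beta>, and as \<delta> is
      missing, \<alpha> is the only filled node covering it, so \<open>no_return\<close>
      applies.\<close>
    define \<gamma> :: dm_node where "\<gamma> = (if j = 1 then ((row \<alpha> - 1, col \<alpha>), snd \<alpha>) else ((row \<alpha>, col \<alpha> - 1), snd \<alpha>))"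
    have \<delta>': "snd \<delta> = snd \<alpha>" "j = 1 \<Longrightarrow> Suc (row \<delta>) = row \<alpha> \<and> col \<delta> = Suc (col \<alpha>)"
      "j = - 1 \<Longrightarrow> row \<delta> = Suc (row \<alpha>) \<and> Suc (col \<delta>) = col \<alpha>"
      using \<delta>(2) \<open>\<delta> \<noteq> \<alpha>\<close> node_eqI[of \<delta> \<alpha>] j by (auto simp: covers_def \<beta>_def split: if_splits)
    have \<gamma>: "valid_node d m \<gamma>" "covers \<gamma> \<alpha>" "diag \<gamma> = diag \<alpha> + j" "snd \<gamma> = snd \<alpha>"
      using \<delta>' \<delta>(1) v j by (auto simp: \<gamma>_def valid_node_def covers_def diag_def)
    have "\<gamma> \<in> \<tau> ` {1..<i}" using addableD(3)[OF a] \<gamma> by blast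
    then obtain r where r: "1 \<le> r" "r < i" "\<tau> r = \<gamma>" by auto
    have only: "\<not> covers (\<tau> r) (\<tau> t)" if t: "1 \<le> t" "t < i" for t
    proof
      assume "covers (\<tau> r) (\<tau> t)"
      then have ct: "covers \<gamma> (\<tau> t)" by (simp add: r)
      have "\<tau> t = \<alpha> \<or> \<tau> t = \<delta>"
        using ct \<delta>' \<gamma>(2) j unfolding covers_def \<gamma>_def prod_eq_iff by (auto split: if_splits)
      moreover have "\<tau> t \<noteq> \<alpha>"
        using inj_onD[OF std_seq_inj[OF W(2)], of t i] t i by (auto simp: \<alpha>_def)
      moreover have "\<tau> t \<in> \<tau> ` {1..i}" using t by simp
      ultimately show False using \<delta>(3) by auto
    qed
    have posg: "node_pos \<alpha> = node_pos \<gamma>" using \<gamma>(4) by (simp add: node_pos_eq)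
    have cg: "node_content \<gamma> = qF powi (2 * j) * node_content (\<tau> i)"
      using content_shift_iff[OF v \<gamma>(1) posg, of j] \<gamma>(3,4) by (simp add: \<alpha>_def)
    have "w = 0"
      by (rule no_return[OF ann i(2) w(1) r(1,2)])
        (use r \<gamma>(2) only J pos W(3)[of i] i cg in \<open>auto simp: \<alpha>_def\<close>)
    then show ?thesis using w(2) by blast
  qed
qed

end

text \<open>Multiplication by a d-th root of unity \<omega> permutes the roots and scales the sum by
  a power of \<omega>. Some \<omega> makes this factor different from 1, since z^t = 1 has only t <
  d solutions.\<close>

lemma root_power_sum:
  fixes \<xi> :: "nat \<Rightarrow> complex"
  assumes "bij_betw \<xi> {1..d} {z. z ^ d = 1}" "0 < t" "t < d"
  shows "(\<Sum>k\<in>{1..d}. (\<xi> k ^ (d - 1)) ^ t) = 0"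
proof -
  let ?R = "{z :: complex. z ^ d = 1}"
  have "\<exists>\<omega>\<in>?R. (\<omega> ^ (d - 1)) ^ t \<noteq> 1"
  proof (rule ccontr)
    assume c: "\<not> ?thesis"
    have "?R \<subseteq> {z. z ^ t = 1}"
    proof safe
      fix z :: complex assume z: "z ^ d = 1"
      have "z ^ t = (z ^ (d - 1)) ^ t * z ^ t" using c z by simp
      also have "\<dots> = (z ^ (d - 1) * z) ^ t" by (simp only: power_mult_distrib)
      also have "z ^ (d - 1) * z = 1" using z assms by (simp flip: power_Suc2)
      finally show "z ^ t = 1" by simp
    qed
    moreover have "finite {z :: complex. z ^ t = 1}" using card_roots_unity_eq[OF assms(2)] assms(2)
      by (intro card_ge_0_finite) simp
    ultimately have "card ?R \<le> t" using card_mono card_roots_unity_eq[OF assms(2)] by metis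
    then show False using card_roots_unity_eq[of d] assms by simp
  qed
  then obtain \<omega> :: complex where \<omega>: "\<omega> ^ d = 1" "(\<omega> ^ (d - 1)) ^ t \<noteq> 1" by blast
  define S where "S = (\<Sum>z\<in>?R. (z ^ (d - 1)) ^ t)"
  have "\<omega> \<noteq> 0" using \<omega>(1) assms by (auto simp: power_0_left)
  have "bij_betw (\<lambda>z. \<omega> * z) ?R ?R"
    by (rule bij_betwI[where g = "\<lambda>z. z / \<omega>"]) (use \<omega> \<open>\<omega> \<noteq> 0\<close> in \<open>auto simp: power_mult_distrib power_divide\<close>)
  then have "S = (\<Sum>z\<in>?R. ((\<omega> * z) ^ (d - 1)) ^ t)"
    unfolding S_def by (rule sum.reindex_bij_betw[symmetric])
  also have "\<dots> = (\<omega> ^ (d - 1)) ^ t * S" by (simp add: S_def power_mult_distrib sum_distrib_left)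
  finally have "S = 0" using \<omega>(2) by simp
  then show ?thesis using sum.reindex_bij_betw[OF assms(1), of "\<lambda>z. (z ^ (d - 1)) ^ t"] by (simp add: S_def)
qed

context hecke_ring
begin

section \<open>Eigenvalues of the next Jucys-Murphy element\<close>

lemma addable_insert: "addable d m D \<delta> \<Longrightarrow> \<delta> \<noteq> \<alpha> \<Longrightarrow> addable d m (insert \<alpha> D) \<delta>"
  unfolding addable_def by blast

text \<open>Here g_i squares to the identity and intertwines X_i with X_(i+1), so the annihilating
  product for X_i on g_i w serves for X_(i+1) on w. Nodes of the position p (i + 1) stay addable
  after inserting a node of another position.\<close>

lemma annihilated_different_position:
  assumes ann: "annihilated k" and i: "i = Suc k" "i < n" and w: "wt i p \<tau> w" and ne: "p i \<noteq> p (Suc i)"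
  shows "\<exists>bs. distinct bs \<and> set bs \<subseteq> next_contents i p \<tau> \<and> ann s (JM (Suc i)) bs w = 0"
proof -
  note W = wtD[OF w]
  have i1: "1 \<le> i" using i by simp
  have wk: "wt k p \<tau> w" by (rule wt_le[OF w]) (simp add: i)
  have u: "wt k (p \<circ> swap i) \<tau> (G i * w)" by (rule wt_G[OF wk _ i(2)]) (simp add: i)
  then obtain bs where bs: "distinct bs" "set bs \<subseteq> next_contents k (p \<circ> swap i) \<tau>" "ann s (JM (Suc k)) bs (G i * w) = 0"
    using ann unfolding annihilated_def by blast
  have bK: "b \<in> K" if "b \<in> set bs" for b using that bs(2) next_contents_K by blast
  have kap0: "kap p i = 0" "kap (p \<circ> swap i) i = 0" using ne by (simp_all add: kap_def)
  have "(\<lambda>v. G i * v) (ann s (JM i) bs (G i * w)) = ann s (JM (Suc i)) bs (G i * (G i * w))"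
  proof (rule ann_transport[where P = "teig (p \<circ> swap i)"])
    show "G i * (JM i * v) = JM (Suc i) * (G i * v)" if "teig (p \<circ> swap i) v" for v
      using JM_Suc_G[OF that i1 i(2)] kap0 by (simp add: s_zero)
    show "G i * (s b * v) = s b * (G i * v)" if "b \<in> set bs" for b v using s_act(3)[OF bK[OF that] bK[OF that]] .
    show "teig (p \<circ> swap i) (JM i * v - s b * v)" if "b \<in> set bs" "teig (p \<circ> swap i) v" for b v
      using that teig_JM[OF that(2) i1] i bK by (intro stableD(5)[OF teig_stable]) auto
    show "teig (p \<circ> swap i) (G i * w)" by (rule wtD(1)[OF u])
  qed (simp add: right_diff_distrib)
  then have "ann s (JM (Suc i)) bs w = 0"
    using bs(3) GG_act[OF W(1) i1 i(2)] kap0 by (simp add: i(1) s_zero)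
  moreover have "set bs \<subseteq> next_contents i p \<tau>"
  proof
    fix b assume "b \<in> set bs"
    then obtain \<delta> where \<delta>: "addable d m (\<tau> ` {1..k}) \<delta>" "node_pos \<delta> = p (Suc i)" "b = node_content \<delta>"
      using bs(2) i(1) by (auto simp: next_contents_def)
    have "\<delta> \<noteq> \<tau> i" using W(3)[OF i1 order_refl] ne \<delta>(2) by auto
    then have "addable d m (\<tau> ` {1..i}) \<delta>" unfolding i(1) image_atLeastAtMost_Suc
      using addable_insert[OF \<delta>(1)] i(1) by blast
    then show "b \<in> next_contents i p \<tau>" unfolding next_contents_def using \<delta>(2,3) by blast
  qed
  ultimately show ?thesis using bs(1) by blast
qed

text \<open>The intertwiner with denominators cleared. It makes sense without knowing that X_(i+1)
  has eigenvalues, which is just what is to be proved.\<close>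

definition phi :: "nat \<Rightarrow> 'y \<Rightarrow> 'y" where
  "phi i v = G i * (JM i * v) - G i * (JM (Suc i) * v) + s (qF - inverse qF) * (JM (Suc i) * v)"

context
  fixes i :: nat and p :: "nat \<Rightarrow> nat"
  assumes i: "1 \<le> i" "i < n" and eq: "p i = p (Suc i)"
begin

lemma kap_eq: "kap p i = qF - inverse qF"
  using eq by (simp add: kap_def)

lemma p_swap: "p \<circ> swap i = p"
  using eq by (auto simp: fun_eq_iff Transposition.transpose_def)

lemma JM_comm: "JM i * (JM (Suc i) * v) = JM (Suc i) * (JM i * v)"
  using JM_commute[of i "Suc i"] i by (simp add: mult.assoc[symmetric])

lemma phi_JM:
  assumes v: "teig p v"
  shows "phi i (JM i * v) = JM (Suc i) * phi i v" "phi i (JM (Suc i) * v) = JM i * phi i v"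
proof -
  have t: "teig p (JM i * v)" "teig p (JM (Suc i) * v)" using teig_JM[OF v] i by auto
  let ?k = "qF - inverse qF"
  note k = s_act(3)[OF kappa_closed kappa_closed]
  have "JM (Suc i) * phi i v = (G i * (JM i * (JM i * v)) + s ?k * (JM (Suc i) * (JM i * v)))
      - (G i * (JM i * (JM (Suc i) * v)) + s ?k * (JM (Suc i) * (JM (Suc i) * v))) + s ?k * (JM (Suc i) * (JM (Suc i) * v))"
    unfolding phi_def right_diff_distrib distrib_left JM_Suc_G[OF t(1) i] JM_Suc_G[OF t(2) i] kap_eq
      k[of "JM (Suc i)"] ..
  then show "phi i (JM i * v) = JM (Suc i) * phi i v" by (simp add: phi_def JM_comm)
  have "JM i * phi i v = (G i * (JM (Suc i) * (JM i * v)) - s ?k * (JM (Suc i) * (JM i * v)))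
      - (G i * (JM (Suc i) * (JM (Suc i) * v)) - s ?k * (JM (Suc i) * (JM (Suc i) * v))) + s ?k * (JM i * (JM (Suc i) * v))"
    unfolding phi_def right_diff_distrib distrib_left JM_G[OF t(1) i] JM_G[OF t(2) i] kap_eq
      k[of "JM i"] ..
  then show "phi i (JM (Suc i) * v) = JM i * phi i v" by (simp add: phi_def JM_comm)
qed

lemma phi_wt:
  assumes w: "wt k p \<tau> v" "k < i"
  shows "wt k p \<tau> (phi i v)"
proof -
  have J: "wt k p \<tau> (JM i * v)" "wt k p \<tau> (JM (Suc i) * v)" using wt_JM[OF w(1)] w(2) i by auto
  have g: "wt k p \<tau> (G i * u)" if "wt k p \<tau> u" for u using wt_G[OF that w(2) i(2)] p_swap by simp
  show ?thesis unfolding phi_def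
    using J g by (intro stableD(2,4)[OF wt_stable] stableD(3)[OF wt_stable kappa_closed])
qed

lemma G_phi: "teig p v \<Longrightarrow> G i * phi i v = JM i * v - JM (Suc i) * v + s (qF - inverse qF) * (G i * (JM i * v))"
proof -
  assume v: "teig p v"
  have t: "teig p (JM i * v)" "teig p (JM (Suc i) * v)" using teig_JM[OF v] i by auto
  show ?thesis
    unfolding phi_def right_diff_distrib distrib_left GG_act[OF t(1) i] GG_act[OF t(2) i] kap_eq
      s_act(3)[OF kappa_closed kappa_closed, of "G i"]
    by simp
qed

text \<open>If X_i acts on v by a, the right-hand side is minus the product of X_(i+1) - q^2 a and
  X_(i+1) - q^(-2) a applied to v, because q^2 + q^(-2) = 2 + (q - q^(-1))^2.\<close>

lemma phi_phi:
  assumes v: "teig p v"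
  shows "phi i (phi i v) = s (2 + (qF - inverse qF) * (qF - inverse qF)) * (JM (Suc i) * (JM i * v))
    - JM (Suc i) * (JM (Suc i) * v) - JM i * (JM i * v)"
proof -
  let ?k = "qF - inverse qF" and ?X = "JM i" and ?Y = "JM (Suc i)"
  have t: "teig p (?X * v)" "teig p (?Y * v)" using teig_JM[OF v] i by auto
  have "phi i (phi i v) = G i * phi i (?Y * v) - G i * phi i (?X * v) + s ?k * phi i (?X * v)"
    unfolding phi_JM[OF v] by (simp add: phi_def)
  also have "\<dots> = (?X * (?Y * v) - ?Y * (?Y * v) + s ?k * (G i * (?X * (?Y * v))))
      - (?X * (?X * v) - ?Y * (?X * v) + s ?k * (G i * (?X * (?X * v))))
      + s ?k * (G i * (?X * (?X * v)) - G i * (?Y * (?X * v)) + s ?k * (?Y * (?X * v)))"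
    unfolding G_phi[OF t(1)] G_phi[OF t(2)] by (simp add: phi_def)
  also have "\<dots> = (?Y * (?X * v) + ?Y * (?X * v) + s (?k * ?k) * (?Y * (?X * v))) - ?Y * (?Y * v) - ?X * (?X * v)"
    unfolding JM_comm right_diff_distrib distrib_left s_act(2)[OF kappa_closed kappa_closed]
    by (simp add: algebra_simps)
  also have "?Y * (?X * v) + ?Y * (?X * v) + s (?k * ?k) * (?Y * (?X * v)) = s (2 + ?k * ?k) * (?Y * (?X * v))"
  proof -
    have "e * (?Y * (?X * v)) = ?Y * (?X * v)" using e_JM[of "Suc i"] i by (simp add: mult.assoc[symmetric])
    moreover have "s (1 + 1 + ?k * ?k) = s 1 + s 1 + s (?k * ?k)"
      using kappa_closed by (simp only: s_add Fm_closed)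
    then have "s (2 + ?k * ?k) = e + e + s (?k * ?k)" by (simp add: s_one)
    ultimately show ?thesis by (simp add: distrib_right)
  qed
  finally show ?thesis .
qed

end

text \<open>Transport along \<open>phi\<close> of the annihilating product for X_i on
  \<open>phi i w\<close> kills \<open>phi i (phi i w)\<close>, so w is killed by X_(i+1) with roots
  q^2 a, q^(-2) a and contents of nodes addable one step earlier. These roots are distinct, so w
  splits into eigenvectors. Eigenvalues of nodes that are not addable do not occur: for q^2 a and
  q^(-2) a by \<open>neighbour_addable\<close>, for a itself by a Jordan block argument. The other
  earlier nodes are still addable.\<close>

lemma annihilated_same_position:
  assumes ann: "\<And>k. k < i \<Longrightarrow> annihilated k" and i: "i = Suc k" "i < n" and w: "wt i p \<tau> w" and eq: "p i = p (Suc i)"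
  shows "\<exists>bs. distinct bs \<and> set bs \<subseteq> next_contents i p \<tau> \<and> ann s (JM (Suc i)) bs w = 0"
proof -
  note W = wtD[OF w]
  have i1: "1 \<le> i" using i by simp
  note ctx = i1 i(2) eq
  define \<alpha> a where "\<alpha> = \<tau> i" and "a = node_content \<alpha>"
  have v: "valid_node d m \<alpha>" using W(5)[OF i1 order_refl] by (simp add: \<alpha>_def)
  have pa: "node_pos \<alpha> = p i" using W(3)[OF i1 order_refl] by (simp add: \<alpha>_def)
  have aK: "a \<in> K" and anz: "a \<noteq> 0" using node_content_closed[OF v] by (simp_all add: a_def)
  have add\<alpha>: "addable d m (\<tau> ` {1..k}) \<alpha>" and dck: "down_closed d m (\<tau> ` {1..k})"
    using W(2) std_seq_down_closed[of d m k \<tau>] unfolding i(1) std_seq_Suc by (auto simp: \<alpha>_def i(1))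
  have wk: "wt k p \<tau> w" by (rule wt_le[OF w]) (simp add: i)
  have ki: "k < i" by (simp add: i)
  define c where "c j = qF powi (2 * j) * a" for j :: int
  have cK: "c j \<in> K" for j unfolding c_def by (rule qF_shift_closed[OF aK])
  obtain bs where bs: "distinct bs" "set bs \<subseteq> next_contents k p \<tau>" "ann s (JM i) bs (phi i w) = 0"
    using ann[OF ki] phi_wt[OF ctx wk ki] unfolding annihilated_def i(1) by blast
  have bK: "b \<in> K" if "b \<in> set bs" for b using that bs(2) next_contents_K by blast
  have Xw: "JM i * w = s a * w" using W(4)[OF i1 order_refl] by (simp add: a_def \<alpha>_def)
  have cc: "c 1 + c (- 1) = (2 + (qF - inverse qF) * (qF - inverse qF)) * a" "c 1 * c (- 1) = a * a"
    by (simp_all add: c_def power_int_minus power2_eq_square field_simps)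
  define q where "q = ann s (JM (Suc i)) [c 1, c (- 1)] w"
  have pp: "phi i (phi i w) = - q" unfolding q_def
  proof -
    have "phi i (phi i w) = - ann s (JM (Suc i)) [c 1, c (- 1)] w"
  proof -
    let ?Y = "JM (Suc i)"
    have 2: "2 + (qF - inverse qF) * (qF - inverse qF) \<in> K"
    proof -
      have "(1 + 1) + (qF - inverse qF) * (qF - inverse qF) \<in> K" by (intro Fm_closed kappa_closed)
      then show ?thesis by simp
    qed
    have "phi i (phi i w) = s (c 1 + c (- 1)) * (?Y * w) - ?Y * (?Y * w) - s (c 1 * c (- 1)) * w"
      unfolding phi_phi[OF ctx W(1)] Xw s_act(3)[OF aK aK, of ?Y] s_act(3)[OF aK aK, of "JM i"] cc s_act(2)[OF 2 aK] s_act(2)[OF aK aK] ..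
    also have "\<dots> = - (?Y * (?Y * w - s (c 1) * w) - s (c (- 1)) * (?Y * w - s (c 1) * w))"
      unfolding right_diff_distrib s_act(1)[OF cK cK] s_act(2)[OF cK cK] s_act(3)[OF cK cK, of ?Y]
      by (simp add: mult.commute[of "c (- 1)"])
    finally show ?thesis by simp
  qed
    then show "phi i (phi i w) = - ann s (JM (Suc i)) [c 1, c (- 1)] w" .
  qed
  have tr: "phi i (ann s (JM i) bs (phi i w)) = ann s (JM (Suc i)) bs (phi i (phi i w))"
  proof (rule ann_transport[where P = "teig p"])
    show "phi i (JM i * v) = JM (Suc i) * phi i v" if "teig p v" for v by (rule phi_JM(1)[OF ctx that])
    show "phi i (s b * v) = s b * phi i v" if "b \<in> set bs" for b v
    proof -
      note b = bK[OF that]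
      have "s (qF - inverse qF) * (s b * x) = s b * (s (qF - inverse qF) * x)" for x by (rule s_act(3)[OF b b])
      then show ?thesis
        unfolding phi_def by (simp only: s_act(3)[OF b b, of "JM i"] s_act(3)[OF b b, of "JM (Suc i)"]
            s_act(3)[OF b b, of "G i"] right_diff_distrib distrib_left)
    qed
    show "phi i (u - v) = phi i u - phi i v" for u v by (simp add: phi_def right_diff_distrib)
    show "teig p (JM i * v - s b * v)" if "b \<in> set bs" "teig p v" for b v
      using that teig_JM[OF that(2) i1] i bK by (intro stableD(5)[OF teig_stable]) auto
    show "teig p (phi i w)" by (rule wtD(1)[OF phi_wt[OF ctx wk ki]])
  qed
  have "phi i 0 = 0" by (simp add: phi_def)
  then have "ann s (JM (Suc i)) bs q = 0" using tr unfolding bs(3) pp ann_uminus by simp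
  then have annL: "ann s (JM (Suc i)) ([c 1, c (- 1)] @ bs) w = 0" unfolding ann_append q_def[symmetric] .
  \<comment> \<open>A node with such a content would be addable together with \<alpha> on a
    neighbouring diagonal, against \<open>addable_same_diag\<close>.\<close>
  have notin: "c j \<notin> set bs" if "j = 1 \<or> j = - 1" for j
  proof
    assume "c j \<in> set bs"
    then obtain \<delta> where \<delta>: "addable d m (\<tau> ` {1..k}) \<delta>" "node_pos \<delta> = p i" "c j = node_content \<delta>"
      using bs(2) i(1) by (auto simp: next_contents_def)
    have "node_pos \<alpha> = node_pos \<delta>" using \<delta>(2) pa by simp
    then have sd: "snd \<alpha> = snd \<delta>" "diag \<delta> = diag \<alpha> + j"
      using content_shift_iff[OF v addableD(1)[OF \<delta>(1)], of j] \<delta>(3) by (auto simp: c_def a_def)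
    then have "\<alpha> = \<delta>" using addable_same_diag[OF dck add\<alpha> \<delta>(1)] that by auto
    then show False using sd that by auto
  qed
  have "c 1 \<noteq> c (- 1)"
  proof
    assume "c 1 = c (- 1)"
    then have "qF powi (2 * 1) = qF powi (2 * (- 1))" using anz by (simp only: c_def mult_cancel_right) simp
    then show False using content_inj[of 1 1 "2 * 1" "2 * (- 1)"] by simp
  qed
  then have distL: "distinct ([c 1, c (- 1)] @ bs)" using bs(1) notin by auto
  have LK: "set ([c 1, c (- 1)] @ bs) \<subseteq> K" using cK bK by auto
  define L where "L = [c 1, c (- 1)] @ bs"
  \<comment> \<open>Roots that are not contents of addable nodes may be dropped, once shown to have
    no eigenvectors.\<close>
  define bs' where "bs' = filter (\<lambda>b. b \<in> next_contents i p \<tau>) L"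
  have dec: "w \<in> add_span (\<lambda>u. wt i p \<tau> u \<and> (\<exists>b\<in>set L. JM (Suc i) * u = s b * u))"
    unfolding L_def by (rule eigen_decomp[OF wt_stable _ distL LK w annL]) (rule wt_JM; use i in simp)
  have "ann s (JM (Suc i)) bs' w = 0"
  proof (rule ann_add_span[OF dec])
    fix u assume "wt i p \<tau> u \<and> (\<exists>b\<in>set L. JM (Suc i) * u = s b * u)"
    then obtain b where u: "wt i p \<tau> u" and b: "b \<in> set L" "JM (Suc i) * u = s b * u" by blast
    have eu: "e * u = u" by (rule teigD(1)[OF wtD(1)[OF u]])
    have bs'K: "set bs' \<subseteq> K" unfolding bs'_def using next_contents_K by auto
    have bKK: "b \<in> K" using b(1) LK unfolding L_def by blast
    have "b \<in> next_contents i p \<tau>" if nz: "u \<noteq> 0"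
    proof -
      consider j where "j = 1 \<or> j = - 1" "b = c j" | "b \<in> set bs" using b(1) unfolding L_def by auto
      then show ?thesis
      proof cases
        case 1
        have J: "JM (Suc i) * u = s (qF powi (2 * j) * node_content (\<tau> i)) * u"
          using b(2) 1(2) by (simp only: c_def a_def \<alpha>_def)
        show ?thesis
          using neighbour_addable[OF ann i1 i(2) u nz eq[symmetric] J 1(1)] 1(2) by (simp add: c_def a_def \<alpha>_def)
      next
        case 2
        then obtain \<delta> where \<delta>: "addable d m (\<tau> ` {1..k}) \<delta>" "node_pos \<delta> = p i" "b = node_content \<delta>"
          using bs(2) i(1) by (auto simp: next_contents_def)
        \<comment> \<open>If X_i and X_(i+1) both acted on u by a, then X_i - a would send g_i u to
          a nonzero multiple of u: a Jordan block, although X_i is semisimple on g_i u by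
          induction.\<close>
        have "\<delta> \<noteq> \<alpha>"
        proof
          assume "\<delta> = \<alpha>"
          then have Yu: "JM (Suc i) * u = s a * u" using b(2) \<delta>(3) by (simp add: a_def)
          have Xu: "JM i * u = s a * u" using wtD(4)[OF u i1 order_refl] by (simp add: a_def \<alpha>_def)
          define g where "g = G i * u"
          have uk: "wt k p \<tau> u" by (rule wt_le[OF u]) (simp add: i)
          have g: "wt k p \<tau> g" unfolding g_def using wt_G[OF uk ki i(2)] p_swap[OF ctx] by simp
          obtain cs where cs: "distinct cs" "set cs \<subseteq> next_contents k p \<tau>" "ann s (JM i) cs g = 0"
            using ann[OF ki] g unfolding annihilated_def i(1) by blast
          have kaK: "(qF - inverse qF) * a \<in> K" by (intro Fm_closed kappa_closed aK)
          have Xg: "JM i * g = s a * g - s ((qF - inverse qF) * a) * u"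
            unfolding g_def JM_G[OF wtD(1)[OF u] i1 i(2)] Yu kap_eq[OF ctx] s_act(3)[OF aK aK, of "G i"]
              s_act(2)[OF kappa_closed aK] ..
          have z: "JM i * g - s a * g = - (s ((qF - inverse qF) * a) * u)" using Xg by simp
          have eg: "e * g = g" "e * (JM i * g) = JM i * g"
            using teigD(1)[OF wtD(1)[OF g]] teigD(1)[OF teig_JM[OF wtD(1)[OF g] i1]] i by auto
          have eigz: "JM i * (JM i * g - s a * g) = s a * (JM i * g - s a * g)"
            unfolding z using eigen_scale[OF kaK aK Xu] by simp
          have "JM i * g = s a * g"
            by (rule no_jordan_block[OF cs(1) subset_trans[OF cs(2) next_contents_K] aK cs(3) eg eigz])
          then have "s ((qF - inverse qF) * a) * u = 0" using z by simp
          then have "u = 0" using s_cancel[OF kaK _ eu] anz q_diff_nz by simp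
          then show False using nz by simp
        qed
        then have "addable d m (\<tau> ` {1..i}) \<delta>" unfolding i(1) image_atLeastAtMost_Suc
          using addable_insert[OF \<delta>(1)] i(1) \<alpha>_def by blast
        then show ?thesis unfolding next_contents_def using \<delta>(2,3) eq by auto
      qed
    qed
    then show "ann s (JM (Suc i)) bs' u = 0"
      using ann_eigen_zero(1)[OF bs'K bKK b(2) eu] b(1) ann_zero[of s "JM (Suc i)" bs'] by (cases "u = 0") (auto simp: bs'_def)
  qed
  moreover have "distinct bs'" unfolding bs'_def L_def by (rule distinct_filter[OF distL])
  moreover have "set bs' \<subseteq> next_contents i p \<tau>" by (auto simp: bs'_def)
  ultimately show ?thesis by blast
qed

lemma annihilated_all: "i < n \<Longrightarrow> annihilated i"
proof (induction i rule: less_induct)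
  case (less i)
  show ?case
  proof (cases i)
    case 0
    then show ?thesis using annihilated_0 by simp
  next
    case (Suc k)
    have IH: "annihilated j" if "j < i" for j using less that by simp
    show ?thesis
      unfolding annihilated_def
    proof (intro allI impI)
      fix p \<tau> w assume w: "wt i p \<tau> w"
      show "\<exists>bs. distinct bs \<and> set bs \<subseteq> next_contents i p \<tau> \<and> ann s (JM (Suc i)) bs w = 0"
      proof (cases "p i = p (Suc i)")
        case True
        show ?thesis by (rule annihilated_same_position[OF IH Suc less.prems w True])
      next
        case False
        have "annihilated k" using IH Suc by simp
        then show ?thesis by (rule annihilated_different_position[OF _ Suc less.prems w False])
      qed
    qed
  qed
qed

section \<open>Decomposition of the corner into weight vectors\<close>

lemma level_decomp: "i \<le> n \<Longrightarrow> teig p w \<Longrightarrow> w \<in> add_span (\<lambda>u. \<exists>\<tau>. wt i p \<tau> u)"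
proof (induction i)
  case 0
  then have "wt 0 p (\<lambda>_. undefined) w" by (simp add: wt_def std_seq_def)
  then show ?case by (intro add_span_base) blast
next
  case (Suc i)
  then have "w \<in> add_span (\<lambda>u. \<exists>\<tau>. wt i p \<tau> u)" by simp
  then show ?case
  proof (rule add_span_bind)
    fix u assume "\<exists>\<tau>. wt i p \<tau> u"
    then obtain \<tau> where u: "wt i p \<tau> u" by blast
    obtain bs where bs: "distinct bs" "set bs \<subseteq> next_contents i p \<tau>" "ann s (JM (Suc i)) bs u = 0"
    proof -
      have "annihilated i" using annihilated_all[of i] Suc.prems(1) by simp
      then show thesis using that u unfolding annihilated_def by blast
    qed
    have "u \<in> add_span (\<lambda>v. wt i p \<tau> v \<and> (\<exists>b\<in>set bs. JM (Suc i) * v = s b * v))"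
      by (rule eigen_decomp[OF wt_stable _ bs(1) subset_trans[OF bs(2) next_contents_K] u bs(3)])
        (rule wt_JM; use Suc.prems in simp)
    then show "u \<in> add_span (\<lambda>u. \<exists>\<tau>. wt (Suc i) p \<tau> u)"
    proof (rule add_span_mono)
      fix v assume "wt i p \<tau> v \<and> (\<exists>b\<in>set bs. JM (Suc i) * v = s b * v)"
      then obtain b where v: "wt i p \<tau> v" and b: "b \<in> set bs" "JM (Suc i) * v = s b * v" by blast
      obtain \<delta> where \<delta>: "addable d m (\<tau> ` {1..i}) \<delta>" "node_pos \<delta> = p (Suc i)" "b = node_content \<delta>"
        using b(1) bs(2) by (auto simp: next_contents_def)
      \<comment> \<open>The eigenvalue is the content of an addable node \<delta>, and the entry i +
        1 is placed there.\<close>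
      let ?\<tau> = "\<tau>(Suc i := \<delta>)"
      have "?\<tau> ` {1..i} = \<tau> ` {1..i}" by (intro image_cong) auto
      then have "std_seq d m (Suc i) ?\<tau>"
        unfolding std_seq_Suc using wtD(2)[OF v] \<delta>(1) std_seq_cong[of i ?\<tau> \<tau> d m] by simp
      then have "wt (Suc i) p ?\<tau> v"
        using v \<delta> b(2) unfolding wt_def by (auto simp: le_Suc_eq)
      then show "\<exists>\<tau>. wt (Suc i) p \<tau> v" by blast
    qed
  qed
qed

lemma add_span_sum: "finite B \<Longrightarrow> (\<And>i. i \<in> B \<Longrightarrow> f i \<in> add_span P) \<Longrightarrow> sum f B \<in> add_span P"
  by (induction B rule: finite_induct) (auto intro: add_span.zero add_span_add)

lemma stable_sum:
  assumes "stable P" "finite B" "B \<noteq> {}" "\<And>i. i \<in> B \<Longrightarrow> P (f i)"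
  shows "P (sum f B)"
  using assms(2-4) by (induction B rule: finite_ne_induct) (auto intro: stableD(2)[OF assms(1)])

text \<open>Discrete Fourier transform: the component for the root r is the average of r^(-t) times
  T^t w over t < d.\<close>

lemma T_decomp:
  assumes st: "stable P" and TP: "\<And>u. P u \<Longrightarrow> P (T j * u)" and j: "1 \<le> j" "j \<le> n" and w: "P w"
  shows "w \<in> add_span (\<lambda>u. P u \<and> (\<exists>k\<in>{1..d}. T j * u = s (rt k) * u))"
proof -
  \<comment> \<open>The inverse of the k-th root of unity, as its power d - 1.\<close>
  define r where "r k = rt k ^ (d - 1)" for k
  define f where "f k t = s (r k ^ t) * (T j ^ t * w)" for k t
  define u where "u k = s (to_Fm (const (1 / of_nat d))) * (\<Sum>t<d. f k t)" for k
  have rK: "r k ^ t \<in> K" for k t unfolding r_def by (intro K_power rt_closed)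
  have cK: "to_Fm (const (1 / of_nat d)) \<in> K" by (simp add: to_Fm_closed)
  have ew: "e * w = w" by (rule stableD(1)[OF st w])
  have TtP: "P (T j ^ t * w)" for t
    by (induction t) (simp_all add: w TP mult.assoc)
  have r1: "rt k * r k = 1" and rd: "r k ^ d = 1" if "k \<in> {1..d}" for k
  proof -
    have x: "\<xi> k * \<xi> k ^ (d - 1) = 1" using rt_root[OF that] d_pos by (simp flip: power_Suc)
    have "rt k * r k = to_Fm (const (\<xi> k * \<xi> k ^ (d - 1)))"
      by (simp only: rt_def r_def const_simps const_power to_Fm_power to_Fm_simps)
    then show "rt k * r k = 1" unfolding x by (simp add: const_simps)
    have "r k ^ d = to_Fm (const ((\<xi> k ^ d) ^ (d - 1)))"
      by (simp only: rt_def r_def const_power to_Fm_power power_mult[symmetric] mult.commute)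
    then show "r k ^ d = 1" using rt_root[OF that] by (simp add: const_simps)
  qed
  have eig: "T j * u k = s (rt k) * u k" if k: "k \<in> {1..d}" for k
  proof -
    have "T j * f k t = s (rt k) * f k (Suc t)" for t
    proof -
      have "s (rt k) * f k (Suc t) = s (rt k * r k ^ Suc t) * (T j ^ Suc t * w)"
        unfolding f_def by (rule s_act(2)[OF rt_closed rK])
      also have "rt k * r k ^ Suc t = r k ^ t" using r1[OF k] by (simp add: mult.assoc[symmetric])
      also have "s (r k ^ t) * (T j ^ Suc t * w) = T j * f k t"
        unfolding f_def s_act(3)[OF rK rK] by (simp add: mult.assoc)
      finally show ?thesis ..
    qed
    then have "T j * (\<Sum>t<d. f k t) = s (rt k) * (\<Sum>t<d. f k (Suc t))" by (simp add: sum_distrib_left)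
    also have "(\<Sum>t<d. f k (Suc t)) = (\<Sum>t<d. f k t)"
    proof -
      have "f k 0 + (\<Sum>t<d. f k (Suc t)) = (\<Sum>t<d. f k t) + f k d"
        unfolding sum.lessThan_Suc_shift[symmetric] by simp
      moreover have "f k 0 = w" "f k d = w" using ew Td[OF j] rd[OF k] by (simp_all add: f_def s_one)
      ultimately show ?thesis by (simp add: add.commute)
    qed
    finally show ?thesis unfolding u_def by (rule eigen_scale[OF cK rt_closed])
  qed
  have Pu: "P (u k)" for k
    unfolding u_def f_def
    by (intro stableD(3)[OF st cK] stable_sum[OF st] stableD(3)[OF st rK] TtP) (use d_pos in auto)
  have sumr: "(\<Sum>k\<in>{1..d}. r k ^ t) = (if t = 0 then of_nat d else 0)" if "t < d" for t
  proof (cases "t = 0")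
    case False
    have "(\<Sum>k\<in>{1..d}. r k ^ t) = to_Fm (const (\<Sum>k\<in>{1..d}. (\<xi> k ^ (d - 1)) ^ t))"
      by (simp only: rt_def r_def const_power const_sum to_Fm_power to_Fm_sum)
    then show ?thesis using root_power_sum[OF \<xi>, of t] False that by (simp add: const_simps)
  qed simp
  have "(\<Sum>k\<in>{1..d}. u k) = s (to_Fm (const (1 / of_nat d))) * (\<Sum>t<d. \<Sum>k\<in>{1..d}. f k t)"
    unfolding u_def sum_distrib_left[symmetric] by (subst sum.swap) simp
  also have "(\<Sum>t<d. \<Sum>k\<in>{1..d}. f k t) = (\<Sum>t<d. s (if t = 0 then of_nat d else 0) * (T j ^ t * w))"
  proof (rule sum.cong[OF refl])
    fix t assume "t \<in> {..<d}"
    then have t: "t < d" by simp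
    have "(\<Sum>k\<in>{1..d}. f k t) = s (\<Sum>k\<in>{1..d}. r k ^ t) * (T j ^ t * w)"
      unfolding f_def by (subst s_sum) (auto simp: rK sum_distrib_right)
    then show "(\<Sum>k\<in>{1..d}. f k t) = s (if t = 0 then of_nat d else 0) * (T j ^ t * w)" unfolding sumr[OF t] .
  qed
  also have "\<dots> = s (of_nat d) * w"
  proof -
    have "(\<Sum>t<d. s (if t = 0 then of_nat d else 0) * (T j ^ t * w)) = (\<Sum>t\<in>{0}. s (of_nat d) * (T j ^ t * w))"
      using d_pos by (intro sum.mono_neutral_cong_right) (auto simp: s_zero)
    then show ?thesis by simp
  qed
  also have "s (to_Fm (const (1 / of_nat d))) * (s (of_nat d) * w) = w"
  proof -
    have dd: "of_nat d = to_Fm (const (of_nat d))"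
      by (induction d) (simp_all add: const_simps)
    have "to_Fm (const (1 / of_nat d)) * of_nat d = to_Fm (const (1 / of_nat d * of_nat d))"
      unfolding dd by (simp only: const_simps to_Fm_simps)
    also have "\<dots> = 1" using d_pos by (simp add: const_simps)
    finally have "to_Fm (const (1 / of_nat d)) * of_nat d = 1" .
    moreover have "of_nat d \<in> K" unfolding dd by (simp add: to_Fm_closed)
    ultimately show ?thesis using s_act(2)[OF cK, of "of_nat d" w] ew by (simp add: s_one)
  qed
  finally have "w = (\<Sum>k\<in>{1..d}. u k)" ..
  also have "\<dots> \<in> add_span (\<lambda>u. P u \<and> (\<exists>k\<in>{1..d}. T j * u = s (rt k) * u))"
    using Pu eig by (intro add_span_sum add_span_base) auto
  finally show ?thesis .
qed

lemma teig_decomp: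
  assumes "e * w = w"
  shows "w \<in> add_span (\<lambda>u. \<exists>p. teig p u)"
proof -
  define Q where "Q j p u \<longleftrightarrow> e * u = u \<and> (\<forall>i\<in>{1..j}. p i \<in> {1..d} \<and> T i * u = s (rt (p i)) * u)" for j p u
  have "w \<in> add_span (\<lambda>u. \<exists>p. Q j p u)" if "j \<le> n" for j
    using that
  proof (induction j)
    case 0
    then show ?case using assms by (intro add_span_base) (auto simp: Q_def)
  next
    case (Suc j)
    have "w \<in> add_span (\<lambda>u. \<exists>p. Q j p u)" using Suc by simp
    then show ?case
    proof (rule add_span_bind)
      fix u assume "\<exists>p. Q j p u"
      then obtain p where u: "Q j p u" by blast
      have st: "stable (Q j p)"
      proof (rule stableI)
        fix x y a assume x: "Q j p x"
        show "e * x = x" using x by (simp add: Q_def)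
        show "Q j p (x + y)" if "Q j p y" using x that by (simp add: Q_def distrib_left)
        show "Q j p (s a * x)" if "a \<in> K"
          using x eigen_scale[OF that rt_closed] e_scale[OF that] unfolding Q_def by blast
      qed
      have cl: "Q j p (T (Suc j) * x)" if x: "Q j p x" for x
        unfolding Q_def
      proof (intro conjI ballI)
        show "e * (T (Suc j) * x) = T (Suc j) * x"
          using e_gen(1)[of "Suc j"] Suc.prems by (simp add: mult.assoc[symmetric])
        fix i assume i: "i \<in> {1..j}"
        show "p i \<in> {1..d}" using x i by (simp add: Q_def)
        have "T i * (T (Suc j) * x) = T (Suc j) * (T i * x)"
          using TT[of i "Suc j"] i Suc.prems by (simp add: mult.assoc[symmetric])
        then show "T i * (T (Suc j) * x) = s (rt (p i)) * (T (Suc j) * x)"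
          using x i s_act(3)[OF rt_closed rt_closed] by (simp add: Q_def)
      qed
      have "u \<in> add_span (\<lambda>v. Q j p v \<and> (\<exists>k\<in>{1..d}. T (Suc j) * v = s (rt k) * v))"
        using Suc.prems by (intro T_decomp[OF st cl _ _ u]) auto
      then show "u \<in> add_span (\<lambda>u. \<exists>p. Q (Suc j) p u)"
      proof (rule add_span_mono)
        fix v assume "Q j p v \<and> (\<exists>k\<in>{1..d}. T (Suc j) * v = s (rt k) * v)"
        then obtain k where v: "Q j p v" "k \<in> {1..d}" "T (Suc j) * v = s (rt k) * v" by blast
        then have "Q (Suc j) (p(Suc j := k)) v" unfolding Q_def by (auto simp: le_Suc_eq)
        then show "\<exists>p. Q (Suc j) p v" by blast
      qed
    qed
  qed
  from this[of n] show ?thesis by (rule add_span_mono) (auto simp: Q_def teig_def)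
qed

definition fullwt :: "(nat \<Rightarrow> dm_node) \<Rightarrow> 'y \<Rightarrow> bool" where
  "fullwt \<tau> w \<longleftrightarrow> wt n (\<lambda>j. node_pos (\<tau> j)) \<tau> w"

lemma weight_decomp:
  assumes "e * w = w"
  shows "w \<in> add_span (\<lambda>u. \<exists>\<tau>\<in>extensional {1..n}. fullwt \<tau> u)"
  using teig_decomp[OF assms]
proof (rule add_span_bind)
  fix u assume "\<exists>p. teig p u"
  then obtain p where "teig p u" by blast
  then have "u \<in> add_span (\<lambda>u. \<exists>\<tau>. wt n p \<tau> u)" by (intro level_decomp) auto
  then show "u \<in> add_span (\<lambda>u. \<exists>\<tau>\<in>extensional {1..n}. fullwt \<tau> u)"
  proof (rule add_span_mono)
    fix v assume "\<exists>\<tau>. wt n p \<tau> v"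
    then obtain \<tau> where v: "wt n p \<tau> v" by blast
    \<comment> \<open>Restricted to {1..n}, tableaux with the same entries are equal as functions
      and can index a decomposition.\<close>
    have r: "restrict \<tau> {1..n} j = \<tau> j" if "j \<in> {1..n}" for j using that by (rule restrict_apply')
    have "std_seq d m n (restrict \<tau> {1..n})"
      using wtD(2)[OF v] std_seq_cong[of n "restrict \<tau> {1..n}" \<tau> d m] by auto
    then have "fullwt (restrict \<tau> {1..n}) v"
      using v r unfolding fullwt_def wt_def teig_def by auto
    then show "\<exists>\<tau>\<in>extensional {1..n}. fullwt \<tau> v" by blast
  qed
qed

end

section \<open>Homomorphisms from the seminormal representations\<close>

locale hecke_shape = shape d m n \<xi> \<Lambda> + hecke_ring d m n \<xi> e s T G X1
  for d m n :: nat and \<xi> :: "nat \<Rightarrow> complex" and \<Lambda> :: dm_partition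
    and e :: "'y::ring_1" and s :: "laurent fract \<Rightarrow> 'y" and T G :: "nat \<Rightarrow> 'y" and X1 :: 'y
begin

section \<open>Normalised intertwiners\<close>

lemma fullwt_e: "fullwt S u \<Longrightarrow> e * u = u"
  unfolding fullwt_def by (rule teigD(1)[OF wtD(1)])

lemma fullwt_std: "fullwt S u \<Longrightarrow> std_seq d m n S"
  unfolding fullwt_def by (rule wtD(2))

text \<open>Scaled so that weight vectors obey the same formula for g_i as the seminormal
  basis.\<close>

definition nrm :: "nat \<Rightarrow> (nat \<Rightarrow> dm_node) \<Rightarrow> 'y \<Rightarrow> 'y" where
  "nrm i S u = s (inverse (swap_coeff (S i) (S (Suc i)))) * itw i (S i) (S (Suc i)) u"

context
  fixes S :: dm_tableau and u :: 'y and i :: nat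
  assumes S: "S \<in> St" and u: "fullwt S u" and i: "1 \<le> i" "i < n"
begin

lemma fullwt_context:
  "teig (\<lambda>j. node_pos (S j)) u" "separated (S i) (S (Suc i))" "valid_node d m (S i)" "valid_node d m (S (Suc i))"
  "JM i * u = s (node_content (S i)) * u" "JM (Suc i) * u = s (node_content (S (Suc i))) * u"
proof -
  have w: "wt n (\<lambda>j. node_pos (S j)) S u" using u by (simp add: fullwt_def)
  show "teig (\<lambda>j. node_pos (S j)) u" by (rule wtD(1)[OF w])
  show "separated (S i) (S (Suc i))" by (rule std_seq_separated[OF St_std[OF S] i])
  show "valid_node d m (S i)" "valid_node d m (S (Suc i))" using St_valid[OF S] i by auto
  show "JM i * u = s (node_content (S i)) * u" "JM (Suc i) * u = s (node_content (S (Suc i))) * u"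
    using wtD(4)[OF w, of i] wtD(4)[OF w, of "Suc i"] i by auto
qed

lemma coeffs_K:
  "diag_coeff (S i) (S (Suc i)) \<in> K" "swap_coeff (S i) (S (Suc i)) \<in> K" "inverse (swap_coeff (S i) (S (Suc i))) \<in> K"
  "swap_coeff (S (Suc i)) (S i) \<in> K" "inverse (swap_coeff (S (Suc i)) (S i)) \<in> K"
  using coeff_closed[OF fullwt_context(3,4)] coeff_closed[OF fullwt_context(4,3)] by (auto intro: Fm_closed)

text \<open>The intertwiner would give a vector of level i - 1 whose next content belongs to no
  addable node, so it vanishes and g_i acts by its diagonal coefficient.\<close>

lemma G_covers:
  assumes "S \<circ> swap i \<notin> St"
  shows "G i * u = s (diag_coeff (S i) (S (Suc i))) * u"
proof -
  have cov: "covers (S i) (S (Suc i))" using St_swap[OF S i] assms by simp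
  define k where "k = i - 1"
  have k: "i = Suc k" "k < i" "k < n" using i by (auto simp: k_def)
  let ?p = "\<lambda>j. node_pos (S j)"
  define v where "v = itw i (S i) (S (Suc i)) u"
  have wk: "wt k ?p S u" using u wt_le[of n ?p S u k] k by (simp add: fullwt_def)
  have v: "wt k (?p \<circ> swap i) S v"
    unfolding v_def by (rule wt_itw[OF wk k(2) i(2) refl refl fullwt_context(3,4)])
  have J: "JM (Suc k) * v = s (node_content (S (Suc i))) * v"
    using itw_JM_i[OF i fullwt_context(1) refl refl fullwt_context(3,4,2,5,6)] by (simp add: v_def k(1))
  have "v = 0"
  proof (rule ccontr)
    assume "v \<noteq> 0"
    from annihilated_eigenvalue[OF annihilated_all[OF k(3)] v node_content_closed[OF fullwt_context(4)] J this]
    obtain \<delta> where \<delta>: "addable d m (S ` {1..k}) \<delta>" "node_pos \<delta> = node_pos (S (Suc i))"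
      "node_content \<delta> = node_content (S (Suc i))"
      using k(1) by (auto simp: next_contents_def)
    have sd: "snd \<delta> = snd (S (Suc i))" "diag \<delta> = diag (S (Suc i))"
      using node_content_eq_iff[OF addableD(1)[OF \<delta>(1)] fullwt_context(4) \<delta>(2)] \<delta>(3) by auto
    have std: "std_seq d m (Suc (Suc k)) S" using std_seq_mono[OF St_std[OF S]] i k by simp
    have D: "down_closed d m (S ` {1..k})" "addable d m (S ` {1..k}) (S i)" "addable d m (insert (S i) (S ` {1..k})) (S (Suc i))"
      using std std_seq_down_closed[of d m k S] unfolding std_seq_Suc image_atLeastAtMost_Suc k(1) by auto
    show False by (rule covered_not_addable_diag[OF D cov \<delta>(1) sd])
  qed
  then show ?thesis using G_itw[of i u "S i" "S (Suc i)"] by (simp add: v_def)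
qed

context
  assumes S': "S \<circ> swap i \<in> St"
begin

lemma swap_coeffs_nz: "swap_coeff (S i) (S (Suc i)) \<noteq> 0" "swap_coeff (S (Suc i)) (S i) \<noteq> 0"
  using std_seq_swap_coeff_nz[OF St_std[OF S] i] St_swap[OF S i] S' by auto

lemma nrm_fullwt: "fullwt (S \<circ> swap i) (nrm i S u)"
proof -
  have nc: "\<not> covers (S i) (S (Suc i))" using St_swap[OF S i] S' by simp
  have "wt n ((\<lambda>j. node_pos (S j)) \<circ> swap i) (S \<circ> swap i) (itw i (S i) (S (Suc i)) u)"
    using u i by (intro wt_swap(1)[OF _ i _ nc]) (simp_all add: fullwt_def)
  then have "wt n ((\<lambda>j. node_pos (S j)) \<circ> swap i) (S \<circ> swap i) (nrm i S u)"
    unfolding nrm_def by (rule stableD(3)[OF wt_stable coeffs_K(3)])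
  moreover have "(\<lambda>j. node_pos (S j)) \<circ> swap i = (\<lambda>j. node_pos ((S \<circ> swap i) j))" by (simp add: fun_eq_iff)
  ultimately show ?thesis unfolding fullwt_def by simp
qed

lemma G_nrm: "G i * u = s (diag_coeff (S i) (S (Suc i))) * u + s (swap_coeff (S i) (S (Suc i))) * nrm i S u"
proof -
  let ?v = "itw i (S i) (S (Suc i)) u" and ?b = "swap_coeff (S i) (S (Suc i))"
  have "e * ?v = ?v" using teigD(1)[OF itw_teig[OF i fullwt_context(1) refl refl fullwt_context(3,4)]] .
  then have "s ?b * nrm i S u = ?v"
    unfolding nrm_def s_act(2)[OF coeffs_K(2,3)] using swap_coeffs_nz by (simp add: s_one)
  then show ?thesis using G_itw[of i u "S i" "S (Suc i)"] by simp
qed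

text \<open>The scalar of \<open>itw_itw\<close> is the product of the two normalising
  factors.\<close>

lemma nrm_nrm: "nrm i (S \<circ> swap i) (nrm i S u) = u"
proof -
  let ?b = "swap_coeff (S i) (S (Suc i))" and ?b' = "swap_coeff (S (Suc i)) (S i)"
  note iK = coeffs_K(3,5)
  have "itw i \<alpha> \<beta> (s (inverse ?b) * v) = s (inverse ?b) * itw i \<alpha> \<beta> v" if "diag_coeff \<alpha> \<beta> \<in> K" for \<alpha> \<beta> v
    unfolding itw_def right_diff_distrib s_act(3)[OF iK(1,1), of "G i"] s_act(3)[OF iK(1,1), of "s (diag_coeff \<alpha> \<beta>)"] ..
  then have "nrm i (S \<circ> swap i) (nrm i S u) = s (inverse ?b') * (s (inverse ?b) * (s (?b * ?b') * u))"
    unfolding nrm_def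
    using itw_itw[OF i fullwt_context(1) refl refl fullwt_context(3,4,2,5,6)] coeff_closed(1)[OF fullwt_context(4,3)]
    by simp
  also have "\<dots> = s (inverse ?b' * (inverse ?b * (?b * ?b'))) * u"
    using coeffs_K by (simp add: s_act(2) Fm_closed)
  also have "inverse ?b' * (inverse ?b * (?b * ?b')) = (inverse ?b * ?b) * (inverse ?b' * ?b')" by (simp only: mult_ac)
  also have "\<dots> = 1" using swap_coeffs_nz by simp
  finally show ?thesis by (simp only: s_one fullwt_e[OF u])
qed

end

end

lemma commute_algebra:
  fixes a b c :: 'y
  shows "a * c = c * a \<Longrightarrow> b * c = c * b \<Longrightarrow> (a - b) * c = c * (a - b)"
    "a * c = c * a \<Longrightarrow> b * c = c * b \<Longrightarrow> (a * b) * c = c * (a * b)"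
  by (simp_all add: algebra_simps) (metis mult.assoc)

text \<open>Each normalised intertwiner is multiplication by an element built from one g and
  scalars, and neither element depends on the entries exchanged by the other.\<close>

lemma nrm_commute:
  assumes "1 \<le> i" "Suc i < j" "j < n" "B \<in> St" "fullwt B x"
  shows "nrm i (B \<circ> swap j) (nrm j B x) = nrm j (B \<circ> swap i) (nrm i B x)"
proof -
  define N where "N k S = s (inverse (swap_coeff (S k) (S (Suc k)))) * (G k - s (diag_coeff (S k) (S (Suc k))))"
    for k and S :: dm_tableau
  have N: "nrm k S v = N k S * v" for k S v
    by (simp add: nrm_def N_def itw_def left_diff_distrib mult.assoc)
  have nodes: "N i (B \<circ> swap j) = N i B" "N j (B \<circ> swap i) = N j B"
    using assms by (simp_all add: N_def swap_other)
  have i: "i < n" "1 \<le> j" using assms by auto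
  have GG: "G i * G j = G j * G i" by (rule far[OF assms(1-3)])
  note ci = coeffs_K[OF assms(4,5,1) i(1)] and cj = coeffs_K[OF assms(4,5) i(2) assms(3)]
  have sc: "s a * y = y * s a" if "a \<in> K" for a y using s_central[OF that] by simp
  have "N i B * N j B = N j B * N i B"
    unfolding N_def
    by (intro commute_algebra sc ci cj sc[symmetric] GG commute_algebra[symmetric])
  then show ?thesis unfolding N nodes by (simp only: mult.assoc[symmetric])
qed

lemma s_swap: "a \<in> K \<Longrightarrow> b \<in> K \<Longrightarrow> s a * (s b * v) = s b * (s a * v)"
  by (rule s_act(3))

text \<open>Expand both sides of the braid relation applied to u. All coefficients agree by the
  given identities except for the last terms, which are the same nonzero scalar times
  \<open>u121\<close> and \<open>u212\<close>.\<close>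

lemma braid_core:
  assumes ij: "1 \<le> i" "Suc i < n"
    and K: "axy \<in> K" "ayx \<in> K" "ayz \<in> K" "azy \<in> K" "axz \<in> K" "bxy \<in> K" "byx \<in> K" "byz \<in> K" "bzy \<in> K" "bxz \<in> K"
    and br: "axy * ayz + axz * ayx = ayz * axz" "axy * axz = ayz * axy + axz * azy"
      "axy * axy * ayz + bxy * byx * axz = ayz * ayz * axy + byz * bzy * axz"
    and eqs: "G i * u = s axy * u + s bxy * u1" "G i * u1 = s ayx * u1 + s byx * u"
      "G (Suc i) * u1 = s axz * u1 + s bxz * u12" "G i * u12 = s ayz * u12 + s byz * u121"
      "G (Suc i) * u = s ayz * u + s byz * u2" "G (Suc i) * u2 = s azy * u2 + s bzy * u"
      "G i * u2 = s axz * u2 + s bxz * u21" "G (Suc i) * u21 = s axy * u21 + s bxy * u212"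
    and nz: "bxy \<noteq> 0" "byz \<noteq> 0" "bxz \<noteq> 0" and ee: "e * u121 = u121" "e * u212 = u212"
  shows "u121 = u212"
proof -
  have Gs: "G k * (s a * v) = s a * (G k * v)" if "a \<in> K" for k a v by (rule s_act(3)[OF that that])
  note simps = eqs distrib_left distrib_right mult.assoc Gs s_mult s_add s_swap Fm_closed K add_ac
  have L: "G i * (G (Suc i) * (G i * u)) = s (axy * axy * ayz + bxy * byx * axz) * u
      + s (bxy * (axy * ayz + axz * ayx)) * u1 + s (byz * (axy * axz)) * u2 + s (axy * (byz * bxz)) * u21
      + s (bxy * (bxz * ayz)) * u12 + s (bxy * (bxz * byz)) * u121"
    by (simp add: simps)
  have R: "G (Suc i) * (G i * (G (Suc i) * u)) = s (ayz * ayz * axy + byz * bzy * axz) * u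
      + s (bxy * (ayz * axz)) * u1 + s (byz * (ayz * axy + axz * azy)) * u2 + s (axy * (byz * bxz)) * u21
      + s (bxy * (bxz * ayz)) * u12 + s (bxy * (bxz * byz)) * u212"
    by (simp add: simps)
  have "G i * (G (Suc i) * (G i * u)) = G (Suc i) * (G i * (G (Suc i) * u))"
    using braid[OF ij] by (simp only: mult.assoc[symmetric])
  then have "s (bxy * (bxz * byz)) * u121 = s (bxy * (bxz * byz)) * u212"
    unfolding L R br by simp
  then have "s (bxy * (bxz * byz)) * (u121 - u212) = 0" by (simp add: right_diff_distrib)
  moreover have "bxy * (bxz * byz) \<in> K" "bxy * (bxz * byz) \<noteq> 0" using K nz by (auto intro!: Fm_closed)
  moreover have "e * (u121 - u212) = u121 - u212" using ee by (simp add: right_diff_distrib)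
  ultimately have "u121 - u212 = 0" using s_cancel by blast
  then show ?thesis by simp
qed

lemma nrm_braid:
  assumes i: "1 \<le> i" "Suc i < n" and B: "B \<in> St" "fullwt B x"
    and std: "B \<circ> swap i \<in> St" "B \<circ> swap i \<circ> swap (Suc i) \<in> St" "B \<circ> swap i \<circ> swap (Suc i) \<circ> swap i \<in> St"
      "B \<circ> swap (Suc i) \<in> St" "B \<circ> swap (Suc i) \<circ> swap i \<in> St" "B \<circ> swap (Suc i) \<circ> swap i \<circ> swap (Suc i) \<in> St"
  shows "nrm i (B \<circ> swap i \<circ> swap (Suc i)) (nrm (Suc i) (B \<circ> swap i) (nrm i B x))
    = nrm (Suc i) (B \<circ> swap (Suc i) \<circ> swap i) (nrm i (B \<circ> swap (Suc i)) (nrm (Suc i) B x))"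
proof -
  define j where "j = Suc i"
  have ij: "1 \<le> i" "i < n" "1 \<le> j" "j < n" using i by (auto simp: j_def)
  define B1 B12 B2 B21 where "B1 = B \<circ> swap i" and "B12 = B1 \<circ> swap j" and "B2 = B \<circ> swap j" and "B21 = B2 \<circ> swap i"
  define u1 u12 u2 u21 where "u1 = nrm i B x" and "u12 = nrm j B1 u1" and "u2 = nrm j B x" and "u21 = nrm i B2 u2"
  have st: "B1 \<in> St" "B12 \<in> St" "B2 \<in> St" "B21 \<in> St" "B12 \<circ> swap i \<in> St" "B21 \<circ> swap j \<in> St"
    using std by (simp_all add: B1_def B12_def B2_def B21_def j_def)
  have rev: "B1 \<circ> swap i = B" "B2 \<circ> swap j = B" by (simp_all add: B1_def B2_def)
  have w1: "fullwt B1 u1" unfolding B1_def u1_def by (rule nrm_fullwt[OF B ij(1,2)]) (use st in \<open>simp add: B1_def\<close>)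
  have w12: "fullwt B12 u12" unfolding B12_def u12_def by (rule nrm_fullwt[OF st(1) w1 ij(3,4)]) (use st in \<open>simp add: B12_def\<close>)
  have w2: "fullwt B2 u2" unfolding B2_def u2_def by (rule nrm_fullwt[OF B ij(3,4)]) (use st in \<open>simp add: B2_def\<close>)
  have w21: "fullwt B21 u21" unfolding B21_def u21_def by (rule nrm_fullwt[OF st(3) w2 ij(1,2)]) (use st in \<open>simp add: B21_def\<close>)
  have w121: "fullwt (B12 \<circ> swap i) (nrm i B12 u12)" by (rule nrm_fullwt[OF st(2) w12 ij(1,2) st(5)])
  have w212: "fullwt (B21 \<circ> swap j) (nrm j B21 u21)" by (rule nrm_fullwt[OF st(4) w21 ij(3,4) st(6)])
  have n1: "nrm i B1 u1 = x" unfolding B1_def u1_def by (rule nrm_nrm[OF B ij(1,2)]) (use st in \<open>simp add: B1_def\<close>)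
  have n2: "nrm j B2 u2 = x" unfolding B2_def u2_def by (rule nrm_nrm[OF B ij(3,4)]) (use st in \<open>simp add: B2_def\<close>)
  define \<alpha> \<beta> \<gamma> where "\<alpha> = B i" and "\<beta> = B j" and "\<gamma> = B (Suc j)"
  have v: "B i = \<alpha>" "B j = \<beta>" "B (Suc j) = \<gamma>" "B1 i = \<beta>" "B1 j = \<alpha>" "B1 (Suc j) = \<gamma>"
    "B2 i = \<alpha>" "B2 j = \<gamma>" "B2 (Suc j) = \<beta>" "B12 i = \<beta>" "B12 j = \<gamma>" "B12 (Suc j) = \<alpha>"
    "B21 i = \<gamma>" "B21 j = \<alpha>" "B21 (Suc j) = \<beta>"
    by (auto simp: B1_def B12_def B2_def B21_def \<alpha>_def \<beta>_def \<gamma>_def j_def Transposition.transpose_def)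
  have sep: "separated \<alpha> \<beta>" "separated \<beta> \<gamma>" "separated \<alpha> \<gamma>"
    using std_seq_separated[OF St_std[OF B(1)], of i] std_seq_separated[OF St_std[OF B(1)], of j]
      std_seq_separated2[OF St_std[OF B(1)], of i] i ij v by (auto simp: j_def)
  have va: "valid_node d m \<alpha>" "valid_node d m \<beta>" "valid_node d m \<gamma>"
    using St_valid[OF B(1), of i] St_valid[OF B(1), of j] St_valid[OF B(1), of "Suc j"] ij v by auto
  have "nrm i B12 u12 = nrm j B21 u21"
  proof (rule braid_core[OF i, where u = x and ?u1.0 = u1 and ?u2.0 = u2 and ?u12.0 = u12 and ?u21.0 = u21
        and axy = "diag_coeff \<alpha> \<beta>" and ayx = "diag_coeff \<beta> \<alpha>" and ayz = "diag_coeff \<beta> \<gamma>" and azy = "diag_coeff \<gamma> \<beta>"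
        and axz = "diag_coeff \<alpha> \<gamma>" and bxy = "swap_coeff \<alpha> \<beta>" and byx = "swap_coeff \<beta> \<alpha>" and byz = "swap_coeff \<beta> \<gamma>"
        and bzy = "swap_coeff \<gamma> \<beta>" and bxz = "swap_coeff \<alpha> \<gamma>"])
    show "diag_coeff \<alpha> \<beta> \<in> K" "diag_coeff \<beta> \<alpha> \<in> K" "diag_coeff \<beta> \<gamma> \<in> K" "diag_coeff \<gamma> \<beta> \<in> K" "diag_coeff \<alpha> \<gamma> \<in> K"
      "swap_coeff \<alpha> \<beta> \<in> K" "swap_coeff \<beta> \<alpha> \<in> K" "swap_coeff \<beta> \<gamma> \<in> K" "swap_coeff \<gamma> \<beta> \<in> K" "swap_coeff \<alpha> \<gamma> \<in> K"
      using coeff_closed va by blast+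
    show "diag_coeff \<alpha> \<beta> * diag_coeff \<beta> \<gamma> + diag_coeff \<alpha> \<gamma> * diag_coeff \<beta> \<alpha> = diag_coeff \<beta> \<gamma> * diag_coeff \<alpha> \<gamma>"
      "diag_coeff \<alpha> \<beta> * diag_coeff \<alpha> \<gamma> = diag_coeff \<beta> \<gamma> * diag_coeff \<alpha> \<beta> + diag_coeff \<alpha> \<gamma> * diag_coeff \<gamma> \<beta>"
      by (rule diag_coeff_braid[OF sep])+
    show "diag_coeff \<alpha> \<beta> * diag_coeff \<alpha> \<beta> * diag_coeff \<beta> \<gamma> + swap_coeff \<alpha> \<beta> * swap_coeff \<beta> \<alpha> * diag_coeff \<alpha> \<gamma>
      = diag_coeff \<beta> \<gamma> * diag_coeff \<beta> \<gamma> * diag_coeff \<alpha> \<beta> + swap_coeff \<beta> \<gamma> * swap_coeff \<gamma> \<beta> * diag_coeff \<alpha> \<gamma>"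
      unfolding coeff_product[OF sep(1)] coeff_product[OF sep(2)] by (rule diag_coeff_braid(3)[OF sep])
    show "G i * x = s (diag_coeff \<alpha> \<beta>) * x + s (swap_coeff \<alpha> \<beta>) * u1"
      using G_nrm[OF B ij(1,2)] st(1) by (simp add: v j_def[symmetric] B1_def u1_def)
    show "G i * u1 = s (diag_coeff \<beta> \<alpha>) * u1 + s (swap_coeff \<beta> \<alpha>) * x"
      using G_nrm[OF st(1) w1 ij(1,2), unfolded rev n1, OF B(1)] by (simp add: v j_def[symmetric])
    show "G (Suc i) * u1 = s (diag_coeff \<alpha> \<gamma>) * u1 + s (swap_coeff \<alpha> \<gamma>) * u12"
      using G_nrm[OF st(1) w1 ij(3,4)] st(2) by (simp add: v j_def[symmetric] B12_def u12_def)
    show "G i * u12 = s (diag_coeff \<beta> \<gamma>) * u12 + s (swap_coeff \<beta> \<gamma>) * nrm i B12 u12"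
      using G_nrm[OF st(2) w12 ij(1,2) st(5)] by (simp add: v j_def[symmetric])
    show "G (Suc i) * x = s (diag_coeff \<beta> \<gamma>) * x + s (swap_coeff \<beta> \<gamma>) * u2"
      using G_nrm[OF B ij(3,4)] st(3) by (simp add: v j_def[symmetric] B2_def u2_def)
    show "G (Suc i) * u2 = s (diag_coeff \<gamma> \<beta>) * u2 + s (swap_coeff \<gamma> \<beta>) * x"
      using G_nrm[OF st(3) w2 ij(3,4), unfolded rev n2, OF B(1)] by (simp add: v j_def[symmetric])
    show "G i * u2 = s (diag_coeff \<alpha> \<gamma>) * u2 + s (swap_coeff \<alpha> \<gamma>) * u21"
      using G_nrm[OF st(3) w2 ij(1,2)] st(4) by (simp add: v j_def[symmetric] B21_def u21_def)
    show "G (Suc i) * u21 = s (diag_coeff \<alpha> \<beta>) * u21 + s (swap_coeff \<alpha> \<beta>) * nrm j B21 u21"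
      using G_nrm[OF st(4) w21 ij(3,4) st(6)] by (simp add: v j_def[symmetric])
    show "swap_coeff \<alpha> \<beta> \<noteq> 0" using swap_coeffs_nz(1)[OF B ij(1,2)] st(1) by (simp add: v j_def[symmetric] B1_def)
    show "swap_coeff \<beta> \<gamma> \<noteq> 0" using swap_coeffs_nz(1)[OF B ij(3,4)] st(3) by (simp add: v B2_def)
    show "swap_coeff \<alpha> \<gamma> \<noteq> 0" using swap_coeffs_nz(1)[OF st(1) w1 ij(3,4)] st(2) by (simp add: v B12_def)
    show "e * nrm i B12 u12 = nrm i B12 u12" by (rule fullwt_e[OF w121])
    show "e * nrm j B21 u21 = nrm j B21 u21" by (rule fullwt_e[OF w212])
  qed
  then show ?thesis unfolding u12_def u21_def u1_def u2_def B12_def B21_def B1_def B2_def j_def .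
qed

end

context hecke_shape
begin

section \<open>Transport of a weight vector to all tableaux of a shape\<close>

context
  fixes T0 :: dm_tableau and w0 :: 'y
  assumes T0: "T0 \<in> St" and w0: "fullwt T0 w0"
begin

definition desc :: "dm_tableau \<Rightarrow> nat \<Rightarrow> bool" where
  "desc S i \<longleftrightarrow> 1 \<le> i \<and> i < n \<and> rel_pos n T0 S (Suc i) < rel_pos n T0 S i"

text \<open>Distance from the starting tableau; each descent lowers it.\<close>

definition height :: "dm_tableau \<Rightarrow> nat" where
  "height S = card (inversions n (rel_pos n T0 S))"

lemma desc_down:
  assumes "S \<in> St" "desc S i"
  shows "S \<circ> swap i \<in> St" "height (S \<circ> swap i) < height S"
proof -
  have S: "std_seq d m n T0" "std_seq d m n S" "S ` {1..n} = T0 ` {1..n}" using T0 assms(1) by (simp_all add: St_iff)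
  have i: "1 \<le> i" "i < n" "rel_pos n T0 S (Suc i) < rel_pos n T0 S i" using assms(2) by (simp_all add: desc_def)
  have "std_seq d m n (S \<circ> swap i)" by (rule rel_pos_descent_std[OF S i])
  then show "S \<circ> swap i \<in> St"
    using St_swap[OF assms(1) i(1,2)] std_seq_swap_not_covers[OF _ i(1,2)] by blast
  show "height (S \<circ> swap i) < height S"
    unfolding height_def rel_pos_swap by (rule inversions_swap[OF i])
qed

lemma desc_exists:
  assumes "S \<in> St" "S \<noteq> T0"
  obtains i where "desc S i"
proof -
  have S: "std_seq d m n T0" "std_seq d m n S" "S ` {1..n} = T0 ` {1..n}"
    "T0 \<in> extensional {1..n}" "S \<in> extensional {1..n}" using T0 assms(1) by (simp_all add: St_iff)
  show thesis by (rule rel_pos_descent_exists[OF S assms(2)]) (use that desc_def in blast)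
qed

lemma desc_base: "\<not> desc T0 i"
proof -
  have "rel_pos n T0 T0 j = j" if "j \<in> {1..n}" for j
    using inv_into_f_f[OF std_seq_inj[OF St_std[OF T0]] that] by (simp add: rel_pos_def)
  from this[of i] this[of "Suc i"] show ?thesis by (auto simp: desc_def)
qed

lemma desc_swap_cases:
  assumes "S \<in> St" "1 \<le> i" "i < n"
  shows "desc (S \<circ> swap i) i \<or> desc S i"
proof -
  have S: "std_seq d m n T0" "std_seq d m n S" "S ` {1..n} = T0 ` {1..n}" using T0 assms(1) by (simp_all add: St_iff)
  have "rel_pos n T0 S i \<noteq> rel_pos n T0 S (Suc i)"
    using rel_pos_mem[OF S, of i] rel_pos_mem[OF S, of "Suc i"] inj_onD[OF std_seq_inj[OF S(2)], of i "Suc i"] assms by force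
  then show ?thesis using assms by (auto simp: desc_def rel_pos_swap)
qed

text \<open>The vector u arises from w0 along a chain of exchanges, each leading away from the
  starting tableau.\<close>

inductive path :: "dm_tableau \<Rightarrow> 'y \<Rightarrow> bool" where
  base: "path T0 w0"
| step: "path S u \<Longrightarrow> S \<circ> swap i \<in> St \<Longrightarrow> desc (S \<circ> swap i) i \<Longrightarrow> path (S \<circ> swap i) (nrm i S u)"

lemma path_fullwt: "path S u \<Longrightarrow> S \<in> St \<and> fullwt S u"
proof (induction rule: path.induct)
  case (step S u i)
  then have "S \<in> St" "fullwt S u" "1 \<le> i" "i < n" by (simp_all add: desc_def)
  from nrm_fullwt[OF this step.hyps(2)] step.hyps(2) show ?case by (rule conjI[rotated])
qed (use T0 w0 in blast)

lemma path_up: "path (S \<circ> swap i) u \<Longrightarrow> S \<in> St \<Longrightarrow> desc S i \<Longrightarrow> path S (nrm i (S \<circ> swap i) u)"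
  using path.step[of "S \<circ> swap i" u i] by (simp add: comp_assoc)

lemma path_total: "S \<in> St \<Longrightarrow> \<exists>u. path S u"
proof (induction "height S" arbitrary: S rule: less_induct)
  case less
  show ?case
  proof (cases "S = T0")
    case False
    then obtain i where i: "desc S i" using desc_exists less.prems by blast
    show ?thesis using less.hyps[OF desc_down(2,1)[OF less.prems i]] path_up[OF _ less.prems i] by blast
  qed (use base in blast)
qed

lemma path_cases:
  assumes "path S u"
  shows "(S = T0 \<and> u = w0) \<or> (\<exists>i v. desc S i \<and> path (S \<circ> swap i) v \<and> u = nrm i (S \<circ> swap i) v)"
  using assms
proof (cases rule: path.cases)
  case (step S' u' i)
  then have "S \<circ> swap i = S'" by (simp add: comp_assoc)
  then have "path (S \<circ> swap i) u'" "u = nrm i (S \<circ> swap i) u'" "desc S i" using step by simp_all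
  then show ?thesis by (intro disjI2 exI conjI)
qed simp

text \<open>The diamond property: two descents out of the same tableau commute or satisfy the braid relation.\<close>

lemma path_diamond:
  assumes unique: "\<And>S' u v. height S' < height S \<Longrightarrow> path S' u \<Longrightarrow> path S' v \<Longrightarrow> u = v"
    and S: "S \<in> St" and i: "desc S i" "path (S \<circ> swap i) u" and j: "desc S j" "path (S \<circ> swap j) v" and ij: "i < j"
  shows "nrm i (S \<circ> swap i) u = nrm j (S \<circ> swap j) v"
proof -
  have bd: "1 \<le> i" "1 \<le> j" "i < n" "j < n" using i j by (auto simp: desc_def)
  let ?A = "S \<circ> swap i" and ?C = "S \<circ> swap j"
  note dA = desc_down[OF S i(1)] and dC = desc_down[OF S j(1)]
  consider "Suc i < j" | "j = Suc i" using ij by linarith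
  then show ?thesis
  proof cases
    case 1
    define B where "B = ?A \<circ> swap j"
    have B': "B = ?C \<circ> swap i" unfolding B_def by (rule swap_commute[OF 1])
    have BA: "B \<circ> swap j = ?A" by (simp add: B_def comp_assoc)
    have BC: "B \<circ> swap i = ?C" by (simp add: B' comp_assoc)
    have d: "desc ?A j" "desc ?C i" using i(1) j(1) 1 by (auto simp: desc_def rel_pos_swap swap_other)
    have BS: "B \<in> St" unfolding B_def by (rule desc_down(1)[OF dA(1) d(1)])
    obtain x where x: "path B x" using path_total[OF BS] by blast
    have "u = nrm j B x"
      by (rule unique[OF dA(2) i(2)]) (use path_up[OF _ dA(1) d(1)] x in \<open>simp add: B_def\<close>)
    moreover have "v = nrm i B x"
      by (rule unique[OF dC(2) j(2)]) (use path_up[OF _ dC(1) d(2)] x in \<open>simp add: B'\<close>)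
    ultimately show ?thesis
      using nrm_commute[OF bd(1) 1 bd(4) BS, of x] path_fullwt[OF x] unfolding BA BC by simp
  next
    case 2
    \<comment> \<open>Two routes of three descents each lead from S to the same tableau B and
      enclose a hexagon.\<close>
    define A1 B C1 where "A1 = ?A \<circ> swap j" and "B = A1 \<circ> swap i" and "C1 = ?C \<circ> swap i"
    have B': "B = C1 \<circ> swap j"
      by (auto simp: B_def A1_def C1_def 2 fun_eq_iff Transposition.transpose_def)
    have rev: "B \<circ> swap i = A1" "A1 \<circ> swap j = ?A" "?A \<circ> swap i = S"
      by (simp_all add: B_def A1_def comp_assoc)
    have rev': "B \<circ> swap j = C1" "C1 \<circ> swap i = ?C" "?C \<circ> swap j = S"
      by (simp_all add: B' C1_def comp_assoc)
    have d: "desc ?A j" "desc A1 i" "desc ?C i" "desc C1 j"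
      using i(1) j(1) by (auto simp: desc_def A1_def C1_def 2 rel_pos_swap Transposition.transpose_def)
    note dA1 = desc_down[OF dA(1) d(1), folded A1_def] and dC1 = desc_down[OF dC(1) d(3), folded C1_def]
    note dB = desc_down[OF dA1(1) d(2), folded B_def]
    obtain x where x: "path B x" using path_total[OF dB(1)] by blast
    have pA1: "path A1 (nrm i B x)" using path_up[OF _ dA1(1) d(2)] x by (simp add: B_def)
    have pC1: "path C1 (nrm j B x)" using path_up[OF _ dC1(1) d(4)] x by (simp add: B')
    have "u = nrm j A1 (nrm i B x)"
      by (rule unique[OF dA(2) i(2)]) (use path_up[OF _ dA(1) d(1)] pA1 in \<open>simp add: A1_def\<close>)
    moreover have "v = nrm i C1 (nrm j B x)"
      by (rule unique[OF dC(2) j(2)]) (use path_up[OF _ dC(1) d(3)] pC1 in \<open>simp add: C1_def\<close>)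
    moreover have "nrm i (B \<circ> swap i \<circ> swap j) (nrm j (B \<circ> swap i) (nrm i B x))
        = nrm j (B \<circ> swap j \<circ> swap i) (nrm i (B \<circ> swap j) (nrm j B x))"
      unfolding 2
      by (rule nrm_braid[OF bd(1) bd(4)[unfolded 2] dB(1) conjunct2[OF path_fullwt[OF x]]]; unfold rev[unfolded 2] rev'[unfolded 2])
        (use dA(1) dA1(1) dC(1)[unfolded 2] dC1(1) S in auto)
    ultimately show ?thesis unfolding rev rev' by simp
  qed
qed

text \<open>Local confluence suffices: by induction on the height, two last exchanges are compared
  through a common lower tableau by \<open>path_diamond\<close>.\<close>

lemma path_unique: "path S u \<Longrightarrow> path S v \<Longrightarrow> u = v"
proof (induction "height S" arbitrary: S u v rule: less_induct)
  case less
  have S: "S \<in> St" using path_fullwt less.prems by blast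
  show ?case
  proof (cases "S = T0")
    case True
    then show ?thesis using path_cases[OF less.prems(1)] path_cases[OF less.prems(2)] desc_base by blast
  next
    case False
    obtain i u' where i: "desc S i" "path (S \<circ> swap i) u'" "u = nrm i (S \<circ> swap i) u'"
      using path_cases[OF less.prems(1)] False by blast
    obtain j v' where j: "desc S j" "path (S \<circ> swap j) v'" "v = nrm j (S \<circ> swap j) v'"
      using path_cases[OF less.prems(2)] False by blast
    note IH = less.hyps
    consider "i < j" | "i = j" | "j < i" by linarith
    then show ?thesis
    proof cases
      case 1
      show ?thesis unfolding i(3) j(3) by (rule path_diamond[OF IH S i(1,2) j(1,2) 1])
    next
      case 2
      then show ?thesis using IH[OF desc_down(2)[OF S i(1)] i(2)] i(3) j(2,3) by simp
    next
      case 3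
      show ?thesis unfolding i(3) j(3) by (rule path_diamond[OF IH S j(1,2) i(1,2) 3, symmetric])
    qed
  qed
qed

definition W :: "dm_tableau \<Rightarrow> 'y" where
  "W S = (THE u. path S u)"

lemma path_W: "S \<in> St \<Longrightarrow> path S (W S)"
  unfolding W_def using path_total path_unique by (metis theI)

lemma W_base: "W T0 = w0"
  using path_unique[OF path_W[OF T0] base] .

lemma W_fullwt: "S \<in> St \<Longrightarrow> fullwt S (W S)"
  using path_W path_fullwt by blast

text \<open>The exchange away from the start holds by construction; the opposite direction follows
  since \<open>nrm\<close> is inverted by the reverse exchange.\<close>

lemma W_swap:
  assumes S: "S \<in> St" and i: "1 \<le> i" "i < n" and S': "S \<circ> swap i \<in> St"
  shows "W (S \<circ> swap i) = nrm i S (W S)"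
  using desc_swap_cases[OF S i]
proof
  assume "desc (S \<circ> swap i) i"
  then show ?thesis using path_unique[OF path_W[OF S'] path.step[OF path_W[OF S] S']] by simp
next
  assume "desc S i"
  then have W: "W S = nrm i (S \<circ> swap i) (W (S \<circ> swap i))"
    using path_unique[OF path_W[OF S] path_up[OF path_W[OF S'] S]] by simp
  show ?thesis
    using nrm_nrm[OF S' W_fullwt[OF S'] i] S unfolding W[symmetric] by (simp add: comp_assoc)
qed

definition Psi :: "vect \<Rightarrow> 'y" where
  "Psi f = (\<Sum>S\<in>St. s (f S) * W S)"

lemma G_W:
  assumes S: "S \<in> St" and i: "1 \<le> i" "i < n"
  shows "G i * W S = s (diag_coeff (S i) (S (Suc i))) * W S +
    (if S \<circ> swap i \<in> St then s (swap_coeff (S i) (S (Suc i))) * W (S \<circ> swap i) else 0)"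
  using G_nrm[OF S W_fullwt[OF S] i] G_covers[OF S W_fullwt[OF S] i] W_swap[OF S i] by simp

context
  fixes f assumes f: "f \<in> carrier V"
begin

lemma f_K: "f S \<in> K"
  using f by (simp add: carrier_V)

lemma Psi_scale: "c \<in> K \<Longrightarrow> s c * Psi f = Psi (\<lambda>t. c * f t)"
  by (simp add: Psi_def sum_distrib_left s_act(2) f_K)

lemma Psi_e: "e * Psi f = Psi f"
  using Psi_scale[OF Fm_closed(2)] by (simp add: s_one)

lemma Psi_X: "X1 * Psi f = Psi (Dop 1 f)"
proof -
  have "X1 * (s (f S) * W S) = s (node_content (S 1) * f S) * W S" if S: "S \<in> St" for S
  proof -
    have w: "wt n (\<lambda>j. node_pos (S j)) S (W S)" using W_fullwt[OF S] by (simp add: fullwt_def)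
    have c: "node_content (S 1) \<in> K" using node_content_closed[OF St_valid[OF S]] n_pos by simp
    have "X1 * W S = s (node_content (S 1)) * W S" using wtD(4)[OF w, of 1] n_pos by (simp add: JM_1)
    then show ?thesis by (simp add: s_act(3)[OF f_K f_K, of X1] s_act(2) f_K c[simplified] mult.commute)
  qed
  then show ?thesis by (simp add: Psi_def sum_distrib_left Dop_def)
qed

lemma Psi_T:
  assumes j: "1 \<le> j" "j \<le> n"
  shows "T j * Psi f = Psi (Top j f)"
proof -
  have "T j * (s (f S) * W S) = s (root (S j) * f S) * W S" if S: "S \<in> St" for S
  proof -
    have w: "wt n (\<lambda>j. node_pos (S j)) S (W S)" using W_fullwt[OF S] by (simp add: fullwt_def)
    have c: "rt (node_pos (S j)) \<in> K" by (rule rt_closed)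
    have "T j * W S = s (rt (node_pos (S j))) * W S" using teigD(2)[OF wtD(1)[OF w]] j by simp
    then show ?thesis by (simp add: s_act(3)[OF f_K f_K, of "T j"] s_act(2) f_K c[unfolded rt_def] mult.commute root_def rt_def)
  qed
  then show ?thesis by (simp add: Psi_def sum_distrib_left Top_def)
qed

text \<open>The vectors \<open>W S\<close> satisfy the seminormal formulas: \<open>G_nrm\<close> if
  the exchanged tableau is standard, \<open>G_covers\<close> otherwise. Collecting the coefficient
  of each \<open>W S\<close> gives \<open>Gop\<close>.\<close>

lemma Psi_G:
  assumes i: "1 \<le> i" "i < n"
  shows "G i * Psi f = Psi (Gop i f)"
proof -
  let ?a = "\<lambda>S. diag_coeff (S i) (S (Suc i))" and ?b = "\<lambda>S. swap_coeff (S i) (S (Suc i))"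
  let ?P = "{S \<in> St. S \<circ> swap i \<in> St}"
  have K: "?a S \<in> K" "?b S \<in> K" "swap_coeff (S (Suc i)) (S i) \<in> K" if "S \<in> St" for S
    using coeff_closed[OF St_valid[OF that] St_valid[OF that], of i "Suc i"]
      coeff_closed(2)[OF St_valid[OF that] St_valid[OF that], of "Suc i" i] i by auto
  have "G i * (s (f S) * W S) = s (?a S * f S) * W S +
      (if S \<circ> swap i \<in> St then s (?b S * f S) * W (S \<circ> swap i) else 0)" if S: "S \<in> St" for S
    unfolding s_act(3)[OF f_K f_K, of "G i"] G_W[OF S i]
    using K[OF S] by (simp add: distrib_left s_act(2) f_K mult.commute)
  then have "G i * Psi f = (\<Sum>S\<in>St. s (?a S * f S) * W S) +
      (\<Sum>S\<in>St. if S \<circ> swap i \<in> St then s (?b S * f S) * W (S \<circ> swap i) else 0)"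
    by (simp add: Psi_def sum_distrib_left sum.distrib)
  also have "(\<Sum>S\<in>St. if S \<circ> swap i \<in> St then s (?b S * f S) * W (S \<circ> swap i) else 0)
      = (\<Sum>S\<in>?P. s (?b S * f S) * W (S \<circ> swap i))"
    by (rule sum.inter_filter[OF finite_St, symmetric])
  \<comment> \<open>Exchange is an involution on the standard tableaux whose exchange is
    standard.\<close>
  also have "\<dots> = (\<Sum>S\<in>?P. s (swap_coeff (S (Suc i)) (S i) * f (S \<circ> swap i)) * W S)"
    by (rule sum.reindex_bij_witness[of _ "\<lambda>S. S \<circ> swap i" "\<lambda>S. S \<circ> swap i"]) (auto simp: comp_assoc)
  also have "\<dots> = (\<Sum>S\<in>St. s (swap_coeff (S (Suc i)) (S i) * f (S \<circ> swap i)) * W S)"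
    using f s_zero by (intro sum.mono_neutral_left finite_St) (auto simp: carrier_V Vc_def)
  also have "(\<Sum>S\<in>St. s (?a S * f S) * W S) + \<dots> = Psi (Gop i f)"
    unfolding Psi_def sum.distrib[symmetric]
    by (intro sum.cong refl) (simp add: Gop_St s_add f_K K Fm_closed distrib_right)
  finally show ?thesis .
qed

end

lemma Psi_add: "f \<in> carrier V \<Longrightarrow> g \<in> carrier V \<Longrightarrow> Psi (\<lambda>t. f t + g t) = Psi f + Psi g"
  by (simp add: Psi_def s_add f_K distrib_right sum.distrib)

lemma Psi_base: "Psi (\<lambda>t. if t = T0 then 1 else 0) = w0"
proof -
  have "Psi (\<lambda>t. if t = T0 then 1 else 0) = (\<Sum>S\<in>St. if S = T0 then w0 else 0)"
    unfolding Psi_def by (intro sum.cong refl) (use fullwt_e[OF w0] in \<open>simp add: W_base s_one s_zero\<close>)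
  then show ?thesis using T0 finite_St by simp
qed

end

end

section \<open>The Hecke ring inside the algebra\<close>

text \<open>The calculations with weight vectors take place in a type of class \<^class>\<open>ring_1\<close>, whereas the algebras
  live on carrier sets. All of them together embed into the following ring of families; the integer component makes it
  nontrivial.\<close>

lemma ring_FYH: "ring (FYH d m n)"
  by (rule assoc_algebra.axioms(2)[OF yh.assoc_algebra_A])

interpretation FY: ring "FYH d m n" for d m n
  by (rule ring_FYH)

typedef family = "{F :: (nat \<Rightarrow> nat \<Rightarrow> nat \<Rightarrow> yh_elt) \<times> int. \<forall>d m n. fst F d m n \<in> carrier (FYH d m n)}"
  by (rule exI[of _ "(\<lambda>d m n. \<zero>\<^bsub>FYH d m n\<^esub>, 0)"]) simp

definition comp :: "nat \<Rightarrow> nat \<Rightarrow> nat \<Rightarrow> family \<Rightarrow> yh_elt" where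
  "comp d m n F = fst (Rep_family F) d m n"

definition int_comp :: "family \<Rightarrow> int" where
  "int_comp F = snd (Rep_family F)"

definition mk :: "(nat \<Rightarrow> nat \<Rightarrow> nat \<Rightarrow> yh_elt) \<Rightarrow> int \<Rightarrow> family" where
  "mk h k = Abs_family (h, k)"

lemma comp_closed [simp, intro]: "comp d m n F \<in> carrier (FYH d m n)"
  using Rep_family[of F] by (simp add: comp_def)

lemma comp_mk [simp]: "(\<And>d m n. h d m n \<in> carrier (FYH d m n)) \<Longrightarrow> comp d m n (mk h k) = h d m n"
  "(\<And>d m n. h d m n \<in> carrier (FYH d m n)) \<Longrightarrow> int_comp (mk h k) = k"
  by (simp_all add: comp_def int_comp_def mk_def Abs_family_inverse)

lemma family_eqI: "(\<And>d m n. comp d m n F = comp d m n H) \<Longrightarrow> int_comp F = int_comp H \<Longrightarrow> F = H"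
  by (simp add: comp_def int_comp_def Rep_family_inject[symmetric] prod_eq_iff fun_eq_iff)

instantiation family :: ring_1
begin

definition "0 = mk (\<lambda>d m n. \<zero>\<^bsub>FYH d m n\<^esub>) 0"
definition "1 = mk (\<lambda>d m n. \<one>\<^bsub>FYH d m n\<^esub>) 1"
definition "F + H = mk (\<lambda>d m n. comp d m n F \<oplus>\<^bsub>FYH d m n\<^esub> comp d m n H) (int_comp F + int_comp H)"
definition "F * H = mk (\<lambda>d m n. comp d m n F \<otimes>\<^bsub>FYH d m n\<^esub> comp d m n H) (int_comp F * int_comp H)"
definition "- F = mk (\<lambda>d m n. \<ominus>\<^bsub>FYH d m n\<^esub> comp d m n F) (- int_comp F)"
definition "F - (H :: family) = F + (- H)"

lemma comp_simps [simp]: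
  "comp d m n 0 = \<zero>\<^bsub>FYH d m n\<^esub>" "comp d m n 1 = \<one>\<^bsub>FYH d m n\<^esub>"
  "comp d m n (F + H) = comp d m n F \<oplus>\<^bsub>FYH d m n\<^esub> comp d m n H"
  "comp d m n (F * H) = comp d m n F \<otimes>\<^bsub>FYH d m n\<^esub> comp d m n H"
  "comp d m n (- F) = \<ominus>\<^bsub>FYH d m n\<^esub> comp d m n F"
  "int_comp 0 = 0" "int_comp 1 = 1" "int_comp (F + H) = int_comp F + int_comp H"
  "int_comp (F * H) = int_comp F * int_comp H" "int_comp (- F) = - int_comp F"
  by (simp_all add: zero_family_def one_family_def plus_family_def times_family_def uminus_family_def)

instance
proof
  fix a b c :: family
  show "a + b + c = a + (b + c)" by (rule family_eqI) (simp_all add: FY.a_assoc)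
  show "a + b = b + a" by (rule family_eqI) (simp_all add: FY.a_comm)
  show "0 + a = a" by (rule family_eqI) simp_all
  show "- a + a = 0" by (rule family_eqI) (simp_all add: FY.l_neg)
  show "a - b = a + - b" by (simp add: minus_family_def)
  show "a * b * c = a * (b * c)" by (rule family_eqI) (simp_all add: FY.m_assoc)
  show "1 * a = a" "a * 1 = a" by (rule family_eqI; simp)+
  show "(a + b) * c = a * c + b * c" by (rule family_eqI) (simp_all add: FY.l_distr distrib_right)
  show "a * (b + c) = a * b + a * c" by (rule family_eqI) (simp_all add: FY.r_distr distrib_left)
  show "(0 :: family) \<noteq> 1"
  proof
    assume "(0 :: family) = 1"
    then have "int_comp 0 = int_comp 1" by (rule arg_cong)
    then show False by simp
  qed
qed

end

section \<open>One algebra as a corner of the ring of families\<close>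

context yh
begin

text \<open>A type cannot depend on d, m and n, so a family has a component for every triple. An
  element of one algebra is placed in its component with zero elsewhere; its unit becomes an
  idempotent \<open>one_emb\<close> different from 1.\<close>

definition emb :: "yh_elt \<Rightarrow> family" where
  "emb a = mk (\<lambda>d' m' n'. if d' = d \<and> m' = m \<and> n' = n then a else \<zero>\<^bsub>FYH d' m' n'\<^esub>) 0"

abbreviation "cp \<equiv> comp d m n"

lemma comp_emb:
  assumes "a \<in> carrier A"
  shows "comp d' m' n' (emb a) = (if d' = d \<and> m' = m \<and> n' = n then a else \<zero>\<^bsub>FYH d' m' n'\<^esub>)" "int_comp (emb a) = 0"
  using assms unfolding emb_def by (subst comp_mk; simp)+

lemma emb_simps:
  assumes "a \<in> carrier A"
  shows "b \<in> carrier A \<Longrightarrow> emb (a \<oplus>\<^bsub>A\<^esub> b) = emb a + emb b"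
    "y * emb a = emb (cp y \<otimes>\<^bsub>A\<^esub> a)" "emb a * y = emb (a \<otimes>\<^bsub>A\<^esub> cp y)" "cp (emb a) = a"
  using assms by (auto intro!: family_eqI simp: comp_emb)

definition one_emb :: family where "one_emb = emb \<one>\<^bsub>A\<^esub>"

lemma one_emb_mult: "one_emb * y = emb (cp y)" "a \<in> carrier A \<Longrightarrow> one_emb * emb a = emb a" "y * one_emb = one_emb * y"
  by (simp_all add: one_emb_def emb_simps)

lemma one_emb_range: "one_emb * y = y \<Longrightarrow> y = emb (cp y)"
  by (simp add: one_emb_mult)

lemma one_emb_split: "one_emb * (a * b) = (one_emb * a) * (one_emb * b)"
  by (simp add: one_emb_mult(1) emb_simps)

definition scal :: "laurent fract \<Rightarrow> family" where
  "scal c = emb (c \<odot>\<^bsub>A\<^esub> \<one>\<^bsub>A\<^esub>)"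

lemma scal_one_closed: "c \<in> carrier (Fm m) \<Longrightarrow> c \<odot>\<^bsub>A\<^esub> \<one>\<^bsub>A\<^esub> \<in> carrier A"
  by simp

lemma smult_eq: "c \<in> carrier (Fm m) \<Longrightarrow> a \<in> carrier A \<Longrightarrow> c \<odot>\<^bsub>A\<^esub> a = (c \<odot>\<^bsub>A\<^esub> \<one>\<^bsub>A\<^esub>) \<otimes>\<^bsub>A\<^esub> a"
  "c \<in> carrier (Fm m) \<Longrightarrow> a \<in> carrier A \<Longrightarrow> c \<odot>\<^bsub>A\<^esub> a = a \<otimes>\<^bsub>A\<^esub> (c \<odot>\<^bsub>A\<^esub> \<one>\<^bsub>A\<^esub>)"
  by (simp_all add: A.smult_mult_left A.smult_mult_right)

lemma emb_smult: "c \<in> carrier (Fm m) \<Longrightarrow> a \<in> carrier A \<Longrightarrow> emb (c \<odot>\<^bsub>A\<^esub> a) = scal c * emb a"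
  by (subst smult_eq(1)) (simp_all add: scal_def emb_simps)

definition Th :: "pre_elt \<Rightarrow> family" where
  "Th f = emb (quot f)"

lemma Th_simps:
  assumes "f \<in> FF"
  shows "g \<in> FF \<Longrightarrow> Th (f + g) = Th f + Th g" "g \<in> FF \<Longrightarrow> Th (f * g) = Th f * Th g"
    "one_emb * Th f = Th f"
  using assms by (simp_all add: Th_def quot_add quot_mult quot_closed emb_simps one_emb_mult)

lemma Th_one: "Th 1 = one_emb" and Th_scalar: "c \<in> carrier (Rm m) \<Longrightarrow> Th (scalar c) = scal (to_Fm c)"
  by (simp_all add: Th_def one_emb_def scal_def quot_one quot_scalar)

lemma Th_zero: "Th 0 = 0"
  using Th_simps(1)[OF FF_closed(1,1)] by simp

lemma Th_diff: "f \<in> FF \<Longrightarrow> g \<in> FF \<Longrightarrow> Th (f - g) = Th f - Th g"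
  using Th_simps(1)[of "f - g" g] FF_closed(4)[of f g] by (simp add: algebra_simps)

lemma Th_relator: "f \<in> yh_relators d m n \<Longrightarrow> Th f = 0"
  using relators_ideal quot_ideal quot_ideal[of 0] Th_zero
  by (metis Th_def subsetD Y.zero_closed yh_free_eq F.FA_simps(4))

lemma Th_relator_eq: "f - g \<in> yh_relators d m n \<Longrightarrow> f \<in> FF \<Longrightarrow> g \<in> FF \<Longrightarrow> Th f = Th g"
  using Th_relator[of "f - g"] by (simp add: Th_diff)

text \<open>For k = 0 the left power is the unit of the family ring and not of the corner; the
  factor \<open>one_emb\<close> corrects this.\<close>

lemma Th_power: "f \<in> FF \<Longrightarrow> one_emb * Th f ^ k = Th (f ^ k)"
proof (induction k)
  case (Suc k)
  then show ?case using one_emb_split[of "Th f" "Th f ^ k"] by (simp add: Th_simps FF_power)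
qed (simp add: Th_one)

lemma Th_sum: "finite B \<Longrightarrow> (\<And>i. i \<in> B \<Longrightarrow> f i \<in> FF) \<Longrightarrow> Th (sum f B) = (\<Sum>i\<in>B. Th (f i))"
  by (induction B rule: finite_induct) (simp_all add: Th_zero Th_simps FF_sum)

lemma Th_ee:
  assumes i: "1 \<le> i" "i < n"
  shows "Th (ee d i) = scal (to_Fm (const (1 / of_nat d))) * (\<Sum>k<d. Th (tt i) ^ k * (Th (tt (Suc i)) ^ (d - 1)) ^ k)"
    (is "_ = ?c * ?S")
proof -
  have t: "tt i \<in> FF" "tt (Suc i) \<in> FF" using i by (auto intro: FF_gens)
  have c: "Th (scalar (const (1 / of_nat d))) = ?c" by (rule Th_scalar) (rule Rm_const)
  have "one_emb * (Th (tt i) ^ k * (Th (tt (Suc i)) ^ (d - 1)) ^ k) = Th (tt i ^ k * (tt (i + 1) ^ (d - 1)) ^ k)" for k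
    unfolding one_emb_split power_mult[symmetric] by (simp add: Th_power Th_simps t FF_power)
  then have "one_emb * ?S = Th (\<Sum>k<d. tt i ^ k * (tt (i + 1) ^ (d - 1)) ^ k)"
    unfolding sum_distrib_left by (subst Th_sum) (auto intro!: FF_closed FF_power simp: t)
  then have "Th (ee d i) = ?c * (one_emb * ?S)"
    unfolding ee_def c[symmetric] by (subst Th_simps(2)) (auto intro!: FF_closed FF_power FF_sum Rm_const simp: t)
  also have "\<dots> = (one_emb * ?c) * ?S" by (simp only: mult.assoc[symmetric] one_emb_mult(3)[of ?c])
  also have "one_emb * ?c = ?c" unfolding c[symmetric] by (rule Th_simps(3)) (intro FF_closed Rm_const)
  finally show ?thesis .
qed

text \<open>\<open>ann\<close> multiplies new factors from the left, the product of the relator from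
  the right; hence the commutation hypothesis, which survives each step.\<close>

lemma Th_ann:
  assumes "set ls \<subseteq> {..m}" "f \<in> FF" "Th xx * Th f = Th f * Th xx"
  shows "ann scal (Th xx) (map vF ls) (Th f) = Th (f * prod_list (map (\<lambda>l. xx - scalar (indet_pow l 1)) ls))"
  using assms
proof (induction ls arbitrary: f)
  case (Cons l ls)
  have l: "indet_pow l 1 \<in> carrier (Rm m)" "vF l \<in> carrier (Fm m)" using Cons.prems(1) by (auto intro: Rm_indet_pow Fm_indets)
  let ?x = "xx - scalar (indet_pow l 1)"
  have x: "?x \<in> FF" by (intro FF_closed FF_gens l)
  have Tx: "Th ?x = Th xx - scal (vF l)"
    using l by (simp add: Th_diff FF_gens FF_closed Th_scalar vF_def)
  have cen: "scal (vF l) * y = y * scal (vF l)" for y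
    unfolding scal_def using l(2) by (simp add: emb_simps smult_eq[symmetric])
  have eq: "Th xx * Th f - scal (vF l) * Th f = Th (f * ?x)"
    unfolding Th_simps(2)[OF Cons.prems(2) x] Tx using Cons.prems(3) by (simp add: right_diff_distrib cen)
  have xf: "Th xx * (Th f * y) = Th f * (Th xx * y)" for y
    by (simp only: mult.assoc[symmetric] Cons.prems(3))
  have "Th xx * Th (f * ?x) = Th (f * ?x) * Th xx"
    unfolding eq[symmetric] by (simp add: xf right_diff_distrib left_diff_distrib Cons.prems(3) mult.assoc cen)
  moreover have "f * ?x \<in> FF" using Cons.prems(2) x by (rule FF_closed)
  ultimately show ?case
    using Cons.IH[of "f * ?x"] Cons.prems(1) by (simp add: eq mult.assoc)
qed simp

lemma hecke_ring:
  assumes d: "d > 0" and n: "n > 0" and \<xi>: "bij_betw \<xi> {1..d} {z. z ^ d = 1}"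
  shows "hecke_ring d m n \<xi> one_emb scal (\<lambda>j. Th (tt j)) (\<lambda>i. Th (gg i)) (Th xx)"
proof
  note rel = yh_relators_def
  have t: "tt j \<in> FF" if "1 \<le> j" "j \<le> n" for j using that by (rule FF_gens)
  have g: "gg i \<in> FF" if "1 \<le> i" "i < n" for i using that by (rule FF_gens)
  show "scal (a + b) = scal a + scal b" "scal (a * b) = scal a * scal b"
    if "a \<in> carrier (Fm m)" "b \<in> carrier (Fm m)" for a b
    using that A.smult_l_distr[of a b "\<one>\<^bsub>A\<^esub>"] A.smult_assoc1[of a b "\<one>\<^bsub>A\<^esub>"]
    by (simp_all add: scal_def emb_simps smult_eq(1)[symmetric])
  show "scal 1 = one_emb" using A.smult_one[of "\<one>\<^bsub>A\<^esub>"] by (simp add: scal_def one_emb_def)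
  show "y * scal a = scal a * y" if "a \<in> carrier (Fm m)" for a y
    unfolding scal_def using that by (simp add: emb_simps smult_eq[symmetric])
  show "one_emb * Th (tt j) = Th (tt j)" if "1 \<le> j" "j \<le> n" for j using t[OF that] by (rule Th_simps)
  show "one_emb * Th (gg i) = Th (gg i)" if "1 \<le> i" "i < n" for i using g[OF that] by (rule Th_simps)
  show "one_emb * Th xx = Th xx" by (intro Th_simps FF_gens)
  show "Th (tt i) * Th (tt j) = Th (tt j) * Th (tt i)" if "1 \<le> i" "i \<le> n" "1 \<le> j" "j \<le> n" for i j
    using that Th_relator_eq[of "tt i * tt j" "tt j * tt i"] by (auto simp: rel Th_simps t FF_closed)
  show "Th (tt j) ^ d = one_emb" if j: "1 \<le> j" "j \<le> n" for j
  proof -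
    have "Th (tt j ^ d) = one_emb"
      using j Th_relator_eq[of "tt j ^ d" 1] by (auto simp: rel Th_one t FF_closed FF_power)
    \<comment> \<open>Since d is positive, the power contains a factor absorbing
      \<open>one_emb\<close>.\<close>
    moreover have "one_emb * Th (tt j) ^ d = Th (tt j) ^ d"
      using d t[OF j] by (subst (1 2) power_eq_if) (simp add: mult.assoc[symmetric] Th_simps)
    ultimately show ?thesis using Th_power[OF t[OF j]] by simp
  qed
  show "Th (tt j) * Th (gg i) = Th (gg i) * Th (tt (swap i j))" if "1 \<le> i" "i < n" "1 \<le> j" "j \<le> n" for i j
  proof -
    have mem: "tt j * gg i - gg i * tt (swap i j) \<in>
        {tt j * gg i - gg i * tt (Transposition.transpose i (i + 1) j) |i j. i \<in> {1..n - 1} \<and> j \<in> {1..n}}"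
      using that by force
    have "tt j * gg i - gg i * tt (swap i j) \<in> yh_relators d m n"
      unfolding rel by (simp only: Un_iff mem simp_thms)
    then show ?thesis
      using that swap_mem[OF that] Th_relator_eq[of "tt j * gg i" "gg i * tt (swap i j)"]
      by (simp add: Th_simps t g FF_closed)
  qed
  show "Th (gg i) * Th (gg i) = one_emb + scal (qF - inverse qF) *
      (scal (to_Fm (const (1 / of_nat d))) * (\<Sum>k<d. Th (tt i) ^ k * (Th (tt (Suc i)) ^ (d - 1)) ^ k)) * Th (gg i)"
    if i: "1 \<le> i" "i < n" for i
  proof -
    have q: "Th q_diff = scal (qF - inverse qF)"
      unfolding q_diff_def by (subst Th_scalar) (auto intro!: Rm_closed Rm_indet_pow simp: qF_def inverse_qF[unfolded qF_def])
    have mem: "gg i ^ 2 - (1 + q_diff * ee d i * gg i) \<in> {gg i ^ 2 - (1 + q_diff * ee d i * gg i) |i. i \<in> {1..n - 1}}"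
      using i by force
    have "gg i ^ 2 - (1 + q_diff * ee d i * gg i) \<in> yh_relators d m n"
      unfolding rel by (simp only: Un_iff mem simp_thms)
    then have "Th (gg i ^ 2) = Th (1 + q_diff * ee d i * gg i)"
      using i by (intro Th_relator_eq) (auto intro!: FF_closed FF_power FF_gens)
    then show ?thesis
      unfolding q[symmetric] Th_ee[OF i, symmetric]
      using i by (simp add: power2_eq_square Th_simps Th_one FF_closed FF_gens)
  qed
  show "Th (gg i) * Th (gg (Suc i)) * Th (gg i) = Th (gg (Suc i)) * Th (gg i) * Th (gg (Suc i))"
    if "1 \<le> i" "Suc i < n" for i
  proof -
    have mem: "gg i * gg (i + 1) * gg i - gg (i + 1) * gg i * gg (i + 1) \<in>
        {gg i * gg (i + 1) * gg i - gg (i + 1) * gg i * gg (i + 1) |i. i \<in> {1..n - 1} \<and> i + 1 \<in> {1..n - 1}}"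
      using that by force
    have "gg i * gg (i + 1) * gg i - gg (i + 1) * gg i * gg (i + 1) \<in> yh_relators d m n"
      unfolding rel by (simp only: Un_iff mem simp_thms)
    then show ?thesis
      using that Th_relator_eq[of "gg i * gg (i + 1) * gg i" "gg (i + 1) * gg i * gg (i + 1)"]
      by (simp add: Th_simps g FF_closed)
  qed
  show "Th (gg i) * Th (gg j) = Th (gg j) * Th (gg i)" if "1 \<le> i" "Suc i < j" "j < n" for i j
  proof -
    have mem: "gg i * gg j - gg j * gg i \<in> {gg i * gg j - gg j * gg i |i j.
        i \<in> {1..n - 1} \<and> j \<in> {1..n - 1} \<and> \<bar>int i - int j\<bar> > 1}"
      using that by force
    have "gg i * gg j - gg j * gg i \<in> yh_relators d m n"
      unfolding rel by (simp only: Un_iff mem simp_thms)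
    then show ?thesis using that Th_relator_eq[of "gg i * gg j" "gg j * gg i"] by (simp add: Th_simps g FF_closed)
  qed
  show "Th xx * Th (gg 1) * Th xx * Th (gg 1) = Th (gg 1) * Th xx * Th (gg 1) * Th xx" if "2 \<le> n"
  proof -
    have mem: "xx * gg 1 * xx * gg 1 - gg 1 * xx * gg 1 * xx \<in>
        (if n \<ge> 2 then {xx * gg 1 * xx * gg 1 - gg 1 * xx * gg 1 * xx} else {})"
      using that by simp
    have "xx * gg 1 * xx * gg 1 - gg 1 * xx * gg 1 * xx \<in> yh_relators d m n"
      unfolding rel by (simp only: Un_iff mem simp_thms)
    then show ?thesis
      using that Th_relator_eq[of "xx * gg 1 * xx * gg 1" "gg 1 * xx * gg 1 * xx"]
      by (simp add: Th_simps g FF_closed FF_gens(1))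
  qed
  show "Th xx * Th (gg i) = Th (gg i) * Th xx" if "2 \<le> i" "i < n" for i
  proof -
    have mem: "xx * gg i - gg i * xx \<in> {xx * gg i - gg i * xx |i. i \<in> {1..n - 1} \<and> i \<ge> 2}"
      using that by force
    have "xx * gg i - gg i * xx \<in> yh_relators d m n"
      unfolding rel by (simp only: Un_iff mem simp_thms)
    then show ?thesis using that Th_relator_eq[of "xx * gg i" "gg i * xx"] by (simp add: Th_simps g FF_closed FF_gens(1))
  qed
  show "Th xx * Th (tt j) = Th (tt j) * Th xx" if "1 \<le> j" "j \<le> n" for j
  proof -
    have mem: "xx * tt j - tt j * xx \<in> {xx * tt j - tt j * xx |j. j \<in> {1..n}}" using that by force
    have "xx * tt j - tt j * xx \<in> yh_relators d m n"
      unfolding rel by (simp only: Un_iff mem simp_thms)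
    then show ?thesis using that Th_relator_eq[of "xx * tt j" "tt j * xx"] by (simp add: Th_simps t FF_closed FF_gens(1))
  qed
  show "ann scal (Th xx) (map vF [1..<m + 1]) one_emb = 0"
  proof -
    have x1: "Th xx * Th 1 = Th 1 * Th xx" by (simp add: Th_one one_emb_mult(3))
    have "ann scal (Th xx) (map vF [1..<m + 1]) (Th 1)
        = Th (1 * prod_list (map (\<lambda>l. xx - scalar (indet_pow l 1)) [1..<m + 1]))"
      by (rule Th_ann[OF _ FF_closed(2) x1]) auto
    also have "\<dots> = 0" unfolding mult_1 by (rule Th_relator) (simp only: rel Un_iff singleton_iff simp_thms)
    finally show ?thesis by (simp only: Th_one)
  qed
qed (use d n \<xi> in simp_all)

end

section \<open>Homomorphisms and direct sums\<close>

lemma representation_regular: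
  assumes "assoc_algebra K A"
  shows "representation K A A (\<lambda>a b. a \<otimes>\<^bsub>A\<^esub> b)"
proof -
  interpret A: assoc_algebra K A by (rule assms)
  show ?thesis
    by (intro representation.intro representation_axioms.intro assms A.module_axioms)
      (simp_all add: A.r_distr A.l_distr A.smult_mult_left A.smult_mult_right A.m_assoc)
qed

lemma (in module) a_inv_smult: "x \<in> carrier M \<Longrightarrow> \<ominus>\<^bsub>M\<^esub> x = (\<ominus> \<one>) \<odot>\<^bsub>M\<^esub> x"
  using smult_l_minus[of \<one> x] by simp

lemma (in representation) subrepI:
  assumes "U \<subseteq> carrier V" "\<zero>\<^bsub>V\<^esub> \<in> U" "\<And>u v. u \<in> U \<Longrightarrow> v \<in> U \<Longrightarrow> u \<oplus>\<^bsub>V\<^esub> v \<in> U"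
    "\<And>c u. c \<in> carrier R \<Longrightarrow> u \<in> U \<Longrightarrow> c \<odot>\<^bsub>V\<^esub> u \<in> U" "\<And>a u. a \<in> carrier A \<Longrightarrow> u \<in> U \<Longrightarrow> \<rho> a u \<in> U"
  shows "subrep R A V \<rho> U"
proof -
  have "\<ominus>\<^bsub>V\<^esub> u \<in> U" if "u \<in> U" for u
    using assms(1,4) that V.a_inv_smult[of u] by (metis A.R.a_inv_closed A.R.one_closed subsetD)
  then have "submodule U R V"
    using assms by (intro V.submoduleI) (auto simp: a_inv_def)
  then show ?thesis using assms(5) by (simp add: subrep_def)
qed

lemma (in representation) subrepD:
  assumes "subrep R A V \<rho> U"
  shows "U \<subseteq> carrier V" "\<zero>\<^bsub>V\<^esub> \<in> U" "u \<in> U \<Longrightarrow> v \<in> U \<Longrightarrow> u \<oplus>\<^bsub>V\<^esub> v \<in> U"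
    "c \<in> carrier R \<Longrightarrow> u \<in> U \<Longrightarrow> c \<odot>\<^bsub>V\<^esub> u \<in> U" "a \<in> carrier A \<Longrightarrow> u \<in> U \<Longrightarrow> \<rho> a u \<in> U"
proof -
  have sub: "submodule U R V" using assms by (simp add: subrep_def)
  show "U \<subseteq> carrier V" "\<zero>\<^bsub>V\<^esub> \<in> U" "u \<in> U \<Longrightarrow> v \<in> U \<Longrightarrow> u \<oplus>\<^bsub>V\<^esub> v \<in> U"
    "c \<in> carrier R \<Longrightarrow> u \<in> U \<Longrightarrow> c \<odot>\<^bsub>V\<^esub> u \<in> U"
    using V.submoduleE[OF sub] subgroup.one_closed[OF submodule.axioms(1)[OF sub]] by auto
  show "a \<in> carrier A \<Longrightarrow> u \<in> U \<Longrightarrow> \<rho> a u \<in> U" using assms by (simp add: subrep_def)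
qed

locale rep_hom = V: representation R A V \<rho> + W: representation R A W \<sigma>
  for R :: "('k, 'r) ring_scheme" and A :: "('k, 'a, 's) module_scheme"
    and V :: "('k, 'v, 't) module_scheme" and \<rho> and W :: "('k, 'w, 'u) module_scheme" and \<sigma> +
  fixes \<phi> :: "'v \<Rightarrow> 'w"
  assumes hom_closed: "v \<in> carrier V \<Longrightarrow> \<phi> v \<in> carrier W"
    and hom_add: "u \<in> carrier V \<Longrightarrow> v \<in> carrier V \<Longrightarrow> \<phi> (u \<oplus>\<^bsub>V\<^esub> v) = \<phi> u \<oplus>\<^bsub>W\<^esub> \<phi> v"
    and hom_smult: "c \<in> carrier R \<Longrightarrow> v \<in> carrier V \<Longrightarrow> \<phi> (c \<odot>\<^bsub>V\<^esub> v) = c \<odot>\<^bsub>W\<^esub> \<phi> v"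
    and hom_act: "a \<in> carrier A \<Longrightarrow> v \<in> carrier V \<Longrightarrow> \<phi> (\<rho> a v) = \<sigma> a (\<phi> v)"
begin

lemma hom_zero: "\<phi> \<zero>\<^bsub>V\<^esub> = \<zero>\<^bsub>W\<^esub>"
  using hom_smult[OF V.A.R.zero_closed V.V.zero_closed] hom_closed[OF V.V.zero_closed] by simp

lemma subrep_preimage:
  assumes "subrep R A W \<sigma> U"
  shows "subrep R A V \<rho> {v \<in> carrier V. \<phi> v \<in> U}"
  using W.subrepD[OF assms]
  by (intro V.subrepI) (auto simp: hom_zero hom_add hom_smult hom_act V.act_closed)

lemma subrep_image: "subrep R A W \<sigma> (\<phi> ` carrier V)"
proof (intro W.subrepI)
  show "\<zero>\<^bsub>W\<^esub> \<in> \<phi> ` carrier V" using hom_zero[symmetric] by (rule image_eqI) simp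
qed (auto simp: hom_closed hom_add[symmetric] hom_smult[symmetric] hom_act[symmetric] V.act_closed intro!: imageI)

text \<open>Schur's lemma\<close>

lemma isomorphic_repsI:
  assumes irr: "irreducible_rep R A V \<rho>" "irreducible_rep R A W \<sigma>" and v: "v \<in> carrier V" "\<phi> v \<noteq> \<zero>\<^bsub>W\<^esub>"
  shows "isomorphic_reps R A W \<sigma> V \<rho>"
proof -
  have zero: "subrep R A W \<sigma> {\<zero>\<^bsub>W\<^esub>}"
  proof (intro W.subrepI)
    fix a u assume "a \<in> carrier A" "u \<in> {\<zero>\<^bsub>W\<^esub>}"
    then show "\<sigma> a u \<in> {\<zero>\<^bsub>W\<^esub>}"
      using W.act_smult[of a "\<zero>\<^bsub>R\<^esub>" "\<zero>\<^bsub>W\<^esub>"] W.act_closed[of a "\<zero>\<^bsub>W\<^esub>"] by simp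
  qed auto
  have "subrep R A V \<rho> {v \<in> carrier V. \<phi> v \<in> {\<zero>\<^bsub>W\<^esub>}}" by (rule subrep_preimage[OF zero])
  then have ker: "{v \<in> carrier V. \<phi> v \<in> {\<zero>\<^bsub>W\<^esub>}} = {\<zero>\<^bsub>V\<^esub>}"
    using irr(1) v unfolding irreducible_rep_def simple_subrep_def by blast
  have "\<phi> ` carrier V = carrier W"
    using irr(2) subrep_image v hom_closed unfolding irreducible_rep_def simple_subrep_def by blast
  moreover have "inj_on \<phi> (carrier V)"
  proof (rule inj_onI)
    fix x y assume x: "x \<in> carrier V" and y: "y \<in> carrier V" and eq: "\<phi> x = \<phi> y"
    have "\<phi> (\<ominus>\<^bsub>V\<^esub> y) = \<ominus>\<^bsub>W\<^esub> \<phi> y"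
      using y by (simp add: V.V.a_inv_smult W.V.a_inv_smult hom_smult hom_closed)
    then have "\<phi> (x \<ominus>\<^bsub>V\<^esub> y) = \<zero>\<^bsub>W\<^esub>"
      using x y eq by (simp add: a_minus_def hom_add hom_closed W.V.r_neg)
    then have "x \<ominus>\<^bsub>V\<^esub> y = \<zero>\<^bsub>V\<^esub>" using ker x y by auto
    then have "\<ominus>\<^bsub>V\<^esub> (\<ominus>\<^bsub>V\<^esub> y) = x" using x y by (intro V.V.minus_equality) (simp_all add: a_minus_def)
    then show "x = y" using y by simp
  qed
  ultimately have bij: "bij_betw \<phi> (carrier V) (carrier W)" by (simp add: bij_betw_def)
  define \<psi> where "\<psi> = the_inv_into (carrier V) \<phi>"
  have \<psi>: "\<psi> (\<phi> x) = x" if "x \<in> carrier V" for x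
    using bij that by (simp add: \<psi>_def bij_betw_def the_inv_into_f_f)
  have ex: "\<exists>x\<in>carrier V. w = \<phi> x" if "w \<in> carrier W" for w using bij that by (auto simp: bij_betw_def)
  show ?thesis
    unfolding isomorphic_reps_def
  proof (intro exI[of _ \<psi>] conjI ballI)
    show "bij_betw \<psi> (carrier W) (carrier V)" unfolding \<psi>_def by (rule bij_betw_the_inv_into[OF bij])
    fix x y assume "x \<in> carrier W" "y \<in> carrier W"
    then obtain x' y' where "x' \<in> carrier V" "x = \<phi> x'" "y' \<in> carrier V" "y = \<phi> y'" using ex by blast
    then show "\<psi> (x \<oplus>\<^bsub>W\<^esub> y) = \<psi> x \<oplus>\<^bsub>V\<^esub> \<psi> y" by (simp add: hom_add[symmetric] \<psi>)
  next
    fix c x assume "c \<in> carrier R" "x \<in> carrier W"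
    then show "\<psi> (c \<odot>\<^bsub>W\<^esub> x) = c \<odot>\<^bsub>V\<^esub> \<psi> x" using ex[of x] by (auto simp: hom_smult[symmetric] \<psi>)
  next
    fix a x assume "a \<in> carrier A" "x \<in> carrier W"
    then show "\<psi> (\<sigma> a x) = \<rho> a (\<psi> x)" using ex[of x] by (auto simp: hom_act[symmetric] \<psi> V.act_closed)
  qed
qed

text \<open>The preimage of a subrepresentation is 0 or V. If it is V, the subrepresentation
  contains the generator; if it is 0, every element of it is the image of an element of that
  preimage and so vanishes.\<close>

lemma simple_subrep_cyclic:
  assumes irr: "irreducible_rep R A V \<rho>" and v: "v \<in> carrier V" "\<phi> v \<noteq> \<zero>\<^bsub>W\<^esub>"
  shows "simple_subrep R A W \<sigma> ((\<lambda>a. \<sigma> a (\<phi> v)) ` carrier A)" (is "simple_subrep R A W \<sigma> ?U")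
  unfolding simple_subrep_def
proof (intro conjI allI impI)
  have w: "\<phi> v \<in> carrier W" using hom_closed v by blast
  have mem: "\<sigma> a (\<phi> v) \<in> ?U" if "a \<in> carrier A" for a using that by (rule imageI)
  show "subrep R A W \<sigma> ?U"
  proof (intro W.subrepI)
    have "\<sigma> (\<zero>\<^bsub>R\<^esub> \<odot>\<^bsub>A\<^esub> \<one>\<^bsub>A\<^esub>) (\<phi> v) = \<zero>\<^bsub>W\<^esub>" using W.smult_act[OF V.A.one_closed V.A.R.zero_closed w] w W.one_act[OF w] by simp
    then show "\<zero>\<^bsub>W\<^esub> \<in> ?U" using mem[OF V.A.smult_closed[OF V.A.R.zero_closed V.A.one_closed]] by simp
  qed (auto simp: w W.act_closed W.add_act[symmetric] W.smult_act[symmetric] W.mult_act[symmetric] intro!: imageI)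
  show "?U \<noteq> {\<zero>\<^bsub>W\<^esub>}" using mem[of "\<one>\<^bsub>A\<^esub>"] W.one_act[OF w] v by auto
  fix U' assume "subrep R A W \<sigma> U' \<and> U' \<subseteq> ?U"
  then have U': "subrep R A W \<sigma> U'" "U' \<subseteq> ?U" by simp_all
  have "{v \<in> carrier V. \<phi> v \<in> U'} = {\<zero>\<^bsub>V\<^esub>} \<or> {v \<in> carrier V. \<phi> v \<in> U'} = carrier V"
    using irr subrep_preimage[OF U'(1)] unfolding irreducible_rep_def simple_subrep_def by blast
  then show "U' = {\<zero>\<^bsub>W\<^esub>} \<or> U' = ?U"
  proof
    assume z: "{v \<in> carrier V. \<phi> v \<in> U'} = {\<zero>\<^bsub>V\<^esub>}"
    have "u = \<zero>\<^bsub>W\<^esub>" if u: "u \<in> U'" for u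
    proof -
      obtain a where a: "a \<in> carrier A" "u = \<sigma> a (\<phi> v)" using u U'(2) by auto
      then have "\<rho> a v \<in> {v \<in> carrier V. \<phi> v \<in> U'}" using u v by (simp add: hom_act V.act_closed)
      then show ?thesis using a v hom_act[of a v] by (simp add: z hom_zero)
    qed
    then show ?thesis using W.subrepD(2)[OF U'(1)] by blast
  next
    assume "{v \<in> carrier V. \<phi> v \<in> U'} = carrier V"
    then have "\<phi> v \<in> U'" using v by blast
    then show ?thesis using U'(2) W.subrepD(5)[OF U'(1)] by blast
  qed
qed

end

text \<open>Any a is the sum of the a \<epsilon>_i, and right multiplication by \<epsilon>_i
  recovers the i-th summand of any decomposition, so the left ideals generated by the \<epsilon>_i
  form a direct sum.\<close>

lemma (in assoc_algebra) semisimple_orthogonal_idempotents: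
  assumes F: "finite F" and E: "\<And>i. i \<in> F \<Longrightarrow> \<epsilon> i \<in> carrier A" "\<And>i. i \<in> F \<Longrightarrow> \<epsilon> i \<noteq> \<zero>"
    and orth: "\<And>i j. i \<in> F \<Longrightarrow> j \<in> F \<Longrightarrow> \<epsilon> i \<otimes> \<epsilon> j = (if i = j then \<epsilon> j else \<zero>)"
    and one: "(\<Oplus>i\<in>F. \<epsilon> i) = \<one>"
    and simple: "\<And>i. i \<in> F \<Longrightarrow> simple_subrep R A A (\<lambda>a b. a \<otimes> b) ((\<lambda>a. a \<otimes> \<epsilon> i) ` carrier A)"
  shows "semisimple_algebra R A"
proof -
  define U where "U i = (\<lambda>a. a \<otimes> \<epsilon> i) ` carrier A" for i
  have UA: "u \<in> carrier A" if "u \<in> U i" "i \<in> F" for u i using that E by (auto simp: U_def)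
  have Uo: "u \<otimes> \<epsilon> j = (if i = j then u else \<zero>)" if u: "u \<in> U i" and i: "i \<in> F" and j: "j \<in> F" for u i j
  proof -
    obtain a where "a \<in> carrier A" "u = a \<otimes> \<epsilon> i" using u by (auto simp: U_def)
    then show ?thesis using i j E by (simp add: m_assoc orth)
  qed
  \<comment> \<open>The direct sum is indexed by the set of ideals, so different idempotents must
    generate different ideals.\<close>
  have inj: "inj_on U F"
  proof (rule inj_onI, rule ccontr)
    fix i j assume ij: "i \<in> F" "j \<in> F" "U i = U j" "i \<noteq> j"
    have "\<epsilon> i \<in> U i" unfolding U_def using E(1)[OF ij(1)] by (intro image_eqI[of _ _ \<one>]) simp_all
    then have "\<epsilon> i \<otimes> \<epsilon> j = \<epsilon> i" using Uo[of "\<epsilon> i" j j] ij by simp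
    then show False using orth[OF ij(1,2)] ij(4) E(2)[OF ij(1)] by simp
  qed
  have sum: "(\<Oplus>u\<in>U ` F. f u) = (\<Oplus>i\<in>F. f (U i))" if "f \<in> PiE (U ` F) (\<lambda>u. u)" for f
    using that UA by (intro add.finprod_reindex inj) (auto simp: PiE_iff)
  have "\<exists>!f. f \<in> PiE (U ` F) (\<lambda>u. u) \<and> a = (\<Oplus>u\<in>U ` F. f u)" if a: "a \<in> carrier A" for a
  proof (rule ex1I)
    define f where "f = restrict (\<lambda>u. a \<otimes> \<epsilon> (the_inv_into F U u)) (U ` F)"
    have fU: "f (U i) = a \<otimes> \<epsilon> i" if "i \<in> F" for i
      using that inj by (simp add: f_def the_inv_into_f_f)
    have f: "f \<in> PiE (U ` F) (\<lambda>u. u)"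
      using a by (auto simp: PiE_iff fU) (auto simp: f_def U_def)
    have "(\<Oplus>u\<in>U ` F. f u) = (\<Oplus>i\<in>F. a \<otimes> \<epsilon> i)"
      unfolding sum[OF f] using a E fU by (intro add.finprod_cong') auto
    also have "\<dots> = a" using finsum_rdistr[OF F a, of \<epsilon>] a E one by simp
    finally show "f \<in> PiE (U ` F) (\<lambda>u. u) \<and> a = (\<Oplus>u\<in>U ` F. f u)" using f by simp
    fix g assume g: "g \<in> PiE (U ` F) (\<lambda>u. u) \<and> a = (\<Oplus>u\<in>U ` F. g u)"
    have gU: "g (U i) \<in> U i" if "i \<in> F" for i using g that by (auto simp: PiE_iff)
    have "g (U i) = f (U i)" if i: "i \<in> F" for i
    proof -
      have "f (U i) = (\<Oplus>j\<in>F. g (U j)) \<otimes> \<epsilon> i" using fU[OF i] g sum[of g] by simp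
      also have "\<dots> = (\<Oplus>j\<in>F. g (U j) \<otimes> \<epsilon> i)"
        using gU UA E i by (intro finsum_ldistr F) auto
      also have "\<dots> = (\<Oplus>j\<in>F. if i = j then g (U j) else \<zero>)"
        using UA[OF gU] Uo[OF gU _ i] i by (intro add.finprod_cong') auto
      also have "\<dots> = g (U i)" using F i UA[OF gU] by (intro add.finprod_singleton) auto
      finally show ?thesis by simp
    qed
    then show "g = f" using f g by (intro PiE_ext[of g _ _ f]) auto
  qed
  then show ?thesis
    unfolding semisimple_algebra_def using F simple
    by (intro conjI exI[of _ "U ` F"]) (auto simp: U_def[abs_def] intro: assoc_algebra_axioms)
qed

section \<open>Orthogonal idempotents from the weight decomposition\<close>

context hecke_ring
begin

text \<open>Weights concern left multiplication only.\<close>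

lemma fullwt_mult_right: "fullwt \<tau> u \<Longrightarrow> fullwt \<tau> (u * y)"
  unfolding fullwt_def wt_def teig_def by (simp add: mult.assoc[symmetric])

text \<open>Different standard tableaux differ in some position or content, so one of the T or JM
  elements separates them.\<close>

lemma weights_distinct:
  assumes "std_seq d m n \<sigma>" "std_seq d m n \<tau>" "\<sigma> \<in> extensional {1..n}" "\<tau> \<in> extensional {1..n}" "\<sigma> \<noteq> \<tau>"
  obtains Z z where "\<And>\<rho> u. fullwt \<rho> u \<Longrightarrow> Z * u = s (z \<rho>) * u \<and> z \<rho> \<in> K" "z \<sigma> \<noteq> z \<tau>"
proof -
  obtain i where i: "i \<in> {1..n}" "\<not> (node_pos (\<sigma> i) = node_pos (\<tau> i) \<and> node_content (\<sigma> i) = node_content (\<tau> i))"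
    using std_seq_weights_eq[OF assms(1,2)] extensionalityI[OF assms(3,4)] assms(5) by blast
  have v: "valid_node d m (\<sigma> i)" "valid_node d m (\<tau> i)" using std_seq_valid assms(1,2) i(1) by auto
  show thesis
  proof (cases "node_content (\<sigma> i) = node_content (\<tau> i)")
    case True
    have "\<xi> (node_pos (\<sigma> i)) \<noteq> \<xi> (node_pos (\<tau> i))"
      using i(2) True inj_onD[OF bij_betw_imp_inj_on[OF \<xi>], of "node_pos (\<sigma> i)" "node_pos (\<tau> i)"] v
      by (auto simp: valid_node_def node_pos_eq)
    then have "rt (node_pos (\<sigma> i)) \<noteq> rt (node_pos (\<tau> i))" by (simp add: rt_def const_eq_iff)
    moreover have "T i * u = s (rt (node_pos (\<rho> i))) * u \<and> rt (node_pos (\<rho> i)) \<in> K" if "fullwt \<rho> u" for \<rho> u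
      using teigD(2)[OF wtD(1)[OF that[unfolded fullwt_def]]] i(1) rt_closed by simp
    ultimately show thesis using that[of "T i" "\<lambda>\<rho>. rt (node_pos (\<rho> i))"] by blast
  next
    case False
    have "JM i * u = s (node_content (\<rho> i)) * u \<and> node_content (\<rho> i) \<in> K" if "fullwt \<rho> u" for \<rho> u
      using wtD(4,5)[OF that[unfolded fullwt_def], of i] i(1) node_content_closed by auto
    then show thesis using that[of "JM i" "\<lambda>\<rho>. node_content (\<rho> i)"] False by blast
  qed
qed

lemma fullwtD: "fullwt \<tau> u \<Longrightarrow> e * u = u" "fullwt \<tau> u \<Longrightarrow> std_seq d m n \<tau>"
  unfolding fullwt_def using teigD(1)[OF wtD(1)] wtD(2) by blast+

lemma fullwt_stable: "stable (fullwt \<tau>)"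
  using wt_stable unfolding fullwt_def[abs_def] .

text \<open>The usual independence of eigenvectors: apply Z - z \<sigma> for an element Z separating
  \<tau> and \<sigma> to remove the term \<sigma>, and induct on the number of terms.\<close>

lemma weights_independent:
  assumes "finite B" "\<tau> \<notin> B" "insert \<tau> B \<subseteq> extensional {1..n}"
    "\<And>\<sigma>. \<sigma> \<in> insert \<tau> B \<Longrightarrow> fullwt \<sigma> (x \<sigma>)" "x \<tau> = (\<Sum>\<sigma>\<in>B. x \<sigma>)"
  shows "x \<tau> = 0"
  using assms
proof (induction B arbitrary: x rule: finite_induct)
  case (insert \<sigma> B)
  have w: "fullwt \<rho> (x \<rho>)" if "\<rho> \<in> insert \<tau> (insert \<sigma> B)" for \<rho> using insert.prems(3) that by blast
  have std: "std_seq d m n \<tau>" "std_seq d m n \<sigma>" by (rule fullwtD(2)[OF w]; simp)+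
  have ext: "\<tau> \<in> extensional {1..n}" "\<sigma> \<in> extensional {1..n}" "\<tau> \<noteq> \<sigma>" using insert.prems(1,2) by auto
  obtain Z z where Z: "\<And>\<rho> u. fullwt \<rho> u \<Longrightarrow> Z * u = s (z \<rho>) * u \<and> z \<rho> \<in> K" "z \<tau> \<noteq> z \<sigma>"
    using weights_distinct[OF std ext] by metis
  have zK: "z \<rho> - z \<sigma> \<in> K" if "\<rho> \<in> insert \<tau> (insert \<sigma> B)" for \<rho>
    using Z(1)[OF w[OF that]] Z(1)[OF w[of \<sigma>]] by (intro Fm_closed) auto
  have step: "Z * x \<rho> - s (z \<sigma>) * x \<rho> = s (z \<rho> - z \<sigma>) * x \<rho>" if "\<rho> \<in> insert \<tau> (insert \<sigma> B)" for \<rho>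
    using Z(1)[OF w[OF that]] Z(1)[OF w[of \<sigma>]] by (simp add: s_diff left_diff_distrib)
  have "s (z \<tau> - z \<sigma>) * x \<tau> = Z * x \<tau> - s (z \<sigma>) * x \<tau>" by (rule step[symmetric]) simp
  also have "\<dots> = (\<Sum>\<rho>\<in>insert \<sigma> B. Z * x \<rho> - s (z \<sigma>) * x \<rho>)"
    by (simp only: insert.prems(4) sum_distrib_left sum_subtractf)
  also have "\<dots> = (\<Sum>\<rho>\<in>insert \<sigma> B. s (z \<rho> - z \<sigma>) * x \<rho>)" by (intro sum.cong refl step) auto
  also have "\<dots> = (\<Sum>\<rho>\<in>B. s (z \<rho> - z \<sigma>) * x \<rho>)" using insert.hyps by (simp add: s_zero)
  finally have "s (z \<tau> - z \<sigma>) * x \<tau> = (\<Sum>\<rho>\<in>B. s (z \<rho> - z \<sigma>) * x \<rho>)" .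
  from insert.IH[OF _ _ _ this] have "s (z \<tau> - z \<sigma>) * x \<tau> = 0"
    using insert.prems(1,2) stableD(3)[OF fullwt_stable zK w] by auto
  then show ?case
    using s_cancel[OF zK[of \<tau>] _ fullwtD(1)[OF w[of \<tau>]]] Z(2) by simp
qed simp

lemma collect_weights:
  assumes "w \<in> add_span (\<lambda>u. \<exists>\<tau>\<in>extensional {1..n}. fullwt \<tau> u)"
  shows "\<exists>F x. finite F \<and> F \<subseteq> extensional {1..n} \<and> (\<forall>\<tau>\<in>F. fullwt \<tau> (x \<tau>)) \<and> w = (\<Sum>\<tau>\<in>F. x \<tau>)"
  using assms
proof (induction rule: add_span.induct)
  case zero
  show ?case by (rule exI[of _ "{}"]) simp
next
  case (step u v)
  obtain \<tau> where \<tau>: "\<tau> \<in> extensional {1..n}" "fullwt \<tau> u" using step.hyps(1) by blast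
  obtain F x where F: "finite F" "F \<subseteq> extensional {1..n}" "\<And>\<tau>. \<tau> \<in> F \<Longrightarrow> fullwt \<tau> (x \<tau>)" "v = (\<Sum>\<tau>\<in>F. x \<tau>)"
    using step.IH by blast
  define y where "y = x(\<tau> := if \<tau> \<in> F then u + x \<tau> else u)"
  have "u + v = (\<Sum>\<rho>\<in>insert \<tau> F. y \<rho>)"
  proof (cases "\<tau> \<in> F")
    case True
    then have "(\<Sum>\<rho>\<in>insert \<tau> F. y \<rho>) = y \<tau> + (\<Sum>\<rho>\<in>F - {\<tau>}. y \<rho>)" using F(1) by (simp add: sum.remove insert_absorb)
    also have "(\<Sum>\<rho>\<in>F - {\<tau>}. y \<rho>) = (\<Sum>\<rho>\<in>F - {\<tau>}. x \<rho>)" by (rule sum.cong) (auto simp: y_def)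
    finally show ?thesis using True F(1,4) by (simp add: y_def sum.remove add.assoc)
  next
    case False
    have "(\<Sum>\<rho>\<in>F. y \<rho>) = (\<Sum>\<rho>\<in>F. x \<rho>)" using False by (intro sum.cong) (auto simp: y_def)
    then show ?thesis using False F(1,4) by (simp add: y_def)
  qed
  moreover have "fullwt \<rho> (y \<rho>)" if "\<rho> \<in> insert \<tau> F" for \<rho>
    using that F(3) \<tau>(2) stableD(2)[OF fullwt_stable] by (auto simp: y_def)
  ultimately show ?case using F(1,2) \<tau>(1) by (intro exI[of _ "insert \<tau> F"] exI[of _ y]) auto
qed

text \<open>Let e be the sum of the x_\<rho>. In x_\<tau> = e x_\<tau> each product x_\<rho>
  x_\<tau> has weight \<rho>, so comparing weights leaves x_\<tau> x_\<tau> = x_\<tau> and makes the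
  other products zero.\<close>

lemma weight_idempotents:
  obtains F x where "finite F" "F \<subseteq> extensional {1..n}" "e = (\<Sum>\<tau>\<in>F. x \<tau>)"
    "\<And>\<tau>. \<tau> \<in> F \<Longrightarrow> fullwt \<tau> (x \<tau>) \<and> x \<tau> \<noteq> 0"
    "\<And>\<sigma> \<tau>. \<sigma> \<in> F \<Longrightarrow> \<tau> \<in> F \<Longrightarrow> x \<sigma> * x \<tau> = (if \<sigma> = \<tau> then x \<tau> else 0)"
proof -
  have "e * e = e" using s_mult[OF Fm_closed(2,2)] by (simp add: s_one)
  from collect_weights[OF weight_decomp[OF this]]
  obtain F x where F: "finite F" "F \<subseteq> extensional {1..n}" "\<And>\<tau>. \<tau> \<in> F \<Longrightarrow> fullwt \<tau> (x \<tau>)" "e = (\<Sum>\<tau>\<in>F. x \<tau>)"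
    by blast
  have orth: "x \<sigma> * x \<tau> = (if \<sigma> = \<tau> then x \<tau> else 0)" if \<sigma>: "\<sigma> \<in> F" and \<tau>: "\<tau> \<in> F" for \<sigma> \<tau>
  proof -
    \<comment> \<open>The terms of the identity for x_\<tau>, with both contributions of weight
      \<tau> collected in one.\<close>
    define y where "y \<rho> = (if \<rho> = \<tau> then x \<tau> - x \<tau> * x \<tau> else x \<rho> * x \<tau>)" for \<rho>
    have yw: "fullwt \<rho> (y \<rho>)" if "\<rho> \<in> F" for \<rho>
      using stableD(4)[OF fullwt_stable] fullwt_mult_right F(3)[OF that] \<tau> by (auto simp: y_def)
    have "x \<tau> = e * x \<tau>" using fullwtD(1)[OF F(3)[OF \<tau>]] by simp
    also have "\<dots> = x \<tau> * x \<tau> + (\<Sum>\<rho>\<in>F - {\<tau>}. x \<rho> * x \<tau>)"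
      unfolding F(4) sum_distrib_right using F(1) \<tau> by (rule sum.remove)
    also have "(\<Sum>\<rho>\<in>F - {\<tau>}. x \<rho> * x \<tau>) = (\<Sum>\<rho>\<in>F - {\<tau>}. y \<rho>)" by (rule sum.cong) (auto simp: y_def)
    finally have y\<tau>: "y \<tau> = (\<Sum>\<rho>\<in>F - {\<tau>}. y \<rho>)" by (simp add: y_def algebra_simps)
    have "y \<tau> = 0"
      by (rule weights_independent[OF _ _ _ _ y\<tau>]) (use F(1,2) \<tau> yw in auto)
    moreover have "y \<sigma> = 0" if "\<sigma> \<noteq> \<tau>"
    proof -
      have "(\<Sum>\<rho>\<in>F - {\<tau>}. y \<rho>) = y \<sigma> + (\<Sum>\<rho>\<in>F - {\<tau>} - {\<sigma>}. y \<rho>)"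
        using F(1) \<sigma> that by (intro sum.remove) auto
      then have "- y \<sigma> = (\<Sum>\<rho>\<in>F - {\<tau>} - {\<sigma>}. y \<rho>)" using y\<tau> \<open>y \<tau> = 0\<close> by (simp add: neg_eq_iff_add_eq_0)
      then have y\<sigma>: "y \<sigma> = (\<Sum>\<rho>\<in>F - {\<tau>} - {\<sigma>}. - y \<rho>)" unfolding sum_negf by (metis minus_minus)
      define z where "z \<rho> = (if \<rho> = \<sigma> then y \<sigma> else - y \<rho>)" for \<rho>
      have "fullwt \<rho> (- y \<rho>)" if "\<rho> \<in> F" for \<rho>
        using stableD(3)[OF fullwt_stable Fm_closed(4)[OF Fm_closed(2)] yw[OF that]] fullwtD(1)[OF yw[OF that]]
        by (simp add: s_uminus Fm_closed s_one)
      then have zw: "fullwt \<rho> (z \<rho>)" if "\<rho> \<in> F" for \<rho>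
        using yw that \<sigma> by (simp add: z_def)
      have "(\<Sum>\<rho>\<in>F - {\<tau>} - {\<sigma>}. - y \<rho>) = (\<Sum>\<rho>\<in>F - {\<tau>} - {\<sigma>}. z \<rho>)"
        by (rule sum.cong) (auto simp: z_def)
      then have "z \<sigma> = (\<Sum>\<rho>\<in>F - {\<tau>} - {\<sigma>}. z \<rho>)" using y\<sigma> by (simp add: z_def)
      from weights_independent[OF _ _ _ _ this] have "z \<sigma> = 0" using F(1,2) \<sigma> zw by blast
      then show ?thesis by (simp add: z_def)
    qed
    ultimately show ?thesis by (auto simp: y_def)
  qed
  have "e = (\<Sum>\<tau>\<in>{\<tau> \<in> F. x \<tau> \<noteq> 0}. x \<tau>)"
    unfolding F(4) using F(1) by (intro sum.mono_neutral_right) auto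
  then show thesis
    using F orth by (intro that[of "{\<tau> \<in> F. x \<tau> \<noteq> 0}" x]) auto
qed

end

context yh
begin

lemma cp_sum: "finite F \<Longrightarrow> cp (\<Sum>i\<in>F. x i) = (\<Oplus>\<^bsub>A\<^esub>i\<in>F. cp (x i))"
  by (induction F rule: finite_induct) simp_all

end

section \<open>Maps from seminormal modules to the regular module\<close>

context seminormal
begin

lemma hecke_ring_Th: "hecke_ring d m n \<xi> one_emb scal (\<lambda>j. Th (tt j)) (\<lambda>i. Th (gg i)) (Th xx)"
  by (rule hecke_ring[OF d_pos n_pos \<xi>])

sublocale HS: hecke_shape d m n \<xi> \<Lambda> one_emb scal "\<lambda>j. Th (tt j)" "\<lambda>i. Th (gg i)" "Th xx"
  by (intro hecke_shape.intro hecke_ring_Th) unfold_locales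

context
  fixes T0 :: dm_tableau and w0 :: family
  assumes T0: "T0 \<in> St" and w0: "HS.fullwt T0 w0"
begin

abbreviation "Psi \<equiv> HS.Psi T0 w0"

lemma Psi_rep:
  assumes "a \<in> carrier A" "f \<in> carrier V"
  shows "Psi (\<rho> a f) = emb a * Psi f"
  using assms
proof (induction a arbitrary: f rule: A_induct)
  case (gen x)
  have X: "Psi (Dop 1 f) = Th xx * Psi f" if "f \<in> carrier V" for f
    using HS.Psi_X[OF T0 w0 that] by simp
  have Xinv: "Psi (Xinv_op f) = Th xx_inv * Psi f" if f: "f \<in> carrier V"
  proof -
    have c: "Xinv_op f \<in> carrier V" using gen_op_closed[OF _ f, of Xinvgen] by (simp add: yh_gens_def)
    have "Dop 1 (Xinv_op f) = f"
    proof
      fix S show "Dop 1 (Xinv_op f) S = f S"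
        using f node_content_nz Vc_zero[of f S] St_valid[of S 1] n_pos
        by (cases "S \<in> St") (auto simp: Dop_def Xinv_op_def carrier_V)
    qed
    then have "Psi f = Th xx * Psi (Xinv_op f)" using X[OF c] by simp
    then have "Th xx_inv * Psi f = (Th xx_inv * Th xx) * Psi (Xinv_op f)" by (simp add: mult.assoc)
    also have "Th xx_inv * Th xx = one_emb"
      using Th_relator_eq[of "xx_inv * xx" 1] by (simp add: yh_relators_def Th_simps FF_gens FF_closed Th_one)
    finally show ?thesis using HS.Psi_e[OF T0 w0 c] by simp
  qed
  have e: "emb (yh_gen d m n x) = Th (letter x)" by (simp add: Th_def yh_gen_quot)
  show ?case
    unfolding rep_gen[OF gen.hyps gen.prems] e
  proof (cases x)
    case (Tgen j)
    then show "Psi (gen_op x f) = Th (letter x) * Psi f"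
      using HS.Psi_T[OF T0 w0 gen.prems, of j] gen.hyps by (auto simp: yh_gens_def tt_def)
  next
    case (Ggen i)
    then have "1 \<le> i" "i < n" using gen.hyps by (auto simp: yh_gens_def)
    then show "Psi (gen_op x f) = Th (letter x) * Psi f"
      using HS.Psi_G[OF T0 w0 gen.prems, of i] Ggen by (simp add: gg_def)
  next
    case Xgen
    then show "Psi (gen_op x f) = Th (letter x) * Psi f" using X[OF gen.prems] by (simp add: xx_def)
  next
    case Xinvgen
    then show "Psi (gen_op x f) = Th (letter x) * Psi f" using Xinv[OF gen.prems] by (simp add: xx_inv_def)
  qed
next
  case one
  then show ?case using R.one_act HS.Psi_e[OF T0 w0 one] by (simp add: one_emb_def)
next
  case (add a b)
  then show ?case
    using HS.Psi_add[OF T0 w0 R.act_closed[of a f] R.act_closed[of b f]] R.add_act[of a b f]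
    by (simp add: emb_simps(1) distrib_right)
next
  case (mult a b)
  have "emb (a \<otimes>\<^bsub>A\<^esub> b) = emb a * emb b" using mult by (simp add: emb_simps(2,4))
  then show ?case using mult by (simp add: R.mult_act R.act_closed mult.assoc)
next
  case (smult c a)
  have "Psi (\<rho> (c \<odot>\<^bsub>A\<^esub> a) f) = scal c * Psi (\<rho> a f)"
    using smult R.smult_act[of a c f] HS.Psi_scale[OF T0 w0 R.act_closed[of a f]] by simp
  then show ?case using smult by (simp add: emb_smult mult.assoc)
qed

lemma cp_Psi_hom: "rep_hom (Fm m) A V \<rho> A (\<lambda>a b. a \<otimes>\<^bsub>A\<^esub> b) (\<lambda>f. cp (Psi f))"
proof (intro rep_hom.intro repr representation_regular assoc_algebra_A rep_hom_axioms.intro)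
  fix f g c a assume f: "f \<in> carrier V"
  show "cp (Psi f) \<in> carrier A" by simp
  show "cp (Psi (f \<oplus>\<^bsub>V\<^esub> g)) = cp (Psi f) \<oplus>\<^bsub>A\<^esub> cp (Psi g)" if "g \<in> carrier V"
    using HS.Psi_add[OF T0 w0 f that] by simp
  show "cp (Psi (\<rho> a f)) = a \<otimes>\<^bsub>A\<^esub> cp (Psi f)" if "a \<in> carrier A"
    using Psi_rep[OF that f] that by (simp add: emb_simps)
  assume c: "c \<in> carrier (Fm m)"
  have "cp (scal c * Psi f) = c \<odot>\<^bsub>A\<^esub> cp (Psi f)"
    using c by (simp add: scal_def emb_simps smult_eq(1)[symmetric])
  then show "cp (Psi (c \<odot>\<^bsub>V\<^esub> f)) = c \<odot>\<^bsub>A\<^esub> cp (Psi f)"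
    using HS.Psi_scale[OF T0 w0 f c] by simp
qed

lemma cp_Psi_vb: "cp (Psi (vb T0)) = cp w0"
proof -
  have "vb T0 = (\<lambda>t. if t = T0 then 1 else 0)" using T0 by (auto simp: vbasis_def)
  then show ?thesis using HS.Psi_base[OF T0 w0] by simp
qed

end

end

text \<open>Composes a map from V to the regular module with the orbit map of w, producing maps into
  an arbitrary representation.\<close>

lemma hom_comp_action:
  assumes "rep_hom K A V \<rho> A (\<lambda>a b. a \<otimes>\<^bsub>A\<^esub> b) \<phi>" "representation K A W \<sigma>" "w \<in> carrier W"
  shows "rep_hom K A V \<rho> W \<sigma> (\<lambda>v. \<sigma> (\<phi> v) w)"
proof -
  interpret \<phi>: rep_hom K A V \<rho> A "\<lambda>a b. a \<otimes>\<^bsub>A\<^esub> b" \<phi> by (rule assms)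
  interpret W: representation K A W \<sigma> by (rule assms)
  show ?thesis
    by (intro rep_hom.intro \<phi>.V.representation_axioms assms rep_hom_axioms.intro)
      (simp_all add: assms(3) \<phi>.hom_closed \<phi>.hom_add \<phi>.hom_smult \<phi>.hom_act W.act_closed W.add_act W.smult_act W.mult_act)
qed

theorem proposition4p6:
  fixes d m n :: nat and \<xi> :: "nat \<Rightarrow> complex"
  assumes "d > 0" and "m > 0" and "n > 0"
    and "bij_betw \<xi> {1..d} {z. z ^ d = 1}"
  shows "semisimple_algebra (Fm m) (FYH d m n) \<and>
    (\<forall>\<Lambda>\<in>dm_partitions d m n. \<exists>\<rho>. seminormal_rep d m n \<xi> \<Lambda> \<rho>) \<and>
    (\<forall>\<rho>. (\<forall>\<Lambda>\<in>dm_partitions d m n. seminormal_rep d m n \<xi> \<Lambda> (\<rho> \<Lambda>)) \<longrightarrow>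
       (\<forall>\<Lambda>\<in>dm_partitions d m n.
          irreducible_rep (Fm m) (FYH d m n) (Vspace m n \<Lambda>) (\<rho> \<Lambda>)) \<and>
       (\<forall>\<Lambda>\<in>dm_partitions d m n. \<forall>M\<in>dm_partitions d m n. \<Lambda> \<noteq> M \<longrightarrow>
          \<not> isomorphic_reps (Fm m) (FYH d m n) (Vspace m n \<Lambda>) (\<rho> \<Lambda>) (Vspace m n M) (\<rho> M)) \<and>
       (\<forall>(W :: (laurent fract, 'w) module) \<sigma>.
          irreducible_rep (Fm m) (FYH d m n) W \<sigma> \<longrightarrow>
          (\<exists>\<Lambda>\<in>dm_partitions d m n.
             isomorphic_reps (Fm m) (FYH d m n) W \<sigma> (Vspace m n \<Lambda>) (\<rho> \<Lambda>))))"
proof (intro conjI allI impI ballI)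
  interpret yh d m n .
  interpret H: hecke_ring d m n \<xi> one_emb scal "\<lambda>j. Th (tt j)" "\<lambda>i. Th (gg i)" "Th xx"
    by (rule hecke_ring) fact+
  have shape: "shape d m n \<xi> \<Lambda>" if "\<Lambda> \<in> dm_partitions d m n" for \<Lambda>
    using assms that by (simp add: shape_def)
  have seminormal: "seminormal d m n \<xi> \<Lambda> \<rho>"
    if "\<Lambda> \<in> dm_partitions d m n" "seminormal_rep d m n \<xi> \<Lambda> \<rho>" for \<Lambda> \<rho>
    using shape that by (simp add: seminormal_def seminormal_axioms_def)
  show ex: "\<exists>\<rho>. seminormal_rep d m n \<xi> \<Lambda> \<rho>" if "\<Lambda> \<in> dm_partitions d m n" for \<Lambda>
    using shape.seminormal_rho[OF shape[OF that]] by blast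
  obtain F x where F: "finite F" "F \<subseteq> extensional {1..n}" "one_emb = (\<Sum>\<tau>\<in>F. x \<tau>)"
    "\<And>\<tau>. \<tau> \<in> F \<Longrightarrow> H.fullwt \<tau> (x \<tau>) \<and> x \<tau> \<noteq> 0"
    "\<And>\<sigma> \<tau>. \<sigma> \<in> F \<Longrightarrow> \<tau> \<in> F \<Longrightarrow> x \<sigma> * x \<tau> = (if \<sigma> = \<tau> then x \<tau> else 0)"
    using H.weight_idempotents by blast
  have x: "x \<tau> = emb (cp (x \<tau>))" if "\<tau> \<in> F" for \<tau>
    using one_emb_range H.fullwtD(1) F(4)[OF that] by blast
  have cp0: "cp (x \<tau>) \<noteq> \<zero>\<^bsub>A\<^esub>" if "\<tau> \<in> F" for \<tau>
  proof
    assume "cp (x \<tau>) = \<zero>\<^bsub>A\<^esub>"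
    then have "x \<tau> = emb \<zero>\<^bsub>A\<^esub>" using x[OF that] by simp
    also have "\<dots> = 0" using emb_simps(1)[of "\<zero>\<^bsub>A\<^esub>" "\<zero>\<^bsub>A\<^esub>"] by simp
    finally show False using F(4)[OF that] by simp
  qed
  have one: "(\<Oplus>\<^bsub>A\<^esub>\<tau>\<in>F. cp (x \<tau>)) = \<one>\<^bsub>A\<^esub>"
    using cp_sum[OF F(1), of x] emb_simps(4)[of "\<one>\<^bsub>A\<^esub>"] unfolding F(3)[symmetric] by (simp add: one_emb_def)
  \<comment> \<open>The tableau of a weight idempotent has a shape, and the seminormal module of
    that shape maps its basis vector at this tableau to the idempotent.\<close>
  have hom: "\<exists>\<Lambda>\<in>dm_partitions d m n. \<forall>\<rho>. seminormal_rep d m n \<xi> \<Lambda> \<rho> \<longrightarrow>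
      irreducible_rep (Fm m) A (Vspace m n \<Lambda>) \<rho> \<and>
      (\<exists>\<phi> v. rep_hom (Fm m) A (Vspace m n \<Lambda>) \<rho> A (\<lambda>a b. a \<otimes>\<^bsub>A\<^esub> b) \<phi> \<and> v \<in> carrier (Vspace m n \<Lambda>) \<and> \<phi> v = cp (x \<tau>))"
    if \<tau>: "\<tau> \<in> F" for \<tau>
  proof -
    have std: "std_seq d m n \<tau>" using H.fullwtD(2) F(4)[OF \<tau>] by blast
    obtain \<Lambda> where \<Lambda>: "\<Lambda> \<in> dm_partitions d m n" "dm_nodes \<Lambda> = \<tau> ` {1..n}" using std_seq_shape[OF std] .
    have St: "\<tau> \<in> standard_tableaux n \<Lambda>" using standard_tableaux_iff[OF \<Lambda>(1)] std \<Lambda>(2) F(2) \<tau> by blast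
    show ?thesis
    proof (intro bexI[OF _ \<Lambda>(1)] allI impI conjI)
      fix \<rho> assume "seminormal_rep d m n \<xi> \<Lambda> \<rho>"
      then interpret S: seminormal d m n \<xi> \<Lambda> \<rho> by (rule seminormal[OF \<Lambda>(1)])
      have w: "H.fullwt \<tau> (x \<tau>)" using F(4)[OF \<tau>] by blast
      show "irreducible_rep (Fm m) A (Vspace m n \<Lambda>) \<rho>" by (rule S.irreducible)
      show "\<exists>\<phi> v. rep_hom (Fm m) A (Vspace m n \<Lambda>) \<rho> A (\<lambda>a b. a \<otimes>\<^bsub>A\<^esub> b) \<phi>
          \<and> v \<in> carrier (Vspace m n \<Lambda>) \<and> \<phi> v = cp (x \<tau>)"
        using S.cp_Psi_hom[OF St w] S.vb_closed S.cp_Psi_vb[OF St w] by blast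
    qed
  qed
  show "semisimple_algebra (Fm m) A"
  proof (rule A.semisimple_orthogonal_idempotents[OF F(1) _ _ _ one])
    fix \<tau> assume \<tau>: "\<tau> \<in> F"
    show "cp (x \<tau>) \<in> carrier A" "cp (x \<tau>) \<noteq> \<zero>\<^bsub>A\<^esub>" using cp0[OF \<tau>] by simp_all
    show "cp (x \<tau>) \<otimes>\<^bsub>A\<^esub> cp (x \<sigma>) = (if \<tau> = \<sigma> then cp (x \<sigma>) else \<zero>\<^bsub>A\<^esub>)" if "\<sigma> \<in> F" for \<sigma>
      using arg_cong[OF F(5)[OF \<tau> that], of cp] by (simp split: if_splits)
    obtain \<Lambda> \<rho> \<phi> v where "irreducible_rep (Fm m) A (Vspace m n \<Lambda>) \<rho>"
      "rep_hom (Fm m) A (Vspace m n \<Lambda>) \<rho> A (\<lambda>a b. a \<otimes>\<^bsub>A\<^esub> b) \<phi>" "v \<in> carrier (Vspace m n \<Lambda>)" "\<phi> v = cp (x \<tau>)"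
      using hom[OF \<tau>] ex by blast
    then show "simple_subrep (Fm m) A A (\<lambda>a b. a \<otimes>\<^bsub>A\<^esub> b) ((\<lambda>a. a \<otimes>\<^bsub>A\<^esub> cp (x \<tau>)) ` carrier A)"
      using rep_hom.simple_subrep_cyclic[of "Fm m" A "Vspace m n \<Lambda>" \<rho> A _ \<phi> v] cp0[OF \<tau>] by simp
  qed
  fix \<rho> assume \<rho>: "\<forall>\<Lambda>\<in>dm_partitions d m n. seminormal_rep d m n \<xi> \<Lambda> (\<rho> \<Lambda>)"
  show "irreducible_rep (Fm m) A (Vspace m n \<Lambda>) (\<rho> \<Lambda>)" if "\<Lambda> \<in> dm_partitions d m n" for \<Lambda>
    by (rule seminormal.irreducible[OF seminormal]) (use \<rho> that in auto)
  show "\<not> isomorphic_reps (Fm m) A (Vspace m n \<Lambda>) (\<rho> \<Lambda>) (Vspace m n M) (\<rho> M)"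
    if "\<Lambda> \<in> dm_partitions d m n" "M \<in> dm_partitions d m n" "\<Lambda> \<noteq> M" for \<Lambda> M
    using seminormal_not_isomorphic[OF seminormal seminormal] \<rho> that by blast
  fix W :: "(laurent fract, 'w) module" and \<sigma>
  assume irr: "irreducible_rep (Fm m) A W \<sigma>"
  then interpret W: representation "Fm m" A W \<sigma> by (simp add: irreducible_rep_def)
  obtain w where w: "w \<in> carrier W" "w \<noteq> \<zero>\<^bsub>W\<^esub>"
    using irr W.V.zero_closed unfolding irreducible_rep_def simple_subrep_def by blast
  \<comment> \<open>The idempotents sum to 1, so they cannot all kill w.\<close>
  have "\<exists>\<tau>\<in>F. \<sigma> (cp (x \<tau>)) w \<noteq> \<zero>\<^bsub>W\<^esub>"
  proof (rule ccontr)
    assume c: "\<not> ?thesis"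
    have z: "\<sigma> \<zero>\<^bsub>A\<^esub> w = \<zero>\<^bsub>W\<^esub>" 
      using W.add_act[OF FY.zero_closed FY.zero_closed w(1)] W.act_closed[OF FY.zero_closed w(1)] by (simp add: W.V.add.r_cancel_one)
    have "\<sigma> (\<Oplus>\<^bsub>A\<^esub>\<tau>\<in>B. cp (x \<tau>)) w = \<zero>\<^bsub>W\<^esub>" if "B \<subseteq> F" for B
      using finite_subset[OF that F(1)] that
    proof (induction B rule: finite_induct)
      case (insert \<tau> B)
      have "\<sigma> (cp (x \<tau>)) w = \<zero>\<^bsub>W\<^esub>" using c insert.prems by blast
      then show ?case using insert w by (simp add: W.add_act)
    qed (simp add: z)
    from this[of F] show False using w by (simp add: one W.one_act)
  qed
  then obtain \<tau> where \<tau>: "\<tau> \<in> F" "\<sigma> (cp (x \<tau>)) w \<noteq> \<zero>\<^bsub>W\<^esub>" by blast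
  obtain \<Lambda> \<phi> v where \<Lambda>: "\<Lambda> \<in> dm_partitions d m n" and V: "irreducible_rep (Fm m) A (Vspace m n \<Lambda>) (\<rho> \<Lambda>)"
    "rep_hom (Fm m) A (Vspace m n \<Lambda>) (\<rho> \<Lambda>) A (\<lambda>a b. a \<otimes>\<^bsub>A\<^esub> b) \<phi>" "v \<in> carrier (Vspace m n \<Lambda>)" "\<phi> v = cp (x \<tau>)"
    using hom[OF \<tau>(1)] \<rho> by blast
  show "\<exists>\<Lambda>\<in>dm_partitions d m n. isomorphic_reps (Fm m) A W \<sigma> (Vspace m n \<Lambda>) (\<rho> \<Lambda>)"
  proof (rule bexI[OF _ \<Lambda>])
    show "isomorphic_reps (Fm m) A W \<sigma> (Vspace m n \<Lambda>) (\<rho> \<Lambda>)"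
      by (rule rep_hom.isomorphic_repsI[OF hom_comp_action[OF V(2) W.representation_axioms w(1)] V(1) irr V(3)])
        (use V(4) \<tau>(2) in simp)
  qed
qed

end
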